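(* Let $(\Sigma,\sigma)$ be a signature pair with a $\sigma$-theory $T$, and let $M$ be a $\Sigma$-model in a PIE-complete $2$-category $\mathcal K$. Let $u\colon M^T\to M_0$ be the forgetful morphism. Then: 1. Assume $M_c$ is equipped with a representable orthogonal factorization system $(\mathcal E^c,\mathcal M^c)$ for each category symbol $c$ (and $M_0$, and all finite products $M_{\bar c}$, with the product representable orthogonal factorization systems). If every arity support $M(t_1)$ ($t_1$ an arity term) representably preserves the left classes and every coarity support $M(t_2)$ ($t_2$ a coarity term) representably preserves the right classes, then there exists a unique representable orthogonal factorization system on $M^T$ that is representably preserved by the projections $\pi_su\colon M^T\to M_{c_s}$ ($s$ a sort). In particular, the conclusion follows if $M(B)\colon M_{\bar c}\to M_d$ representably preserves both the left and the right classes of morphisms componentwise for each functor symbol $B\colon\bar c\to d$ of $\Sigma$. 2. If each $M_c$ is representably regular, each arity support $M(t_1)$ representably preserves regular epimorphisms and each coarity support $M(t_2)$ representably preserves finite limits, then $M^T$ is representably regular and $u$ representably preserves finite limits and regular epimorphisms. In particular, the conclusion follows if each $M_c$ is representably regular, $T$ is algebraic, and $M(B)$ representably preserves regular epimorphisms for each functor symbol $B$. 3. If each $M_c$ is representably exact, $M(t_1)$ representably preserves coequalizers of kernel pairs for every arity term $t_1$, and $M(t_2)$ representably preserves finite limits for every coarity term $t_2$, then $M^T$ is representably exact. In particular, if each $M_c$ is representably exact, $T$ is algebraic and each $M(B)$ representably preserves reflexive coequalizers componentwise, then $M^T$ is representably exact.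
   Context: 2-categories. A 2-category is strict; $\bullet$ is vertical composition of 2-cells, $*$ horizontal composition, and in whiskerings a 1-cell $h$ stands for $\mathrm{id}_h$. All 2-limits are strict. Product $\prod_i c_i$ with projections $\pi_i$: families of 1-cells $x\to c_i$, resp. of 2-cells between such, correspond uniquely to 1-cells $x\to\prod_i c_i$, resp. 2-cells; notation $(f_i)_i$, $(\alpha_i)_i$. Inserter of $f,g\colon c\to d$: an object $\mathrm{Ins}(f,g)$ with a 1-cell $u\colon\mathrm{Ins}(f,g)\to c$ and a 2-cell $\phi\colon fu\Rightarrow gu$ such that (i) for each $h'\colon x\to c$ and $\alpha\colon fh'\Rightarrow gh'$ there is a unique $h$ with $h'=uh$, $\alpha=\phi*h$; (ii) for $h_1,h_2\colon x\to\mathrm{Ins}(f,g)$ and $\alpha'\colon uh_1\Rightarrow uh_2$ with $(g*\alpha')\bullet(\phi*h_1)=(\phi*h_2)\bullet(f*\alpha')$ there is a unique $\alpha\colon h_1\Rightarrow h_2$ with $\alpha'=u*\alpha$. Equifier of $\eta,\theta\colon f\Rightarrow g\colon c\to d$: an object $\mathrm{Eq}(\eta,\theta)$ with a 1-cell $u$ to $c$, $\eta*u=\theta*u$, such that every $h'\colon x\to c$ with $\eta*h'=\theta*h'$ factors uniquely as $h'=uh$, and $u*(-)\colon\mathcal K(x,\mathrm{Eq}(\eta,\theta))\to\mathcal K(x,c)$ is fully faithful for all $x$. $\mathcal K$ is PIE-complete if it has small products, inserters and equifiers. Syntax. A 2-signature $\Sigma=(C,\mathcal F,\mathcal T)$ consists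 of: a small set $C$ of category symbols; a small set $\mathcal F$ of functor symbols, each with a type $B\colon c_1\cdots c_n\to d$ ($n\ge 0$, $c_i,d\in C$); a set $V$ of variables typed in $C$, countably infinitely many of each type; and a small set $\mathcal T$ of transformation symbols $\alpha^{\bar x}\colon t_1\to t_2$, where $\bar x$ is a context (finite sequence of distinct variables) and $t_1,t_2\in\mathrm{Term}^\Sigma_V$ are terms of the same type whose variables all occur in $\bar x$. For a set $X$ typed in $C$, $\mathrm{Term}^\Sigma_X$ is generated recursively: each $x\colon c$ in $X$ is a term of type $c$, and $B(t_1,\dots,t_n)$ is a term of type $d$ for $B\colon c_1\cdots c_n\to d$ in $\mathcal F$ and terms $t_i\colon c_i$. A 1-signature $\sigma$ relative to $\Sigma$ consists of a small set $S$ of sorts, each $s\in S$ having a type $c_s\in C$, and a small set of function symbols $f\colon t_1\to t_2\colon c$, with $t_1,t_2\in\mathrm{Term}^\Sigma_S$ of common type $c$. $(\Sigma,\sigma)$ is then a signature pair. $t^{\bar x}(t_1',\dots,t_n')$ denotes substitution of $t_i'$ for $x_i$. The term graph $G_\sigma$ has vertices $\mathrm{Term}^\Sigma_S$ and arrows generated recursively by: each function symbol $f\colon t_1\to t_2$; arrows $\alpha_{t_1',\dots,t_n'}\colon t_1^{\bar x}(t_1',\dots,t_n')\to t_2^{\bar x}(t_1',\dots,t_n')$ for $\alpha^{\bar x}\colon t_1\to t_2$ in $\mathcal T$ and terms $t_i'\in\mathrm{Term}^\Sigma_S$ of the type of $x_i$; and arrows $B(t_1',\dots,q,\dots,t_n')\colon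 B(t_1',\dots,t_i',\dots,t_n')\to B(t_1',\dots,t_i'',\dots,t_n')$ for $B\in\mathcal F$ and an arrow $q\colon t_i'\to t_i''$. A $\sigma$-equation is a parallel pair of paths $(p,q\colon t_1\to t_2\colon c)$ in $G_\sigma$; a (bialgebraic) $\sigma$-theory $T$ is a set of $\sigma$-equations. Arity terms are the domains of the function symbols of $\sigma$ and of the equations in $T$; coarity terms are the codomains of the function symbols of $\sigma$ and of the equations in $T$. $T$ is algebraic if all coarity terms are sorts. Models. A $\Sigma$-model $M$ in $\mathcal K$ assigns an object $M_c$ to each $c\in C$ (with $M_{\bar c}=\prod_i M_{c_i}$ for $\bar c=c_1\cdots c_n$, and $M_{\bar x}=\prod_i M_{c_i}$ for $\bar x=(x_1\colon c_1,\dots,x_n\colon c_n)$), a 1-cell $M(B)\colon M_{\bar c}\to M_d$ to each $B\colon\bar c\to d$ (giving for each term $t\colon c$ in context $\bar x$ a 1-cell $M_{\bar x}(t)\colon M_{\bar x}\to M_c$ by $M_{\bar x}(x_i)=\pi_i$, $M_{\bar x}(B(t_1,\dots,t_n))=M(B)(M_{\bar x}(t_1),\dots,M_{\bar x}(t_n))$), and a 2-cell $M(\alpha)\colon M_{\bar x}(t_1)\Rightarrow M_{\bar x}(t_2)$ to each $\alpha^{\bar x}\colon t_1\to t_2$ in $\mathcal T$. Put $M_0=\prod_{s\in S}M_{c_s}$, and for $t\colon c$ in $\mathrm{Term}^\Sigma_S$ define $M(t)\colon M_0\to M_c$ by $M(s)=\pi_s$, $M(B(t_1,\dots,t_n))=M(B)(M(t_1),\dots,M(t_n))$.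 $M^\sigma$ is the inserter of $(M(t_1))_f,(M(t_2))_f\colon M_0\to\prod_{f\colon t_1\to t_2\colon c}M_c$ (over function symbols $f$ of $\sigma$), with 1-cell $u_M\colon M^\sigma\to M_0$ and 2-cell $\phi_M$; put $M^\sigma(t)=M(t)u_M$. For arrows $p\colon t_1\to t_2\colon c$ of $G_\sigma$ define $\bar p_M\colon M^\sigma(t_1)\Rightarrow M^\sigma(t_2)$ by: $\bar f_M=\pi_f*\phi_M$; $\overline{\alpha_{t_1',\dots,t_n'}}_M=M(\alpha)*(M^\sigma(t_1'),\dots,M^\sigma(t_n'))$; $\overline{B(t_1',\dots,q,\dots,t_n')}_M=M(B)*(M^\sigma(t_1'),\dots,\bar q_M,\dots,M^\sigma(t_n'))$; extend to paths by vertical composition. $M^T$, with 1-cell $e_M\colon M^T\to M^\sigma$, is the equifier of $(\bar p_M)_{(p,q)\in T}$ and $(\bar q_M)_{(p,q)\in T}\colon (M^\sigma(t_1))\Rightarrow(M^\sigma(t_2))\colon M^\sigma\to\prod_{(p,q\colon t_1\to t_2\colon c)\in T}M_c$. The forgetful 1-cell is $u=u_Me_M\colon M^T\to M_0$. Factorization systems, regularity, exactness. An orthogonal factorization system (OFS) on a category is a pair $(E,M)$ of classes of morphisms such that every morphism factors as $m\circ e$ with $e\in E$, $m\in M$, and $M=E^\perp$, $E={}^\perp M$ (orthogonality: unique diagonal fillers); $E$ is the left, $M$ the right class; it is stable if pullbacks of morphisms in $E$ are in $E$. A regular category is a category with finite limits and a stable OFS whose right class is the class of monomorphisms; a regular category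 is exact if every internal equivalence relation is a kernel pair of some morphism. A representable OFS on an object $c$ of $\mathcal K$ is a family of OFSs $(E_x,M_x)$ on the categories $\mathcal K(x,c)$, $x\in\mathcal K$, such that for each $f\colon x\to y$ the precomposition functor $f^*\colon\mathcal K(y,c)\to\mathcal K(x,c)$ preserves left and right classes. The product representable OFS on $\prod_ic_i$ is, under $\mathcal K(x,\prod_ic_i)\cong\prod_i\mathcal K(x,c_i)$, given by the products of the left and of the right classes. An object $c$ is representably regular if each $\mathcal K(x,c)$ is a regular category and each $f^*\colon\mathcal K(y,c)\to\mathcal K(x,c)$ preserves finite limits and regular epimorphisms; it is representably exact if moreover each $\mathcal K(x,c)$ is exact. A 1-cell $h\colon c\to d$ representably preserves some structure if each postcomposition functor $h_*\colon\mathcal K(x,c)\to\mathcal K(x,d)$ preserves it. $M(B)$ does so componentwise if for every $x$ the functor $\prod_i\mathcal K(x,M_{c_i})\cong\mathcal K(x,M_{\bar c})\to\mathcal K(x,M_d)$ does so in each variable separately, the other variables being held fixed. *)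

theory Defs
  imports "HOL-Library.FuncSet" "HOL-Library.Countable_Set"
begin

section \<open>Categories\<close>

record ('o, 'a) cat =
  Ob :: "'o set"
  Ar :: "'a set"
  Dm :: "'a \<Rightarrow> 'o"
  Cd :: "'a \<Rightarrow> 'o"
  Idn :: "'o \<Rightarrow> 'a"
  Cmp :: "'a \<Rightarrow> 'a \<Rightarrow> 'a"  \<comment> \<open>\<open>Cmp C g f\<close> is \<open>g\<close> after \<open>f\<close>\<close>

definition in_hom :: "('o, 'a) cat \<Rightarrow> 'a \<Rightarrow> 'o \<Rightarrow> 'o \<Rightarrow> bool" where
  "in_hom C f a b \<longleftrightarrow> f \<in> Ar C \<and> Dm C f = a \<and> Cd C f = b"

locale category =
  fixes C :: "('o, 'a) cat"
  assumes dom_in: "f \<in> Ar C \<Longrightarrow> Dm C f \<in> Ob C"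
    and cod_in: "f \<in> Ar C \<Longrightarrow> Cd C f \<in> Ob C"
    and id_in: "a \<in> Ob C \<Longrightarrow> in_hom C (Idn C a) a a"
    and comp_in: "in_hom C f a b \<Longrightarrow> in_hom C g b c \<Longrightarrow> in_hom C (Cmp C g f) a c"
    and comp_id_right: "in_hom C f a b \<Longrightarrow> Cmp C f (Idn C a) = f"
    and comp_id_left: "in_hom C f a b \<Longrightarrow> Cmp C (Idn C b) f = f"
    and comp_assoc: "in_hom C f a b \<Longrightarrow> in_hom C g b c \<Longrightarrow> in_hom C h c d \<Longrightarrow>
      Cmp C h (Cmp C g f) = Cmp C (Cmp C h g) f"

record ('o, 'a, 'p, 'b) func =
  fo :: "'o \<Rightarrow> 'p"
  fa :: "'a \<Rightarrow> 'b"

definition is_functor ::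
    "('o, 'a) cat \<Rightarrow> ('p, 'b) cat \<Rightarrow> ('o, 'a, 'p, 'b) func \<Rightarrow> bool" where
  "is_functor C D F \<longleftrightarrow>
     (\<forall>a\<in>Ob C. fo F a \<in> Ob D \<and> fa F (Idn C a) = Idn D (fo F a)) \<and>
     (\<forall>f a b. in_hom C f a b \<longrightarrow> in_hom D (fa F f) (fo F a) (fo F b)) \<and>
     (\<forall>f g a b c. in_hom C f a b \<and> in_hom C g b c \<longrightarrow>
        fa F (Cmp C g f) = Cmp D (fa F g) (fa F f))"

definition func_comp ::
    "('p, 'b, 'q, 'c) func \<Rightarrow> ('o, 'a, 'p, 'b) func \<Rightarrow> ('o, 'a, 'q, 'c) func" where
  "func_comp G F = \<lparr>fo = fo G \<circ> fo F, fa = fa G \<circ> fa F\<rparr>"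


subsection \<open>Limits and colimits\<close>

definition is_cone ::
    "('j, 'k) cat \<Rightarrow> ('o, 'a) cat \<Rightarrow> ('j, 'k, 'o, 'a) func \<Rightarrow> 'o \<Rightarrow> ('j \<Rightarrow> 'a) \<Rightarrow> bool" where
  "is_cone J C G a l \<longleftrightarrow> a \<in> Ob C \<and>
     (\<forall>j\<in>Ob J. in_hom C (l j) a (fo G j)) \<and>
     (\<forall>k i j. in_hom J k i j \<longrightarrow> Cmp C (fa G k) (l i) = l j)"

definition is_limit ::
    "('j, 'k) cat \<Rightarrow> ('o, 'a) cat \<Rightarrow> ('j, 'k, 'o, 'a) func \<Rightarrow> 'o \<Rightarrow> ('j \<Rightarrow> 'a) \<Rightarrow> bool" where
  "is_limit J C G a l \<longleftrightarrow> is_cone J C G a l \<and>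
     (\<forall>b m. is_cone J C G b m \<longrightarrow>
        (\<exists>!h. in_hom C h b a \<and> (\<forall>j\<in>Ob J. Cmp C (l j) h = m j)))"

text \<open>Every finite category is isomorphic to one whose objects and arrows are natural
  numbers, so finite diagram shapes may be taken of type \<open>(nat, nat) cat\<close>.\<close>

definition finite_shape :: "(nat, nat) cat \<Rightarrow> bool" where
  "finite_shape J \<longleftrightarrow> category J \<and> finite (Ob J) \<and> finite (Ar J)"

definition has_finite_limits :: "('o, 'a) cat \<Rightarrow> bool" where
  "has_finite_limits C \<longleftrightarrow>
     (\<forall>J G. finite_shape J \<and> is_functor J C G \<longrightarrow> (\<exists>a l. is_limit J C G a l))"

definition is_pullback :: "('o, 'a) cat \<Rightarrow> 'a \<Rightarrow> 'a \<Rightarrow> 'a \<Rightarrow> 'a \<Rightarrow> bool" where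
  "is_pullback C f g p q \<longleftrightarrow>
     {f, g, p, q} \<subseteq> Ar C \<and> Cd C f = Cd C g \<and>
     in_hom C p (Dm C p) (Dm C f) \<and> in_hom C q (Dm C p) (Dm C g) \<and>
     Cmp C f p = Cmp C g q \<and>
     (\<forall>z r s. in_hom C r z (Dm C f) \<and> in_hom C s z (Dm C g) \<and> Cmp C f r = Cmp C g s \<longrightarrow>
        (\<exists>!h. in_hom C h z (Dm C p) \<and> Cmp C p h = r \<and> Cmp C q h = s))"

definition is_coequalizer :: "('o, 'a) cat \<Rightarrow> 'a \<Rightarrow> 'a \<Rightarrow> 'a \<Rightarrow> bool" where
  "is_coequalizer C f g e \<longleftrightarrow>
     {f, g, e} \<subseteq> Ar C \<and> Dm C f = Dm C g \<and> Cd C f = Dm C e \<and> Cd C g = Dm C e \<and>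
     Cmp C e f = Cmp C e g \<and>
     (\<forall>z k. in_hom C k (Dm C e) z \<and> Cmp C k f = Cmp C k g \<longrightarrow>
        (\<exists>!h. in_hom C h (Cd C e) z \<and> Cmp C h e = k))"

definition mono_arrows :: "('o, 'a) cat \<Rightarrow> 'a set" where
  "mono_arrows C = {m \<in> Ar C. \<forall>z f g. in_hom C f z (Dm C m) \<and> in_hom C g z (Dm C m) \<and>
     Cmp C m f = Cmp C m g \<longrightarrow> f = g}"

definition regular_epi :: "('o, 'a) cat \<Rightarrow> 'a \<Rightarrow> bool" where
  "regular_epi C e \<longleftrightarrow> (\<exists>f g. is_coequalizer C f g e)"

definition is_kernel_pair :: "('o, 'a) cat \<Rightarrow> 'a \<Rightarrow> 'a \<Rightarrow> bool" where
  "is_kernel_pair C p q \<longleftrightarrow> (\<exists>f. is_pullback C f f p q)"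

definition is_reflexive_pair :: "('o, 'a) cat \<Rightarrow> 'a \<Rightarrow> 'a \<Rightarrow> bool" where
  "is_reflexive_pair C p q \<longleftrightarrow>
     (\<exists>a b s. in_hom C p a b \<and> in_hom C q a b \<and> in_hom C s b a \<and>
        Cmp C p s = Idn C b \<and> Cmp C q s = Idn C b)"


subsection \<open>Factorization systems, regular and exact categories\<close>

definition orthogonal :: "('o, 'a) cat \<Rightarrow> 'a \<Rightarrow> 'a \<Rightarrow> bool" where
  "orthogonal C e m \<longleftrightarrow>
     (\<forall>r s. in_hom C r (Dm C e) (Dm C m) \<and> in_hom C s (Cd C e) (Cd C m) \<and>
        Cmp C m r = Cmp C s e \<longrightarrow>
        (\<exists>!d. in_hom C d (Cd C e) (Dm C m) \<and> Cmp C d e = r \<and> Cmp C m d = s))"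

definition is_OFS :: "('o, 'a) cat \<Rightarrow> 'a set \<Rightarrow> 'a set \<Rightarrow> bool" where
  "is_OFS C E M \<longleftrightarrow>
     (\<forall>f\<in>Ar C. \<exists>e\<in>E. \<exists>m\<in>M. Cd C e = Dm C m \<and> f = Cmp C m e) \<and>
     M = {m \<in> Ar C. \<forall>e\<in>E. orthogonal C e m} \<and>
     E = {e \<in> Ar C. \<forall>m\<in>M. orthogonal C e m}"

definition pullback_stable :: "('o, 'a) cat \<Rightarrow> 'a set \<Rightarrow> bool" where
  "pullback_stable C E \<longleftrightarrow> (\<forall>e f p q. e \<in> E \<and> is_pullback C e f p q \<longrightarrow> q \<in> E)"

definition regular_category :: "('o, 'a) cat \<Rightarrow> bool" where
  "regular_category C \<longleftrightarrow> category C \<and> has_finite_limits C \<and>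
     (\<exists>E. is_OFS C E (mono_arrows C) \<and> pullback_stable C E)"

definition jointly_monic :: "('o, 'a) cat \<Rightarrow> 'a \<Rightarrow> 'a \<Rightarrow> bool" where
  "jointly_monic C r\<^sub>0 r\<^sub>1 \<longleftrightarrow>
     (\<forall>z f g. in_hom C f z (Dm C r\<^sub>0) \<and> in_hom C g z (Dm C r\<^sub>0) \<and>
        Cmp C r\<^sub>0 f = Cmp C r\<^sub>0 g \<and> Cmp C r\<^sub>1 f = Cmp C r\<^sub>1 g \<longrightarrow> f = g)"

definition is_internal_equiv_rel :: "('o, 'a) cat \<Rightarrow> 'a \<Rightarrow> 'a \<Rightarrow> bool" where
  "is_internal_equiv_rel C r\<^sub>0 r\<^sub>1 \<longleftrightarrow>
     (\<exists>R X. in_hom C r\<^sub>0 R X \<and> in_hom C r\<^sub>1 R X \<and> jointly_monic C r\<^sub>0 r\<^sub>1 \<and>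
        (\<exists>i. in_hom C i X R \<and> Cmp C r\<^sub>0 i = Idn C X \<and> Cmp C r\<^sub>1 i = Idn C X) \<and>
        (\<exists>s. in_hom C s R R \<and> Cmp C r\<^sub>0 s = r\<^sub>1 \<and> Cmp C r\<^sub>1 s = r\<^sub>0) \<and>
        (\<forall>p q. is_pullback C r\<^sub>1 r\<^sub>0 p q \<longrightarrow>
           (\<exists>t. in_hom C t (Dm C p) R \<and>
              Cmp C r\<^sub>0 t = Cmp C r\<^sub>0 p \<and> Cmp C r\<^sub>1 t = Cmp C r\<^sub>1 q)))"

definition exact_category :: "('o, 'a) cat \<Rightarrow> bool" where
  "exact_category C \<longleftrightarrow> regular_category C \<and>
     (\<forall>r\<^sub>0 r\<^sub>1. is_internal_equiv_rel C r\<^sub>0 r\<^sub>1 \<longrightarrow> is_kernel_pair C r\<^sub>0 r\<^sub>1)"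


subsection \<open>Preservation by functors\<close>

definition preserves_finite_limits ::
    "('o, 'a) cat \<Rightarrow> ('p, 'b) cat \<Rightarrow> ('o, 'a, 'p, 'b) func \<Rightarrow> bool" where
  "preserves_finite_limits C D F \<longleftrightarrow>
     (\<forall>J G a l. finite_shape J \<and> is_functor J C G \<and> is_limit J C G a l \<longrightarrow>
        is_limit J D (func_comp F G) (fo F a) (\<lambda>j. fa F (l j)))"

definition preserves_regular_epis ::
    "('o, 'a) cat \<Rightarrow> ('p, 'b) cat \<Rightarrow> ('o, 'a, 'p, 'b) func \<Rightarrow> bool" where
  "preserves_regular_epis C D F \<longleftrightarrow> (\<forall>e. regular_epi C e \<longrightarrow> regular_epi D (fa F e))"

definition preserves_coeqs_of_kernel_pairs ::
    "('o, 'a) cat \<Rightarrow> ('p, 'b) cat \<Rightarrow> ('o, 'a, 'p, 'b) func \<Rightarrow> bool" where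
  "preserves_coeqs_of_kernel_pairs C D F \<longleftrightarrow>
     (\<forall>p q e. is_kernel_pair C p q \<and> is_coequalizer C p q e \<longrightarrow>
        is_coequalizer D (fa F p) (fa F q) (fa F e))"

definition preserves_reflexive_coeqs ::
    "('o, 'a) cat \<Rightarrow> ('p, 'b) cat \<Rightarrow> ('o, 'a, 'p, 'b) func \<Rightarrow> bool" where
  "preserves_reflexive_coeqs C D F \<longleftrightarrow>
     (\<forall>p q e. is_reflexive_pair C p q \<and> is_coequalizer C p q e \<longrightarrow>
        is_coequalizer D (fa F p) (fa F q) (fa F e))"

definition preserves_class ::
    "('o, 'a, 'p, 'b) func \<Rightarrow> 'a set \<Rightarrow> 'b set \<Rightarrow> bool" where
  "preserves_class F E E' \<longleftrightarrow> (\<forall>e\<in>E. fa F e \<in> E')"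


section \<open>Strict 2-categories\<close>

text \<open>\<open>und\<close> is the underlying category of objects and 1-cells; \<open>vert\<close> has the 1-cells as
  objects and the 2-cells as arrows, composed vertically; \<open>hc K \<beta> \<alpha>\<close> is \<open>\<beta> * \<alpha>\<close>.\<close>

record ('o, 'm, 'a) twocat =
  und :: "('o, 'm) cat"
  vert :: "('m, 'a) cat"
  hc :: "'a \<Rightarrow> 'a \<Rightarrow> 'a"

abbreviation Obj :: "('o, 'm, 'a) twocat \<Rightarrow> 'o set" where
  "Obj K \<equiv> Ob (und K)"

abbreviation cell1 :: "('o, 'm, 'a) twocat \<Rightarrow> 'm \<Rightarrow> 'o \<Rightarrow> 'o \<Rightarrow> bool" where
  "cell1 K \<equiv> in_hom (und K)"

abbreviation cell2 :: "('o, 'm, 'a) twocat \<Rightarrow> 'a \<Rightarrow> 'm \<Rightarrow> 'm \<Rightarrow> bool" where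
  "cell2 K \<equiv> in_hom (vert K)"

abbreviation id1 :: "('o, 'm, 'a) twocat \<Rightarrow> 'o \<Rightarrow> 'm" where
  "id1 K \<equiv> Idn (und K)"

abbreviation c1 :: "('o, 'm, 'a) twocat \<Rightarrow> 'm \<Rightarrow> 'm \<Rightarrow> 'm" where
  "c1 K \<equiv> Cmp (und K)"

abbreviation id2 :: "('o, 'm, 'a) twocat \<Rightarrow> 'm \<Rightarrow> 'a" where
  "id2 K \<equiv> Idn (vert K)"

abbreviation vc :: "('o, 'm, 'a) twocat \<Rightarrow> 'a \<Rightarrow> 'a \<Rightarrow> 'a" where
  "vc K \<equiv> Cmp (vert K)"

text \<open>Whiskering: \<open>lw K h \<alpha>\<close> is \<open>h * \<alpha>\<close> and \<open>rw K \<alpha> h\<close> is \<open>\<alpha> * h\<close>.\<close>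

abbreviation lw :: "('o, 'm, 'a) twocat \<Rightarrow> 'm \<Rightarrow> 'a \<Rightarrow> 'a" where
  "lw K h \<alpha> \<equiv> hc K (id2 K h) \<alpha>"

abbreviation rw :: "('o, 'm, 'a) twocat \<Rightarrow> 'a \<Rightarrow> 'm \<Rightarrow> 'a" where
  "rw K \<alpha> h \<equiv> hc K \<alpha> (id2 K h)"

locale two_category =
  fixes K :: "('o, 'm, 'a) twocat"
  assumes und_cat: "category (und K)"
    and vert_cat: "category (vert K)"
    and vert_ob: "Ob (vert K) = Ar (und K)"
    and parallel: "cell2 K \<alpha> f g \<Longrightarrow>
      Dm (und K) f = Dm (und K) g \<and> Cd (und K) f = Cd (und K) g"
    and hc_in: "cell2 K \<alpha> f f' \<Longrightarrow> cell2 K \<beta> g g' \<Longrightarrow> cell1 K f x y \<Longrightarrow> cell1 K g y z \<Longrightarrow>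
      cell2 K (hc K \<beta> \<alpha>) (c1 K g f) (c1 K g' f')"
    and hc_id: "cell1 K f x y \<Longrightarrow> cell1 K g y z \<Longrightarrow> hc K (id2 K g) (id2 K f) = id2 K (c1 K g f)"
    and interchange: "cell2 K \<alpha> f f' \<Longrightarrow> cell2 K \<alpha>' f' f'' \<Longrightarrow> cell2 K \<beta> g g' \<Longrightarrow> cell2 K \<beta>' g' g'' \<Longrightarrow>
      cell1 K f x y \<Longrightarrow> cell1 K g y z \<Longrightarrow>
      hc K (vc K \<beta>' \<beta>) (vc K \<alpha>' \<alpha>) = vc K (hc K \<beta>' \<alpha>') (hc K \<beta> \<alpha>)"
    and hc_unit_right: "cell2 K \<alpha> f g \<Longrightarrow> cell1 K f x y \<Longrightarrow> rw K \<alpha> (id1 K x) = \<alpha>"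
    and hc_unit_left: "cell2 K \<alpha> f g \<Longrightarrow> cell1 K f x y \<Longrightarrow> lw K (id1 K y) \<alpha> = \<alpha>"
    and hc_assoc: "cell2 K \<alpha> f f' \<Longrightarrow> cell2 K \<beta> g g' \<Longrightarrow> cell2 K \<gamma> h h' \<Longrightarrow>
      cell1 K f w x \<Longrightarrow> cell1 K g x y \<Longrightarrow> cell1 K h y z \<Longrightarrow>
      hc K \<gamma> (hc K \<beta> \<alpha>) = hc K (hc K \<gamma> \<beta>) \<alpha>"

definition hom_cat :: "('o, 'm, 'a) twocat \<Rightarrow> 'o \<Rightarrow> 'o \<Rightarrow> ('m, 'a) cat" where
  "hom_cat K x y = \<lparr>
     Ob = {f. cell1 K f x y},
     Ar = {\<alpha>. \<exists>f g. cell1 K f x y \<and> cell1 K g x y \<and> cell2 K \<alpha> f g},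
     Dm = Dm (vert K), Cd = Cd (vert K), Idn = id2 K, Cmp = vc K\<rparr>"

definition postcomp :: "('o, 'm, 'a) twocat \<Rightarrow> 'm \<Rightarrow> ('m, 'a, 'm, 'a) func" where
  "postcomp K h = \<lparr>fo = c1 K h, fa = lw K h\<rparr>"

definition precomp :: "('o, 'm, 'a) twocat \<Rightarrow> 'm \<Rightarrow> ('m, 'a, 'm, 'a) func" where
  "precomp K f = \<lparr>fo = (\<lambda>g. c1 K g f), fa = (\<lambda>\<alpha>. rw K \<alpha> f)\<rparr>"


subsection \<open>Strict PIE-limits\<close>

definition is_product ::
    "('o, 'm, 'a) twocat \<Rightarrow> 'i set \<Rightarrow> ('i \<Rightarrow> 'o) \<Rightarrow> 'o \<Rightarrow> ('i \<Rightarrow> 'm) \<Rightarrow> bool" where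
  "is_product K I c p \<pi> \<longleftrightarrow>
     p \<in> Obj K \<and> (\<forall>i\<in>I. cell1 K (\<pi> i) p (c i)) \<and>
     (\<forall>x\<in>Obj K. \<forall>f. (\<forall>i\<in>I. cell1 K (f i) x (c i)) \<longrightarrow>
        (\<exists>!h. cell1 K h x p \<and> (\<forall>i\<in>I. c1 K (\<pi> i) h = f i))) \<and>
     (\<forall>x\<in>Obj K. \<forall>h\<^sub>1 h\<^sub>2 \<alpha>. cell1 K h\<^sub>1 x p \<and> cell1 K h\<^sub>2 x p \<and>
        (\<forall>i\<in>I. cell2 K (\<alpha> i) (c1 K (\<pi> i) h\<^sub>1) (c1 K (\<pi> i) h\<^sub>2)) \<longrightarrow>
        (\<exists>!\<beta>. cell2 K \<beta> h\<^sub>1 h\<^sub>2 \<and> (\<forall>i\<in>I. lw K (\<pi> i) \<beta> = \<alpha> i)))"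

text \<open>The cells \<open>(f\<^sub>i)\<^sub>i : x \<rightarrow> p\<close> and \<open>(\<alpha>\<^sub>i)\<^sub>i\<close> into a product \<open>p\<close> with projections \<open>\<pi>\<close>.
  The source object \<open>x\<close> has to be given because the index set may be empty.\<close>

definition tuple1 ::
    "('o, 'm, 'a) twocat \<Rightarrow> 'i set \<Rightarrow> 'o \<Rightarrow> ('i \<Rightarrow> 'm) \<Rightarrow> 'o \<Rightarrow> ('i \<Rightarrow> 'm) \<Rightarrow> 'm" where
  "tuple1 K I p \<pi> x f = (THE h. cell1 K h x p \<and> (\<forall>i\<in>I. c1 K (\<pi> i) h = f i))"

definition tuple2 ::
    "('o, 'm, 'a) twocat \<Rightarrow> 'i set \<Rightarrow> 'o \<Rightarrow> ('i \<Rightarrow> 'm) \<Rightarrow> 'o \<Rightarrow> ('i \<Rightarrow> 'a) \<Rightarrow> 'a" where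
  "tuple2 K I p \<pi> x \<alpha> = (THE \<beta>. \<beta> \<in> Ar (hom_cat K x p) \<and> (\<forall>i\<in>I. lw K (\<pi> i) \<beta> = \<alpha> i))"

definition is_inserter ::
    "('o, 'm, 'a) twocat \<Rightarrow> 'm \<Rightarrow> 'm \<Rightarrow> 'o \<Rightarrow> 'm \<Rightarrow> 'a \<Rightarrow> bool" where
  "is_inserter K f g p u \<phi> \<longleftrightarrow>
     p \<in> Obj K \<and> cell1 K u p (Dm (und K) f) \<and> cell2 K \<phi> (c1 K f u) (c1 K g u) \<and>
     (\<forall>x\<in>Obj K. \<forall>h' \<alpha>. cell1 K h' x (Dm (und K) f) \<and> cell2 K \<alpha> (c1 K f h') (c1 K g h') \<longrightarrow>
        (\<exists>!h. cell1 K h x p \<and> h' = c1 K u h \<and> \<alpha> = rw K \<phi> h)) \<and>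
     (\<forall>x\<in>Obj K. \<forall>h\<^sub>1 h\<^sub>2 \<alpha>'. cell1 K h\<^sub>1 x p \<and> cell1 K h\<^sub>2 x p \<and>
        cell2 K \<alpha>' (c1 K u h\<^sub>1) (c1 K u h\<^sub>2) \<and>
        vc K (lw K g \<alpha>') (rw K \<phi> h\<^sub>1) = vc K (rw K \<phi> h\<^sub>2) (lw K f \<alpha>') \<longrightarrow>
        (\<exists>!\<alpha>. cell2 K \<alpha> h\<^sub>1 h\<^sub>2 \<and> \<alpha>' = lw K u \<alpha>))"

definition is_equifier ::
    "('o, 'm, 'a) twocat \<Rightarrow> 'o \<Rightarrow> 'a \<Rightarrow> 'a \<Rightarrow> 'o \<Rightarrow> 'm \<Rightarrow> bool" where
  "is_equifier K c \<eta> \<theta> p u \<longleftrightarrow>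
     p \<in> Obj K \<and> cell1 K u p c \<and> rw K \<eta> u = rw K \<theta> u \<and>
     (\<forall>x\<in>Obj K. \<forall>h'. cell1 K h' x c \<and> rw K \<eta> h' = rw K \<theta> h' \<longrightarrow>
        (\<exists>!h. cell1 K h x p \<and> h' = c1 K u h)) \<and>
     (\<forall>x\<in>Obj K. \<forall>h\<^sub>1 h\<^sub>2 \<alpha>'. cell1 K h\<^sub>1 x p \<and> cell1 K h\<^sub>2 x p \<and>
        cell2 K \<alpha>' (c1 K u h\<^sub>1) (c1 K u h\<^sub>2) \<longrightarrow>
        (\<exists>!\<alpha>. cell2 K \<alpha> h\<^sub>1 h\<^sub>2 \<and> \<alpha>' = lw K u \<alpha>))"

text \<open>Sizes are measured by an (infinite) type \<open>'u\<close>: a set is small when it injects into \<open>'u\<close>.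
  Up to bijection, the small index sets are exactly the subsets of \<open>'u\<close>.\<close>

definition small :: "'u itself \<Rightarrow> 'b set \<Rightarrow> bool" where
  "small U A \<longleftrightarrow> (\<exists>j :: 'b \<Rightarrow> 'u. inj_on j A)"

definition PIE_complete :: "'u itself \<Rightarrow> ('o, 'm, 'a) twocat \<Rightarrow> bool" where
  "PIE_complete U K \<longleftrightarrow> two_category K \<and>
     (\<forall>(I :: 'u set) c. (\<forall>i\<in>I. c i \<in> Obj K) \<longrightarrow> (\<exists>p \<pi>. is_product K I c p \<pi>)) \<and>
     (\<forall>f g c d. cell1 K f c d \<and> cell1 K g c d \<longrightarrow> (\<exists>p u \<phi>. is_inserter K f g p u \<phi>)) \<and>
     (\<forall>f g c d \<eta> \<theta>. cell1 K f c d \<and> cell1 K g c d \<and> cell2 K \<eta> f g \<and> cell2 K \<theta> f g \<longrightarrow>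
        (\<exists>p u. is_equifier K c \<eta> \<theta> p u))"


subsection \<open>Representable structure\<close>

text \<open>A family of pairs (left class, right class) on the categories \<open>K(x, c)\<close>. It is required
  to be \<^const>\<open>undefined\<close> at values \<open>x\<close> that are not objects of \<open>K\<close>, so that equality of such
  families is equality of the families over the objects of \<open>K\<close>.\<close>

type_synonym ('o, 'a) ofs_family = "'o \<Rightarrow> 'a set \<times> 'a set"

definition rep_OFS :: "('o, 'm, 'a) twocat \<Rightarrow> 'o \<Rightarrow> ('o, 'a) ofs_family \<Rightarrow> bool" where
  "rep_OFS K c R \<longleftrightarrow> R \<in> extensional (Obj K) \<and>
     (\<forall>x\<in>Obj K. is_OFS (hom_cat K x c) (fst (R x)) (snd (R x))) \<and>
     (\<forall>x y f. cell1 K f x y \<longrightarrow>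
        preserves_class (precomp K f) (fst (R y)) (fst (R x)) \<and>
        preserves_class (precomp K f) (snd (R y)) (snd (R x)))"

definition product_OFS ::
    "('o, 'm, 'a) twocat \<Rightarrow> 'i set \<Rightarrow> 'o \<Rightarrow> ('i \<Rightarrow> 'm) \<Rightarrow> ('i \<Rightarrow> ('o, 'a) ofs_family) \<Rightarrow>
     ('o, 'a) ofs_family" where
  "product_OFS K I p \<pi> R = (\<lambda>x\<in>Obj K.
     ({\<alpha> \<in> Ar (hom_cat K x p). \<forall>i\<in>I. lw K (\<pi> i) \<alpha> \<in> fst (R i x)},
      {\<alpha> \<in> Ar (hom_cat K x p). \<forall>i\<in>I. lw K (\<pi> i) \<alpha> \<in> snd (R i x)}))"

definition rep_preserves_left ::
    "('o, 'm, 'a) twocat \<Rightarrow> 'm \<Rightarrow> ('o, 'a) ofs_family \<Rightarrow> ('o, 'a) ofs_family \<Rightarrow> bool" where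
  "rep_preserves_left K h R R' \<longleftrightarrow>
     (\<forall>x\<in>Obj K. preserves_class (postcomp K h) (fst (R x)) (fst (R' x)))"

definition rep_preserves_right ::
    "('o, 'm, 'a) twocat \<Rightarrow> 'm \<Rightarrow> ('o, 'a) ofs_family \<Rightarrow> ('o, 'a) ofs_family \<Rightarrow> bool" where
  "rep_preserves_right K h R R' \<longleftrightarrow>
     (\<forall>x\<in>Obj K. preserves_class (postcomp K h) (snd (R x)) (snd (R' x)))"

definition rep_regular :: "('o, 'm, 'a) twocat \<Rightarrow> 'o \<Rightarrow> bool" where
  "rep_regular K c \<longleftrightarrow>
     (\<forall>x\<in>Obj K. regular_category (hom_cat K x c)) \<and>
     (\<forall>x y f. cell1 K f x y \<longrightarrow>
        preserves_finite_limits (hom_cat K y c) (hom_cat K x c) (precomp K f) \<and>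
        preserves_regular_epis (hom_cat K y c) (hom_cat K x c) (precomp K f))"

definition rep_exact :: "('o, 'm, 'a) twocat \<Rightarrow> 'o \<Rightarrow> bool" where
  "rep_exact K c \<longleftrightarrow> rep_regular K c \<and> (\<forall>x\<in>Obj K. exact_category (hom_cat K x c))"

text \<open>\<open>P\<close> is a preservation property of functors between hom-categories.\<close>

definition rep_preserves ::
    "(('m, 'a) cat \<Rightarrow> ('m, 'a) cat \<Rightarrow> ('m, 'a, 'm, 'a) func \<Rightarrow> bool) \<Rightarrow>
     ('o, 'm, 'a) twocat \<Rightarrow> 'm \<Rightarrow> bool" where
  "rep_preserves P K h \<longleftrightarrow>
     (\<forall>x\<in>Obj K. P (hom_cat K x (Dm (und K) h)) (hom_cat K x (Cd (und K) h)) (postcomp K h))"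


section \<open>Signatures and theories\<close>

datatype ('f, 'x) trm = Var 'x | App 'f "('f, 'x) trm list"

primrec tvars :: "('f, 'x) trm \<Rightarrow> 'x set" where
  "tvars (Var x) = {x}"
| "tvars (App B ts) = \<Union>(set (map tvars ts))"

primrec tsubst :: "('x \<Rightarrow> ('f, 'y) trm) \<Rightarrow> ('f, 'x) trm \<Rightarrow> ('f, 'y) trm" where
  "tsubst \<theta> (Var x) = \<theta> x"
| "tsubst \<theta> (App B ts) = App B (map (tsubst \<theta>) ts)"

definition ctx_subst :: "'x list \<Rightarrow> ('f, 'y) trm list \<Rightarrow> ('f, 'x) trm \<Rightarrow> ('f, 'y) trm" where
  "ctx_subst xs ts = tsubst (\<lambda>x. the (map_of (zip xs ts) x))"

record ('c, 'f, 'v, 't) sig2 =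
  CSym :: "'c set"
  FSym :: "'f set"
  far :: "'f \<Rightarrow> 'c list"
  fres :: "'f \<Rightarrow> 'c"
  Vars :: "'v set"
  vty :: "'v \<Rightarrow> 'c"
  TSym :: "'t set"
  tctx :: "'t \<Rightarrow> 'v list"
  tdom :: "'t \<Rightarrow> ('f, 'v) trm"
  tcod :: "'t \<Rightarrow> ('f, 'v) trm"

primrec trm_type :: "('c, 'f, 'v, 't) sig2 \<Rightarrow> ('x \<Rightarrow> 'c) \<Rightarrow> ('f, 'x) trm \<Rightarrow> 'c" where
  "trm_type \<Sigma> ty (Var x) = ty x"
| "trm_type \<Sigma> ty (App B ts) = fres \<Sigma> B"

inductive_set Terms :: "('c, 'f, 'v, 't) sig2 \<Rightarrow> 'x set \<Rightarrow> ('x \<Rightarrow> 'c) \<Rightarrow> ('f, 'x) trm set"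
  for \<Sigma> :: "('c, 'f, 'v, 't) sig2" and X :: "'x set" and ty :: "'x \<Rightarrow> 'c" where
  Var: "x \<in> X \<Longrightarrow> Var x \<in> Terms \<Sigma> X ty"
| App: "B \<in> FSym \<Sigma> \<Longrightarrow> map (trm_type \<Sigma> ty) ts = far \<Sigma> B \<Longrightarrow> (\<And>t. t \<in> set ts \<Longrightarrow> t \<in> Terms \<Sigma> X ty) \<Longrightarrow>
    App B ts \<in> Terms \<Sigma> X ty"

definition signature2 :: "'u itself \<Rightarrow> ('c, 'f, 'v, 't) sig2 \<Rightarrow> bool" where
  "signature2 U \<Sigma> \<longleftrightarrow>
     small U (CSym \<Sigma>) \<and> small U (FSym \<Sigma>) \<and> small U (TSym \<Sigma>) \<and>
     (\<forall>B\<in>FSym \<Sigma>. set (far \<Sigma> B) \<subseteq> CSym \<Sigma> \<and> fres \<Sigma> B \<in> CSym \<Sigma>) \<and>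
     vty \<Sigma> ` Vars \<Sigma> \<subseteq> CSym \<Sigma> \<and>
     (\<forall>c\<in>CSym \<Sigma>. countable {v \<in> Vars \<Sigma>. vty \<Sigma> v = c} \<and> infinite {v \<in> Vars \<Sigma>. vty \<Sigma> v = c}) \<and>
     (\<forall>\<alpha>\<in>TSym \<Sigma>. distinct (tctx \<Sigma> \<alpha>) \<and> set (tctx \<Sigma> \<alpha>) \<subseteq> Vars \<Sigma> \<and>
        tdom \<Sigma> \<alpha> \<in> Terms \<Sigma> (Vars \<Sigma>) (vty \<Sigma>) \<and> tcod \<Sigma> \<alpha> \<in> Terms \<Sigma> (Vars \<Sigma>) (vty \<Sigma>) \<and>
        trm_type \<Sigma> (vty \<Sigma>) (tdom \<Sigma> \<alpha>) = trm_type \<Sigma> (vty \<Sigma>) (tcod \<Sigma> \<alpha>) \<and>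
        tvars (tdom \<Sigma> \<alpha>) \<union> tvars (tcod \<Sigma> \<alpha>) \<subseteq> set (tctx \<Sigma> \<alpha>))"

record ('c, 'f, 's, 'g) sig1 =
  Srt :: "'s set"
  sty :: "'s \<Rightarrow> 'c"
  Fn :: "'g set"
  fdom :: "'g \<Rightarrow> ('f, 's) trm"
  fcod :: "'g \<Rightarrow> ('f, 's) trm"

abbreviation STerms :: "('c, 'f, 'v, 't) sig2 \<Rightarrow> ('c, 'f, 's, 'g) sig1 \<Rightarrow> ('f, 's) trm set" where
  "STerms \<Sigma> \<sigma> \<equiv> Terms \<Sigma> (Srt \<sigma>) (sty \<sigma>)"

abbreviation stype ::
    "('c, 'f, 'v, 't) sig2 \<Rightarrow> ('c, 'f, 's, 'g) sig1 \<Rightarrow> ('f, 's) trm \<Rightarrow> 'c" where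
  "stype \<Sigma> \<sigma> \<equiv> trm_type \<Sigma> (sty \<sigma>)"

definition signature1 ::
    "'u itself \<Rightarrow> ('c, 'f, 'v, 't) sig2 \<Rightarrow> ('c, 'f, 's, 'g) sig1 \<Rightarrow> bool" where
  "signature1 U \<Sigma> \<sigma> \<longleftrightarrow>
     small U (Srt \<sigma>) \<and> small U (Fn \<sigma>) \<and> sty \<sigma> ` Srt \<sigma> \<subseteq> CSym \<Sigma> \<and>
     (\<forall>f\<in>Fn \<sigma>. fdom \<sigma> f \<in> STerms \<Sigma> \<sigma> \<and> fcod \<sigma> f \<in> STerms \<Sigma> \<sigma> \<and>
        stype \<Sigma> \<sigma> (fdom \<sigma> f) = stype \<Sigma> \<sigma> (fcod \<sigma> f))"

definition signature_pair ::
    "'u itself \<Rightarrow> ('c, 'f, 'v, 't) sig2 \<Rightarrow> ('c, 'f, 's, 'g) sig1 \<Rightarrow> bool" where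
  "signature_pair U \<Sigma> \<sigma> \<longleftrightarrow> signature2 U \<Sigma> \<and> signature1 U \<Sigma> \<sigma>"


subsection \<open>The term graph\<close>

text \<open>\<open>WhA B ls q rs\<close> is the arrow \<open>B(t\<^sub>1, \<dots>, q, \<dots>, t\<^sub>n)\<close> with \<open>q\<close> in position \<open>length ls\<close>.\<close>

datatype ('f, 't, 's, 'g) garr =
  FnA 'g
| TrA 't "('f, 's) trm list"
| WhA 'f "('f, 's) trm list" "('f, 't, 's, 'g) garr" "('f, 's) trm list"

primrec adom ::
    "('c, 'f, 'v, 't) sig2 \<Rightarrow> ('c, 'f, 's, 'g) sig1 \<Rightarrow> ('f, 't, 's, 'g) garr \<Rightarrow> ('f, 's) trm" where
  "adom \<Sigma> \<sigma> (FnA f) = fdom \<sigma> f"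
| "adom \<Sigma> \<sigma> (TrA \<alpha> ts) = ctx_subst (tctx \<Sigma> \<alpha>) ts (tdom \<Sigma> \<alpha>)"
| "adom \<Sigma> \<sigma> (WhA B ls q rs) = App B (ls @ adom \<Sigma> \<sigma> q # rs)"

primrec acod ::
    "('c, 'f, 'v, 't) sig2 \<Rightarrow> ('c, 'f, 's, 'g) sig1 \<Rightarrow> ('f, 't, 's, 'g) garr \<Rightarrow> ('f, 's) trm" where
  "acod \<Sigma> \<sigma> (FnA f) = fcod \<sigma> f"
| "acod \<Sigma> \<sigma> (TrA \<alpha> ts) = ctx_subst (tctx \<Sigma> \<alpha>) ts (tcod \<Sigma> \<alpha>)"
| "acod \<Sigma> \<sigma> (WhA B ls q rs) = App B (ls @ acod \<Sigma> \<sigma> q # rs)"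

inductive_set GArr ::
    "('c, 'f, 'v, 't) sig2 \<Rightarrow> ('c, 'f, 's, 'g) sig1 \<Rightarrow> ('f, 't, 's, 'g) garr set"
  for \<Sigma> :: "('c, 'f, 'v, 't) sig2" and \<sigma> :: "('c, 'f, 's, 'g) sig1" where
  FnA: "f \<in> Fn \<sigma> \<Longrightarrow> FnA f \<in> GArr \<Sigma> \<sigma>"
| TrA: "\<alpha> \<in> TSym \<Sigma> \<Longrightarrow> set ts \<subseteq> STerms \<Sigma> \<sigma> \<Longrightarrow>
    map (stype \<Sigma> \<sigma>) ts = map (vty \<Sigma>) (tctx \<Sigma> \<alpha>) \<Longrightarrow> TrA \<alpha> ts \<in> GArr \<Sigma> \<sigma>"
| WhA: "B \<in> FSym \<Sigma> \<Longrightarrow> q \<in> GArr \<Sigma> \<sigma> \<Longrightarrow> set ls \<union> set rs \<subseteq> STerms \<Sigma> \<sigma> \<Longrightarrow>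
    map (stype \<Sigma> \<sigma>) (ls @ adom \<Sigma> \<sigma> q # rs) = far \<Sigma> B \<Longrightarrow> WhA B ls q rs \<in> GArr \<Sigma> \<sigma>"

primrec is_path ::
    "('c, 'f, 'v, 't) sig2 \<Rightarrow> ('c, 'f, 's, 'g) sig1 \<Rightarrow>
     ('f, 's) trm \<Rightarrow> ('f, 't, 's, 'g) garr list \<Rightarrow> ('f, 's) trm \<Rightarrow> bool" where
  "is_path \<Sigma> \<sigma> t\<^sub>1 [] t\<^sub>2 \<longleftrightarrow> t\<^sub>1 \<in> STerms \<Sigma> \<sigma> \<and> t\<^sub>1 = t\<^sub>2"
| "is_path \<Sigma> \<sigma> t\<^sub>1 (a # as) t\<^sub>2 \<longleftrightarrow>
     a \<in> GArr \<Sigma> \<sigma> \<and> adom \<Sigma> \<sigma> a = t\<^sub>1 \<and> is_path \<Sigma> \<sigma> (acod \<Sigma> \<sigma> a) as t\<^sub>2"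

record ('f, 't, 's, 'g) eqn =
  edom :: "('f, 's) trm"
  ecod :: "('f, 's) trm"
  elhs :: "('f, 't, 's, 'g) garr list"
  erhs :: "('f, 't, 's, 'g) garr list"

definition is_theory ::
    "('c, 'f, 'v, 't) sig2 \<Rightarrow> ('c, 'f, 's, 'g) sig1 \<Rightarrow> ('f, 't, 's, 'g) eqn set \<Rightarrow> bool" where
  "is_theory \<Sigma> \<sigma> T \<longleftrightarrow>
     (\<forall>\<epsilon>\<in>T. is_path \<Sigma> \<sigma> (edom \<epsilon>) (elhs \<epsilon>) (ecod \<epsilon>) \<and> is_path \<Sigma> \<sigma> (edom \<epsilon>) (erhs \<epsilon>) (ecod \<epsilon>))"

definition arity_terms ::
    "('c, 'f, 's, 'g) sig1 \<Rightarrow> ('f, 't, 's, 'g) eqn set \<Rightarrow> ('f, 's) trm set" where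
  "arity_terms \<sigma> T = fdom \<sigma> ` Fn \<sigma> \<union> edom ` T"

definition coarity_terms ::
    "('c, 'f, 's, 'g) sig1 \<Rightarrow> ('f, 't, 's, 'g) eqn set \<Rightarrow> ('f, 's) trm set" where
  "coarity_terms \<sigma> T = fcod \<sigma> ` Fn \<sigma> \<union> ecod ` T"

definition algebraic :: "('c, 'f, 's, 'g) sig1 \<Rightarrow> ('f, 't, 's, 'g) eqn set \<Rightarrow> bool" where
  "algebraic \<sigma> T \<longleftrightarrow> coarity_terms \<sigma> T \<subseteq> Var ` Srt \<sigma>"


section \<open>Models\<close>

text \<open>The products \<open>M\<^bsub>c\<^sub>1\<dots>c\<^sub>n\<^esub>\<close> are determined only up to isomorphism and \<open>M(B)\<close> depends on
  their choice, so a choice (\<open>MP\<close>, with projections \<open>MPr\<close>) is part of the data.\<close>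

record ('c, 'f, 't, 'o, 'm, 'a) model =
  MC :: "'c \<Rightarrow> 'o"
  MP :: "'c list \<Rightarrow> 'o"
  MPr :: "'c list \<Rightarrow> nat \<Rightarrow> 'm"
  MB :: "'f \<Rightarrow> 'm"
  MT :: "'t \<Rightarrow> 'a"

definition mtuple1 ::
    "('o, 'm, 'a) twocat \<Rightarrow> ('c, 'f, 't, 'o, 'm, 'a) model \<Rightarrow> 'c list \<Rightarrow> 'o \<Rightarrow> 'm list \<Rightarrow> 'm" where
  "mtuple1 K M cs x fs = tuple1 K {..<length cs} (MP M cs) (MPr M cs) x (\<lambda>i. fs ! i)"

definition mtuple2 ::
    "('o, 'm, 'a) twocat \<Rightarrow> ('c, 'f, 't, 'o, 'm, 'a) model \<Rightarrow> 'c list \<Rightarrow> 'o \<Rightarrow> 'a list \<Rightarrow> 'a" where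
  "mtuple2 K M cs x \<alpha>s = tuple2 K {..<length cs} (MP M cs) (MPr M cs) x (\<lambda>i. \<alpha>s ! i)"

text \<open>The 1-cell out of \<open>x\<close> denoted by a term whose variables denote the 1-cells \<open>\<rho>\<close>.\<close>

primrec interp ::
    "('o, 'm, 'a) twocat \<Rightarrow> ('c, 'f, 'v, 't) sig2 \<Rightarrow> ('c, 'f, 't, 'o, 'm, 'a) model \<Rightarrow>
     'o \<Rightarrow> ('x \<Rightarrow> 'm) \<Rightarrow> ('f, 'x) trm \<Rightarrow> 'm" where
  "interp K \<Sigma> M x \<rho> (Var v) = \<rho> v"
| "interp K \<Sigma> M x \<rho> (App B ts) =
     c1 K (MB M B) (mtuple1 K M (far \<Sigma> B) x (map (interp K \<Sigma> M x \<rho>) ts))"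

definition ctx_interp ::
    "('o, 'm, 'a) twocat \<Rightarrow> ('c, 'f, 'v, 't) sig2 \<Rightarrow> ('c, 'f, 't, 'o, 'm, 'a) model \<Rightarrow>
     'v list \<Rightarrow> ('f, 'v) trm \<Rightarrow> 'm" where
  "ctx_interp K \<Sigma> M xs = (let cs = map (vty \<Sigma>) xs in
     interp K \<Sigma> M (MP M cs) (\<lambda>v. the (map_of (zip xs (map (MPr M cs) [0..<length xs])) v)))"

definition is_model ::
    "('o, 'm, 'a) twocat \<Rightarrow> ('c, 'f, 'v, 't) sig2 \<Rightarrow> ('c, 'f, 't, 'o, 'm, 'a) model \<Rightarrow> bool" where
  "is_model K \<Sigma> M \<longleftrightarrow>
     (\<forall>c\<in>CSym \<Sigma>. MC M c \<in> Obj K) \<and>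
     (\<forall>cs. set cs \<subseteq> CSym \<Sigma> \<longrightarrow>
        is_product K {..<length cs} (\<lambda>i. MC M (cs ! i)) (MP M cs) (MPr M cs)) \<and>
     (\<forall>B\<in>FSym \<Sigma>. cell1 K (MB M B) (MP M (far \<Sigma> B)) (MC M (fres \<Sigma> B))) \<and>
     (\<forall>\<alpha>\<in>TSym \<Sigma>. cell2 K (MT M \<alpha>) (ctx_interp K \<Sigma> M (tctx \<Sigma> \<alpha>) (tdom \<Sigma> \<alpha>))
        (ctx_interp K \<Sigma> M (tctx \<Sigma> \<alpha>) (tcod \<Sigma> \<alpha>)))"

text \<open>A choice of the limits used in the construction of \<open>M\<^sup>T\<close>: the products \<open>M\<^sub>0\<close>,
  \<open>P\<^sub>\<sigma> = \<Prod>\<^sub>f M\<^sub>c\<close> and \<open>P\<^sub>T = \<Prod>\<^sub>\<epsilon> M\<^sub>c\<close> (over the function symbols and over the equations),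
  the inserter \<open>M\<^sup>\<sigma>\<close> and the equifier \<open>M\<^sup>T\<close>.\<close>

record ('f, 't, 's, 'g, 'o, 'm, 'a) constr =
  M0 :: 'o
  pr0 :: "'s \<Rightarrow> 'm"
  PF :: 'o
  prF :: "'g \<Rightarrow> 'm"
  Msig :: 'o
  usig :: 'm
  phi :: 'a
  PT :: 'o
  prT :: "('f, 't, 's, 'g) eqn \<Rightarrow> 'm"
  Mth :: 'o
  eth :: 'm

definition supp ::
    "('o, 'm, 'a) twocat \<Rightarrow> ('c, 'f, 'v, 't) sig2 \<Rightarrow> ('c, 'f, 't, 'o, 'm, 'a) model \<Rightarrow>
     ('f, 't, 's, 'g, 'o, 'm, 'a) constr \<Rightarrow> ('f, 's) trm \<Rightarrow> 'm" where
  "supp K \<Sigma> M L = interp K \<Sigma> M (M0 L) (pr0 L)"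

definition supp_sig ::
    "('o, 'm, 'a) twocat \<Rightarrow> ('c, 'f, 'v, 't) sig2 \<Rightarrow> ('c, 'f, 't, 'o, 'm, 'a) model \<Rightarrow>
     ('f, 't, 's, 'g, 'o, 'm, 'a) constr \<Rightarrow> ('f, 's) trm \<Rightarrow> 'm" where
  "supp_sig K \<Sigma> M L t = c1 K (supp K \<Sigma> M L t) (usig L)"

primrec arr_cell ::
    "('o, 'm, 'a) twocat \<Rightarrow> ('c, 'f, 'v, 't) sig2 \<Rightarrow> ('c, 'f, 't, 'o, 'm, 'a) model \<Rightarrow>
     ('f, 't, 's, 'g, 'o, 'm, 'a) constr \<Rightarrow> ('f, 't, 's, 'g) garr \<Rightarrow> 'a" where
  "arr_cell K \<Sigma> M L (FnA f) = lw K (prF L f) (phi L)"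
| "arr_cell K \<Sigma> M L (TrA \<alpha> ts) =
     rw K (MT M \<alpha>) (mtuple1 K M (map (vty \<Sigma>) (tctx \<Sigma> \<alpha>)) (Msig L) (map (supp_sig K \<Sigma> M L) ts))"
| "arr_cell K \<Sigma> M L (WhA B ls q rs) =
     lw K (MB M B) (mtuple2 K M (far \<Sigma> B) (Msig L)
       (map (\<lambda>t. id2 K (supp_sig K \<Sigma> M L t)) ls @ arr_cell K \<Sigma> M L q #
        map (\<lambda>t. id2 K (supp_sig K \<Sigma> M L t)) rs))"

primrec path_cell ::
    "('o, 'm, 'a) twocat \<Rightarrow> ('c, 'f, 'v, 't) sig2 \<Rightarrow> ('c, 'f, 's, 'g) sig1 \<Rightarrow>
     ('c, 'f, 't, 'o, 'm, 'a) model \<Rightarrow> ('f, 't, 's, 'g, 'o, 'm, 'a) constr \<Rightarrow>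
     ('f, 's) trm \<Rightarrow> ('f, 't, 's, 'g) garr list \<Rightarrow> 'a" where
  "path_cell K \<Sigma> \<sigma> M L t [] = id2 K (supp_sig K \<Sigma> M L t)"
| "path_cell K \<Sigma> \<sigma> M L t (a # as) =
     vc K (path_cell K \<Sigma> \<sigma> M L (acod \<Sigma> \<sigma> a) as) (arr_cell K \<Sigma> M L a)"

definition is_construction ::
    "('o, 'm, 'a) twocat \<Rightarrow> ('c, 'f, 'v, 't) sig2 \<Rightarrow> ('c, 'f, 's, 'g) sig1 \<Rightarrow>
     ('f, 't, 's, 'g) eqn set \<Rightarrow> ('c, 'f, 't, 'o, 'm, 'a) model \<Rightarrow>
     ('f, 't, 's, 'g, 'o, 'm, 'a) constr \<Rightarrow> bool" where
  "is_construction K \<Sigma> \<sigma> T M L \<longleftrightarrow>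
     is_product K (Srt \<sigma>) (\<lambda>s. MC M (sty \<sigma> s)) (M0 L) (pr0 L) \<and>
     is_product K (Fn \<sigma>) (\<lambda>f. MC M (stype \<Sigma> \<sigma> (fdom \<sigma> f))) (PF L) (prF L) \<and>
     is_inserter K
       (tuple1 K (Fn \<sigma>) (PF L) (prF L) (M0 L) (\<lambda>f. supp K \<Sigma> M L (fdom \<sigma> f)))
       (tuple1 K (Fn \<sigma>) (PF L) (prF L) (M0 L) (\<lambda>f. supp K \<Sigma> M L (fcod \<sigma> f)))
       (Msig L) (usig L) (phi L) \<and>
     is_product K T (\<lambda>\<epsilon>. MC M (stype \<Sigma> \<sigma> (edom \<epsilon>))) (PT L) (prT L) \<and>
     is_equifier K (Msig L)
       (tuple2 K T (PT L) (prT L) (Msig L) (\<lambda>\<epsilon>. path_cell K \<Sigma> \<sigma> M L (edom \<epsilon>) (elhs \<epsilon>)))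
       (tuple2 K T (PT L) (prT L) (Msig L) (\<lambda>\<epsilon>. path_cell K \<Sigma> \<sigma> M L (edom \<epsilon>) (erhs \<epsilon>)))
       (Mth L) (eth L)"

definition forgetful ::
    "('o, 'm, 'a) twocat \<Rightarrow> ('f, 't, 's, 'g, 'o, 'm, 'a) constr \<Rightarrow> 'm" where
  "forgetful K L = c1 K (usig L) (eth L)"

text \<open>The functor \<open>K(x, M\<^bsub>c\<^sub>i\<^esub>) \<rightarrow> K(x, M\<^sub>d)\<close> induced by \<open>M(B)\<close> in the variable \<open>i\<close> when the other
  variables are held fixed at \<open>fs\<close> (the entry of \<open>fs\<close> at \<open>i\<close> is irrelevant).\<close>

definition partial_MB ::
    "('o, 'm, 'a) twocat \<Rightarrow> ('c, 'f, 'v, 't) sig2 \<Rightarrow> ('c, 'f, 't, 'o, 'm, 'a) model \<Rightarrow>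
     'f \<Rightarrow> 'o \<Rightarrow> nat \<Rightarrow> 'm list \<Rightarrow> ('m, 'a, 'm, 'a) func" where
  "partial_MB K \<Sigma> M B x i fs = \<lparr>
     fo = (\<lambda>g. c1 K (MB M B) (mtuple1 K M (far \<Sigma> B) x (fs[i := g]))),
     fa = (\<lambda>\<alpha>. lw K (MB M B) (mtuple2 K M (far \<Sigma> B) x ((map (id2 K) fs)[i := \<alpha>])))\<rparr>"

text \<open>\<open>P\<close> receives the object \<open>x\<close>, the category symbols of the variable and of the result, and
  the functor obtained by fixing all other variables.\<close>

definition MB_componentwise ::
    "('o \<Rightarrow> 'c \<Rightarrow> 'c \<Rightarrow> ('m, 'a, 'm, 'a) func \<Rightarrow> bool) \<Rightarrow>
     ('o, 'm, 'a) twocat \<Rightarrow> ('c, 'f, 'v, 't) sig2 \<Rightarrow> ('c, 'f, 't, 'o, 'm, 'a) model \<Rightarrow> 'f \<Rightarrow> bool" where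
  "MB_componentwise P K \<Sigma> M B \<longleftrightarrow>
     (\<forall>x\<in>Obj K. \<forall>i<length (far \<Sigma> B). \<forall>fs. length fs = length (far \<Sigma> B) \<and>
        (\<forall>j<length (far \<Sigma> B). j \<noteq> i \<longrightarrow> cell1 K (fs ! j) x (MC M (far \<Sigma> B ! j))) \<longrightarrow>
        P x (far \<Sigma> B ! i) (fres \<Sigma> B) (partial_MB K \<Sigma> M B x i fs))"

definition MB_preserves_classes_componentwise ::
    "('o, 'm, 'a) twocat \<Rightarrow> ('c, 'f, 'v, 't) sig2 \<Rightarrow> ('c, 'f, 't, 'o, 'm, 'a) model \<Rightarrow>
     ('c \<Rightarrow> ('o, 'a) ofs_family) \<Rightarrow> 'f \<Rightarrow> bool" where
  "MB_preserves_classes_componentwise K \<Sigma> M R =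
     MB_componentwise (\<lambda>x c d F.
       preserves_class F (fst (R c x)) (fst (R d x)) \<and>
       preserves_class F (snd (R c x)) (snd (R d x))) K \<Sigma> M"

definition MB_preserves_reflexive_coeqs_componentwise ::
    "('o, 'm, 'a) twocat \<Rightarrow> ('c, 'f, 'v, 't) sig2 \<Rightarrow> ('c, 'f, 't, 'o, 'm, 'a) model \<Rightarrow> 'f \<Rightarrow> bool" where
  "MB_preserves_reflexive_coeqs_componentwise K \<Sigma> M =
     MB_componentwise (\<lambda>x c d F.
       preserves_reflexive_coeqs (hom_cat K x (MC M c)) (hom_cat K x (MC M d)) F) K \<Sigma> M"

end

theory Submission
  imports Defs
begin

text \<open>The hom-category \<open>K(x, M\<^sup>T)\<close> is the category of objects \<open>d\<close> of \<open>K(x, M\<^sub>0)\<close> with arrows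
  \<open>M(t\<^sub>1) d \<rightarrow> M(t\<^sub>2) d\<close> satisfying the equations, and \<open>K(x, M\<^sub>0)\<close> is a product of the \<open>K(x, M\<^sub>c)\<close>. All
  structure is lifted along the forgetful functor in the same way. If \<open>d\<close> is the middle object of a
  factorization, a limit, or the quotient of an equivalence relation of structured objects, then the
  structure arrow on \<open>d\<close> is the unique diagonal filler between the image of the left arrow under
  \<open>M(t\<^sub>1)\<close> and the image of the right arrow under \<open>M(t\<^sub>2)\<close>, respectively the arrow induced by the
  universal property of the limit preserved by \<open>M(t\<^sub>2)\<close> or of the coequalizer preserved by \<open>M(t\<^sub>1)\<close>.
  The same uniqueness shows that both sides of an equation agree on \<open>d\<close>, because both are natural.
  Regularity comes from lifting the factorization system of regular epimorphisms and monomorphisms.\<close>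

section \<open>Orthogonal factorization systems\<close>

text \<open>Four obstacles shape the development. A regular category is given by some factorization
  system with the monomorphisms on the right, so its left class must first be recognized as the
  class of regular epimorphisms before it can be compared along functors. Preservation of finite
  limits speaks of diagrams over categories of natural numbers, so monicity and joint monicity are
  rewritten as limits before functors can be seen to preserve them. The sides of an equation are
  composites along paths, but the lifting uses only that they are natural and agree on models; it
  therefore speaks of an arbitrary pair of arrows that agree after composition with compatible
  arrows from and to structured objects, and paths occur only when it is instantiated. Finally,
  preservation in each variable separately has to yield preservation in all variables at once. For
  classes closed under composition this is a factorization into arrows that move one variable; for
  coequalizers the factorization alone does not provide the equation in a single variable, and the
  common section of a reflexive pair is what isolates it.\<close>

lemma in_homD:
  assumes "in_hom C f a b"
  shows "f \<in> Ar C" "Dm C f = a" "Cd C f = b"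
  using assms by (auto simp: in_hom_def)

definition is_iso :: "('o, 'a) cat \<Rightarrow> 'a \<Rightarrow> 'o \<Rightarrow> 'o \<Rightarrow> bool" where
  "is_iso C f a b \<longleftrightarrow> in_hom C f a b \<and>
     (\<exists>g. in_hom C g b a \<and> Cmp C g f = Idn C a \<and> Cmp C f g = Idn C b)"

lemma orthogonalI:
  assumes "in_hom C e a b" "in_hom C m c d"
    and "\<And>r s. in_hom C r a c \<Longrightarrow> in_hom C s b d \<Longrightarrow> Cmp C m r = Cmp C s e \<Longrightarrow>
      \<exists>!h. in_hom C h b c \<and> Cmp C h e = r \<and> Cmp C m h = s"
  shows "orthogonal C e m"
  using assms by (auto simp: orthogonal_def in_hom_def)

lemma orthogonalD:
  assumes "orthogonal C e m" "in_hom C e a b" "in_hom C m c d"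
    "in_hom C r a c" "in_hom C s b d" "Cmp C m r = Cmp C s e"
  shows "\<exists>!h. in_hom C h b c \<and> Cmp C h e = r \<and> Cmp C m h = s"
proof -
  have "Dm C e = a" "Cd C e = b" "Dm C m = c" "Cd C m = d"
    using assms(2,3) by (auto simp: in_hom_def)
  then show ?thesis
    using assms(1,4-) unfolding orthogonal_def by blast
qed

lemma orthogonal_fill:
  assumes "orthogonal C e m" "in_hom C e a b" "in_hom C m c d"
    "in_hom C r a c" "in_hom C s b d" "Cmp C m r = Cmp C s e"
  obtains h where "in_hom C h b c" "Cmp C h e = r" "Cmp C m h = s"
  using orthogonalD[OF assms] by blast

lemma is_coequalizerI:
  assumes "in_hom C f a b" "in_hom C g a b" "in_hom C e b c" "Cmp C e f = Cmp C e g"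
    and "\<And>z k. in_hom C k b z \<Longrightarrow> Cmp C k f = Cmp C k g \<Longrightarrow> \<exists>h. in_hom C h c z \<and> Cmp C h e = k"
    and "\<And>z h h'. in_hom C h c z \<Longrightarrow> in_hom C h' c z \<Longrightarrow> Cmp C h e = Cmp C h' e \<Longrightarrow> h = h'"
  shows "is_coequalizer C f g e"
proof -
  have "\<exists>!h. in_hom C h c z \<and> Cmp C h e = k" if "in_hom C k b z" "Cmp C k f = Cmp C k g" for z k
    using assms(5)[OF that] assms(6) by metis
  with assms(1-4) show ?thesis
    unfolding is_coequalizer_def in_hom_def by auto
qed

lemma is_coequalizerE:
  assumes "is_coequalizer C f g e"
  obtains a b c where "in_hom C f a b" "in_hom C g a b" "in_hom C e b c"
    "Cmp C e f = Cmp C e g"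
  using assms unfolding is_coequalizer_def in_hom_def by auto

lemma is_coequalizer_fac:
  assumes "is_coequalizer C f g e" "in_hom C e b c" "in_hom C k b z" "Cmp C k f = Cmp C k g"
  obtains h where "in_hom C h c z" "Cmp C h e = k"
proof -
  have "Dm C e = b" "Cd C e = c" using assms(2) by (auto simp: in_hom_def)
  then show ?thesis using assms(1,3,4) that unfolding is_coequalizer_def by blast
qed

lemma is_pullbackI:
  assumes "in_hom C f a c" "in_hom C g b c" "in_hom C p d a" "in_hom C q d b"
    "Cmp C f p = Cmp C g q"
    and "\<And>z r s. in_hom C r z a \<Longrightarrow> in_hom C s z b \<Longrightarrow> Cmp C f r = Cmp C g s \<Longrightarrow>
      \<exists>h. in_hom C h z d \<and> Cmp C p h = r \<and> Cmp C q h = s"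
    and "\<And>z h h'. in_hom C h z d \<Longrightarrow> in_hom C h' z d \<Longrightarrow> Cmp C p h = Cmp C p h' \<Longrightarrow>
      Cmp C q h = Cmp C q h' \<Longrightarrow> h = h'"
  shows "is_pullback C f g p q"
proof -
  have "\<exists>!h. in_hom C h z d \<and> Cmp C p h = r \<and> Cmp C q h = s"
    if "in_hom C r z a" "in_hom C s z b" "Cmp C f r = Cmp C g s" for z r s
    using assms(6)[OF that] assms(7) by metis
  with assms(1-5) show ?thesis
    unfolding is_pullback_def in_hom_def by auto
qed

lemma is_pullbackE:
  assumes "is_pullback C f g p q"
  obtains a b c d where "in_hom C f a c" "in_hom C g b c" "in_hom C p d a" "in_hom C q d b"
    "Cmp C f p = Cmp C g q"
  using assms unfolding is_pullback_def in_hom_def by auto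

lemma is_pullback_ex1:
  assumes "is_pullback C f g p q" "in_hom C p d a" "in_hom C q d b"
    "in_hom C r z a" "in_hom C s z b" "Cmp C f r = Cmp C g s"
  shows "\<exists>!h. in_hom C h z d \<and> Cmp C p h = r \<and> Cmp C q h = s"
proof -
  have "Dm C f = a" "Dm C g = b" "Dm C p = d"
    using assms(1-3) unfolding is_pullback_def in_hom_def by auto
  then show ?thesis
    using assms unfolding is_pullback_def by blast
qed

lemma is_pullback_fac:
  assumes "is_pullback C f g p q" "in_hom C p d a" "in_hom C q d b"
    "in_hom C r z a" "in_hom C s z b" "Cmp C f r = Cmp C g s"
  obtains h where "in_hom C h z d" "Cmp C p h = r" "Cmp C q h = s"
  using is_pullback_ex1[OF assms] by blast

lemma mono_arrowsI:
  assumes "in_hom C m a b"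
    "\<And>z f g. in_hom C f z a \<Longrightarrow> in_hom C g z a \<Longrightarrow> Cmp C m f = Cmp C m g \<Longrightarrow> f = g"
  shows "m \<in> mono_arrows C"
  using assms unfolding mono_arrows_def in_hom_def by auto

lemma mono_arrowsD:
  assumes "m \<in> mono_arrows C" "in_hom C m a b" "in_hom C f z a" "in_hom C g z a"
    "Cmp C m f = Cmp C m g"
  shows "f = g"
  using assms unfolding mono_arrows_def in_hom_def by auto

lemma OFS_right_eq: "is_OFS C E M \<Longrightarrow> M = {m \<in> Ar C. \<forall>e\<in>E. orthogonal C e m}"
  unfolding is_OFS_def by (rule conjunct1[OF conjunct2])

lemma OFS_left_eq: "is_OFS C E M \<Longrightarrow> E = {e \<in> Ar C. \<forall>m\<in>M. orthogonal C e m}"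
  unfolding is_OFS_def by (rule conjunct2[OF conjunct2])

lemma OFS_subset:
  assumes "is_OFS C E M"
  shows "E \<subseteq> Ar C" "M \<subseteq> Ar C"
  using OFS_left_eq[OF assms] OFS_right_eq[OF assms] by blast+

lemma OFS_orthogonal:
  assumes "is_OFS C E M" "e \<in> E" "m \<in> M"
  shows "orthogonal C e m"
  using OFS_right_eq[OF assms(1)] assms(2,3) by blast

lemma OFS_leftI:
  assumes "is_OFS C E M" "e \<in> Ar C" "\<And>m. m \<in> M \<Longrightarrow> orthogonal C e m"
  shows "e \<in> E"
  using OFS_left_eq[OF assms(1)] assms(2,3) by blast

lemma OFS_rightI:
  assumes "is_OFS C E M" "m \<in> Ar C" "\<And>e. e \<in> E \<Longrightarrow> orthogonal C e m"
  shows "m \<in> M"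
  using OFS_right_eq[OF assms(1)] assms(2,3) by blast

lemma OFS_factor:
  assumes "is_OFS C E M" "in_hom C f a b"
  obtains e m c where "e \<in> E" "m \<in> M" "f = Cmp C m e" "Cd C e = c" "Dm C m = c"
  using conjunct1[OF assms(1)[unfolded is_OFS_def]] assms(2) that unfolding in_hom_def by metis

text \<open>Orthogonality reverses inclusions: an arrow of \<open>E'\<close> is orthogonal to
  \<open>M'\<close>, hence to the smaller \<open>M\<close>, hence lies in \<open>E\<close>.
  Preservation by the projections yields only inclusions of classes, and this turns them into
  equalities.\<close>

lemma OFS_eqI:
  assumes "is_OFS C E M" "is_OFS C E' M'" "E \<subseteq> E'" "M \<subseteq> M'"
  shows "E = E' \<and> M = M'"
proof
  show "E = E'"
    using OFS_leftI[OF assms(1)] OFS_subset(1)[OF assms(2)] OFS_orthogonal[OF assms(2)] assms(3,4)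
    by (meson subset_antisym subset_iff)
  show "M = M'"
    using OFS_rightI[OF assms(1)] OFS_subset(2)[OF assms(2)] OFS_orthogonal[OF assms(2)] assms(3,4)
    by (meson subset_antisym subset_iff)
qed

context category
begin

lemma hom_ob:
  assumes "in_hom C f a b"
  shows "a \<in> Ob C" "b \<in> Ob C"
  using assms dom_in cod_in by (auto simp: in_hom_def)

lemma ar_hom: "f \<in> Ar C \<Longrightarrow> in_hom C f (Dm C f) (Cd C f)"
  by (auto simp: in_hom_def)

lemma OFS_factor_hom:
  assumes "is_OFS C E M" "in_hom C f a b"
  obtains e m c where "e \<in> E" "m \<in> M" "f = Cmp C m e" "in_hom C e a c" "in_hom C m c b"
proof -
  obtain e m c where em: "e \<in> E" "m \<in> M" "f = Cmp C m e" "Cd C e = c" "Dm C m = c"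
    by (rule OFS_factor[OF assms])
  then have e: "in_hom C e (Dm C e) c" and m: "in_hom C m c (Cd C m)"
    using OFS_subset[OF assms(1)] by (auto simp: in_hom_def)
  then have "in_hom C f (Dm C e) (Cd C m)" using comp_in em(3) by blast
  with assms(2) have "Dm C e = a" "Cd C m = b" by (auto simp: in_hom_def)
  with e m em show ?thesis using that by blast
qed

text \<open>A working criterion in place of the two equations between each class and the orthogonal
  complement of the other. If m is right orthogonal to \<open>E\<close>, factor it as
  \<open>m' e\<close>; a filler exhibits e as an isomorphism, and closure of \<open>M\<close> under
  composition with isomorphisms puts m into \<open>M\<close>.\<close>

lemma OFS_I:
  assumes sub: "E \<subseteq> Ar C" "M \<subseteq> Ar C"
    and fac: "\<And>f a b. in_hom C f a b \<Longrightarrow>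
      \<exists>e m c. e \<in> E \<and> m \<in> M \<and> in_hom C e a c \<and> in_hom C m c b \<and> f = Cmp C m e"
    and orth: "\<And>e m. e \<in> E \<Longrightarrow> m \<in> M \<Longrightarrow> orthogonal C e m"
    and E_iso: "\<And>e g a b c. e \<in> E \<Longrightarrow> in_hom C e a b \<Longrightarrow> is_iso C g b c \<Longrightarrow> Cmp C g e \<in> E"
    and M_iso: "\<And>m g a b c. m \<in> M \<Longrightarrow> in_hom C m b c \<Longrightarrow> is_iso C g a b \<Longrightarrow> Cmp C m g \<in> M"
  shows "is_OFS C E M"
  unfolding is_OFS_def
proof (intro conjI ballI)
  fix f assume "f \<in> Ar C"
  then show "\<exists>e\<in>E. \<exists>m\<in>M. Cd C e = Dm C m \<and> f = Cmp C m e"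
    using fac[OF ar_hom] by (metis in_homD(2,3))
next
  show "M = {m \<in> Ar C. \<forall>e\<in>E. orthogonal C e m}"
  proof (intro set_eqI iffI)
    fix m assume "m \<in> {m \<in> Ar C. \<forall>e\<in>E. orthogonal C e m}"
    then have m: "in_hom C m (Dm C m) (Cd C m)" and mo: "\<And>e. e \<in> E \<Longrightarrow> orthogonal C e m"
      using ar_hom by auto
    obtain e m' c where em: "e \<in> E" "m' \<in> M" "in_hom C e (Dm C m) c" "in_hom C m' c (Cd C m)"
      "m = Cmp C m' e"
      using fac[OF m] by blast
    have i: "in_hom C (Idn C (Dm C m)) (Dm C m) (Dm C m)" "in_hom C (Idn C c) c c"
      using id_in hom_ob m em by blast+
    \<comment> \<open>With the identity as top side the filler is a retraction of e. That it is also
      a section follows because \<open>e d\<close> and the identity fill the same square of e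
      against m'.\<close>
    have "Cmp C m (Idn C (Dm C m)) = Cmp C m' e"
      using comp_id_right[OF m] em by simp
    then obtain d where d: "in_hom C d c (Dm C m)" "Cmp C d e = Idn C (Dm C m)" "Cmp C m d = m'"
      using orthogonal_fill[OF mo[OF em(1)] em(3) m i(1) em(4)] by blast
    have ed: "in_hom C (Cmp C e d) c c" using comp_in d em by blast
    have "Cmp C (Cmp C e d) e = e"
      using comp_assoc[OF em(3) d(1) em(3)] d(2) comp_id_right[OF em(3)] by simp
    moreover have "Cmp C m' (Cmp C e d) = m'"
      using comp_assoc[OF d(1) em(3) em(4)] em(5) d(3) by simp
    moreover have "Cmp C (Idn C c) e = e" "Cmp C m' (Idn C c) = m'"
      using comp_id_left comp_id_right em by blast+
    ultimately have "Cmp C e d = Idn C c"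
      using orthogonalD[OF orth[OF em(1,2)] em(3,4,3,4)] ed i by blast
    then have "is_iso C e (Dm C m) c"
      using d em unfolding is_iso_def by blast
    then show "m \<in> M" using M_iso em by blast
  qed (use sub orth in blast)
  show "E = {e \<in> Ar C. \<forall>m\<in>M. orthogonal C e m}"
  proof (intro set_eqI iffI)
    fix e assume "e \<in> {e \<in> Ar C. \<forall>m\<in>M. orthogonal C e m}"
    then have e: "in_hom C e (Dm C e) (Cd C e)" and eo: "\<And>m. m \<in> M \<Longrightarrow> orthogonal C e m"
      using ar_hom by auto
    obtain e' m c where em: "e' \<in> E" "m \<in> M" "in_hom C e' (Dm C e) c" "in_hom C m c (Cd C e)"
      "e = Cmp C m e'"
      using fac[OF e] by blast
    have i: "in_hom C (Idn C (Cd C e)) (Cd C e) (Cd C e)" "in_hom C (Idn C c) c c"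
      using id_in hom_ob e em by blast+
    \<comment> \<open>Dually the identity is the bottom side, so the filler is a section of
      m.\<close>
    have "Cmp C m e' = Cmp C (Idn C (Cd C e)) e"
      using comp_id_left[OF e] em by simp
    then obtain d where d: "in_hom C d (Cd C e) c" "Cmp C d e = e'" "Cmp C m d = Idn C (Cd C e)"
      using orthogonal_fill[OF eo[OF em(2)] e em(4) em(3) i(1)] by blast
    have dm: "in_hom C (Cmp C d m) c c" using comp_in d em by blast
    have "Cmp C (Cmp C d m) e' = e'"
      using comp_assoc[OF em(3,4) d(1)] d(2) em(5) by simp
    moreover have "Cmp C m (Cmp C d m) = m"
      using comp_assoc[OF em(4) d(1) em(4)] d(3) comp_id_left[OF em(4)] by simp
    moreover have "Cmp C (Idn C c) e' = e'" "Cmp C m (Idn C c) = m"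
      using comp_id_left comp_id_right em by blast+
    ultimately have "Cmp C d m = Idn C c"
      using orthogonalD[OF orth[OF em(1,2)] em(3,4,3,4)] dm i by blast
    then have "is_iso C m c (Cd C e)"
      using d em unfolding is_iso_def by blast
    then show "e \<in> E" using E_iso em by metis
  qed (use sub orth in blast)
qed

lemma OFS_left_comp:
  assumes O: "is_OFS C E M" and e: "e \<in> E" "in_hom C e a b" and e': "e' \<in> E" "in_hom C e' b c"
  shows "Cmp C e' e \<in> E"
proof (rule OFS_leftI[OF O])
  have e'e: "in_hom C (Cmp C e' e) a c" using comp_in e e' by blast
  then show "Cmp C e' e \<in> Ar C" by (rule in_homD)
  fix m assume m: "m \<in> M"
  then have mh: "in_hom C m (Dm C m) (Cd C m)" using OFS_subset[OF O] ar_hom by blast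
  note o = OFS_orthogonal[OF O e(1) m] and o' = OFS_orthogonal[OF O e'(1) m]
  show "orthogonal C (Cmp C e' e) m"
  proof (rule orthogonalI[OF e'e mh])
    fix r s assume r: "in_hom C r a (Dm C m)" and s: "in_hom C s c (Cd C m)"
      and eq: "Cmp C m r = Cmp C s (Cmp C e' e)"
    have se: "in_hom C (Cmp C s e') b (Cd C m)" using comp_in s e' by blast
    have eq': "Cmp C m r = Cmp C (Cmp C s e') e" using eq comp_assoc[OF e(2) e'(2) s] by simp
    obtain h where h: "in_hom C h b (Dm C m)" "Cmp C h e = r" "Cmp C m h = Cmp C s e'"
      using eq' by (rule orthogonal_fill[OF o e(2) mh r se])
    obtain k where k: "in_hom C k c (Dm C m)" "Cmp C k e' = h" "Cmp C m k = s"
      by (rule orthogonal_fill[OF o' e'(2) mh h(1) s h(3)])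
    show "\<exists>!h. in_hom C h c (Dm C m) \<and> Cmp C h (Cmp C e' e) = r \<and> Cmp C m h = s"
    proof (rule ex1I[of _ k])
      show "in_hom C k c (Dm C m) \<and> Cmp C k (Cmp C e' e) = r \<and> Cmp C m k = s"
        using k h comp_assoc[OF e(2) e'(2) k(1)] by simp
      fix l assume l: "in_hom C l c (Dm C m) \<and> Cmp C l (Cmp C e' e) = r \<and> Cmp C m l = s"
      have "Cmp C (Cmp C l e') e = r" using l comp_assoc[OF e(2) e'(2), of l] by auto
      moreover have "Cmp C m (Cmp C l e') = Cmp C s e'"
        using l comp_assoc[OF e'(2) _ mh, of l] by auto
      moreover have "in_hom C (Cmp C l e') b (Dm C m)" using comp_in e' l by blast
      ultimately have "Cmp C l e' = h"
        using orthogonalD[OF o e(2) mh r se eq'] h by blast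
      then show "l = k"
        using orthogonalD[OF o' e'(2) mh h(1) s h(3)] k l by blast
    qed
  qed
qed

lemma OFS_right_comp:
  assumes O: "is_OFS C E M" and m: "m \<in> M" "in_hom C m a b" and m': "m' \<in> M" "in_hom C m' b c"
  shows "Cmp C m' m \<in> M"
proof (rule OFS_rightI[OF O])
  have m'm: "in_hom C (Cmp C m' m) a c" using comp_in m m' by blast
  then show "Cmp C m' m \<in> Ar C" by (rule in_homD)
  fix e assume e: "e \<in> E"
  then have eh: "in_hom C e (Dm C e) (Cd C e)" using OFS_subset[OF O] ar_hom by blast
  note o = OFS_orthogonal[OF O e m(1)] and o' = OFS_orthogonal[OF O e m'(1)]
  show "orthogonal C e (Cmp C m' m)"
  proof (rule orthogonalI[OF eh m'm])
    fix r s assume r: "in_hom C r (Dm C e) a" and s: "in_hom C s (Cd C e) c"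
      and eq: "Cmp C (Cmp C m' m) r = Cmp C s e"
    have mr: "in_hom C (Cmp C m r) (Dm C e) b" using comp_in r m by blast
    have eq': "Cmp C m' (Cmp C m r) = Cmp C s e" using eq comp_assoc[OF r m(2) m'(2)] by simp
    then obtain h where h: "in_hom C h (Cd C e) b" "Cmp C h e = Cmp C m r" "Cmp C m' h = s"
      by (rule orthogonal_fill[OF o' eh m'(2) mr s])
    obtain k where k: "in_hom C k (Cd C e) a" "Cmp C k e = r" "Cmp C m k = h"
      by (rule orthogonal_fill[OF o eh m(2) r h(1) h(2)[symmetric]])
    show "\<exists>!h. in_hom C h (Cd C e) a \<and> Cmp C h e = r \<and> Cmp C (Cmp C m' m) h = s"
    proof (rule ex1I[of _ k])
      show "in_hom C k (Cd C e) a \<and> Cmp C k e = r \<and> Cmp C (Cmp C m' m) k = s"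
        using k h comp_assoc[OF k(1) m(2) m'(2)] by simp
      fix l assume l: "in_hom C l (Cd C e) a \<and> Cmp C l e = r \<and> Cmp C (Cmp C m' m) l = s"
      have "Cmp C m' (Cmp C m l) = s" using l comp_assoc[OF _ m(2) m'(2), of l] by auto
      moreover have "Cmp C (Cmp C m l) e = Cmp C m r"
        using l comp_assoc[OF eh _ m(2), of l] by auto
      moreover have "in_hom C (Cmp C m l) (Cd C e) b" using comp_in m l by blast
      ultimately have "Cmp C m l = h"
        using orthogonalD[OF o' eh m'(2) mr s eq'] h by blast
      then show "l = k"
        using orthogonalD[OF o eh m(2) r h(1) h(2)[symmetric]] k l by blast
    qed
  qed
qed

lemma iso_orthogonal:
  assumes g: "is_iso C g a b" and f: "in_hom C f c d"
  shows "orthogonal C g f" "orthogonal C f g"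
proof -
  obtain g' where g': "in_hom C g a b" "in_hom C g' b a" "Cmp C g' g = Idn C a" "Cmp C g g' = Idn C b"
    using g unfolding is_iso_def by blast
  show "orthogonal C g f"
  proof (rule orthogonalI[OF g'(1) f])
    fix r s assume r: "in_hom C r a c" and s: "in_hom C s b d" and eq: "Cmp C f r = Cmp C s g"
    show "\<exists>!h. in_hom C h b c \<and> Cmp C h g = r \<and> Cmp C f h = s"
    proof (rule ex1I[of _ "Cmp C r g'"], intro conjI)
      show "in_hom C (Cmp C r g') b c" using comp_in r g' by blast
      show "Cmp C (Cmp C r g') g = r"
        using comp_assoc[OF g'(1,2) r] g' comp_id_right[OF r] by simp
      show "Cmp C f (Cmp C r g') = s"
        using comp_assoc[OF g'(2) r f] eq comp_assoc[OF g'(2,1) s] g' comp_id_right[OF s] by simp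
      fix h assume h: "in_hom C h b c \<and> Cmp C h g = r \<and> Cmp C f h = s"
      then show "h = Cmp C r g'"
        using comp_assoc[OF g'(2,1), of h c] g' comp_id_right[of h b c] by auto
    qed
  qed
  show "orthogonal C f g"
  proof (rule orthogonalI[OF f g'(1)])
    fix r s assume r: "in_hom C r c a" and s: "in_hom C s d b" and eq: "Cmp C g r = Cmp C s f"
    show "\<exists>!h. in_hom C h d a \<and> Cmp C h f = r \<and> Cmp C g h = s"
    proof (rule ex1I[of _ "Cmp C g' s"], intro conjI)
      show "in_hom C (Cmp C g' s) d a" using comp_in s g' by blast
      show "Cmp C g (Cmp C g' s) = s"
        using comp_assoc[OF s g'(2,1)] g' comp_id_left[OF s] by simp
      show "Cmp C (Cmp C g' s) f = r"
        using comp_assoc[OF f s g'(2)] eq comp_assoc[OF r g'(1,2)] g' comp_id_left[OF r] by simp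
      fix h assume h: "in_hom C h d a \<and> Cmp C h f = r \<and> Cmp C g h = s"
      then show "h = Cmp C g' s"
        using comp_assoc[OF _ g'(1,2), of h d] g' comp_id_left[of h d a] by auto
    qed
  qed
qed

lemma OFS_iso:
  assumes "is_OFS C E M" "is_iso C g a b"
  shows "g \<in> E" "g \<in> M"
proof -
  have "g \<in> Ar C" using assms(2) unfolding is_iso_def in_hom_def by blast
  then show "g \<in> E" "g \<in> M"
    using OFS_leftI[OF assms(1)] OFS_rightI[OF assms(1)] iso_orthogonal[OF assms(2)] ar_hom
      OFS_subset[OF assms(1)] by blast+
qed

lemma id_iso: "a \<in> Ob C \<Longrightarrow> is_iso C (Idn C a) a a"
  unfolding is_iso_def using id_in comp_id_left by blast

end

lemma functor_ob: "is_functor C D F \<Longrightarrow> a \<in> Ob C \<Longrightarrow> fo F a \<in> Ob D"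
  and functor_id: "is_functor C D F \<Longrightarrow> a \<in> Ob C \<Longrightarrow> fa F (Idn C a) = Idn D (fo F a)"
  and functor_hom: "is_functor C D F \<Longrightarrow> in_hom C f a b \<Longrightarrow> in_hom D (fa F f) (fo F a) (fo F b)"
  and functor_comp: "is_functor C D F \<Longrightarrow> in_hom C f a b \<Longrightarrow> in_hom C g b c \<Longrightarrow>
    fa F (Cmp C g f) = Cmp D (fa F g) (fa F f)"
  unfolding is_functor_def by blast+

lemma functor_iso:
  assumes "category C" "is_functor C D F" "is_iso C f a b"
  shows "is_iso D (fa F f) (fo F a) (fo F b)"
proof -
  obtain g where g: "in_hom C f a b" "in_hom C g b a" "Cmp C g f = Idn C a" "Cmp C f g = Idn C b"
    using assms(3) unfolding is_iso_def by blast
  have "a \<in> Ob C" "b \<in> Ob C" using category.hom_ob[OF assms(1) g(1)] by auto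
  then show ?thesis unfolding is_iso_def
    using g functor_hom[OF assms(2)] functor_comp[OF assms(2) g(1,2)]
      functor_comp[OF assms(2) g(2,1)] functor_id[OF assms(2)] by metis
qed

lemma functor_square:
  assumes "is_functor C D F" "in_hom C f a b" "in_hom C g b d" "in_hom C f' a c" "in_hom C g' c d"
    "Cmp C g f = Cmp C g' f'"
  shows "Cmp D (fa F g) (fa F f) = Cmp D (fa F g') (fa F f')"
  using functor_comp[OF assms(1)] assms(2-) by metis

section \<open>Finite limits\<close>

lemma is_limitI:
  assumes "is_cone J C G a l"
    and "\<And>b m. is_cone J C G b m \<Longrightarrow> \<exists>h. in_hom C h b a \<and> (\<forall>j\<in>Ob J. Cmp C (l j) h = m j)"
    and "\<And>b h h'. in_hom C h b a \<Longrightarrow> in_hom C h' b a \<Longrightarrow>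
      (\<And>j. j \<in> Ob J \<Longrightarrow> Cmp C (l j) h = Cmp C (l j) h') \<Longrightarrow> h = h'"
  shows "is_limit J C G a l"
  unfolding is_limit_def
proof (intro conjI allI impI)
  fix b m assume m: "is_cone J C G b m"
  obtain h where h: "in_hom C h b a" "\<forall>j\<in>Ob J. Cmp C (l j) h = m j"
    using assms(2)[OF m] by (elim exE conjE)
  show "\<exists>!h. in_hom C h b a \<and> (\<forall>j\<in>Ob J. Cmp C (l j) h = m j)"
  proof (rule ex1I[of _ h])
    fix h' assume "in_hom C h' b a \<and> (\<forall>j\<in>Ob J. Cmp C (l j) h' = m j)"
    with h show "h' = h" by - (rule assms(3), auto)
  qed (use h in blast)
qed (rule assms(1))

lemma limit_cone: "is_limit J C G a l \<Longrightarrow> is_cone J C G a l"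
  unfolding is_limit_def by blast

lemma limit_fac:
  assumes "is_limit J C G a l" "is_cone J C G b m"
  obtains h where "in_hom C h b a" "\<And>j. j \<in> Ob J \<Longrightarrow> Cmp C (l j) h = m j"
proof -
  have "\<exists>h. in_hom C h b a \<and> (\<forall>j\<in>Ob J. Cmp C (l j) h = m j)"
    by (rule ex1_implies_ex) (rule assms(1)[unfolded is_limit_def, THEN conjunct2, rule_format, OF
        assms(2)])
  then obtain h where "in_hom C h b a \<and> (\<forall>j\<in>Ob J. Cmp C (l j) h = m j)" by (rule exE)
  then show ?thesis by (intro that[of h]) simp_all
qed

lemma coneD:
  assumes "is_cone J C G a l"
  shows "a \<in> Ob C" "j \<in> Ob J \<Longrightarrow> in_hom C (l j) a (fo G j)"
    "in_hom J k i j \<Longrightarrow> Cmp C (fa G k) (l i) = l j"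
  using assms unfolding is_cone_def by blast+

text \<open>Diagrams are HOL functions on whole types, so two of them can agree on the shape without
  being equal. Composed diagrams are compared only up to this agreement.\<close>

lemma is_cone_cong:
  assumes "category J" "\<And>j. j \<in> Ob J \<Longrightarrow> fo G j = fo G' j" "\<And>k. k \<in> Ar J \<Longrightarrow> fa G k = fa G' k"
    "\<And>j. j \<in> Ob J \<Longrightarrow> l j = l' j"
  shows "is_cone J C G a l \<longleftrightarrow> is_cone J C G' a l'"
proof -
  have "Cmp C (fa G k) (l i) = l j \<longleftrightarrow> Cmp C (fa G' k) (l' i) = l' j" if "in_hom J k i j" for k i j
    using category.hom_ob[OF assms(1) that] that assms by (simp add: in_hom_def)
  with assms(2,4) show ?thesis unfolding is_cone_def by auto
qed

lemma is_limit_cong: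
  assumes "category J" "\<And>j. j \<in> Ob J \<Longrightarrow> fo G j = fo G' j" "\<And>k. k \<in> Ar J \<Longrightarrow> fa G k = fa G' k"
    "\<And>j. j \<in> Ob J \<Longrightarrow> l j = l' j"
  shows "is_limit J C G a l \<longleftrightarrow> is_limit J C G' a l'"
proof -
  have "is_cone J C G b m \<longleftrightarrow> is_cone J C G' b m" for b m
    by (rule is_cone_cong[OF assms(1-3)]) simp_all
  moreover have "is_cone J C G a l \<longleftrightarrow> is_cone J C G' a l'"
    by (rule is_cone_cong[OF assms])
  ultimately show ?thesis
    unfolding is_limit_def using assms(4) by simp
qed

lemma functor_func_comp:
  assumes "is_functor C D F" "is_functor D E G"
  shows "is_functor C E (func_comp G F)"
  using assms unfolding is_functor_def func_comp_def by (auto; blast)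

context category
begin

lemma cone_precomp:
  assumes J: "is_cone J C G a l" "is_functor J C G" "category J" and h: "in_hom C h b a"
  shows "is_cone J C G b (\<lambda>j. Cmp C (l j) h)"
  unfolding is_cone_def
proof (intro conjI ballI allI impI)
  show "b \<in> Ob C" using hom_ob h by blast
  fix j assume "j \<in> Ob J"
  then show "in_hom C (Cmp C (l j) h) b (fo G j)" using comp_in[OF h] coneD[OF J(1)] by blast
next
  fix k i j assume k: "in_hom J k i j"
  have Gk: "in_hom C (fa G k) (fo G i) (fo G j)" using functor_hom[OF J(2) k] .
  have "in_hom C (l i) a (fo G i)" using coneD(2)[OF J(1)] category.hom_ob[OF J(3) k] by blast
  then show "Cmp C (fa G k) (Cmp C (l i) h) = Cmp C (l j) h"
    using comp_assoc[OF h _ Gk] coneD(3)[OF J(1) k] by simp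
qed

lemma limit_eqI:
  assumes l: "is_limit J C G a l" "is_functor J C G" "category J" and "in_hom C h b a" "in_hom C h' b a"
    "\<And>j. j \<in> Ob J \<Longrightarrow> Cmp C (l j) h = Cmp C (l j) h'"
  shows "h = h'"
proof -
  have "is_cone J C G b (\<lambda>j. Cmp C (l j) h)"
    using cone_precomp[OF limit_cone[OF l(1)] l(2,3) assms(4)] .
  then have "\<exists>!k. in_hom C k b a \<and> (\<forall>j\<in>Ob J. Cmp C (l j) k = Cmp C (l j) h)"
    by (rule l(1)[unfolded is_limit_def, THEN conjunct2, rule_format])
  then show ?thesis using assms(4-) by (metis (full_types))
qed

text \<open>Together with \<open>limit_unique\<close> this carries a property of one chosen limit
  cone to every limit cone of the same diagram.\<close>

lemma limit_precomp_iso: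
  assumes l: "is_limit J C G a l" "is_functor J C G" "category J" and h: "is_iso C h b a"
    and m: "\<And>j. j \<in> Ob J \<Longrightarrow> m j = Cmp C (l j) h"
  shows "is_limit J C G b m"
proof -
  obtain g where g: "in_hom C h b a" "in_hom C g a b" "Cmp C g h = Idn C b" "Cmp C h g = Idn C a"
    using h unfolding is_iso_def by blast
  have lh: "in_hom C (l j) a (fo G j)" if "j \<in> Ob J" for j
    using that coneD(2)[OF limit_cone[OF l(1)]] by blast
  have "is_limit J C G b (\<lambda>j. Cmp C (l j) h)"
  proof (rule is_limitI)
    show "is_cone J C G b (\<lambda>j. Cmp C (l j) h)"
      using cone_precomp[OF limit_cone[OF l(1)] l(2,3) g(1)] .
    fix c n assume "is_cone J C G c n"
    then obtain k where k: "in_hom C k c a" "\<And>j. j \<in> Ob J \<Longrightarrow> Cmp C (l j) k = n j"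
      using limit_fac[OF l(1)] by metis
    have gk: "in_hom C (Cmp C g k) c b" "Cmp C h (Cmp C g k) = k"
      using comp_in[OF k(1) g(2)] comp_assoc[OF k(1) g(2,1)] g(4) comp_id_left[OF k(1)] by auto
    then have "Cmp C (Cmp C (l j) h) (Cmp C g k) = n j" if "j \<in> Ob J" for j
      using comp_assoc[OF gk(1) g(1) lh] that k(2) by simp
    with gk show "\<exists>k. in_hom C k c b \<and> (\<forall>j\<in>Ob J. Cmp C (Cmp C (l j) h) k = n j)" by blast
  next
    fix c k k' assume k: "in_hom C k c b" "in_hom C k' c b"
      "\<And>j. j \<in> Ob J \<Longrightarrow> Cmp C (Cmp C (l j) h) k = Cmp C (Cmp C (l j) h) k'"
    have "Cmp C (l j) (Cmp C h k) = Cmp C (l j) (Cmp C h k')" if "j \<in> Ob J" for j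
      using k(3)[OF that] comp_assoc[OF k(1) g(1) lh[OF that]] comp_assoc[OF k(2) g(1) lh[OF that]]
      by simp
    then have "Cmp C h k = Cmp C h k'"
      using limit_eqI[OF l comp_in[OF k(1) g(1)] comp_in[OF k(2) g(1)]] by blast
    then show "k = k'"
      using comp_assoc[OF k(1) g(1,2)] comp_assoc[OF k(2) g(1,2)] g(3) comp_id_left k by metis
  qed
  then show ?thesis using is_limit_cong[OF l(3), of G G m "\<lambda>j. Cmp C (l j) h"] m by simp
qed

lemma limit_unique:
  assumes l: "is_limit J C G a l" and m: "is_limit J C G b m" and G: "is_functor J C G" "category J"
  obtains h where "is_iso C h b a" "\<And>j. j \<in> Ob J \<Longrightarrow> Cmp C (l j) h = m j"
proof -
  note lc = limit_cone[OF l] and mc = limit_cone[OF m]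
  obtain h where h: "in_hom C h b a" "\<And>j. j \<in> Ob J \<Longrightarrow> Cmp C (l j) h = m j"
    using limit_fac[OF l mc] by metis
  obtain g where g: "in_hom C g a b" "\<And>j. j \<in> Ob J \<Longrightarrow> Cmp C (m j) g = l j"
    using limit_fac[OF m lc] by metis
  have i: "in_hom C (Idn C a) a a" "in_hom C (Idn C b) b b" using id_in hom_ob h by blast+
  have "Cmp C (l j) (Cmp C h g) = Cmp C (l j) (Idn C a)" if j: "j \<in> Ob J" for j
    using comp_assoc[OF g(1) h(1) coneD(2)[OF lc j]] h(2) g(2) comp_id_right[OF coneD(2)[OF lc j]] j
    by simp
  then have hg: "Cmp C h g = Idn C a" using limit_eqI[OF l G comp_in[OF g(1) h(1)] i(1)] by blast
  have "Cmp C (m j) (Cmp C g h) = Cmp C (m j) (Idn C b)" if j: "j \<in> Ob J" for j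
    using comp_assoc[OF h(1) g(1) coneD(2)[OF mc j]] h(2) g(2) comp_id_right[OF coneD(2)[OF mc j]] j
    by simp
  then have gh: "Cmp C g h = Idn C b" using limit_eqI[OF m G comp_in[OF h(1) g(1)] i(2)] by blast
  show ?thesis using that h g(1) hg gh unfolding is_iso_def by blast
qed

end

text \<open>A finite graph in which no edge ends where another one starts, regarded as a category:
  the vertices are the numbers below \<open>n\<close>, which also serve as the identities, and \<open>n + i\<close> is the
  edge from \<open>s i\<close> to \<open>t i\<close>.\<close>

definition graph_shape :: "nat \<Rightarrow> nat \<Rightarrow> (nat \<Rightarrow> nat) \<Rightarrow> (nat \<Rightarrow> nat) \<Rightarrow> (nat, nat) cat" where
  "graph_shape n k s t = \<lparr>Ob = {..<n}, Ar = {..<n + k},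
     Dm = (\<lambda>i. if i < n then i else s (i - n)), Cd = (\<lambda>i. if i < n then i else t (i - n)),
     Idn = (\<lambda>i. i), Cmp = (\<lambda>g f. if f < n then g else f)\<rparr>"

definition graph_diagram ::
    "('o, 'a) cat \<Rightarrow> nat \<Rightarrow> (nat \<Rightarrow> 'o) \<Rightarrow> (nat \<Rightarrow> 'a) \<Rightarrow> (nat, nat, 'o, 'a) func" where
  "graph_diagram C n X A = \<lparr>fo = X, fa = (\<lambda>i. if i < n then Idn C (X i) else A (i - n))\<rparr>"

lemma Ob_graph_shape: "Ob (graph_shape n k s t) = {..<n}" by (simp add: graph_shape_def)

locale bipartite_graph =
  fixes n k :: nat and s t :: "nat \<Rightarrow> nat"
  assumes edges: "i < k \<Longrightarrow> s i < n" "i < k \<Longrightarrow> t i < n"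
    and bipartite: "i < k \<Longrightarrow> j < k \<Longrightarrow> t i \<noteq> s j"
begin

abbreviation "shape \<equiv> graph_shape n k s t"

lemma in_hom_shape:
  "in_hom shape f a b \<longleftrightarrow> (f < n \<and> a = f \<and> b = f) \<or> (\<exists>i<k. f = n + i \<and> a = s i \<and> b = t i)"
  by (auto simp: in_hom_def graph_shape_def) (metis add_diff_inverse_nat nat_add_left_cancel_less)

lemma shape: "finite_shape shape"
proof -
  have "category shape"
  proof
    show "Dm shape f \<in> Ob shape" "Cd shape f \<in> Ob shape" if "f \<in> Ar shape" for f
      using that edges by (auto simp: graph_shape_def)
    show "in_hom shape (Idn shape a) a a" if "a \<in> Ob shape" for a
      using that by (auto simp: graph_shape_def in_hom_def)
    show "in_hom shape (Cmp shape g f) a c" if "in_hom shape f a b" "in_hom shape g b c" for f g a b c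
      using that bipartite edges unfolding in_hom_shape by (auto simp: graph_shape_def)
    show "Cmp shape f (Idn shape a) = f" if "in_hom shape f a b" for f a b
      using that edges unfolding in_hom_shape by (auto simp: graph_shape_def)
    show "Cmp shape (Idn shape b) f = f" if "in_hom shape f a b" for f a b
      using that edges unfolding in_hom_shape by (auto simp: graph_shape_def)
    show "Cmp shape h (Cmp shape g f) = Cmp shape (Cmp shape h g) f"
      if "in_hom shape f a b" "in_hom shape g b c" "in_hom shape h c d" for f g h a b c d
      using that unfolding in_hom_shape by (auto simp: graph_shape_def)
  qed
  then show ?thesis by (simp add: finite_shape_def graph_shape_def)
qed

lemma shape_category: "category shape"
  using shape by (simp add: finite_shape_def)

lemma functor_graph_diagram:
  assumes "category C" "\<And>i. i < n \<Longrightarrow> X i \<in> Ob C" "\<And>i. i < k \<Longrightarrow> in_hom C (A i) (X (s i)) (X (t i))"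
  shows "is_functor shape C (graph_diagram C n X A)"
proof -
  interpret category C by fact
  note C = comp_id_left[OF assms(3)] comp_id_right[OF assms(3)] id_in assms(2,3)
    comp_id_left[OF id_in] edges
  show ?thesis
    unfolding is_functor_def in_hom_shape
    using C bipartite bipartite[THEN not_sym] by (auto simp: graph_diagram_def graph_shape_def)
qed

lemma is_cone_graph:
  assumes "category C" "\<And>i. i < n \<Longrightarrow> X i \<in> Ob C" "\<And>i. i < k \<Longrightarrow> in_hom C (A i) (X (s i)) (X (t i))"
  shows "is_cone shape C (graph_diagram C n X A) a l \<longleftrightarrow> a \<in> Ob C \<and>
    (\<forall>j<n. in_hom C (l j) a (X j)) \<and> (\<forall>i<k. Cmp C (A i) (l (s i)) = l (t i))" (is "_ \<longleftrightarrow> ?R")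
proof
  assume *: "is_cone shape C (graph_diagram C n X A) a l"
  have "Cmp C (A i) (l (s i)) = l (t i)" if "i < k" for i
    using coneD(3)[OF *, of "n + i" "s i" "t i"] that by (auto simp: graph_diagram_def in_hom_shape)
  then show ?R
    using coneD(1,2)[OF *] by (auto simp: graph_diagram_def Ob_graph_shape)
next
  interpret category C by fact
  assume ?R
  then show "is_cone shape C (graph_diagram C n X A) a l"
    unfolding is_cone_def in_hom_shape Ob_graph_shape
    using comp_id_left by (auto simp: graph_diagram_def)
qed

text \<open>Translates the abstract preservation hypothesis into explicit diagrams. The primed data
  allow the image diagram to be written in its simplified form, for instance with identities of D in
  place of images of identities.\<close>

lemma preserves_graph_limit:
  assumes F: "is_functor C D F" "preserves_finite_limits C D F" and "category C"
    and X: "\<And>i. i < n \<Longrightarrow> X i \<in> Ob C" and A: "\<And>i. i < k \<Longrightarrow> in_hom C (A i) (X (s i)) (X (t i))"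
    and l: "is_limit shape C (graph_diagram C n X A) a l"
    and X': "\<And>i. i < n \<Longrightarrow> X' i = fo F (X i)" and A': "\<And>i. i < k \<Longrightarrow> A' i = fa F (A i)"
    and l': "\<And>i. i < n \<Longrightarrow> l' i = fa F (l i)"
  shows "is_limit shape D (graph_diagram D n X' A') (fo F a) l'"
proof -
  have "is_limit shape D (func_comp F (graph_diagram C n X A)) (fo F a) (\<lambda>j. fa F (l j))"
    using F(2) l shape functor_graph_diagram[OF \<open>category C\<close> X A] unfolding preserves_finite_limits_def
    by blast
  moreover have "fa (func_comp F (graph_diagram C n X A)) i = fa (graph_diagram D n X' A') i"
    if "i \<in> Ar shape" for i
    using that X' A' functor_id[OF F(1) X] by (auto simp: graph_shape_def graph_diagram_def func_comp_def)
  ultimately show ?thesis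
    using is_limit_cong[OF shape_category, where G="func_comp F (graph_diagram C n X A)"
        and G'="graph_diagram D n X' A'" and l="\<lambda>j. fa F (l j)" and l'=l' and C=D and a="fo F a"] X' l'
    by (auto simp: Ob_graph_shape func_comp_def graph_diagram_def)
qed

end

lemma all_less_numeral:
  "(\<forall>i<(2::nat). P i) \<longleftrightarrow> P 0 \<and> P 1" "(\<forall>i<(3::nat). P i) \<longleftrightarrow> P 0 \<and> P 1 \<and> P 2"
  "(\<forall>i<(4::nat). P i) \<longleftrightarrow> P 0 \<and> P 1 \<and> P 2 \<and> P 3"
  by (auto simp: numeral_eq_Suc less_Suc_eq)

lemma ball_lessThan_numeral:
  "(\<forall>i\<in>{..<(2::nat)}. P i) \<longleftrightarrow> P 0 \<and> P 1" "(\<forall>i\<in>{..<(3::nat)}. P i) \<longleftrightarrow> P 0 \<and> P 1 \<and> P 2"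
  "(\<forall>i\<in>{..<(4::nat)}. P i) \<longleftrightarrow> P 0 \<and> P 1 \<and> P 2 \<and> P 3"
  by (auto simp: numeral_eq_Suc less_Suc_eq)

section \<open>Pullbacks, equalizers and binary products as limits over finite graphs\<close>

abbreviation cospan_shape :: "(nat, nat) cat" where
  "cospan_shape \<equiv> graph_shape 3 2 (\<lambda>i. i) (\<lambda>_. 2)"

abbreviation cospan_diagram :: "('o, 'a) cat \<Rightarrow> 'a \<Rightarrow> 'a \<Rightarrow> (nat, nat, 'o, 'a) func" where
  "cospan_diagram C f g \<equiv> graph_diagram C 3
     (\<lambda>i. if i = 0 then Dm C f else if i = 1 then Dm C g else Cd C f) (\<lambda>i. if i = 0 then f else g)"

interpretation cospan: bipartite_graph 3 2 "\<lambda>i. i" "\<lambda>_. 2"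
  by standard auto

context category
begin

text \<open>The leg at vertex 2, the common codomain, carries no data beyond the common value of the
  two composites, so a cone is a commutative square.\<close>

lemma is_cone_cospan:
  assumes "in_hom C f a c" "in_hom C g b c"
  shows "is_cone cospan_shape C (cospan_diagram C f g) d l \<longleftrightarrow>
    in_hom C (l 0) d a \<and> in_hom C (l 1) d b \<and> l 2 = Cmp C f (l 0) \<and> l 2 = Cmp C g (l 1)"
proof -
  have "a \<in> Ob C" "b \<in> Ob C" "c \<in> Ob C" using assms hom_ob by blast+
  then have "is_cone cospan_shape C (cospan_diagram C f g) d l \<longleftrightarrow> d \<in> Ob C \<and>
    (\<forall>j<3. in_hom C (l j) d (if j = 0 then Dm C f else if j = 1 then Dm C g else Cd C f)) \<and>
    (\<forall>i<2. Cmp C (if i = 0 then f else g) (l i) = l 2)"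
    using assms by (intro cospan.is_cone_graph category_axioms) (auto simp: in_hom_def)
  also have "\<dots> \<longleftrightarrow> in_hom C (l 0) d a \<and> in_hom C (l 1) d b \<and> l 2 = Cmp C f (l 0) \<and> l 2 = Cmp C g (l 1)"
    using assms hom_ob comp_in by (auto simp: all_less_numeral in_homD)
  finally show ?thesis .
qed

text \<open>The pullback predicate lists two projections where a limit cone has three legs; the
  hypothesis on \<open>l 2\<close> supplies the third. The conjunct on \<open>d\<close> appears
  because \<open>is_pullback\<close> reads the vertex off the first projection, while
  \<open>is_limit\<close> names it.\<close>

lemma pullback_limit:
  assumes f: "in_hom C f a c" and g: "in_hom C g b c" and l: "l 2 = Cmp C f (l 0)"
  shows "is_pullback C f g (l 0) (l 1) \<and> Dm C (l 0) = d \<longleftrightarrow>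
    is_limit cospan_shape C (cospan_diagram C f g) d l" (is "?L \<longleftrightarrow> ?R")
proof
  assume *: ?L
  have lh: "in_hom C (l 0) d a" "in_hom C (l 1) d b" and eq: "Cmp C f (l 0) = Cmp C g (l 1)"
    using * f g by (auto elim!: is_pullbackE simp: in_hom_def)
  show ?R
  proof (rule is_limitI)
    show "is_cone cospan_shape C (cospan_diagram C f g) d l"
      unfolding is_cone_cospan[OF f g] using lh eq l by simp
    fix z m assume "is_cone cospan_shape C (cospan_diagram C f g) z m"
    then have m: "in_hom C (m 0) z a" "in_hom C (m 1) z b"
      "m 2 = Cmp C f (m 0)" "Cmp C f (m 0) = Cmp C g (m 1)"
      unfolding is_cone_cospan[OF f g] by auto
    then obtain h where h: "in_hom C h z d" "Cmp C (l 0) h = m 0" "Cmp C (l 1) h = m 1"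
      using is_pullback_fac[OF _ lh] * by metis
    moreover have "Cmp C (l 2) h = m 2"
      using comp_assoc[OF h(1) lh(1) f] h m(3) l by simp
    ultimately show "\<exists>h. in_hom C h z d \<and> (\<forall>j\<in>Ob cospan_shape. Cmp C (l j) h = m j)"
      unfolding Ob_graph_shape ball_lessThan_numeral by blast
  next
    fix z h h' assume h: "in_hom C h z d" "in_hom C h' z d"
      and "\<And>j. j \<in> Ob cospan_shape \<Longrightarrow> Cmp C (l j) h = Cmp C (l j) h'"
    then have "Cmp C (l 0) h = Cmp C (l 0) h'" "Cmp C (l 1) h = Cmp C (l 1) h'"
      by (auto simp: Ob_graph_shape)
    moreover have "Cmp C f (Cmp C (l 0) h) = Cmp C g (Cmp C (l 1) h)"
      using comp_assoc[OF h(1) lh(1) f] comp_assoc[OF h(1) lh(2) g] eq by simp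
    ultimately show "h = h'"
      using is_pullback_ex1[OF conjunct1[OF *] lh comp_in[OF h(1) lh(1)] comp_in[OF h(1) lh(2)]] h by metis
  qed
next
  assume *: ?R
  then have lh: "in_hom C (l 0) d a" "in_hom C (l 1) d b" "Cmp C f (l 0) = Cmp C g (l 1)"
    using limit_cone[OF *] unfolding is_cone_cospan[OF f g] by auto
  have "is_functor cospan_shape C (cospan_diagram C f g)"
    using f g hom_ob[OF f] hom_ob[OF g]
    by (intro cospan.functor_graph_diagram category_axioms) (auto simp: in_hom_def)
  note eqI = limit_eqI[OF * this cospan.shape_category]
  have "is_pullback C f g (l 0) (l 1)"
  proof (rule is_pullbackI[OF f g lh])
    fix z r s assume rs: "in_hom C r z a" "in_hom C s z b" "Cmp C f r = Cmp C g s"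
    then have "is_cone cospan_shape C (cospan_diagram C f g) z
        (\<lambda>i. if i = 0 then r else if i = 1 then s else Cmp C f r)"
      unfolding is_cone_cospan[OF f g] by simp
    then obtain h where "in_hom C h z d"
      "\<And>j. j \<in> Ob cospan_shape \<Longrightarrow> Cmp C (l j) h = (if j = 0 then r else if j = 1 then s else Cmp C f r)"
      by (rule limit_fac[OF *]) (rule that)
    then show "\<exists>h. in_hom C h z d \<and> Cmp C (l 0) h = r \<and> Cmp C (l 1) h = s"
      by (intro exI[of _ h]) (auto simp: Ob_graph_shape)
  next
    fix z h h' assume h: "in_hom C h z d" "in_hom C h' z d"
      and e: "Cmp C (l 0) h = Cmp C (l 0) h'" "Cmp C (l 1) h = Cmp C (l 1) h'"
    then have "Cmp C (l 2) h = Cmp C (l 2) h'"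
      using comp_assoc[OF h(1) lh(1) f] comp_assoc[OF h(2) lh(1) f] l by simp
    with e show "h = h'"
      using ball_lessThan_numeral(2)[of "\<lambda>j. Cmp C (l j) h = Cmp C (l j) h'"]
      by (intro eqI[OF h]) (auto simp: Ob_graph_shape)
  qed
  with lh show ?L by (simp add: in_homD)
qed

lemma pullback_ex:
  assumes lim: "has_finite_limits C" and f: "in_hom C f a c" and g: "in_hom C g b c"
  obtains p q d where "is_pullback C f g p q" "in_hom C p d a" "in_hom C q d b"
proof -
  have "is_functor cospan_shape C (cospan_diagram C f g)"
    using f g hom_ob[OF f] hom_ob[OF g]
    by (intro cospan.functor_graph_diagram category_axioms) (auto simp: in_hom_def)
  then obtain d l where *: "is_limit cospan_shape C (cospan_diagram C f g) d l"
    using lim cospan.shape unfolding has_finite_limits_def by blast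
  moreover from this have "in_hom C (l 0) d a" "in_hom C (l 1) d b" "l 2 = Cmp C f (l 0)"
    using limit_cone[OF *] unfolding is_cone_cospan[OF f g] by auto
  ultimately show ?thesis using that pullback_limit[OF f g] by blast
qed

text \<open>Uniqueness of factorizations is recorded as monicity of e, the form in which
  orthogonality can use it.\<close>

lemma equalizer_ex:
  assumes lim: "has_finite_limits C" and f: "in_hom C f a b" and g: "in_hom C g a b"
  obtains e d where "in_hom C e d a" "Cmp C f e = Cmp C g e" "e \<in> mono_arrows C"
    "\<And>k z. in_hom C k z a \<Longrightarrow> Cmp C f k = Cmp C g k \<Longrightarrow> \<exists>h. in_hom C h z d \<and> Cmp C e h = k"
proof -
  interpret pair: bipartite_graph 2 2 "\<lambda>_. 0" "\<lambda>_. 1" by standard auto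
  let ?X = "\<lambda>i. if i = (0::nat) then a else b" and ?A = "\<lambda>i. if i = (0::nat) then f else g"
  let ?D = "graph_diagram C 2 ?X ?A"
  have X: "\<And>i. i < 2 \<Longrightarrow> ?X i \<in> Ob C" and A: "\<And>i. i < 2 \<Longrightarrow> in_hom C (?A i) (?X 0) (?X 1)"
    using f g hom_ob by auto
  have cone: "is_cone pair.shape C ?D d l \<longleftrightarrow>
      in_hom C (l 0) d a \<and> l 1 = Cmp C f (l 0) \<and> l 1 = Cmp C g (l 0)" for d l
    using pair.is_cone_graph[where X="?X" and A="?A" and a=d and l=l, OF category_axioms X A] f g hom_ob
        comp_in
    by (auto simp: all_less_numeral)
  have fct: "is_functor pair.shape C ?D"
    using pair.functor_graph_diagram[where X="?X" and A="?A", OF category_axioms X A] by auto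
  then obtain d l where *: "is_limit pair.shape C ?D d l"
    using lim pair.shape unfolding has_finite_limits_def by blast
  have l: "in_hom C (l 0) d a" "l 1 = Cmp C f (l 0)" "l 1 = Cmp C g (l 0)"
    using limit_cone[OF *] unfolding cone by auto
  show ?thesis
  proof (rule that[OF l(1)])
    show "Cmp C f (l 0) = Cmp C g (l 0)" using l by simp
    show "l 0 \<in> mono_arrows C"
    proof (rule mono_arrowsI[OF l(1)])
      fix z r s assume rs: "in_hom C r z d" "in_hom C s z d" "Cmp C (l 0) r = Cmp C (l 0) s"
      then have "Cmp C (l 1) r = Cmp C (l 1) s"
        using comp_assoc[OF rs(1) l(1) f] comp_assoc[OF rs(2) l(1) f] l(2) by simp
      with rs(3) show "r = s"
        using ball_lessThan_numeral(1)[of "\<lambda>j. Cmp C (l j) r = Cmp C (l j) s"]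
        by (intro limit_eqI[OF * fct pair.shape_category rs(1,2)]) (auto simp: Ob_graph_shape)
    qed
    fix k z assume k: "in_hom C k z a" "Cmp C f k = Cmp C g k"
    then have "is_cone pair.shape C ?D z (\<lambda>i. if i = 0 then k else Cmp C f k)"
      unfolding cone by simp
    then obtain h where "in_hom C h z d"
      "\<And>j. j \<in> Ob pair.shape \<Longrightarrow> Cmp C (l j) h = (if j = 0 then k else Cmp C f k)"
      by (rule limit_fac[OF *]) (rule that)
    then show "\<exists>h. in_hom C h z d \<and> Cmp C (l 0) h = k"
      by (intro exI[of _ h]) (auto simp: Ob_graph_shape)
  qed
qed

lemma product_ex:
  assumes lim: "has_finite_limits C" and ab: "a \<in> Ob C" "b \<in> Ob C"
  obtains p q d where "in_hom C p d a" "in_hom C q d b"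
    "\<And>r s z. in_hom C r z a \<Longrightarrow> in_hom C s z b \<Longrightarrow> \<exists>h. in_hom C h z d \<and> Cmp C p h = r \<and> Cmp C q h = s"
    "\<And>h h' z. in_hom C h z d \<Longrightarrow> in_hom C h' z d \<Longrightarrow> Cmp C p h = Cmp C p h' \<Longrightarrow>
      Cmp C q h = Cmp C q h' \<Longrightarrow> h = h'"
proof -
  interpret two: bipartite_graph 2 0 "\<lambda>i. i" "\<lambda>i. i" by standard auto
  let ?X = "\<lambda>i. if i = (0::nat) then a else b"
  \<comment> \<open>Two vertices and no edges: the family of edge arrows is never consulted, hence
    \<open>undefined\<close>.\<close>
  let ?D = "graph_diagram C 2 ?X undefined"
  have X: "\<And>i. i < 2 \<Longrightarrow> ?X i \<in> Ob C" using ab by auto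
  have cone: "is_cone two.shape C ?D d l \<longleftrightarrow> in_hom C (l 0) d a \<and> in_hom C (l 1) d b" for d l
    using two.is_cone_graph[where X="?X" and A=undefined and a=d and l=l, OF category_axioms X] hom_ob
    by (auto simp: all_less_numeral)
  have fct: "is_functor two.shape C ?D"
    using two.functor_graph_diagram[where X="?X", OF category_axioms X] by auto
  then obtain d l where *: "is_limit two.shape C ?D d l"
    using lim two.shape unfolding has_finite_limits_def by blast
  have l: "in_hom C (l 0) d a" "in_hom C (l 1) d b"
    using limit_cone[OF *] unfolding cone by auto
  show ?thesis
  proof (rule that[OF l])
    fix z r s assume "in_hom C r z a" "in_hom C s z b"
    then have "is_cone two.shape C ?D z (\<lambda>i. if i = 0 then r else s)"
      unfolding cone by simp
    then obtain h where "in_hom C h z d"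
      "\<And>j. j \<in> Ob two.shape \<Longrightarrow> Cmp C (l j) h = (if j = 0 then r else s)"
      by (rule limit_fac[OF *]) (rule that)
    then show "\<exists>h. in_hom C h z d \<and> Cmp C (l 0) h = r \<and> Cmp C (l 1) h = s"
      by (intro exI[of _ h]) (auto simp: Ob_graph_shape)
  next
    fix z h h' assume h: "in_hom C h z d" "in_hom C h' z d"
      and e: "Cmp C (l 0) h = Cmp C (l 0) h'" "Cmp C (l 1) h = Cmp C (l 1) h'"
    then show "h = h'"
      using ball_lessThan_numeral(1)[of "\<lambda>j. Cmp C (l j) h = Cmp C (l j) h'"]
      by (intro limit_eqI[OF * fct two.shape_category h]) (auto simp: Ob_graph_shape)
  qed
qed

text \<open>Turns monicity into a finite limit, so that functors preserving finite limits preserve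
  monomorphisms.\<close>

lemma mono_pullback:
  assumes m: "in_hom C m a b"
  shows "m \<in> mono_arrows C \<longleftrightarrow> is_pullback C m m (Idn C a) (Idn C a)"
proof
  have i: "in_hom C (Idn C a) a a" using id_in hom_ob m by blast
  {
    assume mono: "m \<in> mono_arrows C"
    show "is_pullback C m m (Idn C a) (Idn C a)"
    proof (rule is_pullbackI[OF m m i i])
      fix z r s assume "in_hom C r z a" "in_hom C s z a" "Cmp C m r = Cmp C m s"
      then show "\<exists>h. in_hom C h z a \<and> Cmp C (Idn C a) h = r \<and> Cmp C (Idn C a) h = s"
        using mono_arrowsD[OF mono m] comp_id_left by metis
    qed (use comp_id_left in auto)
  }
  {
    assume pb: "is_pullback C m m (Idn C a) (Idn C a)"
    show "m \<in> mono_arrows C"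
    proof (rule mono_arrowsI[OF m])
      fix z f g assume fg: "in_hom C f z a" "in_hom C g z a" "Cmp C m f = Cmp C m g"
      obtain h where "in_hom C h z a" "Cmp C (Idn C a) h = f" "Cmp C (Idn C a) h = g"
        using is_pullback_fac[OF pb i i fg] .
      then show "f = g" by simp
    qed
  }
qed

end

section \<open>Functors that preserve finite limits\<close>

lemma preserves_pullback:
  assumes F: "is_functor C D F" "preserves_finite_limits C D F" and C: "category C" "category D"
    and pb: "is_pullback C f g p q"
  shows "is_pullback D (fa F f) (fa F g) (fa F p) (fa F q)"
proof -
  obtain a b c d where h: "in_hom C f a c" "in_hom C g b c" "in_hom C p d a" "in_hom C q d b"
    "Cmp C f p = Cmp C g q" using is_pullbackE[OF pb] .
  let ?l = "\<lambda>i::nat. if i = 0 then p else if i = 1 then q else Cmp C f p"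
  let ?l' = "\<lambda>i::nat. if i = 0 then fa F p else if i = 1 then fa F q else Cmp D (fa F f) (fa F p)"
  note ob = category.hom_ob[OF C(1)] and ob' = category.hom_ob[OF C(2)]
  have h': "in_hom D (fa F f) (fo F a) (fo F c)" "in_hom D (fa F g) (fo F b) (fo F c)"
    "in_hom D (fa F p) (fo F d) (fo F a)" using h functor_hom[OF F(1)] by auto
  have "is_limit cospan_shape C (cospan_diagram C f g) d ?l"
    using category.pullback_limit[OF C(1) h(1,2), of ?l d] pb h(3) by (simp add: in_homD)
  then have "is_limit cospan_shape D (cospan_diagram D (fa F f) (fa F g)) (fo F d) ?l'"
    apply (rule cospan.preserves_graph_limit[OF F C(1), rotated 2])
    using h h' ob[OF h(1)] ob[OF h(2)] functor_comp[OF F(1) h(3,1)] by (auto simp: in_homD)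
  then show ?thesis
    using category.pullback_limit[OF C(2) h'(1,2), of ?l' "fo F d"] by simp
qed

lemma preserves_mono:
  assumes F: "is_functor C D F" "preserves_finite_limits C D F" and C: "category C" "category D"
    and m: "m \<in> mono_arrows C"
  shows "fa F m \<in> mono_arrows D"
proof -
  have mh: "in_hom C m (Dm C m) (Cd C m)" using m unfolding mono_arrows_def in_hom_def by simp
  then have "Dm C m \<in> Ob C" using category.hom_ob[OF C(1)] by blast
  then show ?thesis
    using preserves_pullback[OF F C, of m m "Idn C (Dm C m)" "Idn C (Dm C m)"] m
      category.mono_pullback[OF C(1) mh] category.mono_pullback[OF C(2) functor_hom[OF F(1) mh]]
      functor_id[OF F(1)] by simp
qed

lemma jointly_monicD:
  assumes "jointly_monic C r\<^sub>0 r\<^sub>1" "in_hom C r\<^sub>0 a b" "in_hom C f z a" "in_hom C g z a"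
    "Cmp C r\<^sub>0 f = Cmp C r\<^sub>0 g" "Cmp C r\<^sub>1 f = Cmp C r\<^sub>1 g"
  shows "f = g"
  using assms unfolding jointly_monic_def in_hom_def by blast

text \<open>Joint monicity expressed without products: \<open>r\<^sub>0\<close> and
  \<open>r\<^sub>1\<close> are jointly monic exactly when a, with identity legs, is the limit of the
  graph that has two copies of a, one copy of b for each of the two arrows, and each arrow drawn
  from both copies of a.\<close>

lemma preserves_jointly_monic:
  assumes F: "is_functor C D F" "preserves_finite_limits C D F" and C: "category C" "category D"
    and r: "in_hom C r\<^sub>0 a b" "in_hom C r\<^sub>1 a b" "jointly_monic C r\<^sub>0 r\<^sub>1"
  shows "jointly_monic D (fa F r\<^sub>0) (fa F r\<^sub>1)"
proof -
  interpret C: category C by fact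
  interpret D: category D by fact
  \<comment> \<open>Vertices 0 and 1 carry a, vertices 2 and 3 carry b. Edges 0 and 1 are both
    \<open>r\<^sub>0\<close>, into vertex 2; edges 2 and 3 are both \<open>r\<^sub>1\<close>, into
    vertex 3. So \<open>i mod 2\<close> selects the copy of a and \<open>i div 2\<close> the
    arrow.\<close>
  interpret G: bipartite_graph 4 4 "\<lambda>i. i mod 2" "\<lambda>i. 2 + i div 2"
    by standard (auto simp: less_mult_imp_div_less)
  let ?X = "\<lambda>a b i. if i < (2::nat) then a else b" and ?A = "\<lambda>r\<^sub>0 r\<^sub>1 i. if i < (2::nat) then r\<^sub>0 else r\<^sub>1"
  let ?l = "\<lambda>i::nat. if i < 2 then Idn C a else if i = 2 then r\<^sub>0 else r\<^sub>1"
  let ?l' = "\<lambda>i::nat. if i < 2 then Idn D (fo F a) else if i = 2 then fa F r\<^sub>0 else fa F r\<^sub>1"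
  have ab: "a \<in> Ob C" "b \<in> Ob C" using C.hom_ob r by blast+
  have X: "?X a b i \<in> Ob C" for i using ab by auto
  have A: "in_hom C (?A r\<^sub>0 r\<^sub>1 i) (?X a b (i mod 2)) (?X a b (2 + i div 2))" for i
    using r by auto
  have r': "in_hom D (fa F r\<^sub>0) (fo F a) (fo F b)" "in_hom D (fa F r\<^sub>1) (fo F a) (fo F b)"
    using r functor_hom[OF F(1)] by auto
  have ia: "in_hom C (Idn C a) a a" using C.id_in ab by blast
  have cone: "is_cone G.shape C (graph_diagram C 4 (?X a b) (?A r\<^sub>0 r\<^sub>1)) z m \<longleftrightarrow>
     in_hom C (m 0) z a \<and> in_hom C (m 1) z a \<and> Cmp C r\<^sub>0 (m 0) = m 2 \<and> Cmp C r\<^sub>0 (m 1) = m 2 \<and>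
     Cmp C r\<^sub>1 (m 0) = m 3 \<and> Cmp C r\<^sub>1 (m 1) = m 3" for z m
    unfolding G.is_cone_graph[where X="?X a b" and A="?A r\<^sub>0 r\<^sub>1", OF C(1) X A]
    using C.hom_ob(1)[of "m 0" z a] C.comp_in[of "m 0" z a r\<^sub>0 b] C.comp_in[of "m 0" z a r\<^sub>1 b] r
    by (auto simp: all_less_numeral numeral_2_eq_2 numeral_3_eq_3 mod_Suc div_Suc)
  have "is_limit G.shape C (graph_diagram C 4 (?X a b) (?A r\<^sub>0 r\<^sub>1)) a ?l"
  proof (rule is_limitI)
    show "is_cone G.shape C (graph_diagram C 4 (?X a b) (?A r\<^sub>0 r\<^sub>1)) a ?l"
      unfolding cone using ia r C.comp_id_right by simp
    fix z m assume m: "is_cone G.shape C (graph_diagram C 4 (?X a b) (?A r\<^sub>0 r\<^sub>1)) z m"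
    have "m 0 = m 1"
      by (rule jointly_monicD[OF r(3,1), of _ z]) (use m[unfolded cone] in simp_all)
    then show "\<exists>h. in_hom C h z a \<and> (\<forall>j\<in>Ob G.shape. Cmp C (?l j) h = m j)"
      unfolding Ob_graph_shape ball_lessThan_numeral using m[unfolded cone] C.comp_id_left
      by (intro exI[of _ "m 0"]) auto
  next
    fix z h h' assume h: "in_hom C h z a" "in_hom C h' z a"
      and eq: "\<And>j. j \<in> Ob G.shape \<Longrightarrow> Cmp C (?l j) h = Cmp C (?l j) h'"
    show "h = h'" using eq[of 0] h C.comp_id_left by (auto simp: Ob_graph_shape)
  qed
  then have lim: "is_limit G.shape D (graph_diagram D 4 (?X (fo F a) (fo F b)) (?A (fa F r\<^sub>0) (fa F r\<^sub>1)))
      (fo F a) ?l'"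
    by (rule G.preserves_graph_limit[where X="?X a b" and A="?A r\<^sub>0 r\<^sub>1", OF F C(1) X A])
        (use functor_id[OF F(1)] ab in auto)
  have X': "?X (fo F a) (fo F b) i \<in> Ob D" for i using ab functor_ob[OF F(1)] by auto
  have A': "in_hom D (?A (fa F r\<^sub>0) (fa F r\<^sub>1) i) (?X (fo F a) (fo F b) (i mod 2))
      (?X (fo F a) (fo F b) (2 + i div 2))" for i
    using r' by auto
  show ?thesis
    unfolding jointly_monic_def
  proof (intro allI impI)
    fix z f g assume fg: "in_hom D f z (Dm D (fa F r\<^sub>0)) \<and> in_hom D g z (Dm D (fa F r\<^sub>0)) \<and>
      Cmp D (fa F r\<^sub>0) f = Cmp D (fa F r\<^sub>0) g \<and> Cmp D (fa F r\<^sub>1) f = Cmp D (fa F r\<^sub>1) g"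
    then have fg: "in_hom D f z (fo F a)" "in_hom D g z (fo F a)"
      "Cmp D (fa F r\<^sub>0) f = Cmp D (fa F r\<^sub>0) g" "Cmp D (fa F r\<^sub>1) f = Cmp D (fa F r\<^sub>1) g"
      using r' by (auto simp: in_homD)
    \<comment> \<open>Two test arrows that neither projection separates become the legs at the two
      copies of the source; the mediating arrow is equal to both.\<close>
    let ?m = "\<lambda>i::nat. if i = 0 then f else if i = 1 then g else if i = 2 then Cmp D (fa F r\<^sub>0) f
      else Cmp D (fa F r\<^sub>1) f"
    have "is_cone G.shape D (graph_diagram D 4 (?X (fo F a) (fo F b)) (?A (fa F r\<^sub>0) (fa F r\<^sub>1))) z ?m"
      unfolding G.is_cone_graph[where X="?X (fo F a) (fo F b)" and A="?A (fa F r\<^sub>0) (fa F r\<^sub>1)", OF C(2) X'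
          A']
      using D.hom_ob(1)[OF fg(1)] D.comp_in[OF fg(2)] r' fg by (simp add: all_less_numeral)
    then obtain h where h: "in_hom D h z (fo F a)" "\<And>j. j \<in> Ob G.shape \<Longrightarrow> Cmp D (?l' j) h = ?m j"
      by (rule limit_fac[OF lim]) (rule that)
    show "f = g" using h(2)[of 0] h(2)[of 1] by (auto simp: Ob_graph_shape)
  qed
qed

section \<open>Regular categories\<close>

context category
begin

lemma coequalizer_eqI:
  assumes "is_coequalizer C f g e" "in_hom C e b c" "in_hom C h c z" "in_hom C h' c z"
    "Cmp C h e = Cmp C h' e"
  shows "h = h'"
proof -
  obtain a where f: "in_hom C f a b" "in_hom C g a b" "Cmp C e f = Cmp C e g"
    using assms(1,2) by (metis is_coequalizerE in_homD(2,3))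
  have k: "in_hom C (Cmp C h e) b z" using comp_in assms by blast
  have "Cmp C (Cmp C h e) f = Cmp C (Cmp C h e) g"
    using comp_assoc[OF f(1) assms(2,3)] comp_assoc[OF f(2) assms(2,3)] f(3) by simp
  then have "\<exists>!k. in_hom C k c z \<and> Cmp C k e = Cmp C h e"
    using assms(1) k in_homD(2,3)[OF assms(2)] unfolding is_coequalizer_def by blast
  then show ?thesis using assms(3-) by metis
qed

lemma regular_epi_hom:
  assumes "regular_epi C e"
  shows "in_hom C e (Dm C e) (Cd C e)"
  using assms unfolding regular_epi_def is_coequalizer_def in_hom_def by auto

text \<open>Cancelling m shows that r coequalizes the pair of which e is a coequalizer, so r factors
  through e; the other triangle commutes because e is epi.\<close>

lemma regular_epi_orthogonal_mono:
  assumes "regular_epi C e" "m \<in> mono_arrows C"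
  shows "orthogonal C e m"
proof -
  obtain f g where c: "is_coequalizer C f g e" using assms(1) unfolding regular_epi_def by blast
  obtain a b c where h: "in_hom C f a b" "in_hom C g a b" "in_hom C e b c" "Cmp C e f = Cmp C e g"
    using is_coequalizerE[OF c] .
  have m: "in_hom C m (Dm C m) (Cd C m)" using assms(2) unfolding mono_arrows_def in_hom_def by simp
  show ?thesis
  proof (rule orthogonalI[OF h(3) m])
    fix r s assume r: "in_hom C r b (Dm C m)" and s: "in_hom C s c (Cd C m)"
      and eq: "Cmp C m r = Cmp C s e"
    have "Cmp C m (Cmp C r f) = Cmp C m (Cmp C r g)"
      using comp_assoc[OF h(1) r m] comp_assoc[OF h(2) r m] comp_assoc[OF h(1,3) s]
        comp_assoc[OF h(2,3) s] h(4) eq by simp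
    then have "Cmp C r f = Cmp C r g"
      using mono_arrowsD[OF assms(2) m] comp_in[OF h(1) r] comp_in[OF h(2) r] by blast
    then obtain d where d: "in_hom C d c (Dm C m)" "Cmp C d e = r"
      using is_coequalizer_fac[OF c h(3) r] by blast
    have "Cmp C (Cmp C m d) e = Cmp C s e" using comp_assoc[OF h(3) d(1) m] d(2) eq by simp
    then have "Cmp C m d = s" using coequalizer_eqI[OF c h(3)] comp_in[OF d(1) m] s by blast
    then show "\<exists>!d. in_hom C d c (Dm C m) \<and> Cmp C d e = r \<and> Cmp C m d = s"
      using d coequalizer_eqI[OF c h(3)] by blast
  qed
qed

end

locale regular_cat = category C for C :: "('o, 'a) cat" +
  fixes E :: "'a set"
  assumes finite_limits: "has_finite_limits C"
    and OFS: "is_OFS C E (mono_arrows C)"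
    and stable: "pullback_stable C E"
begin

lemma E_hom: "e \<in> E \<Longrightarrow> in_hom C e (Dm C e) (Cd C e)"
  using OFS_subset(1)[OF OFS] ar_hom by blast

text \<open>The equalizer of f and g is monic and e factors through it, so orthogonality provides a
  section of the equalizer, and f and g agree.\<close>

lemma E_epi:
  assumes e: "e \<in> E" "in_hom C e a b" and fg: "in_hom C f b c" "in_hom C g b c"
    and eq: "Cmp C f e = Cmp C g e"
  shows "f = g"
proof -
  obtain m d where m: "in_hom C m d b" "Cmp C f m = Cmp C g m" "m \<in> mono_arrows C"
    and u: "\<And>k z. in_hom C k z b \<Longrightarrow> Cmp C f k = Cmp C g k \<Longrightarrow> \<exists>h. in_hom C h z d \<and> Cmp C m h = k"
    using equalizer_ex[OF finite_limits fg] by blast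
  obtain r where r: "in_hom C r a d" "Cmp C m r = e" using u[OF e(2) eq] by blast
  have i: "in_hom C (Idn C b) b b" using id_in hom_ob e by blast
  have "Cmp C m r = Cmp C (Idn C b) e" using r comp_id_left[OF e(2)] by simp
  then obtain s where s: "in_hom C s b d" "Cmp C m s = Idn C b"
    using orthogonal_fill[OF OFS_orthogonal[OF OFS e(1) m(3)] e(2) m(1) r(1) i] by blast
  show ?thesis
    using comp_assoc[OF s(1) m(1) fg(1)] comp_assoc[OF s(1) m(1) fg(2)] s(2) m(2)
      comp_id_right[OF fg(1)] comp_id_right[OF fg(2)] by simp
qed

text \<open>Filling the square of \<open>m e\<close> against m with an identity at the bottom gives
  a right inverse of m, and a monomorphism with a right inverse is invertible.\<close>

lemma mono_E_iso:
  assumes m: "m \<in> mono_arrows C" "in_hom C m b c" and e: "in_hom C e a b" "Cmp C m e \<in> E"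
  obtains n where "in_hom C n c b" "Cmp C m n = Idn C c" "Cmp C n m = Idn C b"
proof -
  have me: "in_hom C (Cmp C m e) a c" using comp_in e m by blast
  have i: "in_hom C (Idn C c) c c" "in_hom C (Idn C b) b b" using id_in hom_ob m by blast+
  have "Cmp C m e = Cmp C (Idn C c) (Cmp C m e)" using comp_id_left[OF me] by simp
  then obtain n where n: "in_hom C n c b" "Cmp C m n = Idn C c"
    using orthogonal_fill[OF OFS_orthogonal[OF OFS e(2) m(1)] me m(2) e(1) i(1)] by blast
  have "Cmp C m (Cmp C n m) = Cmp C m (Idn C b)"
    using comp_assoc[OF m(2) n(1) m(2)] n(2) comp_id_left[OF m(2)] comp_id_right[OF m(2)] by simp
  then have "Cmp C n m = Idn C b"
    using mono_arrowsD[OF m comp_in[OF m(2) n(1)] i(2)] by blast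
  then show ?thesis using that n by blast
qed

lemma E_stable:
  assumes "e \<in> E" "in_hom C e a b" "in_hom C f c b"
  obtains p q d where "in_hom C p d a" "in_hom C q d c" "q \<in> E" "Cmp C e p = Cmp C f q"
proof -
  obtain p q d where pb: "is_pullback C e f p q" "in_hom C p d a" "in_hom C q d c"
    using pullback_ex[OF finite_limits assms(2,3)] by blast
  have "q \<in> E" using stable assms(1) pb(1) unfolding pullback_stable_def by blast
  moreover have "Cmp C e p = Cmp C f q" by (rule is_pullbackE[OF pb(1)])
  ultimately show ?thesis using that pb by blast
qed

text \<open>Given \<open>k\<close> that coequalizes the kernel pair of \<open>e\<close>, the image of \<open>(e, k)\<close> projects
  isomorphically to the codomain of \<open>e\<close>: it is the graph of the factorization of \<open>k\<close>.\<close>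

lemma E_coequalizer_kernel_pair:
  assumes e: "e \<in> E" and pb: "is_pullback C e e p q"
  shows "is_coequalizer C p q e"
proof -
  obtain a b d where h: "in_hom C e a b" "in_hom C p d a" "in_hom C q d a" "Cmp C e p = Cmp C e q"
    using is_pullbackE[OF pb] by (metis in_homD(2))
  show ?thesis
  proof (rule is_coequalizerI[OF h(2,3,1,4)])
    fix z k assume k: "in_hom C k a z" "Cmp C k p = Cmp C k q"
    obtain p1 p2 bz where p1: "in_hom C p1 bz b" and p2: "in_hom C p2 bz z"
      and pair: "\<And>r s x. in_hom C r x b \<Longrightarrow> in_hom C s x z \<Longrightarrow>
        \<exists>h. in_hom C h x bz \<and> Cmp C p1 h = r \<and> Cmp C p2 h = s"
      and pair_eqI: "\<And>h h' x. in_hom C h x bz \<Longrightarrow> in_hom C h' x bz \<Longrightarrow> Cmp C p1 h = Cmp C p1 h' \<Longrightarrow>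
        Cmp C p2 h = Cmp C p2 h' \<Longrightarrow> h = h'"
      using product_ex[OF finite_limits] hom_ob[OF h(1)] hom_ob[OF k(1)] by metis
    obtain w where w: "in_hom C w a bz" "Cmp C p1 w = e" "Cmp C p2 w = k"
      using pair[OF h(1) k(1)] by blast
    obtain e' m c where em: "e' \<in> E" "m \<in> mono_arrows C" "w = Cmp C m e'"
      "in_hom C e' a c" "in_hom C m c bz"
      using OFS_factor_hom[OF OFS w(1)] .
    define m1 where "m1 = Cmp C p1 m"
    define m2 where "m2 = Cmp C p2 m"
    have m1: "in_hom C m1 c b" and m2: "in_hom C m2 c z"
      unfolding m1_def m2_def using comp_in em(5) p1 p2 by blast+
    have m1e: "Cmp C m1 e' = e" and m2e: "Cmp C m2 e' = k"
      unfolding m1_def m2_def using comp_assoc[OF em(4,5) p1] comp_assoc[OF em(4,5) p2] em(3) w by auto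
    have "m1 \<in> mono_arrows C"
    proof (rule mono_arrowsI[OF m1])
      \<comment> \<open>s and t are made to lift through e' one after the other, by pulling back, so
        that on the cover \<open>u v\<close> of x both come from arrows into a. The cover lies in
        \<open>E\<close>, hence is epi and can be cancelled at the end.\<close>
      fix x s t assume s: "in_hom C s x c" and t: "in_hom C t x c" and st: "Cmp C m1 s = Cmp C m1 t"
      obtain s1 u x1 where s1: "in_hom C s1 x1 a" "in_hom C u x1 x" "u \<in> E" "Cmp C e' s1 = Cmp C s u"
        using E_stable[OF em(1,4) s] .
      have tu: "in_hom C (Cmp C t u) x1 c" using comp_in s1 t by blast
      obtain t2 v x2 where t2: "in_hom C t2 x2 a" "in_hom C v x2 x1" "v \<in> E"
        "Cmp C e' t2 = Cmp C (Cmp C t u) v"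
        using E_stable[OF em(1,4) tu] .
      let ?s2 = "Cmp C s1 v"
      have s2: "in_hom C ?s2 x2 a" using comp_in s1 t2 by blast
      have suv: "Cmp C e' ?s2 = Cmp C (Cmp C s u) v" using comp_assoc[OF t2(2) s1(1) em(4)] s1(4) by simp
      have uv: "in_hom C (Cmp C u v) x2 x" "Cmp C u v \<in> E"
        using comp_in[OF t2(2) s1(2)] OFS_left_comp[OF OFS t2(3,2) s1(3,2)] by auto
      have a1: "Cmp C (Cmp C s u) v = Cmp C s (Cmp C u v)" "Cmp C (Cmp C t u) v = Cmp C t (Cmp C u v)"
        using comp_assoc[OF t2(2) s1(2) s] comp_assoc[OF t2(2) s1(2) t] by auto
      have "Cmp C e ?s2 = Cmp C (Cmp C m1 s) (Cmp C u v)"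
        using comp_assoc[OF s2 em(4) m1] comp_assoc[OF uv(1) s m1] suv a1 m1e by simp
      also have "\<dots> = Cmp C e t2"
        using comp_assoc[OF t2(1) em(4) m1] comp_assoc[OF uv(1) t m1] t2(4) a1 m1e st by simp
      finally obtain y where y: "in_hom C y x2 d" "Cmp C p y = ?s2" "Cmp C q y = t2"
        using is_pullback_fac[OF pb h(2,3) s2 t2(1)] by blast
      \<comment> \<open>Both lifts have the same image under e, so they factor through the kernel
        pair of e, which k coequalizes.\<close>
      have kk: "Cmp C k ?s2 = Cmp C k t2"
        using comp_assoc[OF y(1) h(2) k(1)] comp_assoc[OF y(1) h(3) k(1)] y k(2) by simp
      have es: "in_hom C (Cmp C e' ?s2) x2 c" "in_hom C (Cmp C e' t2) x2 c"
        using comp_in s2 t2(1) em(4) by blast+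
      have "Cmp C m (Cmp C e' ?s2) = Cmp C m (Cmp C e' t2)"
      proof (rule pair_eqI)
        show "in_hom C (Cmp C m (Cmp C e' ?s2)) x2 bz" "in_hom C (Cmp C m (Cmp C e' t2)) x2 bz"
          using comp_in es em(5) by blast+
        show "Cmp C p1 (Cmp C m (Cmp C e' ?s2)) = Cmp C p1 (Cmp C m (Cmp C e' t2))"
          using comp_assoc[OF es(1) em(5) p1] comp_assoc[OF es(2) em(5) p1] \<open>Cmp C (Cmp C m1 s) _ = _\<close>
            comp_assoc[OF s2 em(4) m1] comp_assoc[OF t2(1) em(4) m1] m1e
            comp_assoc[OF uv(1) s m1] comp_assoc[OF uv(1) t m1] suv a1 t2(4) st
          unfolding m1_def[symmetric] by simp
        show "Cmp C p2 (Cmp C m (Cmp C e' ?s2)) = Cmp C p2 (Cmp C m (Cmp C e' t2))"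
          using comp_assoc[OF es(1) em(5) p2] comp_assoc[OF es(2) em(5) p2]
            comp_assoc[OF s2 em(4) m2] comp_assoc[OF t2(1) em(4) m2] m2e kk
          unfolding m2_def[symmetric] by simp
      qed
      then have "Cmp C e' ?s2 = Cmp C e' t2" using mono_arrowsD[OF em(2,5) es] by blast
      then have "Cmp C s (Cmp C u v) = Cmp C t (Cmp C u v)" using suv a1 t2(4) by simp
      then show "s = t" using E_epi[OF uv(2,1) s t] by blast
    qed
    \<comment> \<open>m1 is monic and \<open>m1 e' = e\<close> lies in \<open>E\<close>, so m1 is
      invertible; its inverse followed by m2 is the factorization of k through e.\<close>
    then obtain n where n: "in_hom C n b c" "Cmp C m1 n = Idn C b" "Cmp C n m1 = Idn C c"
      using mono_E_iso[OF _ m1 em(4)] m1e e by metis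
    have "Cmp C n e = e'"
      using comp_assoc[OF em(4) m1 n(1)] m1e n(3) comp_id_left[OF em(4)] by simp
    then have "Cmp C (Cmp C m2 n) e = k" using comp_assoc[OF h(1) n(1) m2] m2e by simp
    then show "\<exists>h. in_hom C h b z \<and> Cmp C h e = k" using comp_in[OF n(1) m2] by blast
  next
    fix z h' h'' assume "in_hom C h' b z" "in_hom C h'' b z" "Cmp C h' e = Cmp C h'' e"
    then show "h' = h''" using E_epi[OF e h(1)] by blast
  qed
qed

text \<open>Members of \<open>E\<close> are coequalizers of their kernel pairs, and regular
  epimorphisms are orthogonal to monomorphisms. Hence the left class is determined by the category,
  and the existential in \<open>regular_category\<close> can be replaced by a concrete
  class.\<close>

lemma regular_epi_iff: "regular_epi C e \<longleftrightarrow> e \<in> E"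
proof
  assume e: "regular_epi C e"
  show "e \<in> E"
    by (rule OFS_leftI[OF OFS in_homD(1)[OF regular_epi_hom[OF e]] regular_epi_orthogonal_mono[OF e]])
next
  assume e: "e \<in> E"
  then have h: "in_hom C e (Dm C e) (Cd C e)" by (rule E_hom)
  obtain p q d where "is_pullback C e e p q" using pullback_ex[OF finite_limits h h] .
  then show "regular_epi C e"
    using E_coequalizer_kernel_pair[OF e] unfolding regular_epi_def by blast
qed

lemma E_regular_epi: "E = {e. regular_epi C e}"
  using regular_epi_iff by blast

end

lemma regular_category_iff:
  "regular_category C \<longleftrightarrow> category C \<and> has_finite_limits C \<and>
     is_OFS C {e. regular_epi C e} (mono_arrows C) \<and> pullback_stable C {e. regular_epi C e}"
proof
  assume "regular_category C"
  then obtain E where "regular_cat C E"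
    using regular_cat.intro regular_cat_axioms.intro unfolding regular_category_def by metis
  then show "category C \<and> has_finite_limits C \<and>
     is_OFS C {e. regular_epi C e} (mono_arrows C) \<and> pullback_stable C {e. regular_epi C e}"
    using regular_cat.E_regular_epi[of C E]
    unfolding regular_cat_def regular_cat_axioms_def by metis
qed (auto simp: regular_category_def)

lemma regular_category_regular_cat: "regular_category C \<Longrightarrow> regular_cat C {e. regular_epi C e}"
  unfolding regular_category_iff regular_cat_def regular_cat_axioms_def by blast

lemma regular_coequalizer_kernel_pair:
  assumes "regular_category C" "regular_epi C e" "is_pullback C e e p q"
  shows "is_coequalizer C p q e"
  using regular_cat.E_coequalizer_kernel_pair[OF regular_category_regular_cat[OF assms(1)]] assms(2,3)
  by blast

lemma functor_cone:
  assumes "category J" "is_functor J C G" "is_functor C D F" "is_cone J C G a l"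
  shows "is_cone J D (func_comp F G) (fo F a) (\<lambda>j. fa F (l j))"
  unfolding is_cone_def
proof (intro conjI ballI allI impI)
  note c = coneD[OF assms(4)]
  show "fo F a \<in> Ob D" using functor_ob[OF assms(3) c(1)] .
  fix j assume "j \<in> Ob J"
  then show "in_hom D (fa F (l j)) (fo F a) (fo (func_comp F G) j)"
    using functor_hom[OF assms(3) c(2)] by (simp add: func_comp_def)
next
  note c = coneD[OF assms(4)]
  fix k i j assume k: "in_hom J k i j"
  have "in_hom C (l i) a (fo G i)" using c(2) category.hom_ob[OF assms(1) k] by blast
  then show "Cmp D (fa (func_comp F G) k) (fa F (l i)) = fa F (l j)"
    using functor_comp[OF assms(3) _ functor_hom[OF assms(2) k], symmetric] c(3)[OF k]
    by (simp add: func_comp_def)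
qed

text \<open>Transitivity is a condition on every pullback of the pair. A given pullback in D is
  therefore compared with the image of one from C, and the transitivity arrow is transported along
  the comparison.\<close>

lemma preserves_internal_equiv_rel:
  assumes F: "is_functor C D F" "preserves_finite_limits C D F" and C: "category C" "category D"
    and lim: "has_finite_limits C" and r: "is_internal_equiv_rel C r\<^sub>0 r\<^sub>1"
  shows "is_internal_equiv_rel D (fa F r\<^sub>0) (fa F r\<^sub>1)"
proof -
  obtain R X where rh: "in_hom C r\<^sub>0 R X" "in_hom C r\<^sub>1 R X" "jointly_monic C r\<^sub>0 r\<^sub>1"
    and refl: "\<exists>i. in_hom C i X R \<and> Cmp C r\<^sub>0 i = Idn C X \<and> Cmp C r\<^sub>1 i = Idn C X"
    and sym: "\<exists>s. in_hom C s R R \<and> Cmp C r\<^sub>0 s = r\<^sub>1 \<and> Cmp C r\<^sub>1 s = r\<^sub>0"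
    and trans: "\<And>p q. is_pullback C r\<^sub>1 r\<^sub>0 p q \<Longrightarrow> \<exists>t. in_hom C t (Dm C p) R \<and>
      Cmp C r\<^sub>0 t = Cmp C r\<^sub>0 p \<and> Cmp C r\<^sub>1 t = Cmp C r\<^sub>1 q"
    using r unfolding is_internal_equiv_rel_def by blast
  note fh = functor_hom[OF F(1)] and fc = functor_comp[OF F(1)]
  have X: "X \<in> Ob C" using category.hom_ob[OF C(1) rh(1)] by blast
  note rF = fh[OF rh(1)] fh[OF rh(2)]
  show ?thesis
    unfolding is_internal_equiv_rel_def
  proof (rule exI[of _ "fo F R"], rule exI[of _ "fo F X"], intro conjI allI impI)
    show "jointly_monic D (fa F r\<^sub>0) (fa F r\<^sub>1)" by (rule preserves_jointly_monic[OF F C rh])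
    obtain i where i: "in_hom C i X R" "Cmp C r\<^sub>0 i = Idn C X" "Cmp C r\<^sub>1 i = Idn C X"
      using refl by blast
    show "\<exists>i. in_hom D i (fo F X) (fo F R) \<and> Cmp D (fa F r\<^sub>0) i = Idn D (fo F X) \<and>
        Cmp D (fa F r\<^sub>1) i = Idn D (fo F X)"
      using fh[OF i(1)] fc[OF i(1) rh(1)] fc[OF i(1) rh(2)] i(2,3) functor_id[OF F(1) X]
      by (intro exI[of _ "fa F i"]) simp
    obtain s where s: "in_hom C s R R" "Cmp C r\<^sub>0 s = r\<^sub>1" "Cmp C r\<^sub>1 s = r\<^sub>0" using sym by blast
    show "\<exists>s. in_hom D s (fo F R) (fo F R) \<and> Cmp D (fa F r\<^sub>0) s = fa F r\<^sub>1 \<and>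
        Cmp D (fa F r\<^sub>1) s = fa F r\<^sub>0"
      using fh[OF s(1)] fc[OF s(1) rh(1)] fc[OF s(1) rh(2)] s(2,3)
      by (intro exI[of _ "fa F s"]) simp
  next
    fix p' q' assume pb': "is_pullback D (fa F r\<^sub>1) (fa F r\<^sub>0) p' q'"
    obtain p q P where pb: "is_pullback C r\<^sub>1 r\<^sub>0 p q" and pq: "in_hom C p P R" "in_hom C q P R"
      using category.pullback_ex[OF C(1) lim rh(2,1)] by blast
    then obtain t where t: "in_hom C t P R" "Cmp C r\<^sub>0 t = Cmp C r\<^sub>0 p" "Cmp C r\<^sub>1 t = Cmp C r\<^sub>1 q"
      using trans[OF pb] by (auto simp: in_homD)
    have Fpb: "is_pullback D (fa F r\<^sub>1) (fa F r\<^sub>0) (fa F p) (fa F q)"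
      by (rule preserves_pullback[OF F C pb])
    have p': "in_hom D p' (Dm D p') (fo F R)" "in_hom D q' (Dm D p') (fo F R)"
      "Cmp D (fa F r\<^sub>1) p' = Cmp D (fa F r\<^sub>0) q'"
      using pb' rF unfolding is_pullback_def by (simp_all add: in_homD)
    obtain h where h: "in_hom D h (Dm D p') (fo F P)" "Cmp D (fa F p) h = p'" "Cmp D (fa F q) h = q'"
      using is_pullback_fac[OF Fpb fh[OF pq(1)] fh[OF pq(2)] p'] .
    note as = category.comp_assoc[OF C(2) h(1)]
    show "\<exists>t. in_hom D t (Dm D p') (fo F R) \<and> Cmp D (fa F r\<^sub>0) t = Cmp D (fa F r\<^sub>0) p' \<and>
        Cmp D (fa F r\<^sub>1) t = Cmp D (fa F r\<^sub>1) q'"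
    proof (intro exI[of _ "Cmp D (fa F t) h"] conjI)
      show "in_hom D (Cmp D (fa F t) h) (Dm D p') (fo F R)"
        using category.comp_in[OF C(2) h(1) fh[OF t(1)]] .
      show "Cmp D (fa F r\<^sub>0) (Cmp D (fa F t) h) = Cmp D (fa F r\<^sub>0) p'"
        using as[OF fh[OF t(1)] rF(1)] as[OF fh[OF pq(1)] rF(1)] fc[OF t(1) rh(1)]
          fc[OF pq(1) rh(1)] t(2) h(2) by simp
      show "Cmp D (fa F r\<^sub>1) (Cmp D (fa F t) h) = Cmp D (fa F r\<^sub>1) q'"
        using as[OF fh[OF t(1)] rF(2)] as[OF fh[OF pq(2)] rF(2)] fc[OF t(1) rh(2)]
          fc[OF pq(2) rh(2)] t(3) h(3) by simp
    qed
  qed (fact rF)+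
qed


section \<open>Products of categories\<close>

text \<open>The functor from D to the product of the \<open>C s\<close> is fully faithful and
  surjective on objects, and the transfer arguments rest on this. Injectivity on objects is added in
  \<open>finite_product_category\<close>.\<close>

locale product_category = D: category D
  for D :: "('p, 'b) cat" +
  fixes S :: "'s set" and C :: "'s \<Rightarrow> ('o, 'a) cat" and P :: "'s \<Rightarrow> ('p, 'b, 'o, 'a) func"
  assumes C_cat: "s \<in> S \<Longrightarrow> category (C s)"
    and P_functor: "s \<in> S \<Longrightarrow> is_functor D (C s) (P s)"
    and tuple_ob: "(\<And>s. s \<in> S \<Longrightarrow> c s \<in> Ob (C s)) \<Longrightarrow> \<exists>d\<in>Ob D. \<forall>s\<in>S. fo (P s) d = c s"
    and tuple_ar: "d \<in> Ob D \<Longrightarrow> d' \<in> Ob D \<Longrightarrow>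
      (\<And>s. s \<in> S \<Longrightarrow> in_hom (C s) (f s) (fo (P s) d) (fo (P s) d')) \<Longrightarrow>
      \<exists>!g. in_hom D g d d' \<and> (\<forall>s\<in>S. fa (P s) g = f s)"
begin

lemmas P_hom = functor_hom[OF P_functor]
lemmas P_ob = functor_ob[OF P_functor]
lemmas P_comp = functor_comp[OF P_functor]
lemmas P_id = functor_id[OF P_functor]

lemma tuple_ar_ex:
  assumes "d \<in> Ob D" "d' \<in> Ob D" "\<And>s. s \<in> S \<Longrightarrow> in_hom (C s) (f s) (fo (P s) d) (fo (P s) d')"
  obtains g where "in_hom D g d d'" "\<And>s. s \<in> S \<Longrightarrow> fa (P s) g = f s"
proof -
  obtain g where "in_hom D g d d' \<and> (\<forall>s\<in>S. fa (P s) g = f s)"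
    using ex1_implies_ex[OF tuple_ar[OF assms]] by (rule exE)
  then show ?thesis by (intro that[of g]) simp_all
qed

lemma ar_eqI:
  assumes "in_hom D g d d'" "in_hom D g' d d'" "\<And>s. s \<in> S \<Longrightarrow> fa (P s) g = fa (P s) g'"
  shows "g = g'"
proof -
  have "\<exists>!h. in_hom D h d d' \<and> (\<forall>s\<in>S. fa (P s) h = fa (P s) g)"
    using assms(1) P_hom D.hom_ob by (intro tuple_ar) blast+
  then show ?thesis using assms by (elim ex1E) (metis (no_types, lifting))
qed

text \<open>Universal properties in a single factor are tested in D by varying one component and
  freezing the others.\<close>

lemma replace_ob:
  assumes "s \<in> S" "d \<in> Ob D" "c \<in> Ob (C s)"
  obtains d' where "d' \<in> Ob D" "fo (P s) d' = c" "\<And>t. t \<in> S \<Longrightarrow> t \<noteq> s \<Longrightarrow> fo (P t) d' = fo (P t) d"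
proof -
  have "\<exists>d'\<in>Ob D. \<forall>t\<in>S. fo (P t) d' = (if t = s then c else fo (P t) d)"
    using assms P_ob by (intro tuple_ob) auto
  then obtain d' where "d' \<in> Ob D" "\<forall>t\<in>S. fo (P t) d' = (if t = s then c else fo (P t) d)" by blast
  then show ?thesis using assms(1) by (intro that[of d']) auto
qed

lemma limitI:
  assumes J: "category J" "is_functor J D G" and a: "a \<in> Ob D"
    and l: "\<And>j. j \<in> Ob J \<Longrightarrow> in_hom D (l j) a (fo G j)"
    and lim: "\<And>s. s \<in> S \<Longrightarrow> is_limit J (C s) (func_comp (P s) G) (fo (P s) a) (\<lambda>j. fa (P s) (l j))"
  shows "is_limit J D G a l"
proof (rule is_limitI)
  show "is_cone J D G a l"
    unfolding is_cone_def
  proof (intro conjI ballI allI impI a l)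
    fix k i j assume k: "in_hom J k i j"
    have ij: "i \<in> Ob J" "j \<in> Ob J" using category.hom_ob[OF J(1) k] by auto
    have Gk: "in_hom D (fa G k) (fo G i) (fo G j)" by (rule functor_hom[OF J(2) k])
    show "Cmp D (fa G k) (l i) = l j"
    proof (rule ar_eqI[OF D.comp_in[OF l[OF ij(1)] Gk] l[OF ij(2)]])
      fix s assume s: "s \<in> S"
      show "fa (P s) (Cmp D (fa G k) (l i)) = fa (P s) (l j)"
        using coneD(3)[OF limit_cone[OF lim[OF s]] k] P_comp[OF s l[OF ij(1)] Gk]
        by (simp add: func_comp_def)
    qed
  qed
  fix b m assume m: "is_cone J D G b m"
  have "\<forall>s\<in>S. \<exists>h. in_hom (C s) h (fo (P s) b) (fo (P s) a) \<and>
      (\<forall>j\<in>Ob J. Cmp (C s) (fa (P s) (l j)) h = fa (P s) (m j))"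
  proof
    fix s assume s: "s \<in> S"
    show "\<exists>h. in_hom (C s) h (fo (P s) b) (fo (P s) a) \<and>
      (\<forall>j\<in>Ob J. Cmp (C s) (fa (P s) (l j)) h = fa (P s) (m j))"
      by (rule limit_fac[OF lim[OF s] functor_cone[OF J P_functor[OF s] m]]) blast
  qed
  then obtain h where h: "\<forall>s\<in>S. in_hom (C s) (h s) (fo (P s) b) (fo (P s) a) \<and>
      (\<forall>j\<in>Ob J. Cmp (C s) (fa (P s) (l j)) (h s) = fa (P s) (m j))"
    by (rule bchoice[THEN exE])
  obtain g where g: "in_hom D g b a" "\<And>s. s \<in> S \<Longrightarrow> fa (P s) g = h s"
    using h by (rule_tac tuple_ar_ex[OF coneD(1)[OF m] a, of h]) auto
  have "Cmp D (l j) g = m j" if j: "j \<in> Ob J" for j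
    using g(2) h P_comp[OF _ g(1) l[OF j]] j
    by (intro ar_eqI[OF D.comp_in[OF g(1) l[OF j]] coneD(2)[OF m j]]) simp
  with g(1) show "\<exists>h. in_hom D h b a \<and> (\<forall>j\<in>Ob J. Cmp D (l j) h = m j)" by blast
next
  fix b h h' assume h: "in_hom D h b a" "in_hom D h' b a"
    and eq: "\<And>j. j \<in> Ob J \<Longrightarrow> Cmp D (l j) h = Cmp D (l j) h'"
  show "h = h'"
  proof (rule ar_eqI[OF h])
    fix s assume s: "s \<in> S"
    show "fa (P s) h = fa (P s) h'"
      using P_comp[OF s h(1) l] P_comp[OF s h(2) l] eq
      by (intro category.limit_eqI[OF C_cat[OF s] lim[OF s] functor_func_comp[OF J(2) P_functor[OF s]] J(1)
            P_hom[OF s h(1)] P_hom[OF s h(2)]]) metis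
  qed
qed

text \<open>A competing cone in the factor s is completed to a cone in D by the limit cone itself in
  all other components. Thus the projection preserves every limit that exists in D.\<close>

lemma P_limit:
  assumes J: "category J" "is_functor J D G" and s: "s \<in> S" and lim: "is_limit J D G a l"
  shows "is_limit J (C s) (func_comp (P s) G) (fo (P s) a) (\<lambda>j. fa (P s) (l j))"
proof (rule is_limitI)
  interpret Cs: category "C s" by (rule C_cat[OF s])
  note lc = limit_cone[OF lim]
  note a = coneD(1)[OF lc] and l = coneD(2)[OF lc]
  show "is_cone J (C s) (func_comp (P s) G) (fo (P s) a) (\<lambda>j. fa (P s) (l j))"
    by (rule functor_cone[OF J P_functor[OF s] lc])
  fix b m assume m: "is_cone J (C s) (func_comp (P s) G) b m"
  obtain d where d: "d \<in> Ob D" "fo (P s) d = b" "\<And>t. t \<in> S \<Longrightarrow> t \<noteq> s \<Longrightarrow> fo (P t) d = fo (P t) a"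
    by (rule replace_ob[OF s a coneD(1)[OF m]]) (rule that)
  have "\<forall>j\<in>Ob J. \<exists>g. in_hom D g d (fo G j) \<and> (\<forall>t\<in>S. fa (P t) g = (if t = s then m j else fa (P t) (l j)))"
  proof
    fix j assume j: "j \<in> Ob J"
    have "in_hom (C t) (if t = s then m j else fa (P t) (l j)) (fo (P t) d) (fo (P t) (fo G j))" if "t \<in> S"
        for t
      using that d(2,3) coneD(2)[OF m j] P_hom[OF that l[OF j]] by (simp add: func_comp_def)
    then show "\<exists>g. in_hom D g d (fo G j) \<and> (\<forall>t\<in>S. fa (P t) g = (if t = s then m j else fa (P t) (l j)))"
      by (rule ex1_implies_ex[OF tuple_ar[OF d(1) functor_ob[OF J(2) j]]])
  qed
  then obtain n where n: "\<forall>j\<in>Ob J. in_hom D (n j) d (fo G j) \<and>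
      (\<forall>t\<in>S. fa (P t) (n j) = (if t = s then m j else fa (P t) (l j)))"
    by (rule bchoice[THEN exE])
  have "is_cone J D G d n"
    unfolding is_cone_def
  proof (intro conjI ballI allI impI d(1))
    show "in_hom D (n j) d (fo G j)" if "j \<in> Ob J" for j using n that by blast
    fix k i j assume k: "in_hom J k i j"
    have ij: "i \<in> Ob J" "j \<in> Ob J" using category.hom_ob[OF J(1) k] by auto
    have Gk: "in_hom D (fa G k) (fo G i) (fo G j)" by (rule functor_hom[OF J(2) k])
    have nij: "in_hom D (n i) d (fo G i)" "in_hom D (n j) d (fo G j)" using n ij by auto
    show "Cmp D (fa G k) (n i) = n j"
    proof (rule ar_eqI[OF D.comp_in[OF nij(1) Gk] nij(2)])
      fix t assume t: "t \<in> S"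
      have "fa (P t) (Cmp D (fa G k) (l i)) = fa (P t) (l j)" using coneD(3)[OF lc k] by simp
      then show "fa (P t) (Cmp D (fa G k) (n i)) = fa (P t) (n j)"
        using P_comp[OF t nij(1) Gk] P_comp[OF t l[OF ij(1)] Gk] n ij t coneD(3)[OF m k]
        by (auto simp: func_comp_def)
    qed
  qed
  then obtain h where h: "in_hom D h d a" "\<And>j. j \<in> Ob J \<Longrightarrow> Cmp D (l j) h = n j"
    by (rule limit_fac[OF lim]) (rule that)
  have "Cmp (C s) (fa (P s) (l j)) (fa (P s) h) = m j" if j: "j \<in> Ob J" for j
    using P_comp[OF s h(1) l[OF j]] h(2)[OF j] n j s by simp
  then show "\<exists>h. in_hom (C s) h b (fo (P s) a) \<and> (\<forall>j\<in>Ob J. Cmp (C s) (fa (P s) (l j)) h = m j)"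
    using P_hom[OF s h(1)] d(2) by blast
next
  interpret Cs: category "C s" by (rule C_cat[OF s])
  note lc = limit_cone[OF lim]
  note a = coneD(1)[OF lc] and l = coneD(2)[OF lc]
  fix b h h' assume h: "in_hom (C s) h b (fo (P s) a)" "in_hom (C s) h' b (fo (P s) a)"
    and eq: "\<And>j. j \<in> Ob J \<Longrightarrow> Cmp (C s) (fa (P s) (l j)) h = Cmp (C s) (fa (P s) (l j)) h'"
  obtain d where d: "d \<in> Ob D" "fo (P s) d = b" "\<And>t. t \<in> S \<Longrightarrow> t \<noteq> s \<Longrightarrow> fo (P t) d = fo (P t) a"
    by (rule replace_ob[OF s a Cs.hom_ob(1)[OF h(1)]]) (rule that)
  \<comment> \<open>Test arrows are completed by identities in the other components, so that
    uniqueness in D applies to them.\<close>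
  have ext: "\<exists>g. in_hom D g d a \<and> (\<forall>t\<in>S. fa (P t) g = (if t = s then k else Idn (C t) (fo (P t) a)))"
    if "in_hom (C s) k b (fo (P s) a)" for k
    by (rule ex1_implies_ex[OF tuple_ar[OF d(1) a]])
       (use that d category.id_in[OF C_cat P_ob[OF _ a]] in auto)
  obtain g where g: "in_hom D g d a" "\<And>t. t \<in> S \<Longrightarrow> fa (P t) g =
      (if t = s then h else Idn (C t) (fo (P t) a))"
    using ext[OF h(1)] by blast
  obtain g' where g': "in_hom D g' d a" "\<And>t. t \<in> S \<Longrightarrow> fa (P t) g' =
      (if t = s then h' else Idn (C t) (fo (P t) a))"
    using ext[OF h(2)] by blast
  have "g = g'"
  proof (rule D.limit_eqI[OF lim J(2,1) g(1) g'(1)])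
    fix j assume j: "j \<in> Ob J"
    show "Cmp D (l j) g = Cmp D (l j) g'"
      using g(2) g'(2) eq[OF j] P_comp[OF _ g(1) l[OF j]] P_comp[OF _ g'(1) l[OF j]]
      by (intro ar_eqI[OF D.comp_in[OF g(1) l[OF j]] D.comp_in[OF g'(1) l[OF j]]]) simp
  qed
  then show "h = h'" using g(2)[OF s] g'(2)[OF s] by simp
qed

lemma P_preserves_finite_limits: "s \<in> S \<Longrightarrow> preserves_finite_limits D (C s) (P s)"
  unfolding preserves_finite_limits_def finite_shape_def using P_limit by blast

lemma has_finite_limits:
  assumes "\<And>s. s \<in> S \<Longrightarrow> has_finite_limits (C s)"
  shows "has_finite_limits D"
  unfolding has_finite_limits_def
proof (intro allI impI, elim conjE)
  fix J :: "(nat, nat) cat" and G :: "(nat, nat, 'p, 'b) func"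
  assume fJ: "finite_shape J" and G: "is_functor J D G"
  then have J: "category J" by (simp add: finite_shape_def)
  have "\<forall>s\<in>S. \<exists>al. is_limit J (C s) (func_comp (P s) G) (fst al) (snd al)"
  proof
    fix s assume "s \<in> S"
    then have "\<exists>a l. is_limit J (C s) (func_comp (P s) G) a l"
      using assms fJ functor_func_comp[OF G P_functor] unfolding has_finite_limits_def by blast
    then show "\<exists>al. is_limit J (C s) (func_comp (P s) G) (fst al) (snd al)" by auto
  qed
  then obtain al where al: "\<forall>s\<in>S. is_limit J (C s) (func_comp (P s) G) (fst (al s)) (snd (al s))"
    by (rule bchoice[THEN exE])
  have c: "is_cone J (C s) (func_comp (P s) G) (fst (al s)) (snd (al s))" if "s \<in> S" for s
    by (rule limit_cone) (use al that in blast)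
  obtain a where a: "a \<in> Ob D" "\<forall>s\<in>S. fo (P s) a = fst (al s)"
    using tuple_ob[of "\<lambda>s. fst (al s)"] coneD(1)[OF c] by blast
  have "\<forall>j\<in>Ob J. \<exists>g. in_hom D g a (fo G j) \<and> (\<forall>s\<in>S. fa (P s) g = snd (al s) j)"
  proof
    fix j assume j: "j \<in> Ob J"
    show "\<exists>g. in_hom D g a (fo G j) \<and> (\<forall>s\<in>S. fa (P s) g = snd (al s) j)"
      by (rule ex1_implies_ex[OF tuple_ar[OF a(1) functor_ob[OF G j]]])
        (use coneD(2)[OF c j] a(2) in \<open>simp add: func_comp_def\<close>)
  qed
  then obtain l where l: "\<forall>j\<in>Ob J. in_hom D (l j) a (fo G j) \<and> (\<forall>s\<in>S. fa (P s) (l j) = snd (al s) j)"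
    by (rule bchoice[THEN exE])
  have "is_limit J D G a l"
  proof (rule limitI[OF J G a(1)])
    fix s assume s: "s \<in> S"
    have "is_limit J (C s) (func_comp (P s) G) (fst (al s)) (snd (al s))" using al s by blast
    then have "is_limit J (C s) (func_comp (P s) G) (fst (al s)) (\<lambda>j. fa (P s) (l j))"
      by (subst is_limit_cong[OF J, of _ "func_comp (P s) G" _ "snd (al s)"]) (use l s in auto)
    then show "is_limit J (C s) (func_comp (P s) G) (fo (P s) a) (\<lambda>j. fa (P s) (l j))"
      using a(2) s by simp
  qed (use l in blast)
  then show "\<exists>a l. is_limit J D G a l" by blast
qed

lemma coequalizerI:
  assumes f: "in_hom D f x y" "in_hom D g x y" "in_hom D e y z"
    and co: "\<And>s. s \<in> S \<Longrightarrow> is_coequalizer (C s) (fa (P s) f) (fa (P s) g) (fa (P s) e)"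
  shows "is_coequalizer D f g e"
proof (rule is_coequalizerI[OF f])
  have eq: "Cmp (C s) (fa (P s) e) (fa (P s) f) = Cmp (C s) (fa (P s) e) (fa (P s) g)" if "s \<in> S" for s
    using co[OF that] by (rule is_coequalizerE)
  show "Cmp D e f = Cmp D e g"
    using eq P_comp[OF _ f(1,3)] P_comp[OF _ f(2,3)]
    by (intro ar_eqI[OF D.comp_in[OF f(1,3)] D.comp_in[OF f(2,3)]]) simp
  fix w k assume k: "in_hom D k y w" "Cmp D k f = Cmp D k g"
  have "\<forall>s\<in>S. \<exists>h. in_hom (C s) h (fo (P s) z) (fo (P s) w) \<and> Cmp (C s) h (fa (P s) e) = fa (P s) k"
  proof
    fix s assume s: "s \<in> S"
    have "Cmp (C s) (fa (P s) k) (fa (P s) f) = Cmp (C s) (fa (P s) k) (fa (P s) g)"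
      using P_comp[OF s f(1) k(1)] P_comp[OF s f(2) k(1)] k(2) by simp
    then show "\<exists>h. in_hom (C s) h (fo (P s) z) (fo (P s) w) \<and> Cmp (C s) h (fa (P s) e) = fa (P s) k"
      using is_coequalizer_fac[OF co[OF s] P_hom[OF s f(3)] P_hom[OF s k(1)]] by metis
  qed
  then obtain h where h: "\<forall>s\<in>S. in_hom (C s) (h s) (fo (P s) z) (fo (P s) w) \<and>
      Cmp (C s) (h s) (fa (P s) e) = fa (P s) k"
    by (rule bchoice[THEN exE])
  have zw: "z \<in> Ob D" "w \<in> Ob D" using D.hom_ob f k by blast+
  obtain m where m: "in_hom D m z w" "\<And>s. s \<in> S \<Longrightarrow> fa (P s) m = h s"
    using h by (rule_tac tuple_ar_ex[OF zw, of h]) auto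
  have "Cmp D m e = k"
    using h m(2) P_comp[OF _ f(3) m(1)] by (intro ar_eqI[OF D.comp_in[OF f(3) m(1)] k(1)]) simp
  with m(1) show "\<exists>h. in_hom D h z w \<and> Cmp D h e = k" by blast
next
  fix w h h' assume h: "in_hom D h z w" "in_hom D h' z w" "Cmp D h e = Cmp D h' e"
  show "h = h'"
  proof (rule ar_eqI[OF h(1,2)])
    fix s assume s: "s \<in> S"
    show "fa (P s) h = fa (P s) h'"
      using P_comp[OF s f(3) h(1)] P_comp[OF s f(3) h(2)] h(3)
      by (intro category.coequalizer_eqI[OF C_cat[OF s] co[OF s] P_hom[OF s f(3)] P_hom[OF s h(1)]
          P_hom[OF s h(2)]])
        simp
  qed
qed

text \<open>Dual to \<open>P_limit\<close>: outside s a competing arrow is completed by e itself,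
  which coequalizes the pair there.\<close>

lemma P_coequalizer:
  assumes s: "s \<in> S" and co: "is_coequalizer D f g e"
  shows "is_coequalizer (C s) (fa (P s) f) (fa (P s) g) (fa (P s) e)"
proof -
  interpret Cs: category "C s" by (rule C_cat[OF s])
  obtain x y z where f: "in_hom D f x y" "in_hom D g x y" "in_hom D e y z" "Cmp D e f = Cmp D e g"
    using is_coequalizerE[OF co] .
  note z = D.hom_ob(2)[OF f(3)]
  show ?thesis
  proof (rule is_coequalizerI[OF P_hom[OF s f(1)] P_hom[OF s f(2)] P_hom[OF s f(3)]])
    show "Cmp (C s) (fa (P s) e) (fa (P s) f) = Cmp (C s) (fa (P s) e) (fa (P s) g)"
      using P_comp[OF s f(1,3)] P_comp[OF s f(2,3)] f(4) by simp
    fix w k assume k: "in_hom (C s) k (fo (P s) y) w"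
      "Cmp (C s) k (fa (P s) f) = Cmp (C s) k (fa (P s) g)"
    obtain d where d: "d \<in> Ob D" "fo (P s) d = w" "\<And>t. t \<in> S \<Longrightarrow> t \<noteq> s \<Longrightarrow> fo (P t) d = fo (P t) z"
      by (rule replace_ob[OF s z Cs.hom_ob(2)[OF k(1)]]) (rule that)
    obtain m where m: "in_hom D m y d" "\<And>t. t \<in> S \<Longrightarrow> fa (P t) m = (if t = s then k else fa (P t) e)"
      by (rule tuple_ar_ex[OF D.hom_ob(1)[OF f(3)] d(1), of "\<lambda>t. if t = s then k else fa (P t) e"])
        (use k(1) d(2,3) P_hom[OF _ f(3)] in \<open>auto intro: that\<close>)
    have eq: "Cmp (C t) (fa (P t) e) (fa (P t) f) = Cmp (C t) (fa (P t) e) (fa (P t) g)" if "t \<in> S" for t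
      using P_comp[OF that f(1,3)] P_comp[OF that f(2,3)] f(4) by simp
    have "Cmp D m f = Cmp D m g"
      using P_comp[OF _ f(1) m(1)] P_comp[OF _ f(2) m(1)] m(2) k(2) eq
      by (intro ar_eqI[OF D.comp_in[OF f(1) m(1)] D.comp_in[OF f(2) m(1)]]) auto
    then obtain h where h: "in_hom D h z d" "Cmp D h e = m"
      using is_coequalizer_fac[OF co f(3) m(1)] by blast
    then show "\<exists>h. in_hom (C s) h (fo (P s) z) w \<and> Cmp (C s) h (fa (P s) e) = k"
      using P_hom[OF s h(1)] d(2) P_comp[OF s f(3) h(1)] m(2)[OF s] by auto
  next
    fix w h h' assume h: "in_hom (C s) h (fo (P s) z) w" "in_hom (C s) h' (fo (P s) z) w"
      "Cmp (C s) h (fa (P s) e) = Cmp (C s) h' (fa (P s) e)"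
    obtain d where d: "d \<in> Ob D" "fo (P s) d = w" "\<And>t. t \<in> S \<Longrightarrow> t \<noteq> s \<Longrightarrow> fo (P t) d = fo (P t) z"
      by (rule replace_ob[OF s z Cs.hom_ob(2)[OF h(1)]]) (rule that)
    have ext: "\<exists>g. in_hom D g z d \<and> (\<forall>t\<in>S. fa (P t) g = (if t = s then k else Idn (C t) (fo (P t) z)))"
      if "in_hom (C s) k (fo (P s) z) w" for k
      by (rule ex1_implies_ex[OF tuple_ar[OF z d(1)]])
         (use that d category.id_in[OF C_cat P_ob[OF _ z]] in auto)
    obtain m where m: "in_hom D m z d" "\<And>t. t \<in> S \<Longrightarrow> fa (P t) m =
        (if t = s then h else Idn (C t) (fo (P t) z))"
      using ext[OF h(1)] by blast
    obtain m' where m': "in_hom D m' z d" "\<And>t. t \<in> S \<Longrightarrow> fa (P t) m' =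
        (if t = s then h' else Idn (C t) (fo (P t) z))"
      using ext[OF h(2)] by blast
    have "Cmp D m e = Cmp D m' e"
      using P_comp[OF _ f(3) m(1)] P_comp[OF _ f(3) m'(1)] m(2) m'(2) h(3)
      by (intro ar_eqI[OF D.comp_in[OF f(3) m(1)] D.comp_in[OF f(3) m'(1)]]) simp
    then have "m = m'" using D.coequalizer_eqI[OF co f(3) m(1) m'(1)] by blast
    then show "h = h'" using m(2)[OF s] m'(2)[OF s] by simp
  qed
qed

lemma regular_epi_iff:
  assumes e: "in_hom D e y z"
  shows "regular_epi D e \<longleftrightarrow> (\<forall>s\<in>S. regular_epi (C s) (fa (P s) e))"
proof
  assume "regular_epi D e"
  then show "\<forall>s\<in>S. regular_epi (C s) (fa (P s) e)"
    using P_coequalizer unfolding regular_epi_def by blast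
next
  assume "\<forall>s\<in>S. regular_epi (C s) (fa (P s) e)"
  then have "\<forall>s\<in>S. \<exists>fg. is_coequalizer (C s) (fst fg) (snd fg) (fa (P s) e)"
    unfolding regular_epi_def by simp
  then obtain fg where fg: "\<forall>s\<in>S. is_coequalizer (C s) (fst (fg s)) (snd (fg s)) (fa (P s) e)"
    by (rule bchoice[THEN exE])
  have h: "in_hom (C s) (fst (fg s)) (Dm (C s) (fst (fg s))) (fo (P s) y)"
    "in_hom (C s) (snd (fg s)) (Dm (C s) (fst (fg s))) (fo (P s) y)" if "s \<in> S" for s
    using fg that P_hom[OF that e] unfolding is_coequalizer_def in_hom_def by auto
  \<comment> \<open>The pairs chosen in the factors have unrelated sources; these become the
    components of one object of D.\<close>
  obtain x where x: "x \<in> Ob D" "\<forall>s\<in>S. fo (P s) x = Dm (C s) (fst (fg s))"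
    using tuple_ob[of "\<lambda>s. Dm (C s) (fst (fg s))"] category.hom_ob(1)[OF C_cat h(1)] by blast
  have y: "y \<in> Ob D" using D.hom_ob e by blast
  obtain f where f: "in_hom D f x y" "\<And>s. s \<in> S \<Longrightarrow> fa (P s) f = fst (fg s)"
    by (rule tuple_ar_ex[OF x(1) y, of "\<lambda>s. fst (fg s)"]) (use h x in \<open>auto intro: that\<close>)
  obtain g where g: "in_hom D g x y" "\<And>s. s \<in> S \<Longrightarrow> fa (P s) g = snd (fg s)"
    by (rule tuple_ar_ex[OF x(1) y, of "\<lambda>s. snd (fg s)"]) (use h x in \<open>auto intro: that\<close>)
  have "is_coequalizer D f g e"
    using fg f(2) g(2) by (intro coequalizerI[OF f(1) g(1) e]) simp
  then show "regular_epi D e" unfolding regular_epi_def by blast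
qed

lemma pullbackI:
  assumes h: "in_hom D f x z" "in_hom D g y z" "in_hom D p w x" "in_hom D q w y"
    and pb: "\<And>s. s \<in> S \<Longrightarrow> is_pullback (C s) (fa (P s) f) (fa (P s) g) (fa (P s) p) (fa (P s) q)"
  shows "is_pullback D f g p q"
proof (rule is_pullbackI[OF h])
  have eq: "Cmp (C s) (fa (P s) f) (fa (P s) p) = Cmp (C s) (fa (P s) g) (fa (P s) q)" if "s \<in> S" for s
    using pb[OF that] by (rule is_pullbackE)
  show "Cmp D f p = Cmp D g q"
    using eq P_comp[OF _ h(3,1)] P_comp[OF _ h(4,2)]
    by (intro ar_eqI[OF D.comp_in[OF h(3,1)] D.comp_in[OF h(4,2)]]) simp
  fix v r t assume r: "in_hom D r v x" "in_hom D t v y" "Cmp D f r = Cmp D g t"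
  have "\<forall>s\<in>S. \<exists>k. in_hom (C s) k (fo (P s) v) (fo (P s) w) \<and>
      Cmp (C s) (fa (P s) p) k = fa (P s) r \<and> Cmp (C s) (fa (P s) q) k = fa (P s) t"
  proof
    fix s assume s: "s \<in> S"
    have "Cmp (C s) (fa (P s) f) (fa (P s) r) = Cmp (C s) (fa (P s) g) (fa (P s) t)"
      using P_comp[OF s r(1) h(1)] P_comp[OF s r(2) h(2)] r(3) by simp
    from is_pullback_ex1[OF pb[OF s] P_hom[OF s h(3)] P_hom[OF s h(4)] P_hom[OF s r(1)] P_hom[OF s r(2)]
        this]
    show "\<exists>k. in_hom (C s) k (fo (P s) v) (fo (P s) w) \<and>
      Cmp (C s) (fa (P s) p) k = fa (P s) r \<and> Cmp (C s) (fa (P s) q) k = fa (P s) t"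
      by (rule ex1_implies_ex)
  qed
  then obtain k where k: "\<forall>s\<in>S. in_hom (C s) (k s) (fo (P s) v) (fo (P s) w) \<and>
      Cmp (C s) (fa (P s) p) (k s) = fa (P s) r \<and> Cmp (C s) (fa (P s) q) (k s) = fa (P s) t"
    by (rule bchoice[THEN exE])
  have vw: "v \<in> Ob D" "w \<in> Ob D" using D.hom_ob r h by blast+
  obtain m where m: "in_hom D m v w" "\<And>s. s \<in> S \<Longrightarrow> fa (P s) m = k s"
    by (rule tuple_ar_ex[OF vw, of k]) (use k in \<open>auto intro: that\<close>)
  have "Cmp D p m = r" "Cmp D q m = t"
    using k m(2) P_comp[OF _ m(1) h(3)] P_comp[OF _ m(1) h(4)]
    by (intro ar_eqI[OF D.comp_in[OF m(1) h(3)] r(1)] ar_eqI[OF D.comp_in[OF m(1) h(4)] r(2)]; simp)+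
  with m(1) show "\<exists>h. in_hom D h v w \<and> Cmp D p h = r \<and> Cmp D q h = t" by blast
next
  fix v k k' assume k: "in_hom D k v w" "in_hom D k' v w" "Cmp D p k = Cmp D p k'" "Cmp D q k = Cmp D q k'"
  show "k = k'"
  proof (rule ar_eqI[OF k(1,2)])
    fix s assume s: "s \<in> S"
    note hs = P_hom[OF s h(1)] P_hom[OF s h(2)] P_hom[OF s h(3)] P_hom[OF s h(4)]
    note ks = P_hom[OF s k(1)] P_hom[OF s k(2)]
    interpret Cs: category "C s" by (rule C_cat[OF s])
    have e: "Cmp (C s) (fa (P s) p) (fa (P s) k) = Cmp (C s) (fa (P s) p) (fa (P s) k')"
      "Cmp (C s) (fa (P s) q) (fa (P s) k) = Cmp (C s) (fa (P s) q) (fa (P s) k')"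
      using P_comp[OF s k(1) h(3)] P_comp[OF s k(2) h(3)] P_comp[OF s k(1) h(4)] P_comp[OF s k(2) h(4)]
          k(3,4)
      by auto
    have "Cmp (C s) (fa (P s) f) (fa (P s) p) = Cmp (C s) (fa (P s) g) (fa (P s) q)"
      using pb[OF s] by (rule is_pullbackE)
    then have "Cmp (C s) (fa (P s) f) (Cmp (C s) (fa (P s) p) (fa (P s) k)) =
        Cmp (C s) (fa (P s) g) (Cmp (C s) (fa (P s) q) (fa (P s) k))"
      using Cs.comp_assoc[OF ks(1) hs(3,1)] Cs.comp_assoc[OF ks(1) hs(4,2)] by simp
    from is_pullback_ex1[OF pb[OF s] hs(3,4) Cs.comp_in[OF ks(1) hs(3)] Cs.comp_in[OF ks(1) hs(4)] this]
    show "fa (P s) k = fa (P s) k'" using ks e by (elim ex1E) metis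
  qed
qed

lemma mono_iff:
  assumes m: "in_hom D m y z"
  shows "m \<in> mono_arrows D \<longleftrightarrow> (\<forall>s\<in>S. fa (P s) m \<in> mono_arrows (C s))"
proof
  assume "m \<in> mono_arrows D"
  then show "\<forall>s\<in>S. fa (P s) m \<in> mono_arrows (C s)"
    using preserves_mono[OF P_functor P_preserves_finite_limits D.category_axioms C_cat] by blast
next
  assume *: "\<forall>s\<in>S. fa (P s) m \<in> mono_arrows (C s)"
  show "m \<in> mono_arrows D"
  proof (rule mono_arrowsI[OF m])
    fix x f g assume f: "in_hom D f x y" "in_hom D g x y" "Cmp D m f = Cmp D m g"
    show "f = g"
    proof (rule ar_eqI[OF f(1,2)])
      fix s assume s: "s \<in> S"
      then show "fa (P s) f = fa (P s) g"
        using * mono_arrowsD[OF _ P_hom[OF s m] P_hom[OF s f(1)] P_hom[OF s f(2)]]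
          P_comp[OF s f(1) m] P_comp[OF s f(2) m] f(3) by simp
    qed
  qed
qed

lemma product_OFS:
  assumes O: "\<And>s. s \<in> S \<Longrightarrow> is_OFS (C s) (E s) (M s)"
  shows "is_OFS D {f \<in> Ar D. \<forall>s\<in>S. fa (P s) f \<in> E s} {f \<in> Ar D. \<forall>s\<in>S. fa (P s) f \<in> M s}"
    (is "is_OFS D ?E ?M")
proof (rule D.OFS_I)
  fix f a b assume f: "in_hom D f a b"
  \<comment> \<open>The two arrows and the middle object of a factorization are packed into a
    triple, so that a single choice over all factors suffices.\<close>
  have "\<forall>s\<in>S. \<exists>emc. fst emc \<in> E s \<and> fst (snd emc) \<in> M s \<and>
     fa (P s) f = Cmp (C s) (fst (snd emc)) (fst emc) \<and>
     in_hom (C s) (fst emc) (fo (P s) a) (snd (snd emc)) \<and>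
     in_hom (C s) (fst (snd emc)) (snd (snd emc)) (fo (P s) b)"
  proof
    fix s assume s: "s \<in> S"
    obtain e m c where "e \<in> E s" "m \<in> M s" "fa (P s) f = Cmp (C s) m e"
      "in_hom (C s) e (fo (P s) a) c" "in_hom (C s) m c (fo (P s) b)"
      using category.OFS_factor_hom[OF C_cat[OF s] O[OF s] P_hom[OF s f]] .
    then show "\<exists>emc. fst emc \<in> E s \<and> fst (snd emc) \<in> M s \<and>
      fa (P s) f = Cmp (C s) (fst (snd emc)) (fst emc) \<and>
      in_hom (C s) (fst emc) (fo (P s) a) (snd (snd emc)) \<and>
      in_hom (C s) (fst (snd emc)) (snd (snd emc)) (fo (P s) b)"
      by (intro exI[of _ "(e, m, c)"]) simp
  qed
  then obtain emc where emc: "\<forall>s\<in>S. fst (emc s) \<in> E s \<and> fst (snd (emc s)) \<in> M s \<and>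
     fa (P s) f = Cmp (C s) (fst (snd (emc s))) (fst (emc s)) \<and>
     in_hom (C s) (fst (emc s)) (fo (P s) a) (snd (snd (emc s))) \<and>
     in_hom (C s) (fst (snd (emc s))) (snd (snd (emc s))) (fo (P s) b)"
    by (rule bchoice[THEN exE])
  have "\<exists>c\<in>Ob D. \<forall>s\<in>S. fo (P s) c = snd (snd (emc s))"
    using emc category.hom_ob(2)[OF C_cat] by (intro tuple_ob) blast
  then obtain c where c: "c \<in> Ob D" "\<forall>s\<in>S. fo (P s) c = snd (snd (emc s))" by blast
  have ab: "a \<in> Ob D" "b \<in> Ob D" using D.hom_ob f by blast+
  obtain e where e: "in_hom D e a c" "\<And>s. s \<in> S \<Longrightarrow> fa (P s) e = fst (emc s)"
    by (rule tuple_ar_ex[OF ab(1) c(1), of "\<lambda>s. fst (emc s)"]) (use emc c in \<open>auto intro: that\<close>)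
  obtain m where m: "in_hom D m c b" "\<And>s. s \<in> S \<Longrightarrow> fa (P s) m = fst (snd (emc s))"
    by (rule tuple_ar_ex[OF c(1) ab(2), of "\<lambda>s. fst (snd (emc s))"]) (use emc c in \<open>auto intro: that\<close>)
  have "f = Cmp D m e"
    using emc e m P_comp[OF _ e(1) m(1)] by (intro ar_eqI[OF f D.comp_in[OF e(1) m(1)]]) simp
  moreover have "e \<in> ?E" "m \<in> ?M" using emc e m in_homD(1) by auto
  ultimately show "\<exists>e m c. e \<in> ?E \<and> m \<in> ?M \<and> in_hom D e a c \<and> in_hom D m c b \<and> f = Cmp D m e"
    using e(1) m(1) by blast
next
  fix e m assume em: "e \<in> ?E" "m \<in> ?M"
  then have e: "in_hom D e (Dm D e) (Cd D e)" and m: "in_hom D m (Dm D m) (Cd D m)"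
    using D.ar_hom by auto
  show "orthogonal D e m"
  proof (rule orthogonalI[OF e m])
    fix r t assume r: "in_hom D r (Dm D e) (Dm D m)" and t: "in_hom D t (Cd D e) (Cd D m)"
      and eq: "Cmp D m r = Cmp D t e"
    have "\<exists>!h. in_hom (C s) h (fo (P s) (Cd D e)) (fo (P s) (Dm D m)) \<and>
      Cmp (C s) h (fa (P s) e) = fa (P s) r \<and> Cmp (C s) (fa (P s) m) h = fa (P s) t" if s: "s \<in> S" for s
      using em P_comp[OF s r m] P_comp[OF s e t] eq s
      by (intro orthogonalD[OF OFS_orthogonal[OF O[OF s]] P_hom[OF s e] P_hom[OF s m] P_hom[OF s r]
          P_hom[OF s t]])
        auto
    note ex1 = this
    have "\<forall>s\<in>S. \<exists>h. in_hom (C s) h (fo (P s) (Cd D e)) (fo (P s) (Dm D m)) \<and>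
      Cmp (C s) h (fa (P s) e) = fa (P s) r \<and> Cmp (C s) (fa (P s) m) h = fa (P s) t"
      using ex1_implies_ex[OF ex1] by blast
    then obtain h where h: "\<forall>s\<in>S. in_hom (C s) (h s) (fo (P s) (Cd D e)) (fo (P s) (Dm D m)) \<and>
      Cmp (C s) (h s) (fa (P s) e) = fa (P s) r \<and> Cmp (C s) (fa (P s) m) (h s) = fa (P s) t"
      by (rule bchoice[THEN exE])
    obtain k where k: "in_hom D k (Cd D e) (Dm D m)" "\<And>s. s \<in> S \<Longrightarrow> fa (P s) k = h s"
      by (rule tuple_ar_ex[OF D.hom_ob(2)[OF e] D.hom_ob(1)[OF m], of h]) (use h in \<open>auto intro: that\<close>)
    show "\<exists>!h. in_hom D h (Cd D e) (Dm D m) \<and> Cmp D h e = r \<and> Cmp D m h = t"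
    proof (rule ex1I[of _ k], intro conjI k(1))
      show "Cmp D k e = r"
        using h k(2) P_comp[OF _ e k(1)] by (intro ar_eqI[OF D.comp_in[OF e k(1)] r]) simp
      show "Cmp D m k = t"
        using h k(2) P_comp[OF _ k(1) m] by (intro ar_eqI[OF D.comp_in[OF k(1) m] t]) simp
      fix l assume l: "in_hom D l (Cd D e) (Dm D m) \<and> Cmp D l e = r \<and> Cmp D m l = t"
      then have lh: "in_hom D l (Cd D e) (Dm D m)" by blast
      show "l = k"
      proof (rule ar_eqI[OF lh k(1)])
        fix s assume s: "s \<in> S"
        have "in_hom (C s) (fa (P s) l) (fo (P s) (Cd D e)) (fo (P s) (Dm D m)) \<and>
          Cmp (C s) (fa (P s) l) (fa (P s) e) = fa (P s) r \<and> Cmp (C s) (fa (P s) m) (fa (P s) l) = fa (P s)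
              t"
          using P_hom[OF s lh] P_comp[OF s e lh] P_comp[OF s lh m] l by simp
        then show "fa (P s) l = fa (P s) k"
          using ex1[OF s] h s k(2)[OF s] by (elim ex1E) metis
      qed
    qed
  qed
next
  fix e g a b c assume e: "e \<in> ?E" "in_hom D e a b" and g: "is_iso D g b c"
  have gh: "in_hom D g b c" using g unfolding is_iso_def by blast
  have "fa (P s) (Cmp D g e) \<in> E s" if s: "s \<in> S" for s
  proof -
    interpret Cs: category "C s" by (rule C_cat[OF s])
    have "fa (P s) g \<in> E s"
      by (rule Cs.OFS_iso(1)[OF O[OF s] functor_iso[OF D.category_axioms P_functor[OF s] g]])
    then have "Cmp (C s) (fa (P s) g) (fa (P s) e) \<in> E s"
      using e(1) s Cs.OFS_left_comp[OF O[OF s] _ P_hom[OF s e(2)] _ P_hom[OF s gh]] by blast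
    then show ?thesis using P_comp[OF s e(2) gh] by simp
  qed
  then show "Cmp D g e \<in> ?E" using in_homD(1)[OF D.comp_in[OF e(2) gh]] by blast
next
  fix m g a b c assume m: "m \<in> ?M" "in_hom D m b c" and g: "is_iso D g a b"
  have gh: "in_hom D g a b" using g unfolding is_iso_def by blast
  have "fa (P s) (Cmp D m g) \<in> M s" if s: "s \<in> S" for s
  proof -
    interpret Cs: category "C s" by (rule C_cat[OF s])
    have "fa (P s) g \<in> M s"
      by (rule Cs.OFS_iso(2)[OF O[OF s] functor_iso[OF D.category_axioms P_functor[OF s] g]])
    then have "Cmp (C s) (fa (P s) m) (fa (P s) g) \<in> M s"
      using m(1) s Cs.OFS_right_comp[OF O[OF s] _ P_hom[OF s gh] _ P_hom[OF s m(2)]] by blast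
    then show ?thesis using P_comp[OF s gh m(2)] by simp
  qed
  then show "Cmp D m g \<in> ?M" using in_homD(1)[OF D.comp_in[OF gh m(2)]] by blast
qed auto

text \<open>Regular epimorphisms and monomorphisms of D are the componentwise ones, so the
  factorization system of regularity is the product system.\<close>

lemma product_regular:
  assumes "\<And>s. s \<in> S \<Longrightarrow> regular_category (C s)"
  shows "regular_category D"
  unfolding regular_category_iff
proof (intro conjI D.category_axioms)
  have C: "has_finite_limits (C s)" "is_OFS (C s) {e. regular_epi (C s) e} (mono_arrows (C s))"
    "pullback_stable (C s) {e. regular_epi (C s) e}" if "s \<in> S" for s
    using assms[OF that] unfolding regular_category_iff by auto
  show lim: "has_finite_limits D" by (rule has_finite_limits[OF C(1)])
  have "{e. regular_epi D e} = {e \<in> Ar D. \<forall>s\<in>S. fa (P s) e \<in> {e. regular_epi (C s) e}}"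
    using regular_epi_iff D.ar_hom in_homD(1)[OF D.regular_epi_hom] by blast
  moreover have "mono_arrows D = {m \<in> Ar D. \<forall>s\<in>S. fa (P s) m \<in> mono_arrows (C s)}"
    using mono_iff D.ar_hom unfolding mono_arrows_def[of D] by blast
  ultimately show "is_OFS D {e. regular_epi D e} (mono_arrows D)"
    using product_OFS[OF C(2)] by simp
  show "pullback_stable D {e. regular_epi D e}"
    unfolding pullback_stable_def
  proof (intro allI impI)
    fix e f p q assume *: "e \<in> {e. regular_epi D e} \<and> is_pullback D e f p q"
    then obtain a b where q: "in_hom D q a b" by (meson is_pullbackE)
    have "regular_epi (C s) (fa (P s) q)" if s: "s \<in> S" for s
    proof -
      have "is_pullback (C s) (fa (P s) e) (fa (P s) f) (fa (P s) p) (fa (P s) q)"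
        using preserves_pullback[OF P_functor[OF s] P_preserves_finite_limits[OF s] D.category_axioms
            C_cat[OF s]] *
        by blast
      moreover have "regular_epi (C s) (fa (P s) e)"
        using * s regular_epi_iff[OF D.regular_epi_hom] by blast
      ultimately show ?thesis using C(3)[OF s] unfolding pullback_stable_def by blast
    qed
    then show "q \<in> {e. regular_epi D e}" using regular_epi_iff[OF q] by simp
  qed
qed

text \<open>The projections preserve finite limits and hence internal equivalence relations. The
  arrows whose kernel pairs are the projected relations are assembled into one arrow of D.\<close>

lemma product_exact:
  assumes "\<And>s. s \<in> S \<Longrightarrow> exact_category (C s)"
  shows "exact_category D"
proof -
  have reg: "regular_category D"
    using assms product_regular unfolding exact_category_def by blast
  have "is_kernel_pair D r\<^sub>0 r\<^sub>1" if r: "is_internal_equiv_rel D r\<^sub>0 r\<^sub>1" for r\<^sub>0 r\<^sub>1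
  proof -
    obtain R X where rh: "in_hom D r\<^sub>0 R X" "in_hom D r\<^sub>1 R X"
      using r unfolding is_internal_equiv_rel_def by blast
    have "\<forall>s\<in>S. \<exists>f. is_pullback (C s) f f (fa (P s) r\<^sub>0) (fa (P s) r\<^sub>1)"
    proof
      fix s assume s: "s \<in> S"
      have "is_internal_equiv_rel (C s) (fa (P s) r\<^sub>0) (fa (P s) r\<^sub>1)"
        using reg r unfolding regular_category_iff
        by (intro preserves_internal_equiv_rel[OF P_functor[OF s] P_preserves_finite_limits[OF s]
              D.category_axioms C_cat[OF s]]) blast+
      then show "\<exists>f. is_pullback (C s) f f (fa (P s) r\<^sub>0) (fa (P s) r\<^sub>1)"
        using assms[OF s] unfolding exact_category_def is_kernel_pair_def by blast
    qed
    then obtain f where f: "\<forall>s\<in>S. is_pullback (C s) (f s) (f s) (fa (P s) r\<^sub>0) (fa (P s) r\<^sub>1)"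
      by (rule bchoice[THEN exE])
    have fh: "in_hom (C s) (f s) (fo (P s) X) (Cd (C s) (f s))" if s: "s \<in> S" for s
      using f s P_hom[OF s rh(1)] unfolding is_pullback_def in_hom_def by auto
    obtain Y where Y: "Y \<in> Ob D" "\<forall>s\<in>S. fo (P s) Y = Cd (C s) (f s)"
      using tuple_ob[of "\<lambda>s. Cd (C s) (f s)"] category.hom_ob(2)[OF C_cat fh] by blast
    obtain g where g: "in_hom D g X Y" "\<And>s. s \<in> S \<Longrightarrow> fa (P s) g = f s"
      by (rule tuple_ar_ex[OF D.hom_ob(2)[OF rh(1)] Y(1), of f]) (use fh Y in \<open>auto intro: that\<close>)
    have "is_pullback D g g r\<^sub>0 r\<^sub>1"
      using f g(2) by (intro pullbackI[OF g(1) g(1) rh]) simp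
    then show ?thesis unfolding is_kernel_pair_def by blast
  qed
  with reg show ?thesis unfolding exact_category_def by blast
qed

end

section \<open>Lifting along inserters and equifiers\<close>

text \<open>\<open>A\<close> is the category of objects \<open>d\<close> of \<open>D\<close> with a family of arrows \<open>F\<^sub>i d \<rightarrow> G\<^sub>i d\<close>, \<open>i \<in> I\<close>,
  subject to equations between arrows \<open>F\<^sub>j d \<rightarrow> G\<^sub>j d\<close>, \<open>j \<in> J\<close>, which are natural in \<open>d\<close>. The
  equations enter only through \<open>lift_ob\<close>: by naturality they hold for \<open>d\<close> as soon as the arrows
  from and to objects of \<open>A\<close> jointly determine an arrow \<open>F\<^sub>j d \<rightarrow> G\<^sub>j d\<close>.\<close>

locale lifting = A: category A + D: category D
  for A :: "('o, 'a) cat" and D :: "('p, 'b) cat" +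
  fixes U :: "('o, 'a, 'p, 'b) func" and I J :: "'i set" and C :: "'i \<Rightarrow> ('q, 'c) cat"
    and F G :: "'i \<Rightarrow> ('p, 'b, 'q, 'c) func" and \<phi> :: "'i \<Rightarrow> 'o \<Rightarrow> 'c"
  assumes C_cat: "i \<in> I \<union> J \<Longrightarrow> category (C i)"
    and U_functor: "is_functor A D U"
    and F_functor: "i \<in> I \<union> J \<Longrightarrow> is_functor D (C i) (F i)"
    and G_functor: "i \<in> I \<union> J \<Longrightarrow> is_functor D (C i) (G i)"
    and phi_in: "i \<in> I \<Longrightarrow> a \<in> Ob A \<Longrightarrow>
      in_hom (C i) (\<phi> i a) (fo (F i) (fo U a)) (fo (G i) (fo U a))"
    and phi_nat: "i \<in> I \<Longrightarrow> in_hom A f a b \<Longrightarrow>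
      Cmp (C i) (fa (G i) (fa U f)) (\<phi> i a) = Cmp (C i) (\<phi> i b) (fa (F i) (fa U f))"
    and faithful: "in_hom A f a b \<Longrightarrow> in_hom A g a b \<Longrightarrow> fa U f = fa U g \<Longrightarrow> f = g"
    and lift_ar: "a \<in> Ob A \<Longrightarrow> b \<in> Ob A \<Longrightarrow> in_hom D h (fo U a) (fo U b) \<Longrightarrow>
      (\<And>i. i \<in> I \<Longrightarrow> Cmp (C i) (fa (G i) h) (\<phi> i a) = Cmp (C i) (\<phi> i b) (fa (F i) h)) \<Longrightarrow>
      \<exists>f. in_hom A f a b \<and> fa U f = h"
    and lift_ob: "d \<in> Ob D \<Longrightarrow>
      (\<And>i. i \<in> I \<Longrightarrow> in_hom (C i) (\<psi> i) (fo (F i) d) (fo (G i) d)) \<Longrightarrow>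
      (\<And>j r s. j \<in> J \<Longrightarrow> in_hom (C j) r (fo (F j) d) (fo (G j) d) \<Longrightarrow>
        in_hom (C j) s (fo (F j) d) (fo (G j) d) \<Longrightarrow>
        (\<And>b e. b \<in> Ob A \<Longrightarrow> in_hom D e (fo U b) d \<Longrightarrow>
          (\<And>i. i \<in> I \<Longrightarrow> Cmp (C i) (fa (G i) e) (\<phi> i b) = Cmp (C i) (\<psi> i) (fa (F i) e)) \<Longrightarrow>
          Cmp (C j) r (fa (F j) e) = Cmp (C j) s (fa (F j) e)) \<Longrightarrow>
        (\<And>b m. b \<in> Ob A \<Longrightarrow> in_hom D m d (fo U b) \<Longrightarrow>
          (\<And>i. i \<in> I \<Longrightarrow> Cmp (C i) (fa (G i) m) (\<psi> i) = Cmp (C i) (\<phi> i b) (fa (F i) m)) \<Longrightarrow>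
          Cmp (C j) (fa (G j) m) r = Cmp (C j) (fa (G j) m) s) \<Longrightarrow> r = s) \<Longrightarrow>
      \<exists>a\<in>Ob A. fo U a = d \<and> (\<forall>i\<in>I. \<phi> i a = \<psi> i)"
begin

lemmas U_hom = functor_hom[OF U_functor]
lemmas U_comp = functor_comp[OF U_functor]
lemmas F_hom = functor_hom[OF F_functor]
lemmas G_hom = functor_hom[OF G_functor]
lemmas F_comp = functor_comp[OF F_functor]
lemmas G_comp = functor_comp[OF G_functor]

text \<open>The filler h exists in D. It lifts because the two composites that compatibility with
  the structure compares both fill the square of \<open>F e\<close> against \<open>G m\<close> whose
  other sides come from r and s.\<close>

lemma orthogonal_lift:
  assumes e: "in_hom A e a b" and m: "in_hom A m c d"
    and o: "orthogonal D (fa U e) (fa U m)"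
    and oi: "\<And>i. i \<in> I \<Longrightarrow> orthogonal (C i) (fa (F i) (fa U e)) (fa (G i) (fa U m))"
  shows "orthogonal A e m"
proof (rule orthogonalI[OF e m])
  fix r s assume r: "in_hom A r a c" and s: "in_hom A s b d" and eq: "Cmp A m r = Cmp A s e"
  have sq: "Cmp D (fa U m) (fa U r) = Cmp D (fa U s) (fa U e)"
    using U_comp[OF r m] U_comp[OF e s] eq by simp
  obtain h where h: "in_hom D h (fo U b) (fo U c)" "Cmp D h (fa U e) = fa U r" "Cmp D (fa U m) h = fa U s"
    by (rule orthogonal_fill[OF o U_hom[OF e] U_hom[OF m] U_hom[OF r] U_hom[OF s] sq])
  have ob: "a \<in> Ob A" "b \<in> Ob A" "c \<in> Ob A" "d \<in> Ob A" using A.hom_ob e m by blast+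
  have "Cmp (C i) (fa (G i) h) (\<phi> i b) = Cmp (C i) (\<phi> i c) (fa (F i) h)" if i: "i \<in> I" for i
  proof -
    interpret Ci: category "C i" using C_cat i by blast
    have iIJ: "i \<in> I \<union> J" using i by blast
    note Fh = F_hom[OF iIJ] and Gh = G_hom[OF iIJ] and ph = phi_in[OF i]
    note Fe = Fh[OF U_hom[OF e]] and Gm = Gh[OF U_hom[OF m]]
    let ?l = "Cmp (C i) (fa (G i) h) (\<phi> i b)" and ?l' = "Cmp (C i) (\<phi> i c) (fa (F i) h)"
    let ?r = "Cmp (C i) (fa (G i) (fa U r)) (\<phi> i a)" and ?s = "Cmp (C i) (fa (G i) (fa U s)) (\<phi> i b)"
    have lh: "in_hom (C i) ?l (fo (F i) (fo U b)) (fo (G i) (fo U c))"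
      "in_hom (C i) ?l' (fo (F i) (fo U b)) (fo (G i) (fo U c))"
      using Ci.comp_in[OF ph[OF ob(2)] Gh[OF h(1)]] Ci.comp_in[OF Fh[OF h(1)] ph[OF ob(3)]] by auto
    have 1: "Cmp (C i) ?l (fa (F i) (fa U e)) = ?r"
      using Ci.comp_assoc[OF Fe ph[OF ob(2)] Gh[OF h(1)]] phi_nat[OF i e]
        Ci.comp_assoc[OF ph[OF ob(1)] Gh[OF U_hom[OF e]] Gh[OF h(1)]] G_comp[OF iIJ U_hom[OF e] h(1)] h(2)
      by simp
    have 2: "Cmp (C i) ?l' (fa (F i) (fa U e)) = ?r"
      using Ci.comp_assoc[OF Fe Fh[OF h(1)] ph[OF ob(3)]] F_comp[OF iIJ U_hom[OF e] h(1)] h(2)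
        phi_nat[OF i r] by simp
    have 3: "Cmp (C i) (fa (G i) (fa U m)) ?l = ?s"
      using Ci.comp_assoc[OF ph[OF ob(2)] Gh[OF h(1)] Gm] G_comp[OF iIJ h(1) U_hom[OF m]] h(3) by simp
    have 4: "Cmp (C i) (fa (G i) (fa U m)) ?l' = ?s"
      using Ci.comp_assoc[OF Fh[OF h(1)] ph[OF ob(3)] Gm] phi_nat[OF i m]
        Ci.comp_assoc[OF Fh[OF h(1)] Fh[OF U_hom[OF m]] ph[OF ob(4)]] F_comp[OF iIJ h(1) U_hom[OF m]] h(3)
        phi_nat[OF i s] by simp
    have rh: "in_hom (C i) ?r (fo (F i) (fo U a)) (fo (G i) (fo U c))"
      and sh: "in_hom (C i) ?s (fo (F i) (fo U b)) (fo (G i) (fo U d))"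
      using Ci.comp_in[OF ph[OF ob(1)] Gh[OF U_hom[OF r]]] Ci.comp_in[OF ph[OF ob(2)] Gh[OF U_hom[OF s]]] by
          auto
    have "Cmp (C i) (fa (G i) (fa U m)) ?r = Cmp (C i) ?s (fa (F i) (fa U e))"
      using Ci.comp_assoc[OF Fe lh(1) Gm] 1 3 by simp
    from orthogonalD[OF oi[OF i] Fe Gm rh sh this] show "?l = ?l'"
      using 1 2 3 4 lh by (elim ex1E) metis
  qed
  then obtain k where k: "in_hom A k b c" "fa U k = h"
    using lift_ar[OF ob(2,3) h(1)] by blast
  show "\<exists>!h. in_hom A h b c \<and> Cmp A h e = r \<and> Cmp A m h = s"
  proof (rule ex1I[of _ k], intro conjI k(1))
    show "Cmp A k e = r" using U_comp[OF e k(1)] k(2) h(2) by (intro faithful[OF A.comp_in[OF e k(1)] r])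
        simp
    show "Cmp A m k = s" using U_comp[OF k(1) m] k(2) h(3) by (intro faithful[OF A.comp_in[OF k(1) m] s])
        simp
    fix l assume l: "in_hom A l b c \<and> Cmp A l e = r \<and> Cmp A m l = s"
    then have lh: "in_hom A l b c" by blast
    have "in_hom D (fa U l) (fo U b) (fo U c) \<and> Cmp D (fa U l) (fa U e) = fa U r \<and>
        Cmp D (fa U m) (fa U l) = fa U s"
      using U_hom[OF lh] U_comp[OF e lh] U_comp[OF lh m] l by simp
    then have "fa U l = h"
      using orthogonalD[OF o U_hom[OF e] U_hom[OF m] U_hom[OF r] U_hom[OF s] sq] h by (elim ex1E) metis
    then show "l = k" using faithful[OF lh k(1)] k(2) by simp
  qed
qed

lemma lift_OFS:
  assumes O: "is_OFS D E M"
    and Oi: "\<And>i. i \<in> I \<union> J \<Longrightarrow> is_OFS (C i) (Ei i) (Mi i)"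
    and F: "\<And>i. i \<in> I \<union> J \<Longrightarrow> preserves_class (F i) E (Ei i)"
    and G: "\<And>i. i \<in> I \<union> J \<Longrightarrow> preserves_class (G i) M (Mi i)"
  shows "is_OFS A {f \<in> Ar A. fa U f \<in> E} {f \<in> Ar A. fa U f \<in> M}" (is "is_OFS A ?E ?M")
proof (rule A.OFS_I)
  have o: "orthogonal (C i) (fa (F i) e) (fa (G i) m)" if "i \<in> I \<union> J" "e \<in> E" "m \<in> M" for i e m
    using OFS_orthogonal[OF Oi] F G that unfolding preserves_class_def by blast
  fix f a b assume f: "in_hom A f a b"
  have ab: "a \<in> Ob A" "b \<in> Ob A" using A.hom_ob f by blast+
  obtain e m c where em: "e \<in> E" "m \<in> M" "fa U f = Cmp D m e" "in_hom D e (fo U a) c"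
      "in_hom D m c (fo U b)"
    using D.OFS_factor_hom[OF O U_hom[OF f]] .
  have c: "c \<in> Ob D" using D.hom_ob em by blast
  have "\<forall>i\<in>I. \<exists>h. in_hom (C i) h (fo (F i) c) (fo (G i) c) \<and>
     Cmp (C i) h (fa (F i) e) = Cmp (C i) (fa (G i) e) (\<phi> i a) \<and>
     Cmp (C i) (fa (G i) m) h = Cmp (C i) (\<phi> i b) (fa (F i) m)"
  proof
    fix i assume i: "i \<in> I"
    then have iIJ: "i \<in> I \<union> J" by blast
    interpret Ci: category "C i" using C_cat iIJ by blast
    note Fh = F_hom[OF iIJ] and Gh = G_hom[OF iIJ] and ph = phi_in[OF i]
    note Fe = Fh[OF em(4)] and Ge = Gh[OF em(4)] and Fm = Fh[OF em(5)] and Gm = Gh[OF em(5)]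
    \<comment> \<open>The square commutes by naturality of \<open>\<phi> i\<close> at f, once
      \<open>F i\<close> and \<open>G i\<close> are applied to the factorization of
      \<open>U f\<close>.\<close>
    have "Cmp (C i) (fa (G i) m) (Cmp (C i) (fa (G i) e) (\<phi> i a)) =
        Cmp (C i) (Cmp (C i) (\<phi> i b) (fa (F i) m)) (fa (F i) e)"
      using Ci.comp_assoc[OF ph[OF ab(1)] Ge Gm] Ci.comp_assoc[OF Fe Fm ph[OF ab(2)]]
        F_comp[OF iIJ em(4,5)] G_comp[OF iIJ em(4,5)] phi_nat[OF i f] em(3) by simp
    from orthogonalD[OF o[OF iIJ em(1,2)] Fe Gm Ci.comp_in[OF ph[OF ab(1)] Ge]
        Ci.comp_in[OF Fm ph[OF ab(2)]] this]
    show "\<exists>h. in_hom (C i) h (fo (F i) c) (fo (G i) c) \<and>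
     Cmp (C i) h (fa (F i) e) = Cmp (C i) (fa (G i) e) (\<phi> i a) \<and>
     Cmp (C i) (fa (G i) m) h = Cmp (C i) (\<phi> i b) (fa (F i) m)"
      by (rule ex1_implies_ex)
  qed
  then obtain \<psi> where psi: "\<forall>i\<in>I. in_hom (C i) (\<psi> i) (fo (F i) c) (fo (G i) c) \<and>
     Cmp (C i) (\<psi> i) (fa (F i) e) = Cmp (C i) (fa (G i) e) (\<phi> i a) \<and>
     Cmp (C i) (fa (G i) m) (\<psi> i) = Cmp (C i) (\<phi> i b) (fa (F i) m)"
    by (rule bchoice[THEN exE])
  have "\<exists>x\<in>Ob A. fo U x = c \<and> (\<forall>i\<in>I. \<phi> i x = \<psi> i)"
  proof (rule lift_ob[OF c])
    fix j r s assume j: "j \<in> J" and r: "in_hom (C j) r (fo (F j) c) (fo (G j) c)"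
      and s: "in_hom (C j) s (fo (F j) c) (fo (G j) c)"
      and src: "\<And>b e. b \<in> Ob A \<Longrightarrow> in_hom D e (fo U b) c \<Longrightarrow>
          (\<And>i. i \<in> I \<Longrightarrow> Cmp (C i) (fa (G i) e) (\<phi> i b) = Cmp (C i) (\<psi> i) (fa (F i) e)) \<Longrightarrow>
          Cmp (C j) r (fa (F j) e) = Cmp (C j) s (fa (F j) e)"
      and tgt: "\<And>b m. b \<in> Ob A \<Longrightarrow> in_hom D m c (fo U b) \<Longrightarrow>
          (\<And>i. i \<in> I \<Longrightarrow> Cmp (C i) (fa (G i) m) (\<psi> i) = Cmp (C i) (\<phi> i b) (fa (F i) m)) \<Longrightarrow>
          Cmp (C j) (fa (G j) m) r = Cmp (C j) (fa (G j) m) s"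
    have jIJ: "j \<in> I \<union> J" using j by blast
    interpret Cj: category "C j" using C_cat jIJ by blast
    note Fe = F_hom[OF jIJ em(4)] and Gm = G_hom[OF jIJ em(5)]
    have re: "Cmp (C j) r (fa (F j) e) = Cmp (C j) s (fa (F j) e)"
      by (rule src[OF ab(1) em(4)]) (use psi in simp)
    have rm: "Cmp (C j) (fa (G j) m) r = Cmp (C j) (fa (G j) m) s"
      by (rule tgt[OF ab(2) em(5)]) (use psi in simp)
    \<comment> \<open>Associativity exhibits r itself as a filler of the square with top
      \<open>r F(e)\<close> and bottom \<open>G(m) r\<close>; by the two preceding equations s fills
      the same square.\<close>
    from orthogonalD[OF o[OF jIJ em(1,2)] Fe Gm Cj.comp_in[OF Fe r] Cj.comp_in[OF r Gm]
        Cj.comp_assoc[OF Fe r Gm]]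
    show "r = s" using re rm r s by (elim ex1E) metis
  qed (use psi in blast)
  then obtain x where x: "x \<in> Ob A" "fo U x = c" "\<And>i. i \<in> I \<Longrightarrow> \<phi> i x = \<psi> i" by blast
  obtain e' where e': "in_hom A e' a x" "fa U e' = e"
    using lift_ar[OF ab(1) x(1), of e] em(4) x psi by auto
  obtain m' where m': "in_hom A m' x b" "fa U m' = m"
    using lift_ar[OF x(1) ab(2), of m] em(5) x psi by auto
  have "f = Cmp A m' e'"
    using U_comp[OF e'(1) m'(1)] e'(2) m'(2) em(3) by (intro faithful[OF f A.comp_in[OF e'(1) m'(1)]]) simp
  then show "\<exists>e m c. e \<in> ?E \<and> m \<in> ?M \<and> in_hom A e a c \<and> in_hom A m c b \<and> f = Cmp A m e"
    using e' m' em(1,2) in_homD(1)[OF e'(1)] in_homD(1)[OF m'(1)] by blast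
next
  have o: "orthogonal (C i) (fa (F i) e) (fa (G i) m)" if "i \<in> I \<union> J" "e \<in> E" "m \<in> M" for i e m
    using OFS_orthogonal[OF Oi] F G that unfolding preserves_class_def by blast
  fix e m assume "e \<in> ?E" "m \<in> ?M"
  then show "orthogonal A e m"
    using A.ar_hom OFS_orthogonal[OF O] o by (intro orthogonal_lift) auto
next
  fix e g a b c assume e: "e \<in> ?E" "in_hom A e a b" and g: "is_iso A g b c"
  have gh: "in_hom A g b c" using g unfolding is_iso_def by blast
  have "fa U g \<in> E" by (rule D.OFS_iso(1)[OF O functor_iso[OF A.category_axioms U_functor g]])
  then have "fa U (Cmp A g e) \<in> E"
    using e D.OFS_left_comp[OF O _ U_hom[OF e(2)] _ U_hom[OF gh]] U_comp[OF e(2) gh] by simp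
  then show "Cmp A g e \<in> ?E" using in_homD(1)[OF A.comp_in[OF e(2) gh]] by simp
next
  fix m g a b c assume m: "m \<in> ?M" "in_hom A m b c" and g: "is_iso A g a b"
  have gh: "in_hom A g a b" using g unfolding is_iso_def by blast
  have "fa U g \<in> M" by (rule D.OFS_iso(2)[OF O functor_iso[OF A.category_axioms U_functor g]])
  then have "fa U (Cmp A m g) \<in> M"
    using m D.OFS_right_comp[OF O _ U_hom[OF gh] _ U_hom[OF m(2)]] U_comp[OF gh m(2)] by simp
  then show "Cmp A m g \<in> ?M" using in_homD(1)[OF A.comp_in[OF gh m(2)]] by simp
qed auto

text \<open>Compatibility of the mediating arrow is an equation between arrows into
  \<open>G i\<close> of the limit, so it can be tested after composition with the legs. This is why
  the limit has to be preserved by \<open>G\<close>, while \<open>F\<close> is merely applied to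
  arrows.\<close>

lemma reflect_limit:
  assumes S: "category S" "is_functor S A H" and k: "is_cone S A H a k"
    and lim: "is_limit S D (func_comp U H) (fo U a) (\<lambda>j. fa U (k j))"
    and G: "\<And>i. i \<in> I \<Longrightarrow> is_limit S (C i) (func_comp (G i) (func_comp U H)) (fo (G i) (fo U a))
        (\<lambda>j. fa (G i) (fa U (k j)))"
  shows "is_limit S A H a k"
proof (rule is_limitI[OF k])
  note a = coneD(1)[OF k] and kh = coneD(2)[OF k]
  fix b m assume m: "is_cone S A H b m"
  note b = coneD(1)[OF m] and mh = coneD(2)[OF m]
  obtain h where h: "in_hom D h (fo U b) (fo U a)" "\<And>j. j \<in> Ob S \<Longrightarrow> Cmp D (fa U (k j)) h = fa U (m j)"
    by (rule limit_fac[OF lim functor_cone[OF S U_functor m]]) (rule that)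
  have "\<exists>f. in_hom A f b a \<and> fa U f = h"
  proof (rule lift_ar[OF b a h(1)])
    fix i assume i: "i \<in> I"
    then have iIJ: "i \<in> I \<union> J" by blast
    interpret Ci: category "C i" using C_cat iIJ by blast
    note Fh = F_hom[OF iIJ] and Gh = G_hom[OF iIJ] and ph = phi_in[OF i]
    show "Cmp (C i) (fa (G i) h) (\<phi> i b) = Cmp (C i) (\<phi> i a) (fa (F i) h)"
    proof (rule Ci.limit_eqI[OF G[OF i] functor_func_comp[OF functor_func_comp[OF S(2) U_functor]
        G_functor[OF iIJ]] S(1)
          Ci.comp_in[OF ph[OF b] Gh[OF h(1)]] Ci.comp_in[OF Fh[OF h(1)] ph[OF a]]])
      fix j assume j: "j \<in> Ob S"
      note Uk = U_hom[OF kh[OF j]]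
      have "Cmp (C i) (fa (G i) (fa U (k j))) (Cmp (C i) (fa (G i) h) (\<phi> i b)) =
          Cmp (C i) (fa (G i) (fa U (m j))) (\<phi> i b)"
        using Ci.comp_assoc[OF ph[OF b] Gh[OF h(1)] Gh[OF Uk]] G_comp[OF iIJ h(1) Uk] h(2)[OF j] by simp
      also have "\<dots> = Cmp (C i) (\<phi> i (fo H j)) (fa (F i) (fa U (m j)))"
        by (rule phi_nat[OF i mh[OF j]])
      also have "\<dots> = Cmp (C i) (fa (G i) (fa U (k j))) (Cmp (C i) (\<phi> i a) (fa (F i) h))"
        using Ci.comp_assoc[OF Fh[OF h(1)] ph[OF a] Gh[OF Uk]] phi_nat[OF i kh[OF j]]
          Ci.comp_assoc[OF Fh[OF h(1)] Fh[OF Uk] ph[OF A.hom_ob(2)[OF kh[OF j]]]]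
          F_comp[OF iIJ h(1) Uk] h(2)[OF j] by simp
      finally show "Cmp (C i) (fa (G i) (fa U (k j))) (Cmp (C i) (fa (G i) h) (\<phi> i b)) =
          Cmp (C i) (fa (G i) (fa U (k j))) (Cmp (C i) (\<phi> i a) (fa (F i) h))" .
    qed
  qed
  then obtain f where f: "in_hom A f b a" "fa U f = h" by blast
  have "Cmp A (k j) f = m j" if j: "j \<in> Ob S" for j
    using U_comp[OF f(1) kh[OF j]] f(2) h(2)[OF j]
    by (intro faithful[OF A.comp_in[OF f(1) kh[OF j]] mh[OF j]]) simp
  with f(1) show "\<exists>h. in_hom A h b a \<and> (\<forall>j\<in>Ob S. Cmp A (k j) h = m j)" by blast
next
  note kh = coneD(2)[OF k]
  fix b h h' assume h: "in_hom A h b a" "in_hom A h' b a"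
    and eq: "\<And>j. j \<in> Ob S \<Longrightarrow> Cmp A (k j) h = Cmp A (k j) h'"
  have "fa U h = fa U h'"
  proof (rule D.limit_eqI[OF lim functor_func_comp[OF S(2) U_functor] S(1) U_hom[OF h(1)] U_hom[OF h(2)]])
    fix j assume j: "j \<in> Ob S"
    show "Cmp D (fa U (k j)) (fa U h) = Cmp D (fa U (k j)) (fa U h')"
      using U_comp[OF h(1) kh[OF j]] U_comp[OF h(2) kh[OF j]] eq[OF j] by simp
  qed
  then show "h = h'" by (rule faithful[OF h])
qed

lemma create_limit:
  assumes S: "category S" "is_functor S A H"
    and lim: "is_limit S D (func_comp U H) d l"
    and G: "\<And>i. i \<in> I \<union> J \<Longrightarrow> is_limit S (C i) (func_comp (G i) (func_comp U H)) (fo (G i) d)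
        (\<lambda>j. fa (G i) (l j))"
  obtains a k where "is_limit S A H a k" "fo U a = d" "\<And>j. j \<in> Ob S \<Longrightarrow> fa U (k j) = l j"
proof -
  note lc = limit_cone[OF lim]
  note d = coneD(1)[OF lc]
  have lh: "in_hom D (l j) d (fo U (fo H j))" if "j \<in> Ob S" for j
    using coneD(2)[OF lc that] by (simp add: func_comp_def)
  note Hob = functor_ob[OF S(2)]
  have "\<forall>i\<in>I. \<exists>h. in_hom (C i) h (fo (F i) d) (fo (G i) d) \<and>
    (\<forall>j\<in>Ob S. Cmp (C i) (fa (G i) (l j)) h = Cmp (C i) (\<phi> i (fo H j)) (fa (F i) (l j)))"
  proof
    fix i assume i: "i \<in> I"
    then have iIJ: "i \<in> I \<union> J" by blast
    interpret Ci: category "C i" using C_cat iIJ by blast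
    note Fh = F_hom[OF iIJ] and Gh = G_hom[OF iIJ] and ph = phi_in[OF i]
    \<comment> \<open>These legs form a cone because \<open>\<phi> i\<close> is natural along the
      arrows of the diagram \<open>H\<close>, which lie in A.\<close>
    let ?m = "\<lambda>j. Cmp (C i) (\<phi> i (fo H j)) (fa (F i) (l j))"
    have mh: "in_hom (C i) (?m j) (fo (F i) d) (fo (G i) (fo U (fo H j)))" if "j \<in> Ob S" for j
      by (rule Ci.comp_in[OF Fh[OF lh[OF that]] ph[OF Hob[OF that]]])
    have "is_cone S (C i) (func_comp (G i) (func_comp U H)) (fo (F i) d) ?m"
      unfolding is_cone_def
    proof (intro conjI ballI allI impI)
      show "fo (F i) d \<in> Ob (C i)" using functor_ob[OF F_functor[OF iIJ] d] .
      show "in_hom (C i) (?m j) (fo (F i) d) (fo (func_comp (G i) (func_comp U H)) j)" if "j \<in> Ob S" for j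
        using mh[OF that] by (simp add: func_comp_def)
      fix k x y assume k: "in_hom S k x y"
      have xy: "x \<in> Ob S" "y \<in> Ob S" using category.hom_ob[OF S(1) k] by auto
      note Hk = functor_hom[OF S(2) k]
      have "Cmp D (fa U (fa H k)) (l x) = l y"
        using coneD(3)[OF lc k] by (simp add: func_comp_def)
      then show "Cmp (C i) (fa (func_comp (G i) (func_comp U H)) k) (?m x) = ?m y"
        using Ci.comp_assoc[OF Fh[OF lh[OF xy(1)]] ph[OF Hob[OF xy(1)]] Gh[OF U_hom[OF Hk]]]
          phi_nat[OF i Hk] Ci.comp_assoc[OF Fh[OF lh[OF xy(1)]] Fh[OF U_hom[OF Hk]] ph[OF Hob[OF xy(2)]]]
          F_comp[OF iIJ lh[OF xy(1)] U_hom[OF Hk]]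
        by (simp add: func_comp_def)
    qed
    then show "\<exists>h. in_hom (C i) h (fo (F i) d) (fo (G i) d) \<and>
      (\<forall>j\<in>Ob S. Cmp (C i) (fa (G i) (l j)) h = ?m j)"
      by (rule limit_fac[OF G[OF iIJ]]) blast
  qed
  then obtain \<psi> where psi: "\<forall>i\<in>I. in_hom (C i) (\<psi> i) (fo (F i) d) (fo (G i) d) \<and>
    (\<forall>j\<in>Ob S. Cmp (C i) (fa (G i) (l j)) (\<psi> i) = Cmp (C i) (\<phi> i (fo H j)) (fa (F i) (l j)))"
    by (rule bchoice[THEN exE])
  have "\<exists>a\<in>Ob A. fo U a = d \<and> (\<forall>i\<in>I. \<phi> i a = \<psi> i)"
  proof (rule lift_ob[OF d])
    fix i r s assume i: "i \<in> J" and r: "in_hom (C i) r (fo (F i) d) (fo (G i) d)"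
      and s: "in_hom (C i) s (fo (F i) d) (fo (G i) d)"
      and tgt: "\<And>b m. b \<in> Ob A \<Longrightarrow> in_hom D m d (fo U b) \<Longrightarrow>
          (\<And>i. i \<in> I \<Longrightarrow> Cmp (C i) (fa (G i) m) (\<psi> i) = Cmp (C i) (\<phi> i b) (fa (F i) m)) \<Longrightarrow>
          Cmp (C i) (fa (G i) m) r = Cmp (C i) (fa (G i) m) s"
    have iIJ: "i \<in> I \<union> J" using i by blast
    interpret Ci: category "C i" using C_cat iIJ by blast
    \<comment> \<open>The legs of the preserved limit jointly detect arrows into
      \<open>G i d\<close>. Each leg goes to a structured object and respects the structure, so
      \<open>tgt\<close> applies to it.\<close>
    show "r = s"
    proof (rule Ci.limit_eqI[OF G[OF iIJ] functor_func_comp[OF functor_func_comp[OF S(2) U_functor]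
        G_functor[OF iIJ]] S(1) r s])
      fix j assume j: "j \<in> Ob S"
      show "Cmp (C i) (fa (G i) (l j)) r = Cmp (C i) (fa (G i) (l j)) s"
        by (rule tgt[OF Hob[OF j] lh[OF j]]) (use psi j in blast)
    qed
  qed (use psi in blast)
  then obtain a where a: "a \<in> Ob A" "fo U a = d" "\<And>i. i \<in> I \<Longrightarrow> \<phi> i a = \<psi> i" by blast
  have "\<forall>j\<in>Ob S. \<exists>f. in_hom A f a (fo H j) \<and> fa U f = l j"
  proof
    fix j assume j: "j \<in> Ob S"
    show "\<exists>f. in_hom A f a (fo H j) \<and> fa U f = l j"
      by (rule lift_ar[OF a(1) Hob[OF j]]) (use a psi lh[OF j] j in auto)
  qed
  then obtain k where k: "\<forall>j\<in>Ob S. in_hom A (k j) a (fo H j) \<and> fa U (k j) = l j"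
    by (rule bchoice[THEN exE])
  have "is_limit S A H a k"
  proof (rule reflect_limit[OF S])
    show "is_cone S A H a k"
      unfolding is_cone_def
    proof (intro conjI ballI allI impI a(1))
      show "in_hom A (k j) a (fo H j)" if "j \<in> Ob S" for j using k that by blast
      fix n x y assume n: "in_hom S n x y"
      have xy: "x \<in> Ob S" "y \<in> Ob S" using category.hom_ob[OF S(1) n] by auto
      have kx: "in_hom A (k x) a (fo H x)" "in_hom A (k y) a (fo H y)" using k xy by auto
      note Hn = functor_hom[OF S(2) n]
      show "Cmp A (fa H n) (k x) = k y"
        using U_comp[OF kx(1) Hn] k xy coneD(3)[OF lc n]
        by (intro faithful[OF A.comp_in[OF kx(1) Hn] kx(2)]) (simp add: func_comp_def)
    qed
    have "is_limit S D (func_comp U H) d (\<lambda>j. fa U (k j)) \<longleftrightarrow> is_limit S D (func_comp U H) d l"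
      by (rule is_limit_cong[OF S(1)]) (use k in auto)
    then show "is_limit S D (func_comp U H) (fo U a) (\<lambda>j. fa U (k j))" using lim a(2) by simp
    fix i assume i: "i \<in> I"
    have "is_limit S (C i) (func_comp (G i) (func_comp U H)) (fo (G i) d) (\<lambda>j. fa (G i) (fa U (k j)))
      \<longleftrightarrow> is_limit S (C i) (func_comp (G i) (func_comp U H)) (fo (G i) d) (\<lambda>j. fa (G i) (l j))"
      by (rule is_limit_cong[OF S(1)]) (use k in auto)
    then show "is_limit S (C i) (func_comp (G i) (func_comp U H)) (fo (G i) (fo U a))
        (\<lambda>j. fa (G i) (fa U (k j)))"
      using G i a(2) by simp
  qed
  then show ?thesis using that a(2) k by blast
qed

end

section \<open>Lifting finite limits\<close>

locale lifting_limits = lifting +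
  assumes D_limits: "has_finite_limits D"
    and G_limits: "i \<in> I \<union> J \<Longrightarrow> preserves_finite_limits D (C i) (G i)"
begin

lemma G_limit:
  assumes "finite_shape S" "is_functor S A H" "is_limit S D (func_comp U H) d l" "i \<in> I \<union> J"
  shows "is_limit S (C i) (func_comp (G i) (func_comp U H)) (fo (G i) d) (\<lambda>j. fa (G i) (l j))"
  using G_limits[OF assms(4)] assms(1,3) functor_func_comp[OF assms(2) U_functor]
  unfolding preserves_finite_limits_def by blast

lemma finite_limit_lift:
  assumes "finite_shape S" "is_functor S A H"
  obtains a k where "is_limit S A H a k" "is_limit S D (func_comp U H) (fo U a) (\<lambda>j. fa U (k j))"
proof -
  have S: "category S" using assms(1) by (simp add: finite_shape_def)
  obtain d l where dl: "is_limit S D (func_comp U H) d l"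
    using D_limits assms(1) functor_func_comp[OF assms(2) U_functor] unfolding has_finite_limits_def by
        blast
  obtain a k where a: "is_limit S A H a k" "fo U a = d" "\<And>j. j \<in> Ob S \<Longrightarrow> fa U (k j) = l j"
    by (rule create_limit[OF S assms(2) dl G_limit[OF assms dl]]) (assumption, rule that)
  have "is_limit S D (func_comp U H) (fo U a) (\<lambda>j. fa U (k j)) \<longleftrightarrow> is_limit S D (func_comp U H) (fo U a) l"
    by (rule is_limit_cong[OF S]) (use a in auto)
  then show ?thesis using that a(1,2) dl by simp
qed

lemma A_limits: "has_finite_limits A"
  unfolding has_finite_limits_def
proof (intro allI impI, elim conjE)
  fix S H assume "finite_shape S" "is_functor S A H"
  then show "\<exists>a l. is_limit S A H a l" by (rule finite_limit_lift) blast
qed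

text \<open>An arbitrary limit cone in A differs by an isomorphism from the one created over D, and
  functors preserve isomorphisms.\<close>

lemma U_limits: "preserves_finite_limits A D U"
  unfolding preserves_finite_limits_def
proof (intro allI impI, elim conjE)
  fix S H b m assume S: "finite_shape S" "is_functor S A H" and m: "is_limit S A H b m"
  have cS: "category S" using S(1) by (simp add: finite_shape_def)
  obtain a k where k: "is_limit S A H a k" "is_limit S D (func_comp U H) (fo U a) (\<lambda>j. fa U (k j))"
    by (rule finite_limit_lift[OF S]) (rule that)
  obtain h where h: "is_iso A h b a" "\<And>j. j \<in> Ob S \<Longrightarrow> Cmp A (k j) h = m j"
    by (rule A.limit_unique[OF k(1) m S(2) cS]) (rule that)
  have hh: "in_hom A h b a" using h(1) unfolding is_iso_def by blast
  show "is_limit S D (func_comp U H) (fo U b) (\<lambda>j. fa U (m j))"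
  proof (rule D.limit_precomp_iso[OF k(2) functor_func_comp[OF S(2) U_functor] cS
        functor_iso[OF A.category_axioms U_functor h(1)]])
    fix j assume j: "j \<in> Ob S"
    show "fa U (m j) = Cmp D (fa U (k j)) (fa U h)"
      using U_comp[OF hh coneD(2)[OF limit_cone[OF k(1)] j]] h(2)[OF j] by simp
  qed
qed

lemma reflect_finite_limit:
  assumes "finite_shape S" "is_functor S A H" "is_cone S A H a k"
    "is_limit S D (func_comp U H) (fo U a) (\<lambda>j. fa U (k j))"
  shows "is_limit S A H a k"
proof -
  have S: "category S" using assms(1) by (simp add: finite_shape_def)
  show ?thesis
    by (rule reflect_limit[OF S assms(2-4)]) (use G_limit[OF assms(1,2,4)] in blast)
qed

text \<open>Lets kernel pairs in A be detected in D, which is how exactness is transferred.\<close>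

lemma reflect_pullback:
  assumes h: "in_hom A f a c" "in_hom A g b c" "in_hom A p d a" "in_hom A q d b"
    and eq: "Cmp A f p = Cmp A g q"
    and pb: "is_pullback D (fa U f) (fa U g) (fa U p) (fa U q)"
  shows "is_pullback A f g p q"
proof -
  let ?l = "\<lambda>i::nat. if i = 0 then p else if i = 1 then q else Cmp A f p"
  note ob = A.hom_ob[OF h(1)] A.hom_ob[OF h(2)]
  have fct: "is_functor cospan_shape A (cospan_diagram A f g)"
    using h ob by (intro cospan.functor_graph_diagram A.category_axioms) (auto simp: in_homD)
  have cone: "is_cone cospan_shape A (cospan_diagram A f g) d ?l"
    using A.is_cone_cospan[OF h(1,2), of d ?l] h eq by simp
  have "is_limit cospan_shape D (cospan_diagram D (fa U f) (fa U g)) (fo U d) (\<lambda>j. fa U (?l j))"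
    using D.pullback_limit[OF U_hom[OF h(1)] U_hom[OF h(2)], of "\<lambda>j. fa U (?l j)" "fo U d"] pb
      U_comp[OF h(3,1)] in_homD(2)[OF U_hom[OF h(3)]] by simp
  moreover have "fa (func_comp U (cospan_diagram A f g)) k = fa (cospan_diagram D (fa U f) (fa U g)) k" for
      k
    using functor_id[OF U_functor] ob in_homD[OF h(1)] in_homD[OF h(2)] in_homD[OF U_hom[OF h(1)]]
      in_homD[OF U_hom[OF h(2)]] by (auto simp: func_comp_def graph_diagram_def)
  moreover have "fo (func_comp U (cospan_diagram A f g)) k = fo (cospan_diagram D (fa U f) (fa U g)) k" for
      k
    using in_homD[OF h(1)] in_homD[OF h(2)] in_homD[OF U_hom[OF h(1)]]
      in_homD[OF U_hom[OF h(2)]] by (simp add: func_comp_def graph_diagram_def)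
  ultimately have "is_limit cospan_shape D (func_comp U (cospan_diagram A f g)) (fo U d) (\<lambda>j. fa U (?l j))"
    using is_limit_cong[OF cospan.shape_category, of "cospan_diagram D (fa U f) (fa U g)"
      "func_comp U (cospan_diagram A f g)" "\<lambda>j. fa U (?l j)" "\<lambda>j. fa U (?l j)" D "fo U d"] by simp
  then have "is_limit cospan_shape A (cospan_diagram A f g) d ?l"
    by (rule reflect_finite_limit[OF cospan.shape fct cone])
  then show ?thesis using A.pullback_limit[OF h(1,2), of ?l d] by simp
qed

end

section \<open>Lifting regularity\<close>

locale lifting_regular = lifting_limits +
  assumes D_regular: "regular_category D"
    and C_regular: "i \<in> I \<union> J \<Longrightarrow> regular_category (C i)"
    and F_regular: "i \<in> I \<union> J \<Longrightarrow> preserves_regular_epis D (C i) (F i)"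
begin

lemma A_OFS: "is_OFS A {f \<in> Ar A. regular_epi D (fa U f)} (mono_arrows A)"
proof -
  have "is_OFS A {f \<in> Ar A. fa U f \<in> {e. regular_epi D e}} {f \<in> Ar A. fa U f \<in> mono_arrows D}"
  proof (rule lift_OFS)
    show "is_OFS D {e. regular_epi D e} (mono_arrows D)"
      using D_regular unfolding regular_category_iff by blast
    fix i assume i: "i \<in> I \<union> J"
    show "is_OFS (C i) {e. regular_epi (C i) e} (mono_arrows (C i))"
      using C_regular[OF i] unfolding regular_category_iff by blast
    show "preserves_class (F i) {e. regular_epi D e} {e. regular_epi (C i) e}"
      using F_regular[OF i] unfolding preserves_class_def preserves_regular_epis_def by blast
    show "preserves_class (G i) (mono_arrows D) (mono_arrows (C i))"
      using preserves_mono[OF G_functor[OF i] G_limits[OF i] D.category_axioms C_cat[OF i]]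
      unfolding preserves_class_def by blast
  qed
  \<comment> \<open>\<open>U\<close> preserves monomorphisms because it preserves finite limits, and
    reflects them because it is faithful. So the lifted right class is the one that regularity
    prescribes.\<close>
  moreover have "{f \<in> Ar A. fa U f \<in> mono_arrows D} = mono_arrows A"
  proof (intro set_eqI iffI)
    fix m assume m: "m \<in> mono_arrows A"
    then show "m \<in> {f \<in> Ar A. fa U f \<in> mono_arrows D}"
      using preserves_mono[OF U_functor U_limits A.category_axioms D.category_axioms m]
      unfolding mono_arrows_def[of A] by blast
  next
    fix m assume "m \<in> {f \<in> Ar A. fa U f \<in> mono_arrows D}"
    then have m: "in_hom A m (Dm A m) (Cd A m)" "fa U m \<in> mono_arrows D" using A.ar_hom by auto
    show "m \<in> mono_arrows A"
    proof (rule mono_arrowsI[OF m(1)])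
      fix z f g assume f: "in_hom A f z (Dm A m)" "in_hom A g z (Dm A m)" "Cmp A m f = Cmp A m g"
      then have "Cmp D (fa U m) (fa U f) = Cmp D (fa U m) (fa U g)"
        using U_comp[OF f(1) m(1)] U_comp[OF f(2) m(1)] by simp
      then show "f = g"
        by (intro faithful[OF f(1,2)] mono_arrowsD[OF m(2) U_hom[OF m(1)] U_hom[OF f(1)] U_hom[OF f(2)]])
    qed
  qed
  ultimately show ?thesis by simp
qed

lemma A_regular_cat: "regular_cat A {f \<in> Ar A. regular_epi D (fa U f)}"
proof (intro regular_cat.intro regular_cat_axioms.intro A.category_axioms A_limits A_OFS)
  show "pullback_stable A {f \<in> Ar A. regular_epi D (fa U f)}"
    unfolding pullback_stable_def
  proof (intro allI impI, elim conjE)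
    fix e f p q assume e: "e \<in> {f \<in> Ar A. regular_epi D (fa U f)}" and pb: "is_pullback A e f p q"
    have "regular_epi D (fa U q)"
      using D_regular e preserves_pullback[OF U_functor U_limits A.category_axioms D.category_axioms pb]
      unfolding regular_category_iff pullback_stable_def by blast
    moreover have "q \<in> Ar A" using pb unfolding is_pullback_def by blast
    ultimately show "q \<in> {f \<in> Ar A. regular_epi D (fa U f)}" by blast
  qed
qed

lemma A_regular: "regular_category A"
  unfolding regular_category_def
  using A.category_axioms A_limits A_OFS regular_cat.stable[OF A_regular_cat] by blast

text \<open>The lifted left class is paired with the monomorphisms of A, so
  \<open>regular_epi_iff\<close> in A identifies it with the regular epimorphisms; no coequalizer is
  lifted.\<close>

lemma regular_epi_lift_iff: "regular_epi A f \<longleftrightarrow> f \<in> Ar A \<and> regular_epi D (fa U f)"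
  using regular_cat.regular_epi_iff[OF A_regular_cat] by blast

lemma U_regular: "preserves_regular_epis A D U"
  unfolding preserves_regular_epis_def using regular_epi_lift_iff by blast

end

text \<open>In a regular category every regular epimorphism is the coequalizer of its own kernel
  pair. Thus the hypotheses of the exact case imply those of the regular case.\<close>

lemma preserves_coeqs_imp_regular_epis:
  assumes "regular_category C" "preserves_coeqs_of_kernel_pairs C D F"
  shows "preserves_regular_epis C D F"
  unfolding preserves_regular_epis_def
proof (intro allI impI)
  fix e assume e: "regular_epi C e"
  interpret C: category C using assms(1) unfolding regular_category_iff by blast
  note h = C.regular_epi_hom[OF e]
  have lim: "has_finite_limits C" using assms(1) unfolding regular_category_iff by blast
  obtain p q d where pb: "is_pullback C e e p q" "in_hom C p d (Dm C e)"
    by (rule C.pullback_ex[OF lim h h]) (rule that)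
  have "is_coequalizer D (fa F p) (fa F q) (fa F e)"
    using assms(2) pb(1) regular_coequalizer_kernel_pair[OF assms(1) e pb(1)]
    unfolding preserves_coeqs_of_kernel_pairs_def is_kernel_pair_def by blast
  then show "regular_epi D (fa F e)" unfolding regular_epi_def by blast
qed

section \<open>Lifting exactness\<close>

locale lifting_exact = lifting_regular +
  assumes D_exact: "exact_category D"
    and F_coeqs: "i \<in> I \<union> J \<Longrightarrow> preserves_coeqs_of_kernel_pairs D (C i) (F i)"
begin

lemma A_exact: "exact_category A"
  unfolding exact_category_def
proof (intro conjI allI impI A_regular)
  fix r\<^sub>0 r\<^sub>1 assume r: "is_internal_equiv_rel A r\<^sub>0 r\<^sub>1"
  obtain R X where rh: "in_hom A r\<^sub>0 R X" "in_hom A r\<^sub>1 R X"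
    using r unfolding is_internal_equiv_rel_def by blast
  have RX: "R \<in> Ob A" "X \<in> Ob A" using A.hom_ob rh by blast+
  note Ur = U_hom[OF rh(1)] U_hom[OF rh(2)]
  have "is_kernel_pair D (fa U r\<^sub>0) (fa U r\<^sub>1)"
    using D_exact preserves_internal_equiv_rel[OF U_functor U_limits A.category_axioms D.category_axioms
        A_limits r]
    unfolding exact_category_def by blast
  then obtain f where f: "is_pullback D f f (fa U r\<^sub>0) (fa U r\<^sub>1)" unfolding is_kernel_pair_def by blast
  obtain Y where fh: "in_hom D f (fo U X) Y"
    using f Ur unfolding is_pullback_def in_hom_def by auto
  have OFS: "is_OFS D {e. regular_epi D e} (mono_arrows D)"
    using D_regular unfolding regular_category_iff by blast
  \<comment> \<open>The arrow f whose kernel pair is the relation need not be a regular epimorphism.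
    Its left factor e has the same kernel pair because m is monic, and e is moreover the coequalizer
    of the relation.\<close>
  obtain e m c where em: "e \<in> {e. regular_epi D e}" "m \<in> mono_arrows D" "f = Cmp D m e"
    "in_hom D e (fo U X) c" "in_hom D m c Y"
    using D.OFS_factor_hom[OF OFS fh] .
  have c: "c \<in> Ob D" using D.hom_ob em by blast
  have pb: "is_pullback D e e (fa U r\<^sub>0) (fa U r\<^sub>1)"
  proof (rule is_pullbackI[OF em(4,4) Ur])
    have mm: "Cmp D e s = Cmp D e t"
      if "Cmp D f s = Cmp D f t" "in_hom D s z (fo U X)" "in_hom D t z (fo U X)" for s t z
      using that em D.comp_assoc[OF that(2) em(4,5)] D.comp_assoc[OF that(3) em(4,5)]
        mono_arrowsD[OF em(2,5) D.comp_in[OF that(2) em(4)] D.comp_in[OF that(3) em(4)]] by simp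
    have "Cmp D f (fa U r\<^sub>0) = Cmp D f (fa U r\<^sub>1)" using f by (rule is_pullbackE)
    then show eq: "Cmp D e (fa U r\<^sub>0) = Cmp D e (fa U r\<^sub>1)" using mm Ur by blast
    {
      fix z s t assume st: "in_hom D s z (fo U X)" "in_hom D t z (fo U X)" "Cmp D e s = Cmp D e t"
      have "Cmp D f s = Cmp D f t"
        using st D.comp_assoc[OF st(1) em(4,5)] D.comp_assoc[OF st(2) em(4,5)] em(3) by simp
      from ex1_implies_ex[OF is_pullback_ex1[OF f Ur st(1,2) this]]
      show "\<exists>h. in_hom D h z (fo U R) \<and> Cmp D (fa U r\<^sub>0) h = s \<and> Cmp D (fa U r\<^sub>1) h = t" .
    }
    fix z h h' assume h: "in_hom D h z (fo U R)" "in_hom D h' z (fo U R)"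
      "Cmp D (fa U r\<^sub>0) h = Cmp D (fa U r\<^sub>0) h'" "Cmp D (fa U r\<^sub>1) h = Cmp D (fa U r\<^sub>1) h'"
    have "Cmp D f (Cmp D (fa U r\<^sub>0) h) = Cmp D f (Cmp D (fa U r\<^sub>1) h)"
      using D.comp_assoc[OF h(1) Ur(1) fh] D.comp_assoc[OF h(1) Ur(2) fh] \<open>Cmp D f (fa U r\<^sub>0) = _\<close> by simp
    from is_pullback_ex1[OF f Ur D.comp_in[OF h(1) Ur(1)] D.comp_in[OF h(1) Ur(2)] this]
    show "h = h'" using h by (elim ex1E) metis
  qed
  have co: "is_coequalizer D (fa U r\<^sub>0) (fa U r\<^sub>1) e"
    using regular_coequalizer_kernel_pair[OF D_regular _ pb] em(1) by blast
  then have coF: "is_coequalizer (C i) (fa (F i) (fa U r\<^sub>0)) (fa (F i) (fa U r\<^sub>1)) (fa (F i) e)" if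
      "i \<in> I \<union> J" for i
    using F_coeqs[OF that] pb unfolding preserves_coeqs_of_kernel_pairs_def is_kernel_pair_def by blast
  have er: "Cmp D e (fa U r\<^sub>0) = Cmp D e (fa U r\<^sub>1)" using co by (rule is_coequalizerE)
  have "\<forall>i\<in>I. \<exists>h. in_hom (C i) h (fo (F i) c) (fo (G i) c) \<and>
     Cmp (C i) h (fa (F i) e) = Cmp (C i) (fa (G i) e) (\<phi> i X)"
  proof
    fix i assume i: "i \<in> I"
    then have iIJ: "i \<in> I \<union> J" by blast
    interpret Ci: category "C i" using C_cat iIJ by blast
    note Fh = F_hom[OF iIJ] and Gh = G_hom[OF iIJ] and ph = phi_in[OF i]
    \<comment> \<open>Naturality at the two projections moves them past the structure arrow of X,
      where e identifies them. Hence \<open>?k\<close> descends along the coequalizer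
      \<open>F i e\<close>.\<close>
    let ?k = "Cmp (C i) (fa (G i) e) (\<phi> i X)"
    have kh: "in_hom (C i) ?k (fo (F i) (fo U X)) (fo (G i) c)"
      by (rule Ci.comp_in[OF ph[OF RX(2)] Gh[OF em(4)]])
    have k: "Cmp (C i) ?k (fa (F i) (fa U s)) = Cmp (C i) (fa (G i) (Cmp D e (fa U s))) (\<phi> i R)"
      if s: "in_hom A s R X" for s
      using Ci.comp_assoc[OF Fh[OF U_hom[OF s]] ph[OF RX(2)] Gh[OF em(4)]] phi_nat[OF i s]
        Ci.comp_assoc[OF ph[OF RX(1)] Gh[OF U_hom[OF s]] Gh[OF em(4)]] G_comp[OF iIJ U_hom[OF s] em(4)] by
            simp
    have "Cmp (C i) ?k (fa (F i) (fa U r\<^sub>0)) = Cmp (C i) ?k (fa (F i) (fa U r\<^sub>1))"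
      using k[OF rh(1)] k[OF rh(2)] er by simp
    then show "\<exists>h. in_hom (C i) h (fo (F i) c) (fo (G i) c) \<and> Cmp (C i) h (fa (F i) e) = ?k"
      using is_coequalizer_fac[OF coF[OF iIJ] Fh[OF em(4)] kh] by metis
  qed
  then obtain \<psi> where psi: "\<forall>i\<in>I. in_hom (C i) (\<psi> i) (fo (F i) c) (fo (G i) c) \<and>
     Cmp (C i) (\<psi> i) (fa (F i) e) = Cmp (C i) (fa (G i) e) (\<phi> i X)"
    by (rule bchoice[THEN exE])
  have "\<exists>x\<in>Ob A. fo U x = c \<and> (\<forall>i\<in>I. \<phi> i x = \<psi> i)"
  proof (rule lift_ob[OF c])
    fix j r s assume j: "j \<in> J" and r: "in_hom (C j) r (fo (F j) c) (fo (G j) c)"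
      and s: "in_hom (C j) s (fo (F j) c) (fo (G j) c)"
      and src: "\<And>b e. b \<in> Ob A \<Longrightarrow> in_hom D e (fo U b) c \<Longrightarrow>
          (\<And>i. i \<in> I \<Longrightarrow> Cmp (C i) (fa (G i) e) (\<phi> i b) = Cmp (C i) (\<psi> i) (fa (F i) e)) \<Longrightarrow>
          Cmp (C j) r (fa (F j) e) = Cmp (C j) s (fa (F j) e)"
    have jIJ: "j \<in> I \<union> J" using j by blast
    \<comment> \<open>X is structured and \<open>\<psi>\<close> was chosen to make e compatible, so
      r and s agree after \<open>F j e\<close>, which is a coequalizer and can be cancelled.\<close>
    have "Cmp (C j) r (fa (F j) e) = Cmp (C j) s (fa (F j) e)"
      by (rule src[OF RX(2) em(4)]) (use psi in simp)
    then show "r = s"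
      by (rule category.coequalizer_eqI[OF C_cat[OF jIJ] coF[OF jIJ] F_hom[OF jIJ em(4)] r s])
  qed (use psi in blast)
  then obtain x where x: "x \<in> Ob A" "fo U x = c" "\<And>i. i \<in> I \<Longrightarrow> \<phi> i x = \<psi> i" by blast
  obtain e' where e': "in_hom A e' X x" "fa U e' = e"
    using lift_ar[OF RX(2) x(1), of e] em(4) x psi by auto
  have "Cmp A e' r\<^sub>0 = Cmp A e' r\<^sub>1"
    using U_comp[OF rh(1) e'(1)] U_comp[OF rh(2) e'(1)] e'(2) er
    by (intro faithful[OF A.comp_in[OF rh(1) e'(1)] A.comp_in[OF rh(2) e'(1)]]) simp
  then have "is_pullback A e' e' r\<^sub>0 r\<^sub>1"
    using pb e'(2) by (intro reflect_pullback[OF e'(1) e'(1) rh]) simp_all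
  then show "is_kernel_pair A r\<^sub>0 r\<^sub>1" unfolding is_kernel_pair_def by blast
qed

end

section \<open>Hom-categories of a 2-category\<close>

lemma Ob_hom_cat: "f \<in> Ob (hom_cat K x y) \<longleftrightarrow> cell1 K f x y"
  by (simp add: hom_cat_def)

lemma hom_cat_sel: "Dm (hom_cat K x y) = Dm (vert K)" "Cd (hom_cat K x y) = Cd (vert K)"
  "Idn (hom_cat K x y) = id2 K" "Cmp (hom_cat K x y) = vc K"
  by (simp_all add: hom_cat_def)

lemma in_hom_hom_cat:
  "in_hom (hom_cat K x y) \<alpha> f g \<longleftrightarrow> cell1 K f x y \<and> cell1 K g x y \<and> cell2 K \<alpha> f g"
  by (auto simp: hom_cat_def in_hom_def)

lemma postcomp_sel: "fo (postcomp K h) = c1 K h" "fa (postcomp K h) = lw K h"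
  by (simp_all add: postcomp_def)

lemma precomp_sel: "fo (precomp K f) g = c1 K g f" "fa (precomp K f) \<alpha> = rw K \<alpha> f"
  by (simp_all add: precomp_def)

context two_category
begin

lemma cell1_ob: "cell1 K f x y \<Longrightarrow> x \<in> Obj K" "cell1 K f x y \<Longrightarrow> y \<in> Obj K"
  using category.hom_ob[OF und_cat] by blast+

lemmas c1_in = category.comp_in[OF und_cat]
lemmas c1_assoc = category.comp_assoc[OF und_cat]
lemmas vc_in = category.comp_in[OF vert_cat]
lemmas vc_assoc = category.comp_assoc[OF vert_cat]
lemmas vc_id_right = category.comp_id_right[OF vert_cat]
lemmas vc_id_left = category.comp_id_left[OF vert_cat]

lemma id2_in: "cell1 K f x y \<Longrightarrow> cell2 K (id2 K f) f f"
  using category.id_in[OF vert_cat] vert_ob by (simp add: in_hom_def)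

lemma cell2_cell1:
  assumes "cell2 K \<alpha> f g"
  shows "cell1 K f x y \<Longrightarrow> cell1 K g x y" "cell1 K g x y \<Longrightarrow> cell1 K f x y"
  using parallel[OF assms] category.hom_ob[OF vert_cat assms] vert_ob by (auto simp: in_hom_def)

lemma hom_category: "category (hom_cat K x y)"
proof
  show "Dm (hom_cat K x y) \<alpha> \<in> Ob (hom_cat K x y)" "Cd (hom_cat K x y) \<alpha> \<in> Ob (hom_cat K x y)"
    if "\<alpha> \<in> Ar (hom_cat K x y)" for \<alpha>
    using that by (auto simp: hom_cat_def in_hom_def)
  show "in_hom (hom_cat K x y) (Idn (hom_cat K x y) f) f f" if "f \<in> Ob (hom_cat K x y)" for f
    using that id2_in by (auto simp: in_hom_hom_cat Ob_hom_cat hom_cat_sel)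
qed (auto simp: in_hom_hom_cat hom_cat_sel vc_in vc_id_left vc_id_right vc_assoc)

lemma lw_in:
  assumes "cell1 K h y z" "cell1 K f x y" "cell2 K \<alpha> f g"
  shows "cell2 K (lw K h \<alpha>) (c1 K h f) (c1 K h g)"
  using hc_in[OF assms(3) id2_in[OF assms(1)] assms(2,1)] .

lemma rw_in:
  assumes "cell1 K h x y" "cell1 K f y z" "cell2 K \<alpha> f g"
  shows "cell2 K (rw K \<alpha> h) (c1 K f h) (c1 K g h)"
  using hc_in[OF id2_in[OF assms(1)] assms(3,1,2)] .

lemma lw_comp:
  assumes "cell1 K h y z" "cell1 K f x y" "cell2 K \<alpha> f g" "cell2 K \<beta> g k"
  shows "lw K h (vc K \<beta> \<alpha>) = vc K (lw K h \<beta>) (lw K h \<alpha>)"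
  using interchange[OF assms(3,4) id2_in[OF assms(1)] id2_in[OF assms(1)] assms(2,1)]
    vc_id_left[OF id2_in[OF assms(1)]] by simp

lemma rw_comp:
  assumes "cell1 K h x y" "cell1 K f y z" "cell2 K \<alpha> f g" "cell2 K \<beta> g k"
  shows "rw K (vc K \<beta> \<alpha>) h = vc K (rw K \<beta> h) (rw K \<alpha> h)"
  using interchange[OF id2_in[OF assms(1)] id2_in[OF assms(1)] assms(3,4,1,2)]
    vc_id_left[OF id2_in[OF assms(1)]] by simp

text \<open>Both sides are the horizontal composite of the two cells. Naturality of structure cells
  and of the sides of equations is an instance of this.\<close>

lemma whisker_exchange:
  assumes f: "cell1 K f x y" "cell2 K \<alpha> f g" and h: "cell1 K h y z" "cell2 K \<beta> h k"
  shows "vc K (rw K \<beta> g) (lw K h \<alpha>) = vc K (lw K k \<alpha>) (rw K \<beta> f)"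
proof -
  have g: "cell1 K g x y" and k: "cell1 K k y z" using cell2_cell1 f h by blast+
  have "hc K (vc K \<beta> (id2 K h)) (vc K (id2 K g) \<alpha>) = vc K (rw K \<beta> g) (lw K h \<alpha>)"
    by (rule interchange[OF f(2) id2_in[OF g] id2_in[OF h(1)] h(2) f(1) h(1)])
  moreover have "hc K (vc K (id2 K k) \<beta>) (vc K \<alpha> (id2 K f)) = vc K (lw K k \<alpha>) (rw K \<beta> f)"
    by (rule interchange[OF id2_in[OF f(1)] f(2) h(2) id2_in[OF k] f(1) h(1)])
  ultimately show ?thesis
    using vc_id_left[OF f(2)] vc_id_right[OF f(2)] vc_id_left[OF h(2)] vc_id_right[OF h(2)] by simp
qed

lemma lw_lw:
  assumes "cell1 K h y z" "cell1 K k z w" "cell1 K f x y" "cell2 K \<alpha> f g"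
  shows "lw K k (lw K h \<alpha>) = lw K (c1 K k h) \<alpha>"
  using hc_assoc[OF assms(4) id2_in[OF assms(1)] id2_in[OF assms(2)] assms(3,1,2)] hc_id[OF assms(1,2)] by
      simp

lemma rw_rw:
  assumes "cell1 K k w x" "cell1 K h x y" "cell1 K f y z" "cell2 K \<alpha> f g"
  shows "rw K (rw K \<alpha> h) k = rw K \<alpha> (c1 K h k)"
  using hc_assoc[OF id2_in[OF assms(1)] id2_in[OF assms(2)] assms(4) assms(1,2,3)] hc_id[OF assms(1,2)] by
      simp

lemma rw_lw:
  assumes "cell1 K k w x" "cell1 K f x y" "cell2 K \<alpha> f g" "cell1 K h y z"
  shows "rw K (lw K h \<alpha>) k = lw K h (rw K \<alpha> k)"
  using hc_assoc[OF id2_in[OF assms(1)] assms(3) id2_in[OF assms(4)] assms(1,2,4)] by simp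

lemma postcomp_functor:
  assumes "cell1 K h y z"
  shows "is_functor (hom_cat K x y) (hom_cat K x z) (postcomp K h)"
  unfolding is_functor_def Ball_def in_hom_hom_cat Ob_hom_cat hom_cat_sel postcomp_sel
  by (auto intro: c1_in[OF _ assms] lw_in[OF assms] lw_comp[OF assms] hc_id[OF _ assms])

lemma precomp_functor:
  assumes "cell1 K f x y"
  shows "is_functor (hom_cat K y z) (hom_cat K x z) (precomp K f)"
  unfolding is_functor_def Ball_def in_hom_hom_cat Ob_hom_cat hom_cat_sel precomp_sel
  by (auto intro: c1_in[OF assms] rw_in[OF assms] rw_comp[OF assms] hc_id[OF assms])

lemma hom_ar: "\<alpha> \<in> Ar (hom_cat K x y) \<longleftrightarrow> in_hom (hom_cat K x y) \<alpha> (Dm (vert K) \<alpha>) (Cd (vert K) \<alpha>)"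
  by (auto simp: hom_cat_def in_hom_def)

end

section \<open>Products, inserters and equifiers as seen from hom-categories\<close>

locale two_product = two_category K
  for K :: "('o, 'm, 'a) twocat" +
  fixes I :: "'i set" and c :: "'i \<Rightarrow> 'o" and p :: 'o and \<pi> :: "'i \<Rightarrow> 'm"
  assumes product: "is_product K I c p \<pi>"
begin

lemma p_ob: "p \<in> Obj K"
  and pi_in: "i \<in> I \<Longrightarrow> cell1 K (\<pi> i) p (c i)"
  using product unfolding is_product_def by blast+

lemma tuple1_ex1:
  assumes "x \<in> Obj K" "\<And>i. i \<in> I \<Longrightarrow> cell1 K (f i) x (c i)"
  shows "\<exists>!h. cell1 K h x p \<and> (\<forall>i\<in>I. c1 K (\<pi> i) h = f i)"
  using product[unfolded is_product_def, THEN conjunct2, THEN conjunct2, THEN conjunct1, rule_format, OF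
      assms] .

lemma tuple2_ex1:
  assumes "cell1 K h x p" "cell1 K k x p" "\<And>i. i \<in> I \<Longrightarrow> cell2 K (\<alpha> i) (c1 K (\<pi> i) h) (c1 K (\<pi> i) k)"
  shows "\<exists>!\<beta>. cell2 K \<beta> h k \<and> (\<forall>i\<in>I. lw K (\<pi> i) \<beta> = \<alpha> i)"
  using product[unfolded is_product_def, THEN conjunct2, THEN conjunct2, THEN conjunct2, rule_format,
      OF cell1_ob(1)[OF assms(1)], of h k \<alpha>] assms by blast

lemma cell1_eqI:
  assumes "cell1 K h x p" "cell1 K k x p" "\<And>i. i \<in> I \<Longrightarrow> c1 K (\<pi> i) h = c1 K (\<pi> i) k"
  shows "h = k"
proof -
  have "\<exists>!l. cell1 K l x p \<and> (\<forall>i\<in>I. c1 K (\<pi> i) l = c1 K (\<pi> i) h)"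
    using tuple1_ex1[of x "\<lambda>i. c1 K (\<pi> i) h"] cell1_ob(1)[OF assms(1)] c1_in[OF assms(1) pi_in] by blast
  then show ?thesis using assms by (elim ex1E) metis
qed

lemma cell2_eqI:
  assumes "cell1 K h x p" "cell2 K \<alpha> h k" "cell2 K \<beta> h k" "\<And>i. i \<in> I \<Longrightarrow> lw K (\<pi> i) \<alpha> = lw K (\<pi> i) \<beta>"
  shows "\<alpha> = \<beta>"
proof -
  have k: "cell1 K k x p" using cell2_cell1(1)[OF assms(2,1)] .
  have "\<exists>!\<gamma>. cell2 K \<gamma> h k \<and> (\<forall>i\<in>I. lw K (\<pi> i) \<gamma> = lw K (\<pi> i) \<alpha>)"
    using lw_in[OF pi_in assms(1,2)] by (intro tuple2_ex1[OF assms(1) k]) blast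
  then show ?thesis using assms by (elim ex1E) metis
qed

lemma tuple1:
  assumes "x \<in> Obj K" "\<forall>i\<in>I. cell1 K (f i) x (c i)"
  shows tuple1_in: "cell1 K (tuple1 K I p \<pi> x f) x p"
    and pi_tuple1: "i \<in> I \<Longrightarrow> c1 K (\<pi> i) (tuple1 K I p \<pi> x f) = f i"
proof -
  have "\<exists>!h. cell1 K h x p \<and> (\<forall>i\<in>I. c1 K (\<pi> i) h = f i)"
    using tuple1_ex1[OF assms(1)] assms(2) by simp
  from theI'[OF this] show "cell1 K (tuple1 K I p \<pi> x f) x p"
    "i \<in> I \<Longrightarrow> c1 K (\<pi> i) (tuple1 K I p \<pi> x f) = f i"
    unfolding tuple1_def by auto
qed

text \<open>\<open>tuple2\<close> is described by its components alone, without source and target.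
  These are forced: the components have determined endpoints, and a 1-cell into a product is
  determined by its components.\<close>

lemma tuple2_unique:
  assumes h: "cell1 K h x p" and \<beta>: "cell2 K \<beta> h k" "\<And>i. i \<in> I \<Longrightarrow> lw K (\<pi> i) \<beta> = \<alpha> i"
  shows "tuple2 K I p \<pi> x \<alpha> = \<beta>"
  unfolding tuple2_def
proof (rule the_equality)
  have k: "cell1 K k x p" using cell2_cell1(1)[OF \<beta>(1) h] .
  show "\<beta> \<in> Ar (hom_cat K x p) \<and> (\<forall>i\<in>I. lw K (\<pi> i) \<beta> = \<alpha> i)"
    using h k \<beta> unfolding hom_cat_def by auto
  fix \<gamma> assume \<gamma>: "\<gamma> \<in> Ar (hom_cat K x p) \<and> (\<forall>i\<in>I. lw K (\<pi> i) \<gamma> = \<alpha> i)"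
  then obtain h' k' where \<gamma>h: "cell1 K h' x p" "cell1 K k' x p" "cell2 K \<gamma> h' k'"
    unfolding hom_cat_def by auto
  have e: "c1 K (\<pi> i) h' = c1 K (\<pi> i) h \<and> c1 K (\<pi> i) k' = c1 K (\<pi> i) k" if "i \<in> I" for i
    using lw_in[OF pi_in[OF that] h \<beta>(1)] lw_in[OF pi_in[OF that] \<gamma>h(1,3)] \<gamma> \<beta>(2) that
    by (auto simp: in_hom_def)
  have "h' = h" "k' = k" using cell1_eqI[OF \<gamma>h(1) h] cell1_eqI[OF \<gamma>h(2) k] e by auto
  then have \<gamma>': "cell2 K \<gamma> h k" using \<gamma>h by simp
  show "\<gamma> = \<beta>" by (rule cell2_eqI[OF h \<gamma>' \<beta>(1)]) (use \<gamma> \<beta>(2) in simp)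
qed

lemma tuple2:
  assumes x: "x \<in> Obj K" and f: "\<forall>i\<in>I. cell1 K (f i) x (c i)"
    and \<alpha>: "\<forall>i\<in>I. cell2 K (\<alpha> i) (f i) (g i)"
  shows tuple2_in: "cell2 K (tuple2 K I p \<pi> x \<alpha>) (tuple1 K I p \<pi> x f) (tuple1 K I p \<pi> x g)"
    and pi_tuple2: "i \<in> I \<Longrightarrow> lw K (\<pi> i) (tuple2 K I p \<pi> x \<alpha>) = \<alpha> i"
proof -
  have g: "\<forall>i\<in>I. cell1 K (g i) x (c i)" using cell2_cell1(1) \<alpha> f by blast
  note tf = tuple1_in[OF x f] and tg = tuple1_in[OF x g]
  have "\<exists>!\<beta>. cell2 K \<beta> (tuple1 K I p \<pi> x f) (tuple1 K I p \<pi> x g) \<and> (\<forall>i\<in>I. lw K (\<pi> i) \<beta> = \<alpha> i)"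
    by (rule tuple2_ex1[OF tf tg]) (use \<alpha> pi_tuple1[OF x f] pi_tuple1[OF x g] in simp)
  then obtain \<beta> where \<beta>: "cell2 K \<beta> (tuple1 K I p \<pi> x f) (tuple1 K I p \<pi> x g)"
    "\<And>i. i \<in> I \<Longrightarrow> lw K (\<pi> i) \<beta> = \<alpha> i" by blast
  have "tuple2 K I p \<pi> x \<alpha> = \<beta>" by (rule tuple2_unique[OF tf \<beta>])
  then show "cell2 K (tuple2 K I p \<pi> x \<alpha>) (tuple1 K I p \<pi> x f) (tuple1 K I p \<pi> x g)"
    "i \<in> I \<Longrightarrow> lw K (\<pi> i) (tuple2 K I p \<pi> x \<alpha>) = \<alpha> i" using \<beta> by auto
qed

lemma tuple1_precomp:
  assumes x: "x \<in> Obj K" and f: "\<forall>i\<in>I. cell1 K (f i) x (c i)" and h: "cell1 K h y x"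
  shows "c1 K (tuple1 K I p \<pi> x f) h = tuple1 K I p \<pi> y (\<lambda>i. c1 K (f i) h)"
proof -
  note y = cell1_ob(1)[OF h]
  have fh: "\<forall>i\<in>I. cell1 K (c1 K (f i) h) y (c i)" using c1_in[OF h] f by blast
  show ?thesis
  proof (rule cell1_eqI[OF c1_in[OF h tuple1_in[OF x f]] tuple1_in[OF y fh]])
    fix i assume i: "i \<in> I"
    show "c1 K (\<pi> i) (c1 K (tuple1 K I p \<pi> x f) h) = c1 K (\<pi> i) (tuple1 K I p \<pi> y (\<lambda>i. c1 K (f i) h))"
      using c1_assoc[OF h tuple1_in[OF x f] pi_in[OF i]] pi_tuple1[OF x f i] pi_tuple1[OF y fh i] by simp
  qed
qed

text \<open>The one- and two-dimensional universal properties are the object and arrow parts of a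
  product of categories, so the transfer results for \<open>product_category\<close> hold at every
  stage x.\<close>

lemma hom_product:
  assumes x: "x \<in> Obj K"
  shows "product_category (hom_cat K x p) I (\<lambda>i. hom_cat K x (c i)) (\<lambda>i. postcomp K (\<pi> i))"
proof (intro product_category.intro product_category_axioms.intro hom_category)
  show "is_functor (hom_cat K x p) (hom_cat K x (c i)) (postcomp K (\<pi> i))" if "i \<in> I" for i
    by (rule postcomp_functor[OF pi_in[OF that]])
  show "\<exists>d\<in>Ob (hom_cat K x p). \<forall>i\<in>I. fo (postcomp K (\<pi> i)) d = f i"
    if "\<And>i. i \<in> I \<Longrightarrow> f i \<in> Ob (hom_cat K x (c i))" for f
    using ex1_implies_ex[OF tuple1_ex1[OF x, of f]] that unfolding Ob_hom_cat postcomp_sel Bex_def by blast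
  show "\<exists>!\<beta>. in_hom (hom_cat K x p) \<beta> h k \<and> (\<forall>i\<in>I. fa (postcomp K (\<pi> i)) \<beta> = \<alpha> i)"
    if "h \<in> Ob (hom_cat K x p)" "k \<in> Ob (hom_cat K x p)"
      "\<And>i. i \<in> I \<Longrightarrow> in_hom (hom_cat K x (c i)) (\<alpha> i) (fo (postcomp K (\<pi> i)) h) (fo (postcomp K (\<pi> i)) k)"
    for h k \<alpha>
    using tuple2_ex1[of h x k \<alpha>] that unfolding Ob_hom_cat in_hom_hom_cat postcomp_sel by simp
qed

end

locale two_inserter = two_category K
  for K :: "('o, 'm, 'a) twocat" +
  fixes f g :: 'm and c d p :: 'o and u :: 'm and \<phi> :: 'a
  assumes f_in: "cell1 K f c d" and g_in: "cell1 K g c d"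
    and inserter: "is_inserter K f g p u \<phi>"
begin

lemma Dm_f: "Dm (und K) f = c" using f_in by (rule in_homD)

lemmas inserter' = inserter[unfolded is_inserter_def Dm_f]

lemma u_in: "cell1 K u p c" and phi_in: "cell2 K \<phi> (c1 K f u) (c1 K g u)"
  using inserter' by blast+

lemma ex_cell1:
  assumes "cell1 K h' x c" "cell2 K \<alpha> (c1 K f h') (c1 K g h')"
  obtains h where "cell1 K h x p" "c1 K u h = h'" "rw K \<phi> h = \<alpha>"
proof -
  have "\<exists>!h. cell1 K h x p \<and> h' = c1 K u h \<and> \<alpha> = rw K \<phi> h"
    using inserter'[THEN conjunct2, THEN conjunct2, THEN conjunct2, THEN conjunct1] assms
      cell1_ob(1)[OF assms(1)] by blast
  then show ?thesis using that by blast
qed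

lemma ex1_cell2:
  assumes "cell1 K h\<^sub>1 x p" "cell1 K h\<^sub>2 x p" "cell2 K \<alpha>' (c1 K u h\<^sub>1) (c1 K u h\<^sub>2)"
    "vc K (lw K g \<alpha>') (rw K \<phi> h\<^sub>1) = vc K (rw K \<phi> h\<^sub>2) (lw K f \<alpha>')"
  shows "\<exists>!\<alpha>. cell2 K \<alpha> h\<^sub>1 h\<^sub>2 \<and> \<alpha>' = lw K u \<alpha>"
  using inserter'[THEN conjunct2, THEN conjunct2, THEN conjunct2, THEN conjunct2] assms
    cell1_ob(1)[OF assms(1)] by blast

lemma phi_natural:
  assumes "cell1 K h\<^sub>1 x p" "cell2 K \<alpha> h\<^sub>1 h\<^sub>2"
  shows "vc K (lw K g (lw K u \<alpha>)) (rw K \<phi> h\<^sub>1) = vc K (rw K \<phi> h\<^sub>2) (lw K f (lw K u \<alpha>))"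
  using whisker_exchange[OF assms c1_in[OF u_in f_in] phi_in]
    lw_lw[OF u_in f_in assms] lw_lw[OF u_in g_in assms] by simp

text \<open>The uniqueness clause of the inserter speaks of compatible 2-cells only; a cell of the
  form \<open>u * \<alpha>\<close> is compatible by naturality, so faithfulness follows.\<close>

lemma cell2_eqI:
  assumes "cell1 K h\<^sub>1 x p" "cell2 K \<alpha> h\<^sub>1 h\<^sub>2" "cell2 K \<beta> h\<^sub>1 h\<^sub>2" "lw K u \<alpha> = lw K u \<beta>"
  shows "\<alpha> = \<beta>"
proof -
  have "\<exists>!\<gamma>. cell2 K \<gamma> h\<^sub>1 h\<^sub>2 \<and> lw K u \<alpha> = lw K u \<gamma>"
    by (rule ex1_cell2[OF assms(1) cell2_cell1(1)[OF assms(2,1)] lw_in[OF u_in assms(1,2)]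
        phi_natural[OF assms(1,2)]])
  then show ?thesis using assms by (elim ex1E) metis
qed

end

locale two_equifier = two_category K
  for K :: "('o, 'm, 'a) twocat" +
  fixes \<eta> \<theta> :: 'a and c p :: 'o and u :: 'm
  assumes equifier: "is_equifier K c \<eta> \<theta> p u"
begin

lemma u_in: "cell1 K u p c" and equified: "rw K \<eta> u = rw K \<theta> u"
  using equifier unfolding is_equifier_def by blast+

lemma ex_cell1:
  assumes "cell1 K h' x c" "rw K \<eta> h' = rw K \<theta> h'"
  obtains h where "cell1 K h x p" "c1 K u h = h'"
proof -
  have "\<exists>!h. cell1 K h x p \<and> h' = c1 K u h"
    using equifier[unfolded is_equifier_def, THEN conjunct2, THEN conjunct2, THEN conjunct2, THEN conjunct1]
        assms
      cell1_ob(1)[OF assms(1)] by blast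
  then show ?thesis using that by blast
qed

lemma ex1_cell2:
  assumes "cell1 K h\<^sub>1 x p" "cell1 K h\<^sub>2 x p" "cell2 K \<alpha>' (c1 K u h\<^sub>1) (c1 K u h\<^sub>2)"
  shows "\<exists>!\<alpha>. cell2 K \<alpha> h\<^sub>1 h\<^sub>2 \<and> \<alpha>' = lw K u \<alpha>"
  using equifier[unfolded is_equifier_def, THEN conjunct2, THEN conjunct2, THEN conjunct2, THEN conjunct2]
      assms
    cell1_ob(1)[OF assms(1)] by blast

lemma cell2_eqI:
  assumes "cell1 K h\<^sub>1 x p" "cell2 K \<alpha> h\<^sub>1 h\<^sub>2" "cell2 K \<beta> h\<^sub>1 h\<^sub>2" "lw K u \<alpha> = lw K u \<beta>"
  shows "\<alpha> = \<beta>"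
proof -
  have "\<exists>!\<gamma>. cell2 K \<gamma> h\<^sub>1 h\<^sub>2 \<and> lw K u \<alpha> = lw K u \<gamma>"
    by (rule ex1_cell2[OF assms(1) cell2_cell1(1)[OF assms(2,1)] lw_in[OF u_in assms(1,2)]])
  then show ?thesis using assms by (elim ex1E) metis
qed

end

section \<open>Terms and the construction of the category of models\<close>

lemma tuple1_cong: "(\<And>i. i \<in> I \<Longrightarrow> f i = g i) \<Longrightarrow> tuple1 K I p \<pi> x f = tuple1 K I p \<pi> x g"
  unfolding tuple1_def by (simp cong: ball_cong)

text \<open>A context assigns values to its own variables only, so a term over all variables has to
  be regarded as a term over the context before it can be interpreted there.\<close>

lemma Terms_tvars: "t \<in> Terms \<Sigma> X ty \<Longrightarrow> tvars t \<subseteq> Y \<Longrightarrow> t \<in> Terms \<Sigma> Y ty"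
proof (induction rule: Terms.induct)
  case (App B ts)
  then show ?case by (intro Terms.App) auto
qed (auto intro: Terms.Var)

lemma tsubst_type:
  assumes "t \<in> Terms \<Sigma> Y ty" "\<forall>v\<in>Y. \<theta> v \<in> Terms \<Sigma> X ty' \<and> trm_type \<Sigma> ty' (\<theta> v) = ty v"
  shows "tsubst \<theta> t \<in> Terms \<Sigma> X ty' \<and> trm_type \<Sigma> ty' (tsubst \<theta> t) = trm_type \<Sigma> ty t"
  using assms(1)
proof (induction rule: Terms.induct)
  case (App B ts)
  have "map (trm_type \<Sigma> ty' \<circ> tsubst \<theta>) ts = map (trm_type \<Sigma> ty) ts"
    using App.IH by simp
  then show ?case using App by (auto intro!: Terms.App)
qed (use assms(2) in auto)

lemma interp_tsubst:
  "interp K \<Sigma> M x \<rho> (tsubst \<theta> t) = interp K \<Sigma> M x (\<lambda>v. interp K \<Sigma> M x \<rho> (\<theta> v)) t"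
proof (induction t)
  case (App B ts)
  then have "map (interp K \<Sigma> M x \<rho> \<circ> tsubst \<theta>) ts = map (interp K \<Sigma> M x (\<lambda>v. interp K \<Sigma> M x \<rho> (\<theta> v))) ts"
    by simp
  then show ?case by (simp only: interp.simps tsubst.simps map_map)
qed simp

lemma interp_cong:
  "(\<And>v. v \<in> tvars t \<Longrightarrow> \<rho> v = \<rho>' v) \<Longrightarrow> interp K \<Sigma> M x \<rho> t = interp K \<Sigma> M x \<rho>' t"
proof (induction t)
  case (App B ts)
  have "map (interp K \<Sigma> M x \<rho>) ts = map (interp K \<Sigma> M x \<rho>') ts"
    using App by (intro map_cong) auto
  then show ?case by (simp only: interp.simps)
qed simp

section \<open>Cells denoted by terms, graph arrows and paths\<close>

locale bialgebra = two_category K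
  for K :: "('o, 'm, 'a) twocat" +
  fixes U :: "'u itself" and \<Sigma> :: "('c, 'f, 'v, 't) sig2" and \<sigma> :: "('c, 'f, 's, 'g) sig1"
    and T :: "('f, 't, 's, 'g) eqn set" and M :: "('c, 'f, 't, 'o, 'm, 'a) model"
    and L :: "('f, 't, 's, 'g, 'o, 'm, 'a) constr"
  assumes sig: "signature_pair U \<Sigma> \<sigma>" and is_th: "is_theory \<Sigma> \<sigma> T"
    and model: "is_model K \<Sigma> M" and constr: "is_construction K \<Sigma> \<sigma> T M L"
begin

lemma far_CSym: "B \<in> FSym \<Sigma> \<Longrightarrow> set (far \<Sigma> B) \<subseteq> CSym \<Sigma>"
  and fres_CSym: "B \<in> FSym \<Sigma> \<Longrightarrow> fres \<Sigma> B \<in> CSym \<Sigma>"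
  and vty_CSym: "v \<in> Vars \<Sigma> \<Longrightarrow> vty \<Sigma> v \<in> CSym \<Sigma>"
  and tctx_distinct: "\<alpha> \<in> TSym \<Sigma> \<Longrightarrow> distinct (tctx \<Sigma> \<alpha>)"
  and tctx_Vars: "\<alpha> \<in> TSym \<Sigma> \<Longrightarrow> set (tctx \<Sigma> \<alpha>) \<subseteq> Vars \<Sigma>"
  and tdom_Terms: "\<alpha> \<in> TSym \<Sigma> \<Longrightarrow> tdom \<Sigma> \<alpha> \<in> Terms \<Sigma> (Vars \<Sigma>) (vty \<Sigma>)"
  and tcod_Terms: "\<alpha> \<in> TSym \<Sigma> \<Longrightarrow> tcod \<Sigma> \<alpha> \<in> Terms \<Sigma> (Vars \<Sigma>) (vty \<Sigma>)"
  and tcod_type: "\<alpha> \<in> TSym \<Sigma> \<Longrightarrow> trm_type \<Sigma> (vty \<Sigma>) (tcod \<Sigma> \<alpha>) = trm_type \<Sigma> (vty \<Sigma>) (tdom \<Sigma> \<alpha>)"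
  and tdom_tvars: "\<alpha> \<in> TSym \<Sigma> \<Longrightarrow> tvars (tdom \<Sigma> \<alpha>) \<subseteq> set (tctx \<Sigma> \<alpha>)"
  and tcod_tvars: "\<alpha> \<in> TSym \<Sigma> \<Longrightarrow> tvars (tcod \<Sigma> \<alpha>) \<subseteq> set (tctx \<Sigma> \<alpha>)"
  using sig unfolding signature_pair_def signature2_def by auto

lemma sty_CSym: "s \<in> Srt \<sigma> \<Longrightarrow> sty \<sigma> s \<in> CSym \<Sigma>"
  and fdom_STerms: "f \<in> Fn \<sigma> \<Longrightarrow> fdom \<sigma> f \<in> STerms \<Sigma> \<sigma>"
  and fcod_STerms: "f \<in> Fn \<sigma> \<Longrightarrow> fcod \<sigma> f \<in> STerms \<Sigma> \<sigma>"
  and fcod_type: "f \<in> Fn \<sigma> \<Longrightarrow> stype \<Sigma> \<sigma> (fcod \<sigma> f) = stype \<Sigma> \<sigma> (fdom \<sigma> f)"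
  using sig unfolding signature_pair_def signature1_def by auto

lemma MB_in: "B \<in> FSym \<Sigma> \<Longrightarrow> cell1 K (MB M B) (MP M (far \<Sigma> B)) (MC M (fres \<Sigma> B))"
  and MT_in: "\<alpha> \<in> TSym \<Sigma> \<Longrightarrow> cell2 K (MT M \<alpha>) (ctx_interp K \<Sigma> M (tctx \<Sigma> \<alpha>) (tdom \<Sigma> \<alpha>))
        (ctx_interp K \<Sigma> M (tctx \<Sigma> \<alpha>) (tcod \<Sigma> \<alpha>))"
  using model unfolding is_model_def by blast+

lemma MP_product:
  "set cs \<subseteq> CSym \<Sigma> \<Longrightarrow> two_product K {..<length cs} (\<lambda>i. MC M (cs ! i)) (MP M cs) (MPr M cs)"
  using model unfolding is_model_def
  by (intro two_product.intro two_product_axioms.intro two_category_axioms) blast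

lemma Terms_type:
  assumes "t \<in> Terms \<Sigma> X ty" "ty ` X \<subseteq> CSym \<Sigma>"
  shows "trm_type \<Sigma> ty t \<in> CSym \<Sigma>"
  using assms by (cases rule: Terms.cases) (auto simp: fres_CSym)

lemma App_args:
  assumes "map (trm_type \<Sigma> ty) ts = far \<Sigma> B"
  shows "length ts = length (far \<Sigma> B)" "i < length (far \<Sigma> B) \<Longrightarrow> trm_type \<Sigma> ty (ts ! i) = far \<Sigma> B ! i"
  using assms by (metis length_map, metis length_map nth_map)

lemma interp_in:
  assumes "t \<in> Terms \<Sigma> X ty" and x: "x \<in> Obj K" and \<rho>: "\<forall>v\<in>X. cell1 K (\<rho> v) x (MC M (ty v))"
  shows "cell1 K (interp K \<Sigma> M x \<rho> t) x (MC M (trm_type \<Sigma> ty t))"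
  using assms(1)
proof (induction rule: Terms.induct)
  case (App B ts)
  interpret P: two_product K "{..<length (far \<Sigma> B)}" "\<lambda>i. MC M (far \<Sigma> B ! i)" "MP M (far \<Sigma> B)"
      "MPr M (far \<Sigma> B)"
    by (rule MP_product[OF far_CSym[OF App.hyps(1)]])
  have "\<forall>i\<in>{..<length (far \<Sigma> B)}. cell1 K (map (interp K \<Sigma> M x \<rho>) ts ! i) x (MC M (far \<Sigma> B ! i))"
    using App.IH App_args[OF App.hyps(2)] by (metis lessThan_iff nth_map nth_mem)
  then show ?case
    using c1_in[OF P.tuple1_in[OF x] MB_in[OF App.hyps(1)]] by (simp add: mtuple1_def)
qed (use \<rho> in auto)

lemma interp_args:
  assumes "B \<in> FSym \<Sigma>" "map (trm_type \<Sigma> ty) ts = far \<Sigma> B" "set ts \<subseteq> Terms \<Sigma> X ty"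
    and x: "x \<in> Obj K" and \<rho>: "\<forall>v\<in>X. cell1 K (\<rho> v) x (MC M (ty v))"
  shows "\<forall>i\<in>{..<length (far \<Sigma> B)}. cell1 K (map (interp K \<Sigma> M x \<rho>) ts ! i) x (MC M (far \<Sigma> B ! i))"
  using interp_in[OF _ x \<rho>] App_args[OF assms(2)] assms(3)
  by (metis lessThan_iff nth_map nth_mem subsetD)

text \<open>Restriction along h passes through every operation by uniqueness of tuples. This allows
  \<open>supp_sig\<close>, defined by restricting a support, to be computed by recursion on terms
  over \<open>Msig L\<close> itself.\<close>

lemma interp_precomp:
  assumes "t \<in> Terms \<Sigma> X ty" and x: "x \<in> Obj K" and \<rho>: "\<forall>v\<in>X. cell1 K (\<rho> v) x (MC M (ty v))"
    and h: "cell1 K h y x"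
  shows "c1 K (interp K \<Sigma> M x \<rho> t) h = interp K \<Sigma> M y (\<lambda>v. c1 K (\<rho> v) h) t"
  using assms(1)
proof (induction rule: Terms.induct)
  case (App B ts)
  interpret P: two_product K "{..<length (far \<Sigma> B)}" "\<lambda>i. MC M (far \<Sigma> B ! i)" "MP M (far \<Sigma> B)"
      "MPr M (far \<Sigma> B)"
    by (rule MP_product[OF far_CSym[OF App.hyps(1)]])
  have a: "\<forall>i\<in>{..<length (far \<Sigma> B)}. cell1 K (map (interp K \<Sigma> M x \<rho>) ts ! i) x (MC M (far \<Sigma> B ! i))"
    by (rule interp_args[OF App.hyps(1,2) _ x \<rho>]) (use App.hyps in auto)
  have "c1 K (mtuple1 K M (far \<Sigma> B) x (map (interp K \<Sigma> M x \<rho>) ts)) h =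
      mtuple1 K M (far \<Sigma> B) y (map (interp K \<Sigma> M y (\<lambda>v. c1 K (\<rho> v) h)) ts)"
    unfolding mtuple1_def P.tuple1_precomp[OF x a h]
    using App.IH App_args(1)[OF App.hyps(2)] by (intro tuple1_cong) simp
  then show ?case
    using c1_assoc[OF h P.tuple1_in[OF x a] MB_in[OF App.hyps(1)]] by (simp add: mtuple1_def)
qed simp

abbreviation Fdom where
  "Fdom \<equiv> tuple1 K (Fn \<sigma>) (PF L) (prF L) (M0 L) (\<lambda>f. supp K \<Sigma> M L (fdom \<sigma> f))"
abbreviation Fcod where
  "Fcod \<equiv> tuple1 K (Fn \<sigma>) (PF L) (prF L) (M0 L) (\<lambda>f. supp K \<Sigma> M L (fcod \<sigma> f))"
abbreviation eql where
  "eql \<equiv> tuple2 K T (PT L) (prT L) (Msig L) (\<lambda>\<epsilon>. path_cell K \<Sigma> \<sigma> M L (edom \<epsilon>) (elhs \<epsilon>))"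
abbreviation eqr where
  "eqr \<equiv> tuple2 K T (PT L) (prT L) (Msig L) (\<lambda>\<epsilon>. path_cell K \<Sigma> \<sigma> M L (edom \<epsilon>) (erhs \<epsilon>))"

sublocale P0: two_product K "Srt \<sigma>" "\<lambda>s. MC M (sty \<sigma> s)" "M0 L" "pr0 L"
  using constr unfolding is_construction_def
  by (intro two_product.intro two_product_axioms.intro two_category_axioms) blast

sublocale PF: two_product K "Fn \<sigma>" "\<lambda>f. MC M (stype \<Sigma> \<sigma> (fdom \<sigma> f))" "PF L" "prF L"
  using constr unfolding is_construction_def
  by (intro two_product.intro two_product_axioms.intro two_category_axioms) blast

sublocale PT: two_product K T "\<lambda>\<epsilon>. MC M (stype \<Sigma> \<sigma> (edom \<epsilon>))" "PT L" "prT L"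
  using constr unfolding is_construction_def
  by (intro two_product.intro two_product_axioms.intro two_category_axioms) blast

lemma pr0_typed: "\<forall>s\<in>Srt \<sigma>. cell1 K (pr0 L s) (M0 L) (MC M (sty \<sigma> s))"
  using P0.pi_in by blast

lemma supp_in: "t \<in> STerms \<Sigma> \<sigma> \<Longrightarrow> cell1 K (supp K \<Sigma> M L t) (M0 L) (MC M (stype \<Sigma> \<sigma> t))"
  unfolding supp_def by (rule interp_in[OF _ P0.p_ob pr0_typed])

lemma fdom_supp: "\<forall>f\<in>Fn \<sigma>. cell1 K (supp K \<Sigma> M L (fdom \<sigma> f)) (M0 L) (MC M (stype \<Sigma> \<sigma> (fdom \<sigma> f)))"
  using supp_in fdom_STerms by blast

lemma fcod_supp: "\<forall>f\<in>Fn \<sigma>. cell1 K (supp K \<Sigma> M L (fcod \<sigma> f)) (M0 L) (MC M (stype \<Sigma> \<sigma> (fdom \<sigma> f)))"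
  using supp_in fcod_STerms fcod_type by metis

sublocale ins: two_inserter K Fdom Fcod "M0 L" "PF L" "Msig L" "usig L" "phi L"
  using constr PF.tuple1_in[OF P0.p_ob fdom_supp] PF.tuple1_in[OF P0.p_ob fcod_supp]
  unfolding is_construction_def
  by (intro two_inserter.intro two_inserter_axioms.intro two_category_axioms) blast+

sublocale eqf: two_equifier K eql eqr "Msig L" "Mth L" "eth L"
  using constr unfolding is_construction_def
  by (intro two_equifier.intro two_equifier_axioms.intro two_category_axioms) blast

lemma Msig_ob: "Msig L \<in> Obj K"
  using cell1_ob(1)[OF ins.u_in] .

lemma forgetful_in: "cell1 K (forgetful K L) (Mth L) (M0 L)"
  unfolding forgetful_def by (rule c1_in[OF eqf.u_in ins.u_in])

lemma supp_sig_in: "t \<in> STerms \<Sigma> \<sigma> \<Longrightarrow> cell1 K (supp_sig K \<Sigma> M L t) (Msig L) (MC M (stype \<Sigma> \<sigma> t))"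
  unfolding supp_sig_def by (rule c1_in[OF ins.u_in supp_in])

lemma supp_sig_interp:
  "t \<in> STerms \<Sigma> \<sigma> \<Longrightarrow> supp_sig K \<Sigma> M L t = interp K \<Sigma> M (Msig L) (\<lambda>s. c1 K (pr0 L s) (usig L)) t"
  unfolding supp_sig_def supp_def by (rule interp_precomp[OF _ P0.p_ob pr0_typed ins.u_in])

text \<open>The cell of a whiskered arrow is built from tuples out of \<open>Msig L\<close>; through
  this equation its endpoints are recognized as supports.\<close>

lemma supp_sig_App:
  assumes "App B ts \<in> STerms \<Sigma> \<sigma>"
  shows "supp_sig K \<Sigma> M L (App B ts) =
    c1 K (MB M B) (mtuple1 K M (far \<Sigma> B) (Msig L) (map (supp_sig K \<Sigma> M L) ts))"
proof -
  have "map (interp K \<Sigma> M (Msig L) (\<lambda>s. c1 K (pr0 L s) (usig L))) ts = map (supp_sig K \<Sigma> M L) ts"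
    using assms by (auto elim: Terms.cases simp: supp_sig_interp)
  then show ?thesis using supp_sig_interp[OF assms] by (simp only: interp.simps)
qed

lemma map_of_zip_nth':
  "distinct xs \<Longrightarrow> length ys = length xs \<Longrightarrow> i < length xs \<Longrightarrow> the (map_of (zip xs ys) (xs ! i)) = ys ! i"
  by (simp add: map_of_zip_nth)

lemma ctx_subst_STerms:
  assumes "t \<in> Terms \<Sigma> (Vars \<Sigma>) (vty \<Sigma>)" "tvars t \<subseteq> set xs" "distinct xs"
    and ts: "set ts \<subseteq> STerms \<Sigma> \<sigma>" "map (stype \<Sigma> \<sigma>) ts = map (vty \<Sigma>) xs"
  shows "ctx_subst xs ts t \<in> STerms \<Sigma> \<sigma> \<and> stype \<Sigma> \<sigma> (ctx_subst xs ts t) = trm_type \<Sigma> (vty \<Sigma>) t"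
  unfolding ctx_subst_def
proof (rule tsubst_type[OF Terms_tvars[OF assms(1,2)]], intro ballI)
  fix v assume "v \<in> set xs"
  then obtain i where i: "i < length xs" "v = xs ! i" by (metis in_set_conv_nth)
  have len: "length ts = length xs" using ts(2) by (metis length_map)
  have "stype \<Sigma> \<sigma> (ts ! i) = vty \<Sigma> (xs ! i)" using ts(2) i(1) len by (metis nth_map)
  then show "the (map_of (zip xs ts) v) \<in> STerms \<Sigma> \<sigma> \<and> stype \<Sigma> \<sigma> (the (map_of (zip xs ts) v)) = vty \<Sigma> v"
    using map_of_zip_nth'[OF assms(3) len i(1)] i ts(1) len by (metis nth_mem subsetD)
qed

lemma ctx_interp_precomp:
  assumes t: "t \<in> Terms \<Sigma> (Vars \<Sigma>) (vty \<Sigma>)" "tvars t \<subseteq> set xs" and xs: "distinct xs" "set xs \<subseteq> Vars \<Sigma>"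
    and h: "cell1 K h y (MP M (map (vty \<Sigma>) xs))"
  shows "c1 K (ctx_interp K \<Sigma> M xs t) h = interp K \<Sigma> M y
      (\<lambda>v. c1 K (the (map_of (zip xs (map (MPr M (map (vty \<Sigma>) xs)) [0..<length xs])) v)) h) t"
    and "cell1 K (ctx_interp K \<Sigma> M xs t) (MP M (map (vty \<Sigma>) xs)) (MC M (trm_type \<Sigma> (vty \<Sigma>) t))"
proof -
  let ?cs = "map (vty \<Sigma>) xs"
  let ?\<rho> = "\<lambda>v. the (map_of (zip xs (map (MPr M ?cs) [0..<length xs])) v)"
  have "set ?cs \<subseteq> CSym \<Sigma>" using xs(2) vty_CSym by auto
  then interpret P: two_product K "{..<length ?cs}" "\<lambda>i. MC M (?cs ! i)" "MP M ?cs" "MPr M ?cs"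
    by (rule MP_product)
  have \<rho>: "\<forall>v\<in>set xs. cell1 K (?\<rho> v) (MP M ?cs) (MC M (vty \<Sigma> v))"
  proof
    fix v assume "v \<in> set xs"
    then obtain i where i: "i < length xs" "v = xs ! i" by (metis in_set_conv_nth)
    have "?\<rho> v = MPr M ?cs i"
      using map_of_zip_nth'[OF xs(1) _ i(1), of "map (MPr M ?cs) [0..<length xs]"] i by simp
    then show "cell1 K (?\<rho> v) (MP M ?cs) (MC M (vty \<Sigma> v))" using P.pi_in[of i] i by simp
  qed
  note tx = Terms_tvars[OF t]
  show "c1 K (ctx_interp K \<Sigma> M xs t) h = interp K \<Sigma> M y (\<lambda>v. c1 K (?\<rho> v) h) t"
    unfolding ctx_interp_def Let_def by (rule interp_precomp[OF tx P.p_ob \<rho> h])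
  show "cell1 K (ctx_interp K \<Sigma> M xs t) (MP M ?cs) (MC M (trm_type \<Sigma> (vty \<Sigma>) t))"
    unfolding ctx_interp_def Let_def by (rule interp_in[OF tx P.p_ob \<rho>])
qed

text \<open>The substitution lemma for supports: interpreting in the context and then inserting the
  values of the arguments is the same as substituting first. It identifies the endpoints of the cell
  of a transformation symbol at given terms.\<close>

lemma supp_sig_ctx_subst:
  assumes t: "t \<in> Terms \<Sigma> (Vars \<Sigma>) (vty \<Sigma>)" "tvars t \<subseteq> set xs" and xs: "distinct xs" "set xs \<subseteq> Vars \<Sigma>"
    and ts: "set ts \<subseteq> STerms \<Sigma> \<sigma>" "map (stype \<Sigma> \<sigma>) ts = map (vty \<Sigma>) xs"
  shows "c1 K (ctx_interp K \<Sigma> M xs t) (mtuple1 K M (map (vty \<Sigma>) xs) (Msig L) (map (supp_sig K \<Sigma> M L) ts)) =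
      supp_sig K \<Sigma> M L (ctx_subst xs ts t)"
    and "cell1 K (mtuple1 K M (map (vty \<Sigma>) xs) (Msig L) (map (supp_sig K \<Sigma> M L) ts)) (Msig L)
      (MP M (map (vty \<Sigma>) xs))"
proof -
  let ?cs = "map (vty \<Sigma>) xs"
  let ?h = "mtuple1 K M ?cs (Msig L) (map (supp_sig K \<Sigma> M L) ts)"
  have "set ?cs \<subseteq> CSym \<Sigma>" using xs(2) vty_CSym by auto
  then interpret P: two_product K "{..<length ?cs}" "\<lambda>i. MC M (?cs ! i)" "MP M ?cs" "MPr M ?cs"
    by (rule MP_product)
  have len: "length ts = length xs" using ts(2) by (metis length_map)
  have "cell1 K (map (supp_sig K \<Sigma> M L) ts ! i) (Msig L) (MC M (?cs ! i))" if "i < length xs" for i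
  proof -
    have "stype \<Sigma> \<sigma> (ts ! i) = ?cs ! i" using ts(2) that len by (metis nth_map)
    then show ?thesis using supp_sig_in[of "ts ! i"] ts(1) that len by (simp add: subset_iff)
  qed
  then have a: "\<forall>i\<in>{..<length ?cs}. cell1 K (map (supp_sig K \<Sigma> M L) ts ! i) (Msig L) (MC M (?cs ! i))"
    by simp
  show h: "cell1 K ?h (Msig L) (MP M ?cs)"
    unfolding mtuple1_def by (rule P.tuple1_in[OF Msig_ob a])
  note st = ctx_subst_STerms[OF t xs(1) ts]
  let ?\<rho> = "\<lambda>s. c1 K (pr0 L s) (usig L)"
  have "supp_sig K \<Sigma> M L (ctx_subst xs ts t) =
      interp K \<Sigma> M (Msig L) (\<lambda>v. interp K \<Sigma> M (Msig L) ?\<rho> (the (map_of (zip xs ts) v))) t"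
    using supp_sig_interp[OF conjunct1[OF st]] by (simp only: ctx_subst_def interp_tsubst)
  also have "\<dots> = interp K \<Sigma> M (Msig L)
      (\<lambda>v. c1 K (the (map_of (zip xs (map (MPr M ?cs) [0..<length xs])) v)) ?h) t"
  proof (rule interp_cong)
    fix v assume "v \<in> tvars t"
    then obtain i where i: "i < length xs" "v = xs ! i" using t(2) by (metis in_set_conv_nth subsetD)
    have "the (map_of (zip xs (map (MPr M ?cs) [0..<length xs])) v) = MPr M ?cs i"
      using map_of_zip_nth'[OF xs(1) _ i(1), of "map (MPr M ?cs) [0..<length xs]"] i by simp
    moreover have "c1 K (MPr M ?cs i) ?h = supp_sig K \<Sigma> M L (ts ! i)"
      using P.pi_tuple1[OF Msig_ob a, of i] i(1) len unfolding mtuple1_def by simp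
    moreover have "the (map_of (zip xs ts) v) = ts ! i"
      using map_of_zip_nth'[OF xs(1) len i(1)] i by simp
    moreover have "interp K \<Sigma> M (Msig L) ?\<rho> (ts ! i) = supp_sig K \<Sigma> M L (ts ! i)"
      using supp_sig_interp[of "ts ! i"] ts(1) len i(1) by (simp add: subset_iff)
    ultimately show "interp K \<Sigma> M (Msig L) ?\<rho> (the (map_of (zip xs ts) v)) =
       c1 K (the (map_of (zip xs (map (MPr M ?cs) [0..<length xs])) v)) ?h" by simp
  qed
  also have "\<dots> = c1 K (ctx_interp K \<Sigma> M xs t) ?h"
    by (rule ctx_interp_precomp(1)[OF t xs h, symmetric])
  finally show "c1 K (ctx_interp K \<Sigma> M xs t) ?h = supp_sig K \<Sigma> M L (ctx_subst xs ts t)" by simp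
qed

lemma GArr_STerms:
  assumes "a \<in> GArr \<Sigma> \<sigma>"
  shows "adom \<Sigma> \<sigma> a \<in> STerms \<Sigma> \<sigma> \<and> acod \<Sigma> \<sigma> a \<in> STerms \<Sigma> \<sigma> \<and>
    stype \<Sigma> \<sigma> (acod \<Sigma> \<sigma> a) = stype \<Sigma> \<sigma> (adom \<Sigma> \<sigma> a)"
  using assms
proof (induction rule: GArr.induct)
  case (FnA f)
  then show ?case using fdom_STerms fcod_STerms fcod_type by simp
next
  case (TrA \<alpha> ts)
  then show ?case
    using ctx_subst_STerms[OF tdom_Terms tdom_tvars tctx_distinct]
        ctx_subst_STerms[OF tcod_Terms tcod_tvars tctx_distinct]
      tcod_type by simp
next
  case (WhA B q ls rs)
  then show ?case by (auto intro!: Terms.App)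
qed

lemma arr_cell_in:
  assumes "a \<in> GArr \<Sigma> \<sigma>"
  shows "cell2 K (arr_cell K \<Sigma> M L a) (supp_sig K \<Sigma> M L (adom \<Sigma> \<sigma> a)) (supp_sig K \<Sigma> M L (acod \<Sigma> \<sigma> a))"
  using assms
proof (induction rule: GArr.induct)
  case (FnA f)
  have d: "c1 K (prF L f) (c1 K Fdom (usig L)) = supp_sig K \<Sigma> M L (fdom \<sigma> f)"
    using c1_assoc[OF ins.u_in ins.f_in PF.pi_in[OF FnA]] PF.pi_tuple1[OF P0.p_ob fdom_supp FnA]
    by (simp add: supp_sig_def)
  have c: "c1 K (prF L f) (c1 K Fcod (usig L)) = supp_sig K \<Sigma> M L (fcod \<sigma> f)"
    using c1_assoc[OF ins.u_in ins.g_in PF.pi_in[OF FnA]] PF.pi_tuple1[OF P0.p_ob fcod_supp FnA]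
    by (simp add: supp_sig_def)
  show ?case
    using lw_in[OF PF.pi_in[OF FnA] c1_in[OF ins.u_in ins.f_in] ins.phi_in] d c by simp
next
  case (TrA \<alpha> ts)
  note d = tdom_Terms[OF TrA(1)] tdom_tvars[OF TrA(1)] tctx_distinct[OF TrA(1)] tctx_Vars[OF TrA(1)]
  note c = tcod_Terms[OF TrA(1)] tcod_tvars[OF TrA(1)] tctx_distinct[OF TrA(1)] tctx_Vars[OF TrA(1)]
  note h = supp_sig_ctx_subst(2)[OF d TrA(2,3)]
  show ?case
    using rw_in[OF h ctx_interp_precomp(2)[OF d h] MT_in[OF TrA(1)]]
      supp_sig_ctx_subst(1)[OF d TrA(2,3)] supp_sig_ctx_subst(1)[OF c TrA(2,3)] by simp
next
  case (WhA B q ls rs)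
  interpret P: two_product K "{..<length (far \<Sigma> B)}" "\<lambda>i. MC M (far \<Sigma> B ! i)" "MP M (far \<Sigma> B)"
      "MPr M (far \<Sigma> B)"
    by (rule MP_product[OF far_CSym[OF WhA(1)]])
  note q = GArr_STerms[OF WhA(2)]
  let ?ts = "ls @ adom \<Sigma> \<sigma> q # rs" and ?us = "ls @ acod \<Sigma> \<sigma> q # rs"
  let ?as = "map (\<lambda>t. id2 K (supp_sig K \<Sigma> M L t)) ls @ arr_cell K \<Sigma> M L q #
        map (\<lambda>t. id2 K (supp_sig K \<Sigma> M L t)) rs"
  have len: "length ?ts = length (far \<Sigma> B)" by (rule App_args(1)[OF WhA(4)]) 
  have ty: "stype \<Sigma> \<sigma> (?ts ! i) = far \<Sigma> B ! i" if "i < length (far \<Sigma> B)" for i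
    by (rule App_args(2)[OF WhA(4) that])
  have T: "?ts ! i \<in> STerms \<Sigma> \<sigma>" if "i < length (far \<Sigma> B)" for i
    using that len WhA(3) q nth_mem[of i ?ts] by auto
  have f: "\<forall>i\<in>{..<length (far \<Sigma> B)}. cell1 K (map (supp_sig K \<Sigma> M L) ?ts ! i) (Msig L) (MC M (far \<Sigma> B ! i))"
    using supp_sig_in[OF T] ty len by (metis lessThan_iff nth_map)
  \<comment> \<open>Position \<open>length ls\<close> holds the cell of q and all others hold
    identities, so the tuples of sources and targets differ in that position only.\<close>
  have cell: "cell2 K (?as ! i) (map (supp_sig K \<Sigma> M L) ?ts ! i) (map (supp_sig K \<Sigma> M L) ?us ! i)"
    if i: "i < length (far \<Sigma> B)" for i
  proof -
    have t: "cell2 K (id2 K (supp_sig K \<Sigma> M L t)) (supp_sig K \<Sigma> M L t) (supp_sig K \<Sigma> M L t)" if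
        "t \<in> set ls \<union> set rs" for t
      using id2_in[OF supp_sig_in] that WhA(3) by blast
    show ?thesis
      using i len t WhA.IH by (auto simp: nth_append nth_Cons split: nat.splits)
  qed
  have AA: "App B ?ts \<in> STerms \<Sigma> \<sigma>" "App B ?us \<in> STerms \<Sigma> \<sigma>"
    using GArr_STerms[OF GArr.WhA[OF WhA(1-4)]] by simp_all
  have "cell2 K (mtuple2 K M (far \<Sigma> B) (Msig L) ?as)
      (mtuple1 K M (far \<Sigma> B) (Msig L) (map (supp_sig K \<Sigma> M L) ?ts))
      (mtuple1 K M (far \<Sigma> B) (Msig L) (map (supp_sig K \<Sigma> M L) ?us))"
    unfolding mtuple1_def mtuple2_def by (rule P.tuple2_in[OF Msig_ob f]) (use cell in simp)
  moreover have "cell1 K (mtuple1 K M (far \<Sigma> B) (Msig L) (map (supp_sig K \<Sigma> M L) ?ts)) (Msig L)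
      (MP M (far \<Sigma> B))"
    unfolding mtuple1_def by (rule P.tuple1_in[OF Msig_ob f])
  ultimately show ?case
    using lw_in[OF MB_in[OF WhA(1)]] supp_sig_App[OF AA(1)] supp_sig_App[OF AA(2)] by simp
qed

lemma path_cell_in:
  assumes "is_path \<Sigma> \<sigma> t\<^sub>1 as t\<^sub>2"
  shows "t\<^sub>1 \<in> STerms \<Sigma> \<sigma> \<and> t\<^sub>2 \<in> STerms \<Sigma> \<sigma> \<and> stype \<Sigma> \<sigma> t\<^sub>2 = stype \<Sigma> \<sigma> t\<^sub>1 \<and>
    cell2 K (path_cell K \<Sigma> \<sigma> M L t\<^sub>1 as) (supp_sig K \<Sigma> M L t\<^sub>1) (supp_sig K \<Sigma> M L t\<^sub>2)"
  using assms
proof (induction as arbitrary: t\<^sub>1)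
  case Nil
  then show ?case using id2_in[OF supp_sig_in] by auto
next
  case (Cons a as)
  then have a: "a \<in> GArr \<Sigma> \<sigma>" "adom \<Sigma> \<sigma> a = t\<^sub>1" "is_path \<Sigma> \<sigma> (acod \<Sigma> \<sigma> a) as t\<^sub>2" by auto
  show ?case
    using vc_in[OF arr_cell_in[OF a(1)]] Cons.IH[OF a(3)] GArr_STerms[OF a(1)] a(2) by auto
qed

lemma eqn_STerms:
  assumes "\<epsilon> \<in> T"
  shows "edom \<epsilon> \<in> STerms \<Sigma> \<sigma>" "ecod \<epsilon> \<in> STerms \<Sigma> \<sigma>" "stype \<Sigma> \<sigma> (ecod \<epsilon>) = stype \<Sigma> \<sigma> (edom \<epsilon>)"
    "cell2 K (path_cell K \<Sigma> \<sigma> M L (edom \<epsilon>) (elhs \<epsilon>)) (supp_sig K \<Sigma> M L (edom \<epsilon>))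
        (supp_sig K \<Sigma> M L (ecod \<epsilon>))"
    "cell2 K (path_cell K \<Sigma> \<sigma> M L (edom \<epsilon>) (erhs \<epsilon>)) (supp_sig K \<Sigma> M L (edom \<epsilon>))
        (supp_sig K \<Sigma> M L (ecod \<epsilon>))"
  using is_th assms path_cell_in unfolding is_theory_def by blast+

end

section \<open>Functors of several variables\<close>

locale finite_product_category = product_category D "{..<n}" C P
  for D :: "('p, 'b) cat" and n :: nat and C :: "nat \<Rightarrow> ('o, 'a) cat" and P :: "nat \<Rightarrow> ('p, 'b, 'o, 'a) func"
      +
  assumes ob_eqI: "d \<in> Ob D \<Longrightarrow> d' \<in> Ob D \<Longrightarrow> (\<And>i. i < n \<Longrightarrow> fo (P i) d = fo (P i) d') \<Longrightarrow> d = d'"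
begin

text \<open>The arrows \<open>(id, ..., g, ..., id)\<close> to which hypotheses in one variable
  apply. The objects are read off the source; since the components are identities, the target has
  the same ones outside i.\<close>

definition varies_only :: "nat \<Rightarrow> 'b \<Rightarrow> bool" where
  "varies_only i g \<longleftrightarrow> (\<forall>j<n. j \<noteq> i \<longrightarrow> fa (P j) g = Idn (C j) (fo (P j) (Dm D g)))"

lemma varies_only_hom:
  "in_hom D g a b \<Longrightarrow> varies_only i g \<Longrightarrow> j < n \<Longrightarrow> j \<noteq> i \<Longrightarrow> fa (P j) g = Idn (C j) (fo (P j) a)"
  unfolding varies_only_def by (auto simp: in_hom_def)

lemma Pid: "d \<in> Ob D \<Longrightarrow> i < n \<Longrightarrow> in_hom (C i) (Idn (C i) (fo (P i) d)) (fo (P i) d) (fo (P i) d)"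
  using category.id_in[OF C_cat] P_ob by simp

lemma extend:
  assumes d: "d \<in> Ob D" and f: "\<And>j. j < n \<Longrightarrow> in_hom (C j) (f j) (fo (P j) d) (x j)"
  obtains d' g where "in_hom D g d d'" "\<And>j. j < n \<Longrightarrow> fo (P j) d' = x j" "\<And>j. j < n \<Longrightarrow> fa (P j) g = f j"
proof -
  have "\<exists>d'\<in>Ob D. \<forall>j\<in>{..<n}. fo (P j) d' = x j"
    using category.hom_ob(2)[OF C_cat f] by (intro tuple_ob) simp
  then obtain d' where d': "d' \<in> Ob D" "\<And>j. j < n \<Longrightarrow> fo (P j) d' = x j" by auto
  obtain g where g: "in_hom D g d d'" "\<And>j. j \<in> {..<n} \<Longrightarrow> fa (P j) g = f j"
    by (rule tuple_ar_ex[OF d d'(1), of f]) (use f d' in \<open>auto intro: that\<close>)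
  show ?thesis by (rule that[OF g(1)]) (use d' g in auto)
qed

lemma coextend:
  assumes d: "d \<in> Ob D" and f: "\<And>j. j < n \<Longrightarrow> in_hom (C j) (f j) (x j) (fo (P j) d)"
  obtains d' g where "in_hom D g d' d" "\<And>j. j < n \<Longrightarrow> fo (P j) d' = x j" "\<And>j. j < n \<Longrightarrow> fa (P j) g = f j"
proof -
  have "\<exists>d'\<in>Ob D. \<forall>j\<in>{..<n}. fo (P j) d' = x j"
    using category.hom_ob(1)[OF C_cat f] by (intro tuple_ob) simp
  then obtain d' where d': "d' \<in> Ob D" "\<And>j. j < n \<Longrightarrow> fo (P j) d' = x j" by auto
  obtain g where g: "in_hom D g d' d" "\<And>j. j \<in> {..<n} \<Longrightarrow> fa (P j) g = f j"
    by (rule tuple_ar_ex[OF d'(1) d, of f]) (use f d' in \<open>auto intro: that\<close>)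
  show ?thesis by (rule that[OF g(1)]) (use d' g in auto)
qed

text \<open>One step in factoring g into n arrows that each move a single component: h has already
  moved the components below k, and m moves component k.\<close>

lemma stage:
  assumes g: "in_hom D g a b" and k: "k < n"
    and h: "in_hom D h a d" "\<And>j. j < n \<Longrightarrow> fa (P j) h = (if j < k then fa (P j) g else Idn (C j)
        (fo (P j) a))"
  obtains m d' where "in_hom D m d d'" "varies_only k m" "fa (P k) m = fa (P k) g"
    "\<And>j. j < n \<Longrightarrow> fa (P j) (Cmp D m h) = (if j < Suc k then fa (P j) g else Idn (C j) (fo (P j) a))"
proof -
  have a: "a \<in> Ob D" and d: "d \<in> Ob D" using D.hom_ob h by blast+
  have Pd: "fo (P j) d = (if j < k then fo (P j) b else fo (P j) a)" if "j < n" for j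
    using in_homD(3)[OF P_hom[OF _ h(1), of j]] h(2)[OF that] in_homD(3)[OF P_hom[OF _ g, of j]]
      in_homD(3)[OF Pid[OF a that]] that by (auto split: if_splits)
  obtain d' m where m: "in_hom D m d d'" "\<And>j. j < n \<Longrightarrow> fo (P j) d' =
      (if j = k then fo (P k) b else fo (P j) d)"
    "\<And>j. j < n \<Longrightarrow> fa (P j) m = (if j = k then fa (P k) g else Idn (C j) (fo (P j) d))"
    by (rule extend[OF d, of "\<lambda>j. if j = k then fa (P k) g else Idn (C j) (fo (P j) d)"
          "\<lambda>j. if j = k then fo (P k) b else fo (P j) d"])
       (use Pid[OF d] P_hom[OF _ g] Pd k in \<open>auto intro: that\<close>)
  show ?thesis
  proof (rule that[OF m(1)])
    show "varies_only k m" using m(1,3) by (simp add: varies_only_def in_homD)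
    show "fa (P k) m = fa (P k) g" using m(3)[OF k] by simp
    fix j assume j: "j < n"
    note Ph = P_hom[OF _ h(1), of j] and Pg = P_hom[OF _ g, of j]
    have "fa (P j) (Cmp D m h) = Cmp (C j) (fa (P j) m) (fa (P j) h)"
      using P_comp[OF _ h(1) m(1)] j by simp
    also have "\<dots> = (if j = k then Cmp (C j) (fa (P k) g) (Idn (C j) (fo (P j) a)) else fa (P j) h)"
      using m(3)[OF j] h(2)[OF j] category.comp_id_left[OF C_cat Ph] j by simp
    also have "\<dots> = (if j < Suc k then fa (P j) g else Idn (C j) (fo (P j) a))"
      using h(2)[OF j] category.comp_id_right[OF C_cat Pg] j by (auto simp: less_Suc_eq)
    finally show "fa (P j) (Cmp D m h) = (if j < Suc k then fa (P j) g else Idn (C j) (fo (P j) a))" .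
  qed
qed

text \<open>The staged factorization ends in an object known only through its components;
  \<open>ob_eqI\<close> identifies it with the target of g.\<close>

lemma joint_eq:
  assumes "in_hom D g a b" "in_hom D h a d" "\<And>j. j < n \<Longrightarrow> fa (P j) h = fa (P j) g"
  shows "h = g"
proof -
  have "d = b"
    using assms(3) in_homD(3)[OF P_hom[OF _ assms(1)]] in_homD(3)[OF P_hom[OF _ assms(2)]]
      D.hom_ob[OF assms(1)] D.hom_ob[OF assms(2)] by (intro ob_eqI) force+
  then show ?thesis using assms by (intro ar_eqI[OF _ assms(1)]) auto
qed

text \<open>g is a composite of arrows that move one component each, so a class closed under
  composition contains \<open>H g\<close>. Identities start the composite and settle the case of no
  variables.\<close>

lemma joint_class:
  assumes E: "category E" and H: "is_functor D E H"
    and one: "\<And>i g. i < n \<Longrightarrow> g \<in> Ar D \<Longrightarrow> varies_only i g \<Longrightarrow> fa (P i) g \<in> X i \<Longrightarrow> fa H g \<in> Y"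
    and id: "\<And>a. a \<in> Ob E \<Longrightarrow> Idn E a \<in> Y"
    and comp: "\<And>f g a b c. f \<in> Y \<Longrightarrow> g \<in> Y \<Longrightarrow> in_hom E f a b \<Longrightarrow> in_hom E g b c \<Longrightarrow> Cmp E g f \<in> Y"
    and g: "in_hom D g a b" "\<And>i. i < n \<Longrightarrow> fa (P i) g \<in> X i"
  shows "fa H g \<in> Y"
proof -
  note a = D.hom_ob(1)[OF g(1)]
  have "\<exists>d h. in_hom D h a d \<and> fa H h \<in> Y \<and>
      (\<forall>j<n. fa (P j) h = (if j < k then fa (P j) g else Idn (C j) (fo (P j) a)))" if "k \<le> n" for k
    using that
  proof (induction k)
    case 0
    have "fa H (Idn D a) \<in> Y" using functor_id[OF H a] id[OF functor_ob[OF H a]] by simp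
    then show ?case using D.id_in[OF a] P_id[OF _ a] by (intro exI[of _ a] exI[of _ "Idn D a"]) auto
  next
    case (Suc k)
    then obtain d h where h: "in_hom D h a d" "fa H h \<in> Y"
      "\<And>j. j < n \<Longrightarrow> fa (P j) h = (if j < k then fa (P j) g else Idn (C j) (fo (P j) a))" by auto
    have k: "k < n" using Suc.prems by simp
    obtain m d' where m: "in_hom D m d d'" "varies_only k m" "fa (P k) m = fa (P k) g"
      "\<And>j. j < n \<Longrightarrow> fa (P j) (Cmp D m h) = (if j < Suc k then fa (P j) g else Idn (C j) (fo (P j) a))"
      by (rule stage[OF g(1) k h(1,3)]) (assumption, rule that)
    have "fa H m \<in> Y" using one[OF k in_homD(1)[OF m(1)] m(2)] m(3) g(2)[OF k] by simp
    then have "fa H (Cmp D m h) \<in> Y"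
      using comp[OF h(2) _ functor_hom[OF H h(1)] functor_hom[OF H m(1)]] functor_comp[OF H h(1) m(1)] by
          simp
    then show ?case using D.comp_in[OF h(1) m(1)] m(4) by blast
  qed
  from this[OF order_refl] obtain d h where h: "in_hom D h a d" "fa H h \<in> Y" "\<forall>j<n. fa (P j) h = fa (P j) g"
    by auto
  then show ?thesis using joint_eq[OF g(1) h(1)] by simp
qed

text \<open>Reflexivity allows to vary one argument at a time: composing with the common section in all
  other arguments turns \<open>k H(p) = k H(q)\<close> into the equation for a single argument.\<close>

lemma joint_reflexive_coeqs:
  assumes E: "category E" and H: "is_functor D E H"
    and one: "\<And>i p q e. i < n \<Longrightarrow> in_hom D p (Dm D p) (Dm D e) \<Longrightarrow> in_hom D q (Dm D p) (Dm D e) \<Longrightarrow> e \<in> Ar D \<Longrightarrow>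
      varies_only i p \<Longrightarrow> varies_only i q \<Longrightarrow> varies_only i e \<Longrightarrow>
      is_reflexive_pair (C i) (fa (P i) p) (fa (P i) q) \<Longrightarrow>
      is_coequalizer (C i) (fa (P i) p) (fa (P i) q) (fa (P i) e) \<Longrightarrow>
      is_coequalizer E (fa H p) (fa H q) (fa H e)"
    and refl: "is_reflexive_pair D p q" and co: "is_coequalizer D p q e"
  shows "is_coequalizer E (fa H p) (fa H q) (fa H e)"
proof -
  interpret E: category E by fact
  obtain a b s where s: "in_hom D p a b" "in_hom D q a b" "in_hom D s b a" "Cmp D p s = Idn D b"
      "Cmp D q s = Idn D b"
    using refl unfolding is_reflexive_pair_def by blast
  obtain c where e: "in_hom D e b c" "Cmp D e p = Cmp D e q"
    using co s(1) by (metis is_coequalizerE in_homD(3))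
  have ob: "a \<in> Ob D" "b \<in> Ob D" "c \<in> Ob D" using D.hom_ob s e by blast+
  have reflC: "is_reflexive_pair (C i) (fa (P i) p) (fa (P i) q)" if "i < n" for i
    using P_hom[OF _ s(1), of i] P_hom[OF _ s(2), of i] P_hom[OF _ s(3), of i] P_comp[OF _ s(3,1), of i]
      P_comp[OF _ s(3,2), of i] s(4,5) P_id[OF _ ob(2), of i] that
    unfolding is_reflexive_pair_def by (metis lessThan_iff)
  have coC: "is_coequalizer (C i) (fa (P i) p) (fa (P i) q) (fa (P i) e)" if "i < n" for i
    using P_coequalizer[OF _ co] that by simp
  \<comment> \<open>The pair p, q is planted in component i over an arbitrary base d, with
    identities elsewhere. The base has to be arbitrary because earlier stages have already replaced
    other components.\<close>
  have single: "\<exists>y p' q'. in_hom D p' y d \<and> in_hom D q' y d \<and> varies_only i p' \<and> varies_only i q' \<and>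
      fa (P i) p' = fa (P i) p \<and> fa (P i) q' = fa (P i) q \<and> is_coequalizer E (fa H p') (fa H q') (fa H g)"
    if i: "i < n" and g: "in_hom D g d d'" "varies_only i g" "fa (P i) g = fa (P i) e" for i g d d'
  proof -
    have d: "d \<in> Ob D" using D.hom_ob g by blast
    have Pd: "fo (P i) d = fo (P i) b"
      using in_homD(2)[OF P_hom[OF _ g(1), of i]] in_homD(2)[OF P_hom[OF _ e(1), of i]] g(3) i by simp
    let ?x = "\<lambda>j. if j = i then fo (P i) a else fo (P j) d"
    obtain y p' where p': "in_hom D p' y d" "\<And>j. j < n \<Longrightarrow> fo (P j) y = ?x j"
      "\<And>j. j < n \<Longrightarrow> fa (P j) p' = (if j = i then fa (P i) p else Idn (C j) (fo (P j) d))"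
      by (rule coextend[OF d, of "\<lambda>j. if j = i then fa (P i) p else Idn (C j) (fo (P j) d)" ?x])
         (use Pid[OF d] P_hom[OF _ s(1)] Pd i in \<open>auto intro: that\<close>)
    have y: "y \<in> Ob D" using D.hom_ob p' by blast
    obtain q' where q': "in_hom D q' y d"
      "\<And>j. j \<in> {..<n} \<Longrightarrow> fa (P j) q' = (if j = i then fa (P i) q else Idn (C j) (fo (P j) d))"
      by (rule tuple_ar_ex[OF y d, of "\<lambda>j. if j = i then fa (P i) q else Idn (C j) (fo (P j) d)"])
         (use Pid[OF d] P_hom[OF _ s(2)] Pd i p'(2) in \<open>auto intro: that\<close>)
    have v: "varies_only i p'" "varies_only i q'"
      using p' q' by (auto simp: varies_only_def in_homD)
    have "is_coequalizer E (fa H p') (fa H q') (fa H g)"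
    proof (rule one[OF i])
      have P: "fa (P i) p' = fa (P i) p" "fa (P i) q' = fa (P i) q" using p'(3)[OF i] q'(2)[of i] i by auto
      show "is_reflexive_pair (C i) (fa (P i) p') (fa (P i) q')"
        "is_coequalizer (C i) (fa (P i) p') (fa (P i) q') (fa (P i) g)"
        unfolding P g(3) using reflC[OF i] coC[OF i] by auto
    qed (use p'(1) q'(1) g v in \<open>auto simp: in_homD\<close>)
    then show ?thesis using p'(1) q'(1) v p'(3)[OF i] q'(2)[of i] i
      by (intro exI[of _ y] exI[of _ p'] exI[of _ q'] conjI) simp_all
  qed
  define epi where "epi = {f \<in> Ar E. \<forall>z g h. in_hom E g (Cd E f) z \<and> in_hom E h (Cd E f) z \<and>
    Cmp E g f = Cmp E h f \<longrightarrow> g = h}"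
  have epiD: "g = h" if "f \<in> epi" "in_hom E f x y" "in_hom E g y z" "in_hom E h y z" "Cmp E g f = Cmp E h f"
    for f g h x y z
    using that unfolding epi_def by (auto simp: in_homD)
  have epiI: "f \<in> epi" if "in_hom E f x y" "\<And>z g h. in_hom E g y z \<Longrightarrow> in_hom E h y z \<Longrightarrow>
      Cmp E g f = Cmp E h f \<Longrightarrow> g = h" for f x y
    using that unfolding epi_def by (auto simp: in_homD)
  \<comment> \<open>A coequalizer is epi, so \<open>H\<close> sends a move by e in one component to
    an epi. Composing such moves covers every arrow whose components are all e or
    identities.\<close>
  have H_epi: "fa H g \<in> epi" if g: "in_hom D g d d'"
    and id_or_e: "\<And>i. i < n \<Longrightarrow> fa (P i) g \<in> {Idn (C i) z | z. z \<in> Ob (C i)} \<union> {fa (P i) e}" for g d d'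
  proof (rule joint_class[OF E H _ _ _ g id_or_e])
    fix i g assume i: "i < n" and g: "g \<in> Ar D" "varies_only i g"
      and gi: "fa (P i) g \<in> {Idn (C i) z | z. z \<in> Ob (C i)} \<union> {fa (P i) e}"
    have gh: "in_hom D g (Dm D g) (Cd D g)" by (rule D.ar_hom[OF g(1)])
    note d = D.hom_ob(1)[OF gh]
    show "fa H g \<in> epi"
    proof (cases "fa (P i) g = fa (P i) e")
      case True
      then obtain p' q' where "is_coequalizer E (fa H p') (fa H q') (fa H g)"
        using single[OF i gh g(2)] by blast
      then show ?thesis
        using E.coequalizer_eqI functor_hom[OF H gh] by (intro epiI) blast+
    next
      case False
      then obtain z where z: "z \<in> Ob (C i)" "fa (P i) g = Idn (C i) z" using gi by blast
      have "z = fo (P i) (Dm D g)"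
        using in_homD(2)[OF P_hom[OF _ gh, of i]] in_homD(2)[OF category.id_in[OF C_cat z(1)]] i z(2) by
            simp
      then have "Idn D (Dm D g) = g"
        using z(2) varies_only_hom[OF gh g(2)] P_id[OF _ d] by (intro joint_eq[OF gh D.id_in[OF d]])
            (metis lessThan_iff)
      then have "fa H g = Idn E (fo H (Dm D g))" using functor_id[OF H d] by simp
      then show ?thesis
        using E.id_in[OF functor_ob[OF H d]] E.comp_id_right by (intro epiI) auto
    qed
  next
    fix x assume x: "x \<in> Ob E"
    show "Idn E x \<in> epi" using E.id_in[OF x] E.comp_id_right by (intro epiI) auto
  next
    fix f g x y z assume f: "f \<in> epi" "g \<in> epi" "in_hom E f x y" "in_hom E g y z"
    show "Cmp E g f \<in> epi"
    proof (rule epiI[OF E.comp_in[OF f(3,4)]])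
      fix w k l assume k: "in_hom E k z w" "in_hom E l z w" "Cmp E k (Cmp E g f) = Cmp E l (Cmp E g f)"
      then have "Cmp E (Cmp E k g) f = Cmp E (Cmp E l g) f"
        using E.comp_assoc[OF f(3,4)] by simp
      then have "Cmp E k g = Cmp E l g"
        using epiD[OF f(1,3)] E.comp_in[OF f(4) k(1)] E.comp_in[OF f(4) k(2)] by blast
      then show "k = l" using epiD[OF f(2,4) k(1,2)] by blast
    qed
  qed
  show ?thesis
  proof (rule is_coequalizerI[OF functor_hom[OF H s(1)] functor_hom[OF H s(2)] functor_hom[OF H e(1)]])
    show "Cmp E (fa H e) (fa H p) = Cmp E (fa H e) (fa H q)"
      by (rule functor_square[OF H s(1) e(1) s(2) e(1) e(2)])
    fix z u assume u: "in_hom E u (fo H b) z" "Cmp E u (fa H p) = Cmp E u (fa H q)"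
    \<comment> \<open>u is factored one component at a time: after k steps h applies e in the
      components below k and v is the remaining factor. At k = n the arrow h is e itself.\<close>
    have "\<exists>d h v. in_hom D h b d \<and> in_hom E v (fo H d) z \<and> Cmp E v (fa H h) = u \<and>
        (\<forall>j<n. fa (P j) h = (if j < k then fa (P j) e else Idn (C j) (fo (P j) b)))" if "k \<le> n" for k
      using that
    proof (induction k)
      case 0
      show ?case
        using D.id_in[OF ob(2)] P_id[OF _ ob(2)] functor_id[OF H ob(2)] u(1) E.comp_id_right[OF u(1)]
        by (intro exI[of _ b] exI[of _ "Idn D b"] exI[of _ u]) auto
    next
      case (Suc k)
      then obtain d h v where h: "in_hom D h b d" "in_hom E v (fo H d) z" "Cmp E v (fa H h) = u"
        "\<And>j. j < n \<Longrightarrow> fa (P j) h = (if j < k then fa (P j) e else Idn (C j) (fo (P j) b))" by auto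
      have k: "k < n" using Suc.prems by simp
      obtain m d' where m: "in_hom D m d d'" "varies_only k m" "fa (P k) m = fa (P k) e"
        "\<And>j. j < n \<Longrightarrow> fa (P j) (Cmp D m h) = (if j < Suc k then fa (P j) e else Idn (C j) (fo (P j) b))"
        by (rule stage[OF e(1) k h(1,4)]) (assumption, rule that)
      obtain y p' q' where p': "in_hom D p' y d" "in_hom D q' y d" "varies_only k p'" "varies_only k q'"
        "fa (P k) p' = fa (P k) p" "fa (P k) q' = fa (P k) q" and
            com: "is_coequalizer E (fa H p') (fa H q') (fa H m)"
        using single[OF k m(1-3)] by blast
      have y: "y \<in> Ob D" and d: "d \<in> Ob D" using D.hom_ob p' by blast+
      have Pyk: "fo (P k) y = fo (P k) a"
        using in_homD(2)[OF P_hom[OF _ p'(1), of k]] in_homD(2)[OF P_hom[OF _ s(1), of k]] p'(5) k by simp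
      have Pyj: "fo (P j) y = fo (P j) d" if "j < n" "j \<noteq> k" for j
        using in_homD(3)[OF P_hom[OF _ p'(1), of j]] varies_only_hom[OF p'(1,3) that]
            in_homD(3)[OF Pid[OF y that(1)]] that
        by simp
      \<comment> \<open>The object w agrees with a in component k and with b elsewhere. The arrow t
        leads to the source y of the planted pair and is h outside k; r leads to a and is the
        section s outside k. Because s is a section of both p and q, t followed by a planted arrow
        equals r followed by the original arrow and then by h.\<close>
      let ?w = "\<lambda>j. if j = k then fo (P k) a else fo (P j) b"
      have "in_hom (C j) (if j = k then Idn (C k) (fo (P k) a) else fa (P j) h) (?w j) (fo (P j) y)" if
          "j < n" for j
        using that Pyk Pyj[OF that] Pid[OF ob(1) k] P_hom[OF _ h(1), of j] by simp
      then obtain w t where t: "in_hom D t w y" "\<And>j. j < n \<Longrightarrow> fo (P j) w = ?w j"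
        "\<And>j. j < n \<Longrightarrow> fa (P j) t = (if j = k then Idn (C k) (fo (P k) a) else fa (P j) h)"
        by (rule coextend[OF y, of "\<lambda>j. if j = k then Idn (C k) (fo (P k) a) else fa (P j) h" ?w])
            (assumption, rule that)
      have w: "w \<in> Ob D" using D.hom_ob t by blast
      have "in_hom (C j) (if j = k then Idn (C k) (fo (P k) a) else fa (P j) s) (fo (P j) w) (fo (P j) a)"
          if "j \<in> {..<n}" for j
        using that t(2)[of j] Pid[OF ob(1) k] P_hom[OF _ s(3), of j] by simp
      then obtain r where r: "in_hom D r w a"
        "\<And>j. j \<in> {..<n} \<Longrightarrow> fa (P j) r = (if j = k then Idn (C k) (fo (P k) a) else fa (P j) s)"
        by (rule tuple_ar_ex[OF w ob(1), of "\<lambda>j. if j = k then Idn (C k) (fo (P k) a) else fa (P j) s"])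
            (assumption, rule that)
      have sq: "Cmp D y' t = Cmp D h (Cmp D x' r)"
        if oo: "in_hom D y' y d" "varies_only k y'" "fa (P k) y' = fa (P k) x'" "in_hom D x' a b"
            "Cmp D x' s = Idn D b" for x' y'
      proof (rule ar_eqI[OF D.comp_in[OF t(1) oo(1)] D.comp_in[OF D.comp_in[OF r(1) oo(4)] h(1)]])
        fix j assume jn: "j \<in> {..<n}"
        then have j: "j < n" by simp
        interpret Cj: category "C j" by (rule C_cat[OF jn])
        have l: "fa (P j) (Cmp D y' t) = Cmp (C j) (fa (P j) y') (fa (P j) t)"
          by (rule P_comp[OF jn t(1) oo(1)])
        have rr: "fa (P j) (Cmp D h (Cmp D x' r)) = Cmp (C j) (fa (P j) h)
            (Cmp (C j) (fa (P j) x') (fa (P j) r))"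
          using P_comp[OF jn D.comp_in[OF r(1) oo(4)] h(1)] P_comp[OF jn r(1) oo(4)] by simp
        show "fa (P j) (Cmp D y' t) = fa (P j) (Cmp D h (Cmp D x' r))"
        proof (cases "j = k")
          case True
          have "in_hom (C j) (fa (P j) x') (fo (P j) a) (fo (P j) b)" by (rule P_hom[OF jn oo(4)])
          then show ?thesis
            unfolding l rr using True oo(3) t(3)[OF j] r(2)[OF jn] h(4)[OF j] Cj.comp_id_right
                Cj.comp_id_left by simp
        next
          case False
          have "Cmp (C j) (fa (P j) x') (fa (P j) s) = Idn (C j) (fo (P j) b)"
            using P_comp[OF jn s(3) oo(4)] oo(5) P_id[OF jn ob(2)] by simp
          then show ?thesis
            unfolding l rr using False t(3)[OF j] r(2)[OF jn] varies_only_hom[OF oo(1,2) j] Pyj[OF j]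
              Cj.comp_id_left[OF P_hom[OF jn h(1)]] Cj.comp_id_right[OF P_hom[OF jn h(1)]] by simp
        qed
      qed
      have vo: "Cmp E (Cmp E v (fa H y')) (fa H t) = Cmp E (Cmp E u (fa H x')) (fa H r)"
        if oo: "in_hom D y' y d" "varies_only k y'" "fa (P k) y' = fa (P k) x'" "in_hom D x' a b"
            "Cmp D x' s = Idn D b" for x' y'
      proof -
        have "Cmp E (Cmp E v (fa H y')) (fa H t) = Cmp E v (fa H (Cmp D y' t))"
          using E.comp_assoc[OF functor_hom[OF H t(1)] functor_hom[OF H oo(1)] h(2)]
              functor_comp[OF H t(1) oo(1)] by simp
        also have "\<dots> = Cmp E v (Cmp E (fa H h) (Cmp E (fa H x') (fa H r)))"
          using sq[OF oo] functor_comp[OF H D.comp_in[OF r(1) oo(4)] h(1)] functor_comp[OF H r(1) oo(4)] by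
              simp
        also have "\<dots> = Cmp E u (Cmp E (fa H x') (fa H r))"
          using E.comp_assoc[OF E.comp_in[OF functor_hom[OF H r(1)] functor_hom[OF H oo(4)]]
              functor_hom[OF H h(1)] h(2)] h(3)
          by simp
        also have "\<dots> = Cmp E (Cmp E u (fa H x')) (fa H r)"
          by (rule E.comp_assoc[OF functor_hom[OF H r(1)] functor_hom[OF H oo(4)] u(1)])
        finally show ?thesis .
      qed
      \<comment> \<open>The equation in one variable has been obtained only after precomposition
        with \<open>H t\<close>. Each component of t is an identity or e, so \<open>H t\<close> is
        epi and can be cancelled.\<close>
      have "fa H t \<in> epi"
      proof (rule H_epi[OF t(1)])
        fix i assume i: "i < n"
        have "fo (P i) b \<in> Ob (C i)" "fo (P i) a \<in> Ob (C i)" using P_ob ob i by auto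
        then show "fa (P i) t \<in> {Idn (C i) z | z. z \<in> Ob (C i)} \<union> {fa (P i) e}"
          using t(3)[OF i] h(4)[OF i] by auto
      qed
      moreover have "Cmp E (Cmp E v (fa H p')) (fa H t) = Cmp E (Cmp E v (fa H q')) (fa H t)"
        using vo[OF p'(1,3,5) s(1,4)] vo[OF p'(2,4,6) s(2,5)] u(2) by simp
      ultimately have "Cmp E v (fa H p') = Cmp E v (fa H q')"
        using epiD[OF _ functor_hom[OF H t(1)] E.comp_in[OF functor_hom[OF H p'(1)] h(2)]
            E.comp_in[OF functor_hom[OF H p'(2)] h(2)]]
        by blast
      then obtain v' where v': "in_hom E v' (fo H d') z" "Cmp E v' (fa H m) = v"
        using is_coequalizer_fac[OF com functor_hom[OF H m(1)] h(2)] by blast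
      have "Cmp E v' (fa H (Cmp D m h)) = u"
        using functor_comp[OF H h(1) m(1)] E.comp_assoc[OF functor_hom[OF H h(1)] functor_hom[OF H m(1)]
            v'(1)] v'(2) h(3)
        by simp
      then show ?case using D.comp_in[OF h(1) m(1)] v'(1) m(4) by blast
    qed
    from this[OF order_refl] obtain d h v where h: "in_hom D h b d" "in_hom E v (fo H d) z"
      "Cmp E v (fa H h) = u" "\<forall>j<n. fa (P j) h = fa (P j) e"
      by auto
    have "h = e" using joint_eq[OF e(1) h(1)] h(4) by simp
    moreover from this have "d = c" using h(1) e(1) by (simp add: in_hom_def)
    ultimately show "\<exists>h. in_hom E h (fo H c) z \<and> Cmp E h (fa H e) = u" using h by blast
  next
    fix z u u' assume u: "in_hom E u (fo H c) z" "in_hom E u' (fo H c) z"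
        "Cmp E u (fa H e) = Cmp E u' (fa H e)"
    show "u = u'" by (rule epiD[OF H_epi[OF e(1)] functor_hom[OF H e(1)] u]) simp
  qed
qed

end

section \<open>Representable structure on the category of models\<close>

text \<open>Precomposition and postcomposition commute on genuine cells, not as HOL functions;
  agreement on the objects and arrows of the source category is enough.\<close>

lemma is_limit_comp_cong:
  assumes S: "category S" "is_functor S A H" and A: "category A"
    and a: "\<And>j. j \<in> Ob S \<Longrightarrow> l j \<in> Ar A"
    and a': "fo F (fo G a) = fo F' (fo G' a)"
    and o: "\<And>b. b \<in> Ob A \<Longrightarrow> fo F (fo G b) = fo F' (fo G' b)"
    and f: "\<And>f. f \<in> Ar A \<Longrightarrow> fa F (fa G f) = fa F' (fa G' f)"
  shows "is_limit S D (func_comp F (func_comp G H)) (fo F (fo G a)) (\<lambda>j. fa F (fa G (l j))) \<longleftrightarrow>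
    is_limit S D (func_comp F' (func_comp G' H)) (fo F' (fo G' a)) (\<lambda>j. fa F' (fa G' (l j)))"
  unfolding a'
proof (rule is_limit_cong[OF S(1)])
  show "fo (func_comp F (func_comp G H)) j = fo (func_comp F' (func_comp G' H)) j" if "j \<in> Ob S" for j
    using o[OF functor_ob[OF S(2) that]] by (simp add: func_comp_def)
  show "fa (func_comp F (func_comp G H)) k = fa (func_comp F' (func_comp G' H)) k" if "k \<in> Ar S" for k
    using f[OF in_homD(1)[OF functor_hom[OF S(2) category.ar_hom[OF S(1) that]]]] by
        (simp add: func_comp_def)
  show "fa F (fa G (l j)) = fa F' (fa G' (l j))" if "j \<in> Ob S" for j
    by (rule f[OF a[OF that]])
qed

text \<open>The diagonal is the common section. Through this, preservation of reflexive coequalizers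
  yields the arity condition of the exact case.\<close>

lemma kernel_pair_reflexive:
  assumes "category C" "is_kernel_pair C p q"
  shows "is_reflexive_pair C p q"
proof -
  interpret category C by fact
  obtain f where pb: "is_pullback C f f p q" using assms(2) unfolding is_kernel_pair_def by blast
  obtain a c d where h: "in_hom C f a c" "in_hom C p d a" "in_hom C q d a"
    using is_pullbackE[OF pb] by (metis in_homD(2))
  have i: "in_hom C (Idn C a) a a" using id_in hom_ob h by blast
  obtain s where "in_hom C s a d" "Cmp C p s = Idn C a" "Cmp C q s = Idn C a"
    using is_pullback_fac[OF pb h(2,3) i i refl] .
  then show ?thesis using h unfolding is_reflexive_pair_def by blast
qed

context two_category
begin

lemma precomp_postcomp:
  assumes "cell1 K f x y" "cell1 K h z w"
  shows "g \<in> Ob (hom_cat K y z) \<Longrightarrow> fo (postcomp K h) (fo (precomp K f) g) = fo (precomp K f)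
      (fo (postcomp K h) g)"
    "\<alpha> \<in> Ar (hom_cat K y z) \<Longrightarrow> fa (postcomp K h) (fa (precomp K f) \<alpha>) = fa (precomp K f)
        (fa (postcomp K h) \<alpha>)"
proof -
  show "g \<in> Ob (hom_cat K y z) \<Longrightarrow> fo (postcomp K h) (fo (precomp K f) g) = fo (precomp K f)
      (fo (postcomp K h) g)"
    using c1_assoc[OF assms(1) _ assms(2)] by (simp add: postcomp_sel precomp_sel Ob_hom_cat)
  assume "\<alpha> \<in> Ar (hom_cat K y z)"
  then have "cell1 K (Dm (vert K) \<alpha>) y z" "cell2 K \<alpha> (Dm (vert K) \<alpha>) (Cd (vert K) \<alpha>)"
    by (auto simp: hom_ar in_hom_hom_cat)
  then show "fa (postcomp K h) (fa (precomp K f) \<alpha>) = fa (precomp K f) (fa (postcomp K h) \<alpha>)"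
    using rw_lw[OF assms(1) _ _ assms(2)] by (simp add: postcomp_sel precomp_sel)
qed

lemma rep_preservesI:
  assumes "cell1 K h y z" "\<And>x. x \<in> Obj K \<Longrightarrow> P (hom_cat K x y) (hom_cat K x z) (postcomp K h)"
  shows "rep_preserves P K h"
  using assms(2) in_homD(2,3)[OF assms(1)] unfolding rep_preserves_def by simp

lemma rep_preservesD:
  assumes "rep_preserves P K h" "cell1 K h y z" "x \<in> Obj K"
  shows "P (hom_cat K x y) (hom_cat K x z) (postcomp K h)"
  using assms(1,3) in_homD(2,3)[OF assms(2)] unfolding rep_preserves_def by simp

end

context two_product
begin

text \<open>Precomposition commutes with the projections, so both preservation statements can be
  checked in each factor.\<close>

lemma product_rep_regular:
  assumes "\<And>i. i \<in> I \<Longrightarrow> rep_regular K (c i)"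
  shows "rep_regular K p"
  unfolding rep_regular_def
proof (intro conjI ballI allI impI)
  fix x assume x: "x \<in> Obj K"
  interpret product_category "hom_cat K x p" I "\<lambda>i. hom_cat K x (c i)" "\<lambda>i. postcomp K (\<pi> i)"
    by (rule hom_product[OF x])
  show "regular_category (hom_cat K x p)"
    using assms x unfolding rep_regular_def by (intro product_regular) blast
next
  fix x y f assume f: "cell1 K f x y"
  note xy = cell1_ob[OF f]
  interpret X: product_category "hom_cat K x p" I "\<lambda>i. hom_cat K x (c i)" "\<lambda>i. postcomp K (\<pi> i)"
    by (rule hom_product[OF xy(1)])
  interpret Y: product_category "hom_cat K y p" I "\<lambda>i. hom_cat K y (c i)" "\<lambda>i. postcomp K (\<pi> i)"
    by (rule hom_product[OF xy(2)])
  note pp = precomp_postcomp[OF f pi_in]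
  show "preserves_finite_limits (hom_cat K y p) (hom_cat K x p) (precomp K f)"
    unfolding preserves_finite_limits_def
  proof (intro allI impI, elim conjE)
    fix S H a l assume S: "finite_shape S" "is_functor S (hom_cat K y p) H" and
        l: "is_limit S (hom_cat K y p) H a l"
    have cS: "category S" using S(1) by (simp add: finite_shape_def)
    note lc = limit_cone[OF l] and pf = precomp_functor[OF f]
    have lh: "in_hom (hom_cat K y p) (l j) a (fo H j)" if "j \<in> Ob S" for j by (rule coneD(2)[OF lc that])
    show "is_limit S (hom_cat K x p) (func_comp (precomp K f) H) (fo (precomp K f) a)
        (\<lambda>j. fa (precomp K f) (l j))"
    proof (rule X.limitI[OF cS functor_func_comp[OF S(2) pf] functor_ob[OF pf coneD(1)[OF lc]]])
      show "in_hom (hom_cat K x p) (fa (precomp K f) (l j)) (fo (precomp K f) a)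
          (fo (func_comp (precomp K f) H) j)"
        if "j \<in> Ob S" for j
        using functor_hom[OF pf lh[OF that]] by (simp add: func_comp_def)
      fix i assume i: "i \<in> I"
      have "is_limit S (hom_cat K x (c i)) (func_comp (precomp K f) (func_comp (postcomp K (\<pi> i)) H))
          (fo (precomp K f) (fo (postcomp K (\<pi> i)) a)) (\<lambda>j. fa (precomp K f) (fa (postcomp K (\<pi> i)) (l j)))"
        using assms[OF i] f S(1) Y.P_limit[OF cS S(2) i l] functor_func_comp[OF S(2) Y.P_functor[OF i]]
        unfolding rep_regular_def preserves_finite_limits_def by blast
      moreover have "is_limit S (hom_cat K x (c i)) (func_comp (postcomp K (\<pi> i))
          (func_comp (precomp K f) H))
          (fo (postcomp K (\<pi> i)) (fo (precomp K f) a)) (\<lambda>j. fa (postcomp K (\<pi> i)) (fa (precomp K f) (l j)))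
              \<longleftrightarrow>
        is_limit S (hom_cat K x (c i)) (func_comp (precomp K f) (func_comp (postcomp K (\<pi> i)) H))
          (fo (precomp K f) (fo (postcomp K (\<pi> i)) a)) (\<lambda>j. fa (precomp K f) (fa (postcomp K (\<pi> i)) (l j)))"
        by (rule is_limit_comp_cong[OF cS S(2) hom_category])
           (use pp[OF i] in_homD(1)[OF lh] coneD(1)[OF lc] in auto)
      ultimately show "is_limit S (hom_cat K x (c i)) (func_comp (postcomp K (\<pi> i))
          (func_comp (precomp K f) H))
          (fo (postcomp K (\<pi> i)) (fo (precomp K f) a)) (\<lambda>j. fa (postcomp K (\<pi> i)) (fa (precomp K f) (l j)))"
        by blast
    qed
  qed
  show "preserves_regular_epis (hom_cat K y p) (hom_cat K x p) (precomp K f)"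
    unfolding preserves_regular_epis_def
  proof (intro allI impI)
    fix e assume e: "regular_epi (hom_cat K y p) e"
    note eh = Y.D.regular_epi_hom[OF e]
    have "regular_epi (hom_cat K x (c i)) (fa (postcomp K (\<pi> i)) (fa (precomp K f) e))" if i: "i \<in> I" for i
    proof -
      have "regular_epi (hom_cat K y (c i)) (fa (postcomp K (\<pi> i)) e)"
        using e i Y.regular_epi_iff[OF eh] by blast
      then have "regular_epi (hom_cat K x (c i)) (fa (precomp K f) (fa (postcomp K (\<pi> i)) e))"
        using assms[OF i] f unfolding rep_regular_def preserves_regular_epis_def by blast
      then show ?thesis using pp(2)[OF i in_homD(1)[OF eh]] by simp
    qed
    then show "regular_epi (hom_cat K x p) (fa (precomp K f) e)"
      using X.regular_epi_iff[OF functor_hom[OF precomp_functor[OF f] eh]] by blast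
  qed
qed

lemma rep_preserves_projection_limits:
  "i \<in> I \<Longrightarrow> rep_preserves preserves_finite_limits K (\<pi> i)"
  by (rule rep_preservesI[OF pi_in]) (assumption, rule product_category.P_preserves_finite_limits[OF
      hom_product])

end

section \<open>Universal properties of the inserter and the equifier, symbol by symbol\<close>

context bialgebra
begin

lemma supp_sig_precomp:
  assumes "t \<in> STerms \<Sigma> \<sigma>" "cell1 K h x (Msig L)"
  shows "c1 K (supp_sig K \<Sigma> M L t) h = c1 K (supp K \<Sigma> M L t) (c1 K (usig L) h)"
  unfolding supp_sig_def using c1_assoc[OF assms(2) ins.u_in supp_in[OF assms(1)]] by simp

lemma forgetful_precomp:
  "cell1 K a x (Mth L) \<Longrightarrow> c1 K (forgetful K L) a = c1 K (usig L) (c1 K (eth L) a)"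
  unfolding forgetful_def using c1_assoc[OF _ eqf.u_in ins.u_in] by simp

lemma lw_supp_sig:
  assumes "t \<in> STerms \<Sigma> \<sigma>" "cell1 K h x (Msig L)" "cell2 K \<alpha> h k"
  shows "lw K (supp_sig K \<Sigma> M L t) \<alpha> = lw K (supp K \<Sigma> M L t) (lw K (usig L) \<alpha>)"
  unfolding supp_sig_def using lw_lw[OF ins.u_in supp_in[OF assms(1)] assms(2,3)] by simp

lemma lw_forgetful:
  assumes "cell1 K a x (Mth L)" "cell2 K \<alpha> a b"
  shows "lw K (forgetful K L) \<alpha> = lw K (usig L) (lw K (eth L) \<alpha>)"
  unfolding forgetful_def using lw_lw[OF eqf.u_in ins.u_in assms] by simp

abbreviation arr :: "'g \<Rightarrow> 'a" where
  "arr f \<equiv> arr_cell K \<Sigma> M L (FnA f)"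

lemma arr_in: "f \<in> Fn \<sigma> \<Longrightarrow> cell2 K (arr f) (supp_sig K \<Sigma> M L (fdom \<sigma> f)) (supp_sig K \<Sigma> M L (fcod \<sigma> f))"
  using arr_cell_in[OF GArr.FnA] by simp

lemma rw_arr:
  assumes "f \<in> Fn \<sigma>" "cell1 K h x (Msig L)"
  shows "rw K (arr f) h = lw K (prF L f) (rw K (phi L) h)"
  using rw_lw[OF assms(2) c1_in[OF ins.u_in ins.f_in] ins.phi_in PF.pi_in[OF assms(1)]] by simp

lemma rw_arr_in:
  assumes "f \<in> Fn \<sigma>" "cell1 K h x (Msig L)"
  shows "cell2 K (rw K (arr f) h) (c1 K (supp K \<Sigma> M L (fdom \<sigma> f)) (c1 K (usig L) h))
    (c1 K (supp K \<Sigma> M L (fcod \<sigma> f)) (c1 K (usig L) h))"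
  using rw_in[OF assms(2) supp_sig_in[OF fdom_STerms[OF assms(1)]] arr_in[OF assms(1)]]
    supp_sig_precomp[OF fdom_STerms[OF assms(1)] assms(2)]
        supp_sig_precomp[OF fcod_STerms[OF assms(1)] assms(2)]
  by simp

lemma lw_prF:
  assumes f: "f \<in> Fn \<sigma>" and h: "cell1 K h x (M0 L)" "cell2 K \<alpha> h k"
  shows "lw K (prF L f) (lw K Fdom \<alpha>) = lw K (supp K \<Sigma> M L (fdom \<sigma> f)) \<alpha>"
    "lw K (prF L f) (lw K Fcod \<alpha>) = lw K (supp K \<Sigma> M L (fcod \<sigma> f)) \<alpha>"
  using lw_lw[OF ins.f_in PF.pi_in[OF f] h] lw_lw[OF ins.g_in PF.pi_in[OF f] h]
    PF.pi_tuple1[OF P0.p_ob fdom_supp f] PF.pi_tuple1[OF P0.p_ob fcod_supp f] by auto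

text \<open>The inserter condition is one equation between 2-cells into \<open>PF L\<close>; its
  projections give one condition for each function symbol.\<close>

lemma sig_lift_cell2:
  assumes h: "cell1 K h\<^sub>1 x (Msig L)" "cell1 K h\<^sub>2 x (Msig L)" and
      \<alpha>: "cell2 K \<alpha> (c1 K (usig L) h\<^sub>1) (c1 K (usig L) h\<^sub>2)"
    and compat: "\<And>f. f \<in> Fn \<sigma> \<Longrightarrow> vc K (lw K (supp K \<Sigma> M L (fcod \<sigma> f)) \<alpha>) (rw K (arr f) h\<^sub>1) =
      vc K (rw K (arr f) h\<^sub>2) (lw K (supp K \<Sigma> M L (fdom \<sigma> f)) \<alpha>)"
  obtains \<beta> where "cell2 K \<beta> h\<^sub>1 h\<^sub>2" "lw K (usig L) \<beta> = \<alpha>"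
proof -
  note uh = c1_in[OF h(1) ins.u_in] c1_in[OF h(2) ins.u_in]
  have Fuh: "c1 K (c1 K Fdom (usig L)) h = c1 K Fdom (c1 K (usig L) h)"
    "c1 K (c1 K Fcod (usig L)) h = c1 K Fcod (c1 K (usig L) h)" if "cell1 K h x (Msig L)" for h
    using c1_assoc[OF that ins.u_in ins.f_in] c1_assoc[OF that ins.u_in ins.g_in] by auto
  have ph: "cell2 K (rw K (phi L) h) (c1 K Fdom (c1 K (usig L) h)) (c1 K Fcod (c1 K (usig L) h))"
    if "cell1 K h x (Msig L)" for h
    using rw_in[OF that c1_in[OF ins.u_in ins.f_in] ins.phi_in] Fuh[OF that] by simp
  note Fa = lw_in[OF ins.f_in uh(1) \<alpha>] and Ga = lw_in[OF ins.g_in uh(1) \<alpha>]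
  have "vc K (lw K Fcod \<alpha>) (rw K (phi L) h\<^sub>1) = vc K (rw K (phi L) h\<^sub>2) (lw K Fdom \<alpha>)"
  proof (rule PF.cell2_eqI[OF c1_in[OF uh(1) ins.f_in] vc_in[OF ph[OF h(1)] Ga] vc_in[OF Fa ph[OF h(2)]]])
    fix f assume f: "f \<in> Fn \<sigma>"
    have "lw K (prF L f) (vc K (lw K Fcod \<alpha>) (rw K (phi L) h\<^sub>1)) =
        vc K (lw K (supp K \<Sigma> M L (fcod \<sigma> f)) \<alpha>) (rw K (arr f) h\<^sub>1)"
      using lw_comp[OF PF.pi_in[OF f] c1_in[OF uh(1) ins.f_in] ph[OF h(1)] Ga] lw_prF[OF f uh(1) \<alpha>]
          rw_arr[OF f h(1)] by simp
    moreover have "lw K (prF L f) (vc K (rw K (phi L) h\<^sub>2) (lw K Fdom \<alpha>)) =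
        vc K (rw K (arr f) h\<^sub>2) (lw K (supp K \<Sigma> M L (fdom \<sigma> f)) \<alpha>)"
      using lw_comp[OF PF.pi_in[OF f] c1_in[OF uh(1) ins.f_in] Fa ph[OF h(2)]] lw_prF[OF f uh(1) \<alpha>]
          rw_arr[OF f h(2)] by simp
    ultimately show "lw K (prF L f) (vc K (lw K Fcod \<alpha>) (rw K (phi L) h\<^sub>1)) =
        lw K (prF L f) (vc K (rw K (phi L) h\<^sub>2) (lw K Fdom \<alpha>))" using compat[OF f] by simp
  qed
  from ins.ex1_cell2[OF h \<alpha> this] show ?thesis using that by blast
qed

text \<open>A family of structure cells, one for each function symbol, amounts to a single 2-cell
  into \<open>PF L\<close>, to which the inserter applies.\<close>

lemma sig_lift_cell1:
  assumes d: "cell1 K d x (M0 L)"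
    and \<psi>: "\<And>f. f \<in> Fn \<sigma> \<Longrightarrow> cell2 K (\<psi> f) (c1 K (supp K \<Sigma> M L (fdom \<sigma> f)) d)
        (c1 K (supp K \<Sigma> M L (fcod \<sigma> f)) d)"
  obtains h where "cell1 K h x (Msig L)" "c1 K (usig L) h = d" "\<And>f. f \<in> Fn \<sigma> \<Longrightarrow> rw K (arr f) h = \<psi> f"
proof -
  have "\<exists>!\<beta>. cell2 K \<beta> (c1 K Fdom d) (c1 K Fcod d) \<and> (\<forall>f\<in>Fn \<sigma>. lw K (prF L f) \<beta> = \<psi> f)"
  proof (rule PF.tuple2_ex1[OF c1_in[OF d ins.f_in] c1_in[OF d ins.g_in]])
    fix f assume f: "f \<in> Fn \<sigma>"
    show "cell2 K (\<psi> f) (c1 K (prF L f) (c1 K Fdom d)) (c1 K (prF L f) (c1 K Fcod d))"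
      using \<psi>[OF f] c1_assoc[OF d ins.f_in PF.pi_in[OF f]] c1_assoc[OF d ins.g_in PF.pi_in[OF f]]
        PF.pi_tuple1[OF P0.p_ob fdom_supp f] PF.pi_tuple1[OF P0.p_ob fcod_supp f] by simp
  qed
  then obtain \<beta> where \<beta>: "cell2 K \<beta> (c1 K Fdom d) (c1 K Fcod d)" "\<forall>f\<in>Fn \<sigma>. lw K (prF L f) \<beta> = \<psi> f" by blast
  obtain h where h: "cell1 K h x (Msig L)" "c1 K (usig L) h = d" "rw K (phi L) h = \<beta>"
    by (rule ins.ex_cell1[OF d \<beta>(1)]) (rule that)
  show ?thesis by (rule that[OF h(1,2)]) (use rw_arr[OF _ h(1)] h(3) \<beta>(2) in simp)
qed

abbreviation lhs where "lhs \<epsilon> \<equiv> path_cell K \<Sigma> \<sigma> M L (edom \<epsilon>) (elhs \<epsilon>)"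
abbreviation rhs where "rhs \<epsilon> \<equiv> path_cell K \<Sigma> \<sigma> M L (edom \<epsilon>) (erhs \<epsilon>)"

lemma edom_supp_sig: "\<forall>\<epsilon>\<in>T. cell1 K (supp_sig K \<Sigma> M L (edom \<epsilon>)) (Msig L) (MC M (stype \<Sigma> \<sigma> (edom \<epsilon>)))"
  using supp_sig_in eqn_STerms(1) by blast

lemma prT_eq:
  assumes "\<epsilon> \<in> T" "cell1 K h x (Msig L)"
  shows "lw K (prT L \<epsilon>) (rw K eql h) = rw K (lhs \<epsilon>) h" "lw K (prT L \<epsilon>) (rw K eqr h) = rw K (rhs \<epsilon>) h"
proof -
  have p: "\<forall>\<epsilon>\<in>T. cell2 K (lhs \<epsilon>) (supp_sig K \<Sigma> M L (edom \<epsilon>)) (supp_sig K \<Sigma> M L (ecod \<epsilon>))"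
    "\<forall>\<epsilon>\<in>T. cell2 K (rhs \<epsilon>) (supp_sig K \<Sigma> M L (edom \<epsilon>)) (supp_sig K \<Sigma> M L (ecod \<epsilon>))"
    using eqn_STerms(4,5) by blast+
  note t = PT.tuple1_in[OF Msig_ob edom_supp_sig]
  show "lw K (prT L \<epsilon>) (rw K eql h) = rw K (lhs \<epsilon>) h"
    using rw_lw[OF assms(2) t PT.tuple2_in[OF Msig_ob edom_supp_sig p(1)] PT.pi_in[OF assms(1)]]
      PT.pi_tuple2[OF Msig_ob edom_supp_sig p(1) assms(1)] by simp
  show "lw K (prT L \<epsilon>) (rw K eqr h) = rw K (rhs \<epsilon>) h"
    using rw_lw[OF assms(2) t PT.tuple2_in[OF Msig_ob edom_supp_sig p(2)] PT.pi_in[OF assms(1)]]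
      PT.pi_tuple2[OF Msig_ob edom_supp_sig p(2) assms(1)] by simp
qed

lemma equations_hold:
  assumes "\<epsilon> \<in> T" "cell1 K a x (Mth L)"
  shows "rw K (lhs \<epsilon>) (c1 K (eth L) a) = rw K (rhs \<epsilon>) (c1 K (eth L) a)"
proof -
  have "rw K (lhs \<epsilon>) (eth L) = rw K (rhs \<epsilon>) (eth L)"
    using prT_eq[OF assms(1) eqf.u_in] eqf.equified by simp
  then show ?thesis
    using rw_rw[OF assms(2) eqf.u_in supp_sig_in[OF eqn_STerms(1)[OF assms(1)]] eqn_STerms(4)[OF assms(1)]]
      rw_rw[OF assms(2) eqf.u_in supp_sig_in[OF eqn_STerms(1)[OF assms(1)]] eqn_STerms(5)[OF assms(1)]] by
          simp
qed

lemma th_lift_cell1: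
  assumes h: "cell1 K h x (Msig L)" and eq: "\<And>\<epsilon>. \<epsilon> \<in> T \<Longrightarrow> rw K (lhs \<epsilon>) h = rw K (rhs \<epsilon>) h"
  obtains a where "cell1 K a x (Mth L)" "c1 K (eth L) a = h"
proof -
  have p: "\<forall>\<epsilon>\<in>T. cell2 K (lhs \<epsilon>) (supp_sig K \<Sigma> M L (edom \<epsilon>)) (supp_sig K \<Sigma> M L (ecod \<epsilon>))"
    "\<forall>\<epsilon>\<in>T. cell2 K (rhs \<epsilon>) (supp_sig K \<Sigma> M L (edom \<epsilon>)) (supp_sig K \<Sigma> M L (ecod \<epsilon>))"
    using eqn_STerms(4,5) by blast+
  note t = PT.tuple1_in[OF Msig_ob edom_supp_sig]
  have "rw K eql h = rw K eqr h"
    by (rule PT.cell2_eqI[OF c1_in[OF h t] rw_in[OF h t PT.tuple2_in[OF Msig_ob edom_supp_sig p(1)]]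
          rw_in[OF h t PT.tuple2_in[OF Msig_ob edom_supp_sig p(2)]]])
       (use prT_eq[OF _ h] eq in simp)
  from eqf.ex_cell1[OF h this] show ?thesis using that by blast
qed

text \<open>A function symbol and an equation both present an arity and a coarity term of common
  type, so they are indexed together: \<open>Inl\<close> for the symbols, which carry structure, and
  \<open>Inr\<close> for the equations.\<close>

abbreviation dmt :: "'g + ('f, 't, 's, 'g) eqn \<Rightarrow> ('f, 's) trm" where
  "dmt \<equiv> case_sum (fdom \<sigma>) edom"
abbreviation cdt :: "'g + ('f, 't, 's, 'g) eqn \<Rightarrow> ('f, 's) trm" where
  "cdt \<equiv> case_sum (fcod \<sigma>) ecod"
text \<open>Only function symbols carry a structure arrow; the value at an equation is a
  placeholder, as \<open>lifting\<close> evaluates \<open>\<phi>\<close> on \<open>I\<close>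
  alone.\<close>

abbreviation struct :: "'g + ('f, 't, 's, 'g) eqn \<Rightarrow> 'm \<Rightarrow> 'a" where
  "struct i a \<equiv> case_sum (\<lambda>f. rw K (arr f) (c1 K (eth L) a)) (\<lambda>_. undefined) i"

lemma dmt_STerms:
  assumes "i \<in> Inl ` Fn \<sigma> \<union> Inr ` T"
  shows "dmt i \<in> STerms \<Sigma> \<sigma>" "cdt i \<in> STerms \<Sigma> \<sigma>" "stype \<Sigma> \<sigma> (cdt i) = stype \<Sigma> \<sigma> (dmt i)"
    "dmt i \<in> arity_terms \<sigma> T" "cdt i \<in> coarity_terms \<sigma> T" "stype \<Sigma> \<sigma> (dmt i) \<in> CSym \<Sigma>"
proof -
  show "dmt i \<in> STerms \<Sigma> \<sigma>" "cdt i \<in> STerms \<Sigma> \<sigma>" "stype \<Sigma> \<sigma> (cdt i) = stype \<Sigma> \<sigma> (dmt i)"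
    "dmt i \<in> arity_terms \<sigma> T" "cdt i \<in> coarity_terms \<sigma> T"
    using assms fdom_STerms fcod_STerms fcod_type eqn_STerms(1-3)
    by (auto simp: arity_terms_def coarity_terms_def)
  then show "stype \<Sigma> \<sigma> (dmt i) \<in> CSym \<Sigma>" using Terms_type[of "dmt i"] sty_CSym by blast
qed

text \<open>The inserter accounts for the structure arrows and for compatibility of 2-cells; the
  equifier is fully faithful, so it only cuts down the objects. Objects are therefore lifted in two
  steps, first to \<open>Msig L\<close> and then, once the equations are verified, to
  \<open>Mth L\<close>.\<close>

lemma hom_lifting:
  assumes x: "x \<in> Obj K"
  shows "lifting (hom_cat K x (Mth L)) (hom_cat K x (M0 L)) (postcomp K (forgetful K L))
    (Inl ` Fn \<sigma>) (Inr ` T) (\<lambda>i. hom_cat K x (MC M (stype \<Sigma> \<sigma> (dmt i))))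
    (\<lambda>i. postcomp K (supp K \<Sigma> M L (dmt i))) (\<lambda>i. postcomp K (supp K \<Sigma> M L (cdt i))) struct"
proof (intro lifting.intro lifting_axioms.intro hom_category)
  let ?I = "Inl ` Fn \<sigma> :: ('g + ('f, 't, 's, 'g) eqn) set" and ?J =
      "Inr ` T :: ('g + ('f, 't, 's, 'g) eqn) set"
  let ?A = "hom_cat K x (Mth L)" and ?D = "hom_cat K x (M0 L)"
  let ?C = "\<lambda>i. hom_cat K x (MC M (stype \<Sigma> \<sigma> (dmt i)))" and ?U = "postcomp K (forgetful K L)"
  let ?F = "\<lambda>i. postcomp K (supp K \<Sigma> M L (dmt i))" and ?G = "\<lambda>i. postcomp K (supp K \<Sigma> M L (cdt i))"
  note sel = in_hom_hom_cat Ob_hom_cat hom_cat_sel postcomp_sel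
  show "is_functor ?A ?D ?U" by (rule postcomp_functor[OF forgetful_in])
  show "is_functor ?D (?C i) (?F i)" if "i \<in> ?I \<union> ?J" for i
    by (rule postcomp_functor[OF supp_in[OF dmt_STerms(1)[OF that]]])
  show "is_functor ?D (?C i) (?G i)" if "i \<in> ?I \<union> ?J" for i
    using postcomp_functor[OF supp_in[OF dmt_STerms(2)[OF that]]] dmt_STerms(3)[OF that] by simp
  show "in_hom (?C i) (struct i a) (fo (?F i) (fo ?U a)) (fo (?G i) (fo ?U a))"
    if i: "i \<in> ?I" and a: "a \<in> Ob ?A" for i a
  proof -
    obtain f where f: "f \<in> Fn \<sigma>" "i = Inl f" using i by blast
    have a: "cell1 K a x (Mth L)" using a by (simp add: Ob_hom_cat)
    have iIJ: "i \<in> ?I \<union> ?J" using i by blast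
    note Ua = c1_in[OF a forgetful_in]
    show ?thesis
      unfolding sel
      using c1_in[OF Ua supp_in[OF dmt_STerms(1)[OF iIJ]]] c1_in[OF Ua supp_in[OF dmt_STerms(2)[OF iIJ]]]
        dmt_STerms(3)[OF iIJ] rw_arr_in[OF f(1) c1_in[OF a eqf.u_in]] forgetful_precomp[OF a] f(2)
      by simp
  qed
  have th_cell2: "\<exists>\<gamma>. cell2 K \<gamma> a b \<and> lw K (forgetful K L) \<gamma> = lw K (usig L) \<beta>"
    if "cell1 K a x (Mth L)" "cell1 K b x (Mth L)" "cell2 K \<beta> (c1 K (eth L) a) (c1 K (eth L) b)" for a b \<beta>
    using ex1_implies_ex[OF eqf.ex1_cell2[OF that]] lw_forgetful[OF that(1)] by auto
  show "Cmp (?C i) (fa (?G i) (fa ?U \<alpha>)) (struct i a) = Cmp (?C i) (struct i b) (fa (?F i) (fa ?U \<alpha>))"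
    if i: "i \<in> ?I" and \<alpha>: "in_hom ?A \<alpha> a b" for i \<alpha> a b
  proof -
    obtain f where f: "f \<in> Fn \<sigma>" "i = Inl f" using i by blast
    have a: "cell1 K a x (Mth L)" "cell2 K \<alpha> a b" using \<alpha> by (simp_all add: in_hom_hom_cat)
    note ea = c1_in[OF a(1) eqf.u_in] and e\<alpha> = lw_in[OF eqf.u_in a]
    show ?thesis
      unfolding sel
      using whisker_exchange[OF ea e\<alpha> supp_sig_in[OF fdom_STerms[OF f(1)]] arr_in[OF f(1)]]
        lw_supp_sig[OF fdom_STerms[OF f(1)] ea e\<alpha>] lw_supp_sig[OF fcod_STerms[OF f(1)] ea e\<alpha>]
        lw_forgetful[OF a] f(2) by simp
  qed
  show "\<alpha> = \<beta>" if "in_hom ?A \<alpha> a b" "in_hom ?A \<beta> a b" "fa ?U \<alpha> = fa ?U \<beta>" for \<alpha> \<beta> a b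
  proof -
    have a: "cell1 K a x (Mth L)" "cell2 K \<alpha> a b" "cell2 K \<beta> a b" using that by
        (simp_all add: in_hom_hom_cat)
    have "lw K (eth L) \<alpha> = lw K (eth L) \<beta>"
      by (rule ins.cell2_eqI[OF c1_in[OF a(1) eqf.u_in] lw_in[OF eqf.u_in a(1,2)]
          lw_in[OF eqf.u_in a(1,3)]])
         (use that(3) lw_forgetful[OF a(1,2)] lw_forgetful[OF a(1,3)] in \<open>simp add: postcomp_sel\<close>)
    then show ?thesis by (rule eqf.cell2_eqI[OF a])
  qed
  show "\<exists>\<gamma>. in_hom ?A \<gamma> a b \<and> fa ?U \<gamma> = h"
    if ab: "a \<in> Ob ?A" "b \<in> Ob ?A" and h: "in_hom ?D h (fo ?U a) (fo ?U b)"
      and compat: "\<And>i. i \<in> ?I \<Longrightarrow> Cmp (?C i) (fa (?G i) h) (struct i a) = Cmp (?C i) (struct i b)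
          (fa (?F i) h)"
    for a b h
  proof -
    have ab: "cell1 K a x (Mth L)" "cell1 K b x (Mth L)" using ab by (simp_all add: Ob_hom_cat)
    have h': "cell2 K h (c1 K (usig L) (c1 K (eth L) a)) (c1 K (usig L) (c1 K (eth L) b))"
      using h forgetful_precomp ab by (simp add: sel)
    obtain \<beta> where \<beta>: "cell2 K \<beta> (c1 K (eth L) a) (c1 K (eth L) b)" "lw K (usig L) \<beta> = h"
      by (rule sig_lift_cell2[OF c1_in[OF ab(1) eqf.u_in] c1_in[OF ab(2) eqf.u_in] h'])
         (use compat[OF imageI] in \<open>simp add: sel\<close>, rule that)
    show ?thesis using th_cell2[OF ab \<beta>(1)] \<beta>(2) ab by (simp add: sel)
  qed
  show "\<exists>a\<in>Ob ?A. fo ?U a = d \<and> (\<forall>i\<in>?I. struct i a = \<psi> i)"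
    if d: "d \<in> Ob ?D" and \<psi>: "\<And>i. i \<in> ?I \<Longrightarrow> in_hom (?C i) (\<psi> i) (fo (?F i) d) (fo (?G i) d)"
      and eqs: "\<And>j r s. j \<in> ?J \<Longrightarrow> in_hom (?C j) r (fo (?F j) d) (fo (?G j) d) \<Longrightarrow>
        in_hom (?C j) s (fo (?F j) d) (fo (?G j) d) \<Longrightarrow>
        (\<And>b e. b \<in> Ob ?A \<Longrightarrow> in_hom ?D e (fo ?U b) d \<Longrightarrow>
          (\<And>i. i \<in> ?I \<Longrightarrow> Cmp (?C i) (fa (?G i) e) (struct i b) = Cmp (?C i) (\<psi> i) (fa (?F i) e)) \<Longrightarrow>
          Cmp (?C j) r (fa (?F j) e) = Cmp (?C j) s (fa (?F j) e)) \<Longrightarrow>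
        (\<And>b m. b \<in> Ob ?A \<Longrightarrow> in_hom ?D m d (fo ?U b) \<Longrightarrow>
          (\<And>i. i \<in> ?I \<Longrightarrow> Cmp (?C i) (fa (?G i) m) (\<psi> i) = Cmp (?C i) (struct i b) (fa (?F i) m)) \<Longrightarrow>
          Cmp (?C j) (fa (?G j) m) r = Cmp (?C j) (fa (?G j) m) s) \<Longrightarrow> r = s"
    for d \<psi>
  proof -
    have d: "cell1 K d x (M0 L)" using d by (simp add: Ob_hom_cat)
    have \<psi>': "cell2 K (\<psi> (Inl f)) (c1 K (supp K \<Sigma> M L (fdom \<sigma> f)) d) (c1 K (supp K \<Sigma> M L (fcod \<sigma> f)) d)"
      if "f \<in> Fn \<sigma>" for f
      using \<psi>[OF imageI[OF that]] by (simp add: sel)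
    obtain h where h: "cell1 K h x (Msig L)" "c1 K (usig L) h = d"
        "\<And>f. f \<in> Fn \<sigma> \<Longrightarrow> rw K (arr f) h = \<psi> (Inl f)"
      by (rule sig_lift_cell1[OF d \<psi>']) (assumption, rule that)
    \<comment> \<open>The arbitrary pair of \<open>lift_ob\<close> is instantiated with the two
      sides of the equation at h. They are defined there because h is already a 1-cell into the
      inserter.\<close>
    have "rw K (lhs \<epsilon>) h = rw K (rhs \<epsilon>) h" if \<epsilon>: "\<epsilon> \<in> T" for \<epsilon>
    proof (rule eqs[OF imageI[OF \<epsilon>]])
      note S = eqn_STerms(1,2)[OF \<epsilon>] and ty = eqn_STerms(3)[OF \<epsilon>]
      note c = c1_in[OF d supp_in[OF S(1)]] c1_in[OF d supp_in[OF S(2)]]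
      note p = eqn_STerms(4,5)[OF \<epsilon>]
      show "in_hom (?C (Inr \<epsilon>)) (rw K (lhs \<epsilon>) h) (fo (?F (Inr \<epsilon>)) d) (fo (?G (Inr \<epsilon>)) d)"
        "in_hom (?C (Inr \<epsilon>)) (rw K (rhs \<epsilon>) h) (fo (?F (Inr \<epsilon>)) d) (fo (?G (Inr \<epsilon>)) d)"
        unfolding sel using rw_in[OF h(1) supp_sig_in[OF S(1)] p(1)]
            rw_in[OF h(1) supp_sig_in[OF S(1)] p(2)]
          supp_sig_precomp[OF S(1) h(1)] supp_sig_precomp[OF S(2) h(1)] h(2) c ty by simp_all
      {
        fix b e assume b: "b \<in> Ob ?A" and e: "in_hom ?D e (fo ?U b) d"
          and compat: "\<And>i. i \<in> ?I \<Longrightarrow> Cmp (?C i) (fa (?G i) e) (struct i b) = Cmp (?C i) (\<psi> i) (fa (?F i) e)"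
        have b: "cell1 K b x (Mth L)" using b by (simp add: Ob_hom_cat)
        note eb = c1_in[OF b eqf.u_in]
        have e: "cell2 K e (c1 K (usig L) (c1 K (eth L) b)) (c1 K (usig L) h)"
          using e forgetful_precomp[OF b] h(2) by (simp add: sel)
        \<comment> \<open>Compatibility makes e the image of a 2-cell \<beta> between 1-cells into
          \<open>Msig L\<close>. The exchange law slides each side of the equation along \<beta> to
          the model b, where the equation holds.\<close>
        obtain \<beta> where \<beta>: "cell2 K \<beta> (c1 K (eth L) b) h" "lw K (usig L) \<beta> = e"
          by (rule sig_lift_cell2[OF eb h(1) e])
             (use compat[OF imageI] h(3) in \<open>simp add: sel\<close>, rule that)
        show "Cmp (?C (Inr \<epsilon>)) (rw K (lhs \<epsilon>) h) (fa (?F (Inr \<epsilon>)) e) = Cmp (?C (Inr \<epsilon>)) (rw K (rhs \<epsilon>) h)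
            (fa (?F (Inr \<epsilon>)) e)"
          using whisker_exchange[OF eb \<beta>(1) supp_sig_in[OF S(1)] p(1)]
              whisker_exchange[OF eb \<beta>(1) supp_sig_in[OF S(1)] p(2)]
            lw_supp_sig[OF S(1) eb \<beta>(1)] \<beta>(2) equations_hold[OF \<epsilon> b] by (simp add: sel)
      }
      fix b m assume b: "b \<in> Ob ?A" and m: "in_hom ?D m d (fo ?U b)"
        and compat: "\<And>i. i \<in> ?I \<Longrightarrow> Cmp (?C i) (fa (?G i) m) (\<psi> i) = Cmp (?C i) (struct i b) (fa (?F i) m)"
      have b: "cell1 K b x (Mth L)" using b by (simp add: Ob_hom_cat)
      note eb = c1_in[OF b eqf.u_in]
      have m: "cell2 K m (c1 K (usig L) h) (c1 K (usig L) (c1 K (eth L) b))"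
        using m forgetful_precomp[OF b] h(2) by (simp add: sel)
      obtain \<beta> where \<beta>: "cell2 K \<beta> h (c1 K (eth L) b)" "lw K (usig L) \<beta> = m"
        by (rule sig_lift_cell2[OF h(1) eb m])
           (use compat[OF imageI] h(3) in \<open>simp add: sel\<close>, rule that)
      show "Cmp (?C (Inr \<epsilon>)) (fa (?G (Inr \<epsilon>)) m) (rw K (lhs \<epsilon>) h) = Cmp (?C (Inr \<epsilon>)) (fa (?G (Inr \<epsilon>)) m)
          (rw K (rhs \<epsilon>) h)"
        using whisker_exchange[OF h(1) \<beta>(1) supp_sig_in[OF S(1)] p(1)]
            whisker_exchange[OF h(1) \<beta>(1) supp_sig_in[OF S(1)] p(2)]
          lw_supp_sig[OF S(2) h(1) \<beta>(1)] \<beta>(2) equations_hold[OF \<epsilon> b] by (simp add: sel)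
    qed
    then obtain a where a: "cell1 K a x (Mth L)" "c1 K (eth L) a = h"
      by (rule th_lift_cell1[OF h(1)]) (assumption, rule that)
    have "c1 K (forgetful K L) a = d" using forgetful_precomp[OF a(1)] a(2) h(2) by simp
    then show ?thesis using a h(3) by (intro bexI[of _ a]) (auto simp: sel)
  qed
qed

end

context two_category
begin

lemma hom_arD:
  assumes "\<alpha> \<in> Ar (hom_cat K x y)"
  shows "cell1 K (Dm (vert K) \<alpha>) x y" "cell2 K \<alpha> (Dm (vert K) \<alpha>) (Cd (vert K) \<alpha>)"
  using assms by (auto simp: hom_ar in_hom_hom_cat)

lemma lw_ar:
  assumes "cell1 K h y z" "\<alpha> \<in> Ar (hom_cat K x y)"
  shows "lw K h \<alpha> \<in> Ar (hom_cat K x z)"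
  using in_homD(1)[OF functor_hom[OF postcomp_functor[OF assms(1)] assms(2)[unfolded hom_ar]]]
  by (simp add: postcomp_sel)

lemma rw_ar:
  assumes "cell1 K h x y" "\<alpha> \<in> Ar (hom_cat K y z)"
  shows "rw K \<alpha> h \<in> Ar (hom_cat K x z)"
  using in_homD(1)[OF functor_hom[OF precomp_functor[OF assms(1)] assms(2)[unfolded hom_ar]]]
  by (simp add: precomp_sel)

lemma lw_lw_ar:
  assumes "cell1 K h y z" "cell1 K k z w" "\<alpha> \<in> Ar (hom_cat K x y)"
  shows "lw K (c1 K k h) \<alpha> = lw K k (lw K h \<alpha>)"
  by (rule lw_lw[OF assms(1,2) hom_arD[OF assms(3)], symmetric])

lemma rw_lw_ar:
  assumes "cell1 K f x y" "cell1 K h z w" "\<alpha> \<in> Ar (hom_cat K y z)"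
  shows "lw K h (rw K \<alpha> f) = rw K (lw K h \<alpha>) f"
  by (rule rw_lw[OF assms(1) hom_arD[OF assms(3)] assms(2), symmetric])

end

section \<open>The factorization system on the object of models\<close>

context bialgebra
begin

lemma lw_pr0_forgetful:
  assumes "\<alpha> \<in> Ar (hom_cat K x (Mth L))" "s \<in> Srt \<sigma>"
  shows "lw K (c1 K (pr0 L s) (forgetful K L)) \<alpha> = lw K (pr0 L s) (lw K (forgetful K L) \<alpha>)"
  by (rule lw_lw_ar[OF forgetful_in P0.pi_in[OF assms(2)] assms(1)])

lemma models_OFS:
  assumes R: "\<forall>c\<in>CSym \<Sigma>. rep_OFS K (MC M c) (R c)"
    and R0: "R0 = product_OFS K (Srt \<sigma>) (M0 L) (pr0 L) (\<lambda>s. R (sty \<sigma> s))"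
    and left: "\<forall>t\<in>arity_terms \<sigma> T. rep_preserves_left K (supp K \<Sigma> M L t) R0 (R (stype \<Sigma> \<sigma> t))"
    and right: "\<forall>t\<in>coarity_terms \<sigma> T. rep_preserves_right K (supp K \<Sigma> M L t) R0 (R (stype \<Sigma> \<sigma> t))"
  shows "\<exists>!Q. rep_OFS K (Mth L) Q \<and>
    (\<forall>s\<in>Srt \<sigma>.
      rep_preserves_left K (c1 K (pr0 L s) (forgetful K L)) Q (R (sty \<sigma> s)) \<and>
      rep_preserves_right K (c1 K (pr0 L s) (forgetful K L)) Q (R (sty \<sigma> s)))"
proof -
  have ROFS: "is_OFS (hom_cat K x (MC M c)) (fst (R c x)) (snd (R c x))" if "c \<in> CSym \<Sigma>" "x \<in> Obj K" for c x
    using R that unfolding rep_OFS_def by blast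
  have R0_eq: "fst (R0 x) = {\<alpha> \<in> Ar (hom_cat K x (M0 L)). \<forall>s\<in>Srt \<sigma>. lw K (pr0 L s) \<alpha> \<in> fst (R (sty \<sigma> s) x)}"
    "snd (R0 x) = {\<alpha> \<in> Ar (hom_cat K x (M0 L)). \<forall>s\<in>Srt \<sigma>. lw K (pr0 L s) \<alpha> \<in> snd (R (sty \<sigma> s) x)}"
    if "x \<in> Obj K" for x
    using that unfolding R0 product_OFS_def by simp_all
  have R0_OFS: "is_OFS (hom_cat K x (M0 L)) (fst (R0 x)) (snd (R0 x))" if x: "x \<in> Obj K" for x
    using product_category.product_OFS[OF P0.hom_product[OF x], of "\<lambda>s. fst (R (sty \<sigma> s) x)"
        "\<lambda>s. snd (R (sty \<sigma> s) x)"]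
      ROFS[OF sty_CSym x] unfolding R0_eq[OF x] postcomp_sel by blast
  \<comment> \<open>Both classes are the preimages of the classes on \<open>M0 L\<close> under the
    forgetful functor. The function is restricted because families are required to be extensional
    over the objects.\<close>
  define Q where "Q = (\<lambda>x\<in>Obj K. ({\<alpha> \<in> Ar (hom_cat K x (Mth L)). lw K (forgetful K L) \<alpha> \<in> fst (R0 x)},
      {\<alpha> \<in> Ar (hom_cat K x (Mth L)). lw K (forgetful K L) \<alpha> \<in> snd (R0 x)}))"
  have Q_eq: "fst (Q x) = {\<alpha> \<in> Ar (hom_cat K x (Mth L)). lw K (forgetful K L) \<alpha> \<in> fst (R0 x)}"
    "snd (Q x) = {\<alpha> \<in> Ar (hom_cat K x (Mth L)). lw K (forgetful K L) \<alpha> \<in> snd (R0 x)}" if "x \<in> Obj K" for x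
    using that unfolding Q_def by simp_all
  \<comment> \<open>Membership is rephrased sort by sort, which is the form shared by preservation
    under the projections and by uniqueness.\<close>
  have Q_mem: "\<alpha> \<in> fst (Q x) \<longleftrightarrow> \<alpha> \<in> Ar (hom_cat K x (Mth L)) \<and>
      (\<forall>s\<in>Srt \<sigma>. lw K (c1 K (pr0 L s) (forgetful K L)) \<alpha> \<in> fst (R (sty \<sigma> s) x))"
    "\<alpha> \<in> snd (Q x) \<longleftrightarrow> \<alpha> \<in> Ar (hom_cat K x (Mth L)) \<and>
      (\<forall>s\<in>Srt \<sigma>. lw K (c1 K (pr0 L s) (forgetful K L)) \<alpha> \<in> snd (R (sty \<sigma> s) x))" if "x \<in> Obj K" for x \<alpha>
    unfolding Q_eq[OF that] R0_eq[OF that] using lw_pr0_forgetful lw_ar[OF forgetful_in] by auto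
  have Q_OFS: "is_OFS (hom_cat K x (Mth L)) (fst (Q x)) (snd (Q x))" if x: "x \<in> Obj K" for x
    unfolding Q_eq[OF x]
  proof (rule lifting.lift_OFS[OF hom_lifting[OF x] R0_OFS[OF x], unfolded postcomp_sel])
    fix i assume i: "i \<in> Inl ` Fn \<sigma> \<union> Inr ` T"
    show "is_OFS (hom_cat K x (MC M (stype \<Sigma> \<sigma> (dmt i)))) (fst (R (stype \<Sigma> \<sigma> (dmt i)) x))
        (snd (R (stype \<Sigma> \<sigma> (dmt i)) x))"
      by (rule ROFS[OF dmt_STerms(6)[OF i] x])
    show "preserves_class (postcomp K (supp K \<Sigma> M L (dmt i))) (fst (R0 x)) (fst (R (stype \<Sigma> \<sigma> (dmt i)) x))"
      using left dmt_STerms(4)[OF i] x unfolding rep_preserves_left_def by blast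
    show "preserves_class (postcomp K (supp K \<Sigma> M L (cdt i))) (snd (R0 x)) (snd (R (stype \<Sigma> \<sigma> (dmt i)) x))"
      using right dmt_STerms(5)[OF i] dmt_STerms(3)[OF i] x unfolding rep_preserves_right_def by metis
  qed
  show ?thesis
  proof (rule ex1I[of _ Q], intro conjI ballI)
    show "rep_OFS K (Mth L) Q"
      unfolding rep_OFS_def
    proof (intro conjI ballI allI impI)
      show "Q \<in> extensional (Obj K)" unfolding Q_def by simp
      show "is_OFS (hom_cat K x (Mth L)) (fst (Q x)) (snd (Q x))" if "x \<in> Obj K" for x by
          (rule Q_OFS[OF that])
      fix x y f assume f: "cell1 K f x y"
      note xy = cell1_ob[OF f]
      have p: "lw K (c1 K (pr0 L s) (forgetful K L)) (rw K \<alpha> f) = rw K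
          (lw K (c1 K (pr0 L s) (forgetful K L)) \<alpha>) f"
        if "\<alpha> \<in> Ar (hom_cat K y (Mth L))" "s \<in> Srt \<sigma>" for \<alpha> s
        by (rule rw_lw_ar[OF f c1_in[OF forgetful_in P0.pi_in[OF that(2)]] that(1)])
      show "preserves_class (precomp K f) (fst (Q y)) (fst (Q x))"
          "preserves_class (precomp K f) (snd (Q y)) (snd (Q x))"
        unfolding preserves_class_def precomp_sel Ball_def Q_mem[OF xy(1)] Q_mem[OF xy(2)]
        using p rw_ar[OF f] R f sty_CSym unfolding rep_OFS_def preserves_class_def precomp_sel by simp_all
    qed
    fix s assume s: "s \<in> Srt \<sigma>"
    show "rep_preserves_left K (c1 K (pr0 L s) (forgetful K L)) Q (R (sty \<sigma> s))"
      "rep_preserves_right K (c1 K (pr0 L s) (forgetful K L)) Q (R (sty \<sigma> s))"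
      unfolding rep_preserves_left_def rep_preserves_right_def preserves_class_def postcomp_sel
      using Q_mem s by blast+
  next
    fix Q' assume Q': "rep_OFS K (Mth L) Q' \<and> (\<forall>s\<in>Srt \<sigma>.
      rep_preserves_left K (c1 K (pr0 L s) (forgetful K L)) Q' (R (sty \<sigma> s)) \<and>
      rep_preserves_right K (c1 K (pr0 L s) (forgetful K L)) Q' (R (sty \<sigma> s)))"
    show "Q' = Q"
    proof (rule extensionalityI[of _ "Obj K"])
      show "Q' \<in> extensional (Obj K)" using Q' unfolding rep_OFS_def by blast
      show "Q \<in> extensional (Obj K)" unfolding Q_def by simp
      fix x assume x: "x \<in> Obj K"
      have O: "is_OFS (hom_cat K x (Mth L)) (fst (Q' x)) (snd (Q' x))" using Q' x unfolding rep_OFS_def by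
          blast
      \<comment> \<open>Preservation by the projections says precisely that the classes of
        \<open>Q'\<close> are contained in those of \<open>Q\<close>.\<close>
      have "fst (Q' x) \<subseteq> fst (Q x)" "snd (Q' x) \<subseteq> snd (Q x)"
        using Q' OFS_subset[OF O] x
        unfolding rep_preserves_left_def rep_preserves_right_def preserves_class_def postcomp_sel
        by (auto simp: Q_mem[OF x])
      then show "Q' x = Q x" using OFS_eqI[OF O Q_OFS[OF x]] by (simp add: prod_eq_iff)
    qed
  qed
qed

section \<open>Supports of terms under hypotheses on the operations\<close>

lemma MB_finite_product:
  assumes "B \<in> FSym \<Sigma>" "x \<in> Obj K"
  shows "finite_product_category (hom_cat K x (MP M (far \<Sigma> B))) (length (far \<Sigma> B))
    (\<lambda>i. hom_cat K x (MC M (far \<Sigma> B ! i))) (\<lambda>i. postcomp K (MPr M (far \<Sigma> B) i))"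
proof -
  interpret P: two_product K "{..<length (far \<Sigma> B)}" "\<lambda>i. MC M (far \<Sigma> B ! i)" "MP M (far \<Sigma> B)"
      "MPr M (far \<Sigma> B)"
    by (rule MP_product[OF far_CSym[OF assms(1)]])
  show ?thesis
    using P.cell1_eqI
    by (intro finite_product_category.intro finite_product_category_axioms.intro P.hom_product[OF assms(2)])
       (auto simp: Ob_hom_cat postcomp_sel)
qed

text \<open>The tuple formed inside \<open>partial_MB\<close> has the components of g and hence is
  g. The entry of \<open>fs\<close> at i is overwritten, so the identities are compared outside i
  only.\<close>

lemma partial_MB_apply:
  assumes B: "B \<in> FSym \<Sigma>" and x: "x \<in> Obj K" and g: "g \<in> Ar (hom_cat K x (MP M (far \<Sigma> B)))"
    and v: "\<And>j. j < length (far \<Sigma> B) \<Longrightarrow> j \<noteq> i \<Longrightarrow> lw K (MPr M (far \<Sigma> B) j) g = id2 K (fs ! j)"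
    and fs: "length fs = length (far \<Sigma> B)"
  shows "fa (partial_MB K \<Sigma> M B x i fs) (lw K (MPr M (far \<Sigma> B) i) g) = lw K (MB M B) g"
proof -
  interpret P: two_product K "{..<length (far \<Sigma> B)}" "\<lambda>i. MC M (far \<Sigma> B ! i)" "MP M (far \<Sigma> B)"
      "MPr M (far \<Sigma> B)"
    by (rule MP_product[OF far_CSym[OF B]])
  have "mtuple2 K M (far \<Sigma> B) x ((map (id2 K) fs)[i := lw K (MPr M (far \<Sigma> B) i) g]) = g"
    unfolding mtuple2_def
  proof (rule P.tuple2_unique[OF hom_arD[OF g]])
    fix j assume "j \<in> {..<length (far \<Sigma> B)}"
    then show "lw K (MPr M (far \<Sigma> B) j) g = (map (id2 K) fs)[i := lw K (MPr M (far \<Sigma> B) i) g] ! j"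
      using v fs by (cases "j = i") auto
  qed
  then show ?thesis by (simp add: partial_MB_def)
qed

lemma MB_componentwiseD:
  assumes "MB_componentwise W K \<Sigma> M B" "B \<in> FSym \<Sigma>" "x \<in> Obj K" "i < length (far \<Sigma> B)"
    "cell1 K d x (MP M (far \<Sigma> B))"
  shows "W x (far \<Sigma> B ! i) (fres \<Sigma> B)
    (partial_MB K \<Sigma> M B x i (map (\<lambda>j. c1 K (MPr M (far \<Sigma> B) j) d) [0..<length (far \<Sigma> B)]))"
proof -
  interpret P: two_product K "{..<length (far \<Sigma> B)}" "\<lambda>i. MC M (far \<Sigma> B ! i)" "MP M (far \<Sigma> B)"
      "MPr M (far \<Sigma> B)"
    by (rule MP_product[OF far_CSym[OF assms(2)]])
  show ?thesis
    using assms(1)[unfolded MB_componentwise_def, rule_format, OF assms(3,4)] c1_in[OF assms(5) P.pi_in] by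
        simp
qed

lemma supp_App:
  assumes B: "B \<in> FSym \<Sigma>" and ts: "map (stype \<Sigma> \<sigma>) ts = far \<Sigma> B" "set ts \<subseteq> STerms \<Sigma> \<sigma>"
  obtains h where "cell1 K h (M0 L) (MP M (far \<Sigma> B))" "supp K \<Sigma> M L (App B ts) = c1 K (MB M B) h"
    "\<And>i. i < length (far \<Sigma> B) \<Longrightarrow> ts ! i \<in> set ts \<and> stype \<Sigma> \<sigma> (ts ! i) = far \<Sigma> B ! i \<and>
      c1 K (MPr M (far \<Sigma> B) i) h = supp K \<Sigma> M L (ts ! i)"
proof -
  interpret P: two_product K "{..<length (far \<Sigma> B)}" "\<lambda>i. MC M (far \<Sigma> B ! i)" "MP M (far \<Sigma> B)"
      "MPr M (far \<Sigma> B)"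
    by (rule MP_product[OF far_CSym[OF B]])
  let ?h = "mtuple1 K M (far \<Sigma> B) (M0 L) (map (interp K \<Sigma> M (M0 L) (pr0 L)) ts)"
  note a = interp_args[OF B ts P0.p_ob pr0_typed]
  show ?thesis
  proof (rule that[of ?h])
    show "cell1 K ?h (M0 L) (MP M (far \<Sigma> B))" unfolding mtuple1_def by (rule P.tuple1_in[OF P0.p_ob a])
    show "supp K \<Sigma> M L (App B ts) = c1 K (MB M B) ?h" by (simp add: supp_def)
    show "ts ! i \<in> set ts \<and> stype \<Sigma> \<sigma> (ts ! i) = far \<Sigma> B ! i \<and>
        c1 K (MPr M (far \<Sigma> B) i) ?h = supp K \<Sigma> M L (ts ! i)" if "i < length (far \<Sigma> B)" for i
      using P.pi_tuple1[OF P0.p_ob a, of i] App_args[OF ts(1)] that unfolding mtuple1_def supp_def by simp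
  qed
qed

lemma supp_Var: "supp K \<Sigma> M L (Var s) = pr0 L s"
  by (simp add: supp_def)

text \<open>Stated for an arbitrary family of classes, to serve the left and the right class alike.
  Closure under identities and composition is what \<open>joint_class\<close> uses to pass from one
  variable to all.\<close>

lemma supp_preserves_classes:
  assumes id: "\<And>c x a. c \<in> CSym \<Sigma> \<Longrightarrow> cell1 K a x (MC M c) \<Longrightarrow> id2 K a \<in> X c x"
    and comp: "\<And>c x \<alpha> \<beta> a b d. c \<in> CSym \<Sigma> \<Longrightarrow> \<alpha> \<in> X c x \<Longrightarrow> \<beta> \<in> X c x \<Longrightarrow>
      in_hom (hom_cat K x (MC M c)) \<alpha> a b \<Longrightarrow> in_hom (hom_cat K x (MC M c)) \<beta> b d \<Longrightarrow> vc K \<beta> \<alpha> \<in> X c x"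
    and MB: "\<And>B. B \<in> FSym \<Sigma> \<Longrightarrow> MB_componentwise (\<lambda>x c d F. preserves_class F (X c x) (X d x)) K \<Sigma> M B"
    and x: "x \<in> Obj K" and \<alpha>: "\<alpha> \<in> Ar (hom_cat K x (M0 L))" "\<forall>s\<in>Srt \<sigma>. lw K (pr0 L s) \<alpha> \<in> X (sty \<sigma> s) x"
    and t: "t \<in> STerms \<Sigma> \<sigma>"
  shows "lw K (supp K \<Sigma> M L t) \<alpha> \<in> X (stype \<Sigma> \<sigma> t) x"
  using t
proof (induction rule: Terms.induct)
  case (Var s)
  then show ?case using \<alpha>(2) by (simp add: supp_Var)
next
  case (App B ts)
  let ?D = "hom_cat K x (MP M (far \<Sigma> B))"
  interpret F: finite_product_category ?D "length (far \<Sigma> B)"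
    "\<lambda>i. hom_cat K x (MC M (far \<Sigma> B ! i))" "\<lambda>i. postcomp K (MPr M (far \<Sigma> B) i)"
    by (rule MB_finite_product[OF App.hyps(1) x])
  interpret P: two_product K "{..<length (far \<Sigma> B)}" "\<lambda>i. MC M (far \<Sigma> B ! i)" "MP M (far \<Sigma> B)"
      "MPr M (far \<Sigma> B)"
    by (rule MP_product[OF far_CSym[OF App.hyps(1)]])
  have ts: "set ts \<subseteq> STerms \<Sigma> \<sigma>" using App.hyps by blast
  obtain h where h: "cell1 K h (M0 L) (MP M (far \<Sigma> B))" "supp K \<Sigma> M L (App B ts) = c1 K (MB M B) h"
    "\<And>i. i < length (far \<Sigma> B) \<Longrightarrow> ts ! i \<in> set ts \<and> stype \<Sigma> \<sigma> (ts ! i) = far \<Sigma> B ! i \<and>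
      c1 K (MPr M (far \<Sigma> B) i) h = supp K \<Sigma> M L (ts ! i)"
    by (rule supp_App[OF App.hyps(1,2) ts]) (rule that)
  note MB_in' = MB_in[OF App.hyps(1)]
  have la: "in_hom ?D (lw K h \<alpha>) (Dm (vert K) (lw K h \<alpha>)) (Cd (vert K) (lw K h \<alpha>))"
    using lw_ar[OF h(1) \<alpha>(1)] by (simp add: hom_ar)
  have "fa (postcomp K (MB M B)) (lw K h \<alpha>) \<in> X (fres \<Sigma> B) x"
  proof (rule F.joint_class[OF hom_category[of x "MC M (fres \<Sigma> B)"] postcomp_functor[OF MB_in'] _ _ _ la])
    fix i g assume i: "i < length (far \<Sigma> B)" and g: "g \<in> Ar ?D" "F.varies_only i g"
      "fa (postcomp K (MPr M (far \<Sigma> B) i)) g \<in> X (far \<Sigma> B ! i) x"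
    let ?fs = "map (\<lambda>j. c1 K (MPr M (far \<Sigma> B) j) (Dm (vert K) g)) [0..<length (far \<Sigma> B)]"
    have "fa (partial_MB K \<Sigma> M B x i ?fs) (lw K (MPr M (far \<Sigma> B) i) g) \<in> X (fres \<Sigma> B) x"
      using MB_componentwiseD[OF MB[OF App.hyps(1)] App.hyps(1) x i hom_arD(1)[OF g(1)]] g(3)
      unfolding preserves_class_def postcomp_sel by blast
    moreover have "fa (partial_MB K \<Sigma> M B x i ?fs) (lw K (MPr M (far \<Sigma> B) i) g) = lw K (MB M B) g"
      by (rule partial_MB_apply[OF App.hyps(1) x g(1)])
         (use g(2) in \<open>auto simp: F.varies_only_def postcomp_sel hom_cat_sel\<close>)
    ultimately show "fa (postcomp K (MB M B)) g \<in> X (fres \<Sigma> B) x" by (simp add: postcomp_sel)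
  next
    show "Idn (hom_cat K x (MC M (fres \<Sigma> B))) a \<in> X (fres \<Sigma> B) x" if
        "a \<in> Ob (hom_cat K x (MC M (fres \<Sigma> B)))" for a
      using id[OF fres_CSym[OF App.hyps(1)]] that by (simp add: Ob_hom_cat hom_cat_sel)
    show "Cmp (hom_cat K x (MC M (fres \<Sigma> B))) g f \<in> X (fres \<Sigma> B) x"
      if "f \<in> X (fres \<Sigma> B) x" "g \<in> X (fres \<Sigma> B) x" "in_hom (hom_cat K x (MC M (fres \<Sigma> B))) f a b"
        "in_hom (hom_cat K x (MC M (fres \<Sigma> B))) g b d" for f g a b d
      using comp[OF fres_CSym[OF App.hyps(1)] that] by (simp add: hom_cat_sel)
    show "fa (postcomp K (MPr M (far \<Sigma> B) i)) (lw K h \<alpha>) \<in> X (far \<Sigma> B ! i) x" if i: "i < length (far \<Sigma> B)"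
        for i
      using App.IH[of "ts ! i"] h(3)[OF i] lw_lw_ar[OF h(1) P.pi_in \<alpha>(1), of i] i by
          (simp add: postcomp_sel)
  qed
  then show ?case using h(2) lw_lw_ar[OF h(1) MB_in' \<alpha>(1)] by (simp add: postcomp_sel)
qed

lemma componentwise_preserves_OFS:
  assumes R: "\<forall>c\<in>CSym \<Sigma>. rep_OFS K (MC M c) (R c)"
    and R0: "R0 = product_OFS K (Srt \<sigma>) (M0 L) (pr0 L) (\<lambda>s. R (sty \<sigma> s))"
    and MB: "\<forall>B\<in>FSym \<Sigma>. MB_preserves_classes_componentwise K \<Sigma> M R B"
    and t: "t \<in> STerms \<Sigma> \<sigma>"
  shows "rep_preserves_left K (supp K \<Sigma> M L t) R0 (R (stype \<Sigma> \<sigma> t))"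
    "rep_preserves_right K (supp K \<Sigma> M L t) R0 (R (stype \<Sigma> \<sigma> t))"
proof -
  have ROFS: "is_OFS (hom_cat K x (MC M c)) (fst (R c x)) (snd (R c x))" if "c \<in> CSym \<Sigma>" "x \<in> Obj K" for c x
    using R that unfolding rep_OFS_def by blast
  have iso: "is_iso (hom_cat K x (MC M c)) (id2 K a) a a" if "cell1 K a x (MC M c)" for a x c
    using category.id_iso[OF hom_category, of a x "MC M c"] that by (simp add: Ob_hom_cat hom_cat_sel)
  have C: "MB_componentwise (\<lambda>x c d F. preserves_class F (fst (R c x)) (fst (R d x))) K \<Sigma> M B"
    "MB_componentwise (\<lambda>x c d F. preserves_class F (snd (R c x)) (snd (R d x))) K \<Sigma> M B" if "B \<in> FSym \<Sigma>" for
        B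
    using MB that unfolding MB_preserves_classes_componentwise_def MB_componentwise_def by simp_all
  show "rep_preserves_left K (supp K \<Sigma> M L t) R0 (R (stype \<Sigma> \<sigma> t))"
    unfolding rep_preserves_left_def preserves_class_def postcomp_sel
  proof (intro ballI)
    fix x \<alpha> assume x: "x \<in> Obj K" and \<alpha>: "\<alpha> \<in> fst (R0 x)"
    show "lw K (supp K \<Sigma> M L t) \<alpha> \<in> fst (R (stype \<Sigma> \<sigma> t) x)"
    proof (rule supp_preserves_classes[of "\<lambda>c x. fst (R c x)", OF _ _ C(1) x _ _ t])
      show "\<alpha> \<in> Ar (hom_cat K x (M0 L))" "\<forall>s\<in>Srt \<sigma>. lw K (pr0 L s) \<alpha> \<in> fst (R (sty \<sigma> s) x)"
        using \<alpha> x unfolding R0 product_OFS_def by simp_all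
      show "id2 K a \<in> fst (R c x)" if "c \<in> CSym \<Sigma>" "cell1 K a x (MC M c)" for c x a
        by (rule category.OFS_iso(1)[OF hom_category ROFS[OF that(1) cell1_ob(1)[OF that(2)]]
            iso[OF that(2)]])
      show "vc K \<beta> \<alpha> \<in> fst (R c x)" if "c \<in> CSym \<Sigma>" "\<alpha> \<in> fst (R c x)" "\<beta> \<in> fst (R c x)"
        "in_hom (hom_cat K x (MC M c)) \<alpha> a b" "in_hom (hom_cat K x (MC M c)) \<beta> b d" for c x \<alpha> \<beta> a b d
        using category.OFS_left_comp[OF hom_category ROFS[OF that(1)] that(2,4,3,5)] that(4) cell1_ob(1)
        by (auto simp: hom_cat_sel in_hom_hom_cat)
    qed
  qed
  show "rep_preserves_right K (supp K \<Sigma> M L t) R0 (R (stype \<Sigma> \<sigma> t))"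
    unfolding rep_preserves_right_def preserves_class_def postcomp_sel
  proof (intro ballI)
    fix x \<alpha> assume x: "x \<in> Obj K" and \<alpha>: "\<alpha> \<in> snd (R0 x)"
    show "lw K (supp K \<Sigma> M L t) \<alpha> \<in> snd (R (stype \<Sigma> \<sigma> t) x)"
    proof (rule supp_preserves_classes[of "\<lambda>c x. snd (R c x)", OF _ _ C(2) x _ _ t])
      show "\<alpha> \<in> Ar (hom_cat K x (M0 L))" "\<forall>s\<in>Srt \<sigma>. lw K (pr0 L s) \<alpha> \<in> snd (R (sty \<sigma> s) x)"
        using \<alpha> x unfolding R0 product_OFS_def by simp_all
      show "id2 K a \<in> snd (R c x)" if "c \<in> CSym \<Sigma>" "cell1 K a x (MC M c)" for c x a
        by (rule category.OFS_iso(2)[OF hom_category ROFS[OF that(1) cell1_ob(1)[OF that(2)]]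
            iso[OF that(2)]])
      show "vc K \<beta> \<alpha> \<in> snd (R c x)" if "c \<in> CSym \<Sigma>" "\<alpha> \<in> snd (R c x)" "\<beta> \<in> snd (R c x)"
        "in_hom (hom_cat K x (MC M c)) \<alpha> a b" "in_hom (hom_cat K x (MC M c)) \<beta> b d" for c x \<alpha> \<beta> a b d
        using category.OFS_right_comp[OF hom_category ROFS[OF that(1)] that(2,4,3,5)] that(4) cell1_ob(1)
        by (auto simp: hom_cat_sel in_hom_hom_cat)
    qed
  qed
qed

text \<open>Each operation is assumed to preserve regular epimorphisms jointly, so it suffices that
  the tuple of the argument supports does; in a product of hom-categories this is checked in each
  component.\<close>

lemma supp_regular_epis:
  assumes MB: "\<forall>B\<in>FSym \<Sigma>. rep_preserves preserves_regular_epis K (MB M B)" and t: "t \<in> STerms \<Sigma> \<sigma>"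
  shows "rep_preserves preserves_regular_epis K (supp K \<Sigma> M L t)"
  using t
proof (induction rule: Terms.induct)
  case (Var s)
  show ?case
    unfolding supp_Var
  proof (rule rep_preservesI[OF P0.pi_in[OF Var]])
    fix x assume x: "x \<in> Obj K"
    interpret X: product_category "hom_cat K x (M0 L)" "Srt \<sigma>" "\<lambda>s. hom_cat K x (MC M (sty \<sigma> s))"
        "\<lambda>s. postcomp K (pr0 L s)"
      by (rule P0.hom_product[OF x])
    show "preserves_regular_epis (hom_cat K x (M0 L)) (hom_cat K x (MC M (sty \<sigma> s))) (postcomp K (pr0 L s))"
      unfolding preserves_regular_epis_def using X.regular_epi_iff[OF X.D.regular_epi_hom] Var by blast
  qed
next
  case (App B ts)
  interpret P: two_product K "{..<length (far \<Sigma> B)}" "\<lambda>i. MC M (far \<Sigma> B ! i)" "MP M (far \<Sigma> B)"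
      "MPr M (far \<Sigma> B)"
    by (rule MP_product[OF far_CSym[OF App.hyps(1)]])
  have ts: "set ts \<subseteq> STerms \<Sigma> \<sigma>" using App.hyps by blast
  obtain h where h: "cell1 K h (M0 L) (MP M (far \<Sigma> B))" "supp K \<Sigma> M L (App B ts) = c1 K (MB M B) h"
    "\<And>i. i < length (far \<Sigma> B) \<Longrightarrow> ts ! i \<in> set ts \<and> stype \<Sigma> \<sigma> (ts ! i) = far \<Sigma> B ! i \<and>
      c1 K (MPr M (far \<Sigma> B) i) h = supp K \<Sigma> M L (ts ! i)"
    by (rule supp_App[OF App.hyps(1,2) ts]) (rule that)
  note MB_in' = MB_in[OF App.hyps(1)]
  show ?case
    unfolding h(2)
  proof (rule rep_preservesI[OF c1_in[OF h(1) MB_in']])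
    fix x assume x: "x \<in> Obj K"
    interpret X: product_category "hom_cat K x (MP M (far \<Sigma> B))" "{..<length (far \<Sigma> B)}"
      "\<lambda>i. hom_cat K x (MC M (far \<Sigma> B ! i))" "\<lambda>i. postcomp K (MPr M (far \<Sigma> B) i)"
      by (rule P.hom_product[OF x])
    show "preserves_regular_epis (hom_cat K x (M0 L)) (hom_cat K x (MC M (fres \<Sigma> B)))
        (postcomp K (c1 K (MB M B) h))"
      unfolding preserves_regular_epis_def
    proof (intro allI impI)
      fix e assume e: "regular_epi (hom_cat K x (M0 L)) e"
      note eh = category.regular_epi_hom[OF hom_category e]
      note ea = in_homD(1)[OF eh]
      have "regular_epi (hom_cat K x (MC M (far \<Sigma> B ! i)))
          (fa (postcomp K (MPr M (far \<Sigma> B) i)) (fa (postcomp K h) e))"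
        if i: "i \<in> {..<length (far \<Sigma> B)}" for i
      proof -
        have i': "i < length (far \<Sigma> B)" using i by simp
        have "ts ! i \<in> STerms \<Sigma> \<sigma>" using ts h(3)[OF i'] by blast
        then have "regular_epi (hom_cat K x (MC M (stype \<Sigma> \<sigma> (ts ! i)))) (lw K (supp K \<Sigma> M L (ts ! i)) e)"
          using rep_preservesD[OF _ supp_in x, of preserves_regular_epis "ts ! i"] App.IH[of "ts ! i"]
              h(3)[OF i'] e
          unfolding preserves_regular_epis_def postcomp_sel by blast
        then show ?thesis using h(3)[OF i'] lw_lw_ar[OF h(1) P.pi_in[OF i] ea] by (simp add: postcomp_sel)
      qed
      then have "regular_epi (hom_cat K x (MP M (far \<Sigma> B))) (fa (postcomp K h) e)"
        using X.regular_epi_iff[OF functor_hom[OF postcomp_functor[OF h(1)] eh]] by blast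
      then have "regular_epi (hom_cat K x (MC M (fres \<Sigma> B))) (lw K (MB M B) (lw K h e))"
        using rep_preservesD[OF MB[rule_format, OF App.hyps(1)] MB_in' x] unfolding
            preserves_regular_epis_def postcomp_sel by blast
      then show "regular_epi (hom_cat K x (MC M (fres \<Sigma> B))) (fa (postcomp K (c1 K (MB M B) h)) e)"
        using lw_lw_ar[OF h(1) MB_in' ea] by (simp add: postcomp_sel)
    qed
  qed
qed

text \<open>Coequalizers in a product are detected componentwise, so the tuple of the argument
  supports preserves those of reflexive pairs; \<open>joint_reflexive_coeqs\<close> then handles the
  operation applied to the tuple.\<close>

lemma supp_reflexive_coeqs:
  assumes MB: "\<forall>B\<in>FSym \<Sigma>. MB_preserves_reflexive_coeqs_componentwise K \<Sigma> M B" and t: "t \<in> STerms \<Sigma> \<sigma>"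
  shows "rep_preserves preserves_reflexive_coeqs K (supp K \<Sigma> M L t)"
  using t
proof (induction rule: Terms.induct)
  case (Var s)
  show ?case
    unfolding supp_Var
  proof (rule rep_preservesI[OF P0.pi_in[OF Var]])
    fix x assume x: "x \<in> Obj K"
    show "preserves_reflexive_coeqs (hom_cat K x (M0 L)) (hom_cat K x (MC M (sty \<sigma> s)))
        (postcomp K (pr0 L s))"
      unfolding preserves_reflexive_coeqs_def using product_category.P_coequalizer[OF P0.hom_product[OF x]
          Var] by blast
  qed
next
  case (App B ts)
  interpret P: two_product K "{..<length (far \<Sigma> B)}" "\<lambda>i. MC M (far \<Sigma> B ! i)" "MP M (far \<Sigma> B)"
      "MPr M (far \<Sigma> B)"
    by (rule MP_product[OF far_CSym[OF App.hyps(1)]])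
  have ts: "set ts \<subseteq> STerms \<Sigma> \<sigma>" using App.hyps by blast
  obtain h where h: "cell1 K h (M0 L) (MP M (far \<Sigma> B))" "supp K \<Sigma> M L (App B ts) = c1 K (MB M B) h"
    "\<And>i. i < length (far \<Sigma> B) \<Longrightarrow> ts ! i \<in> set ts \<and> stype \<Sigma> \<sigma> (ts ! i) = far \<Sigma> B ! i \<and>
      c1 K (MPr M (far \<Sigma> B) i) h = supp K \<Sigma> M L (ts ! i)"
    by (rule supp_App[OF App.hyps(1,2) ts]) (rule that)
  note MB_in' = MB_in[OF App.hyps(1)]
  show ?case
    unfolding h(2)
  proof (rule rep_preservesI[OF c1_in[OF h(1) MB_in']])
    fix x assume x: "x \<in> Obj K"
    let ?D = "hom_cat K x (MP M (far \<Sigma> B))"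
    interpret F: finite_product_category ?D "length (far \<Sigma> B)"
      "\<lambda>i. hom_cat K x (MC M (far \<Sigma> B ! i))" "\<lambda>i. postcomp K (MPr M (far \<Sigma> B) i)"
      by (rule MB_finite_product[OF App.hyps(1) x])
    show "preserves_reflexive_coeqs (hom_cat K x (M0 L)) (hom_cat K x (MC M (fres \<Sigma> B)))
        (postcomp K (c1 K (MB M B) h))"
      unfolding preserves_reflexive_coeqs_def
    proof (intro allI impI, elim conjE)
      fix p q e assume r: "is_reflexive_pair (hom_cat K x (M0 L)) p q" and
          co: "is_coequalizer (hom_cat K x (M0 L)) p q e"
      obtain a b c where pq: "in_hom (hom_cat K x (M0 L)) p a b" "in_hom (hom_cat K x (M0 L)) q a b"
        "in_hom (hom_cat K x (M0 L)) e b c" using is_coequalizerE[OF co] .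
      note ar = in_homD(1)[OF pq(1)] in_homD(1)[OF pq(2)] in_homD(1)[OF pq(3)]
      note hF = postcomp_functor[OF h(1), of x]
      have r': "is_reflexive_pair ?D (lw K h p) (lw K h q)"
      proof -
        obtain a b s where s: "in_hom (hom_cat K x (M0 L)) p a b" "in_hom (hom_cat K x (M0 L)) q a b"
          "in_hom (hom_cat K x (M0 L)) s b a" "Cmp (hom_cat K x (M0 L)) p s = Idn (hom_cat K x (M0 L)) b"
          "Cmp (hom_cat K x (M0 L)) q s = Idn (hom_cat K x (M0 L)) b"
          using r unfolding is_reflexive_pair_def by blast
        have b: "b \<in> Ob (hom_cat K x (M0 L))" using category.hom_ob[OF hom_category s(3)] by blast
        show ?thesis
          unfolding is_reflexive_pair_def
          using functor_hom[OF hF s(1)] functor_hom[OF hF s(2)] functor_hom[OF hF s(3)] functor_id[OF hF b]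
            functor_comp[OF hF s(3,1)] functor_comp[OF hF s(3,2)] s(4,5)
          by (intro exI[of _ "fo (postcomp K h) a"] exI[of _ "fo (postcomp K h) b"] exI[of _ "lw K h s"])
             (simp add: postcomp_sel)
      qed
      have co': "is_coequalizer ?D (lw K h p) (lw K h q) (lw K h e)"
      proof (rule F.coequalizerI[OF functor_hom[OF hF pq(1), unfolded postcomp_sel]
            functor_hom[OF hF pq(2), unfolded postcomp_sel]
                functor_hom[OF hF pq(3), unfolded postcomp_sel]])
        fix i assume i: "i \<in> {..<length (far \<Sigma> B)}"
        then have i': "i < length (far \<Sigma> B)" by simp
        have "ts ! i \<in> STerms \<Sigma> \<sigma>" using ts h(3)[OF i'] by blast
        then have "is_coequalizer (hom_cat K x (MC M (stype \<Sigma> \<sigma> (ts ! i)))) (lw K (supp K \<Sigma> M L (ts ! i)) p)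
            (lw K (supp K \<Sigma> M L (ts ! i)) q) (lw K (supp K \<Sigma> M L (ts ! i)) e)"
          using rep_preservesD[OF _ supp_in x, of preserves_reflexive_coeqs "ts ! i"] App.IH[of "ts ! i"]
              h(3)[OF i'] r co
          unfolding preserves_reflexive_coeqs_def postcomp_sel by blast
        then show "is_coequalizer (hom_cat K x (MC M (far \<Sigma> B ! i)))
            (fa (postcomp K (MPr M (far \<Sigma> B) i)) (lw K h p))
            (fa (postcomp K (MPr M (far \<Sigma> B) i)) (lw K h q))
                (fa (postcomp K (MPr M (far \<Sigma> B) i)) (lw K h e))"
          using h(3)[OF i'] lw_lw_ar[OF h(1) P.pi_in[OF i]] ar by (simp add: postcomp_sel)
      qed
      have "is_coequalizer (hom_cat K x (MC M (fres \<Sigma> B))) (fa (postcomp K (MB M B)) (lw K h p))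
          (fa (postcomp K (MB M B)) (lw K h q)) (fa (postcomp K (MB M B)) (lw K h e))"
      proof (rule F.joint_reflexive_coeqs[OF hom_category postcomp_functor[OF MB_in'] _ r' co'])
        fix i p q e assume i: "i < length (far \<Sigma> B)"
          and pq: "in_hom ?D p (Dm ?D p) (Dm ?D e)" "in_hom ?D q (Dm ?D p) (Dm ?D e)" "e \<in> Ar ?D"
          and v: "F.varies_only i p" "F.varies_only i q" "F.varies_only i e"
          and rc: "is_reflexive_pair (hom_cat K x (MC M (far \<Sigma> B ! i)))
              (fa (postcomp K (MPr M (far \<Sigma> B) i)) p) (fa (postcomp K (MPr M (far \<Sigma> B) i)) q)"
            "is_coequalizer (hom_cat K x (MC M (far \<Sigma> B ! i))) (fa (postcomp K (MPr M (far \<Sigma> B) i)) p)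
              (fa (postcomp K (MPr M (far \<Sigma> B) i)) q) (fa (postcomp K (MPr M (far \<Sigma> B) i)) e)"
        let ?fs = "map (\<lambda>j. c1 K (MPr M (far \<Sigma> B) j) (Dm (vert K) p)) [0..<length (far \<Sigma> B)]"
        let ?H = "partial_MB K \<Sigma> M B x i ?fs"
        note pa = in_homD(1)[OF pq(1)] in_homD(1)[OF pq(2)]
        have "preserves_reflexive_coeqs (hom_cat K x (MC M (far \<Sigma> B ! i))) (hom_cat K x (MC M (fres \<Sigma> B)))
            ?H"
          using MB_componentwiseD[OF MB[rule_format, OF App.hyps(1), unfolded
              MB_preserves_reflexive_coeqs_componentwise_def]
              App.hyps(1) x i hom_arD(1)[OF pa(1)]] .
        then have "is_coequalizer (hom_cat K x (MC M (fres \<Sigma> B))) (fa ?H (lw K (MPr M (far \<Sigma> B) i) p))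
            (fa ?H (lw K (MPr M (far \<Sigma> B) i) q)) (fa ?H (lw K (MPr M (far \<Sigma> B) i) e))"
          using rc unfolding preserves_reflexive_coeqs_def postcomp_sel by blast
        \<comment> \<open>One tuple of frozen arguments has to serve p, q and e, although e starts
          at the target of p. Outside i the two ends of p have the same components, since p is an
          identity there.\<close>
        moreover have "fa ?H (lw K (MPr M (far \<Sigma> B) i) g) = lw K (MB M B) g"
          if g: "in_hom ?D g d d'" "F.varies_only i g"
            and d: "\<And>j. j < length (far \<Sigma> B) \<Longrightarrow> j \<noteq> i \<Longrightarrow> c1 K (MPr M (far \<Sigma> B) j) d = c1 K (MPr M (far \<Sigma> B) j)
                (Dm (vert K) p)"
          for g d d'
          by (rule partial_MB_apply[OF App.hyps(1) x in_homD(1)[OF g(1)]])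
             (use F.varies_only_hom[OF g] d in \<open>auto simp: postcomp_sel hom_cat_sel\<close>)
        note this[OF pq(1) v(1)] this[OF pq(2) v(2)] this[OF F.D.ar_hom[OF pq(3)] v(3)]
        moreover have "c1 K (MPr M (far \<Sigma> B) j) (Dm ?D e) = c1 K (MPr M (far \<Sigma> B) j) (Dm (vert K) p)"
          if "j < length (far \<Sigma> B)" "j \<noteq> i" for j
        proof -
          have jj: "j \<in> {..<length (far \<Sigma> B)}" using that by simp
          have "fa (postcomp K (MPr M (far \<Sigma> B) j)) p = Idn (hom_cat K x (MC M (far \<Sigma> B ! j)))
              (fo (postcomp K (MPr M (far \<Sigma> B) j)) (Dm ?D p))"
            by (rule F.varies_only_hom[OF pq(1) v(1) that])
          then show ?thesis
            using in_homD(3)[OF F.P_hom[OF jj pq(1)]] in_homD(3)[OF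
                F.Pid[OF F.D.hom_ob(1)[OF pq(1)] that(1)]]
            by (simp add: postcomp_sel hom_cat_sel)
        qed
        ultimately show "is_coequalizer (hom_cat K x (MC M (fres \<Sigma> B))) (fa (postcomp K (MB M B)) p)
          (fa (postcomp K (MB M B)) q) (fa (postcomp K (MB M B)) e)"
          by (simp add: postcomp_sel hom_cat_sel)
      qed
      then show "is_coequalizer (hom_cat K x (MC M (fres \<Sigma> B))) (fa (postcomp K (c1 K (MB M B) h)) p)
          (fa (postcomp K (c1 K (MB M B) h)) q) (fa (postcomp K (c1 K (MB M B) h)) e)"
        using lw_lw_ar[OF h(1) MB_in'] ar by (simp add: postcomp_sel)
    qed
  qed
qed

text \<open>In an algebraic theory the coarity supports are projections of \<open>M0 L\<close>, and
  these preserve finite limits at every stage.\<close>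

lemma algebraic_coarity_limits:
  assumes "algebraic \<sigma> T" "t \<in> coarity_terms \<sigma> T"
  shows "rep_preserves preserves_finite_limits K (supp K \<Sigma> M L t)"
  using assms P0.rep_preserves_projection_limits unfolding algebraic_def by (auto simp: supp_Var)

lemma arity_STerms: "t \<in> arity_terms \<sigma> T \<Longrightarrow> t \<in> STerms \<Sigma> \<sigma>"
  and coarity_STerms: "t \<in> coarity_terms \<sigma> T \<Longrightarrow> t \<in> STerms \<Sigma> \<sigma>"
  unfolding arity_terms_def coarity_terms_def using fdom_STerms fcod_STerms eqn_STerms(1,2) by blast+

section \<open>Regularity and exactness of the object of models\<close>

lemma M0_regular: "\<forall>c\<in>CSym \<Sigma>. rep_regular K (MC M c) \<Longrightarrow> rep_regular K (M0 L)"
  using P0.product_rep_regular sty_CSym by blast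

lemma hom_lifting_regular:
  assumes reg: "\<forall>c\<in>CSym \<Sigma>. rep_regular K (MC M c)"
    and ar: "\<forall>t\<in>arity_terms \<sigma> T. rep_preserves preserves_regular_epis K (supp K \<Sigma> M L t)"
    and co: "\<forall>t\<in>coarity_terms \<sigma> T. rep_preserves preserves_finite_limits K (supp K \<Sigma> M L t)"
    and x: "x \<in> Obj K"
  shows "lifting_regular (hom_cat K x (Mth L)) (hom_cat K x (M0 L)) (postcomp K (forgetful K L))
    (Inl ` Fn \<sigma>) (Inr ` T) (\<lambda>i. hom_cat K x (MC M (stype \<Sigma> \<sigma> (dmt i))))
    (\<lambda>i. postcomp K (supp K \<Sigma> M L (dmt i))) (\<lambda>i. postcomp K (supp K \<Sigma> M L (cdt i))) struct"
proof (intro lifting_regular.intro lifting_regular_axioms.intro lifting_limits.intro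
    lifting_limits_axioms.intro
    hom_lifting[OF x])
  show D: "regular_category (hom_cat K x (M0 L))"
    using M0_regular[OF reg] x unfolding rep_regular_def by blast
  then show "has_finite_limits (hom_cat K x (M0 L))" unfolding regular_category_iff by blast
  fix i assume i: "i \<in> Inl ` Fn \<sigma> \<union> Inr ` T"
  note S = dmt_STerms[OF i]
  show "preserves_finite_limits (hom_cat K x (M0 L)) (hom_cat K x (MC M (stype \<Sigma> \<sigma> (dmt i))))
      (postcomp K (supp K \<Sigma> M L (cdt i)))"
    using rep_preservesD[OF co[rule_format, OF S(5)] supp_in[OF S(2)] x] S(3) by simp
  show "regular_category (hom_cat K x (MC M (stype \<Sigma> \<sigma> (dmt i))))"
    using reg S(6) x unfolding rep_regular_def by blast
  show "preserves_regular_epis (hom_cat K x (M0 L)) (hom_cat K x (MC M (stype \<Sigma> \<sigma> (dmt i))))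
      (postcomp K (supp K \<Sigma> M L (dmt i)))"
    by (rule rep_preservesD[OF ar[rule_format, OF S(4)] supp_in[OF S(1)] x])
qed

lemma models_regular:
  assumes reg: "\<forall>c\<in>CSym \<Sigma>. rep_regular K (MC M c)"
    and ar: "\<forall>t\<in>arity_terms \<sigma> T. rep_preserves preserves_regular_epis K (supp K \<Sigma> M L t)"
    and co: "\<forall>t\<in>coarity_terms \<sigma> T. rep_preserves preserves_finite_limits K (supp K \<Sigma> M L t)"
  shows "rep_regular K (Mth L) \<and> rep_preserves preserves_finite_limits K (forgetful K L) \<and>
    rep_preserves preserves_regular_epis K (forgetful K L)"
proof (intro conjI)
  note lr = hom_lifting_regular[OF assms]
  note ll = lifting_regular.axioms(1)[OF lr]
  show lim: "rep_preserves preserves_finite_limits K (forgetful K L)"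
    by (rule rep_preservesI[OF forgetful_in]) (rule lifting_limits.U_limits[OF ll])
  show "rep_preserves preserves_regular_epis K (forgetful K L)"
    by (rule rep_preservesI[OF forgetful_in]) (rule lifting_regular.U_regular[OF lr])
  show "rep_regular K (Mth L)"
    unfolding rep_regular_def
  proof (intro conjI ballI allI impI)
    show "regular_category (hom_cat K x (Mth L))" if "x \<in> Obj K" for x
      by (rule lifting_regular.A_regular[OF lr[OF that]])
    fix x y f assume f: "cell1 K f x y"
    note xy = cell1_ob[OF f] and pf = precomp_functor[OF f]
    let ?U = "postcomp K (forgetful K L)"
    \<comment> \<open>Precomposition commutes with the forgetful functor, and structure upstairs is
      detected below: limits by \<open>reflect_finite_limit\<close>, regular epimorphisms by
      \<open>regular_epi_lift_iff\<close>. Both claims thus reduce to precomposition on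
      \<open>M0 L\<close>.\<close>
    note pp = precomp_postcomp[OF f forgetful_in]
    have D: "preserves_finite_limits (hom_cat K y (M0 L)) (hom_cat K x (M0 L)) (precomp K f)"
      "preserves_regular_epis (hom_cat K y (M0 L)) (hom_cat K x (M0 L)) (precomp K f)"
      using M0_regular[OF reg] f unfolding rep_regular_def by blast+
    note Uf = postcomp_functor[OF forgetful_in]
    show "preserves_finite_limits (hom_cat K y (Mth L)) (hom_cat K x (Mth L)) (precomp K f)"
      unfolding preserves_finite_limits_def
    proof (intro allI impI, elim conjE)
      fix S H a l assume S: "finite_shape S" "is_functor S (hom_cat K y (Mth L)) H"
        and l: "is_limit S (hom_cat K y (Mth L)) H a l"
      have cS: "category S" using S(1) by (simp add: finite_shape_def)
      note lc = limit_cone[OF l]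
      have lh: "in_hom (hom_cat K y (Mth L)) (l j) a (fo H j)" if "j \<in> Ob S" for j by
          (rule coneD(2)[OF lc that])
      have "is_limit S (hom_cat K y (M0 L)) (func_comp ?U H) (fo ?U a) (\<lambda>j. fa ?U (l j))"
        using rep_preservesD[OF lim forgetful_in xy(2)] S l unfolding preserves_finite_limits_def by blast
      then have "is_limit S (hom_cat K x (M0 L)) (func_comp (precomp K f) (func_comp ?U H))
          (fo (precomp K f) (fo ?U a)) (\<lambda>j. fa (precomp K f) (fa ?U (l j)))"
        using D(1) S(1) functor_func_comp[OF S(2) Uf] unfolding preserves_finite_limits_def by blast
      moreover have "is_limit S (hom_cat K x (M0 L)) (func_comp ?U (func_comp (precomp K f) H))
          (fo ?U (fo (precomp K f) a)) (\<lambda>j. fa ?U (fa (precomp K f) (l j))) \<longleftrightarrow>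
        is_limit S (hom_cat K x (M0 L)) (func_comp (precomp K f) (func_comp ?U H))
          (fo (precomp K f) (fo ?U a)) (\<lambda>j. fa (precomp K f) (fa ?U (l j)))"
        by (rule is_limit_comp_cong[OF cS S(2) hom_category])
           (use pp in_homD(1)[OF lh] coneD(1)[OF lc] in auto)
      ultimately have "is_limit S (hom_cat K x (M0 L)) (func_comp ?U (func_comp (precomp K f) H))
          (fo ?U (fo (precomp K f) a)) (\<lambda>j. fa ?U (fa (precomp K f) (l j)))" by blast
      then show "is_limit S (hom_cat K x (Mth L)) (func_comp (precomp K f) H) (fo (precomp K f) a)
          (\<lambda>j. fa (precomp K f) (l j))"
        by (rule lifting_limits.reflect_finite_limit[OF ll[OF xy(1)] S(1) functor_func_comp[OF S(2) pf]
              functor_cone[OF cS S(2) pf lc]])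
    qed
    show "preserves_regular_epis (hom_cat K y (Mth L)) (hom_cat K x (Mth L)) (precomp K f)"
      unfolding preserves_regular_epis_def
    proof (intro allI impI)
      fix e assume "regular_epi (hom_cat K y (Mth L)) e"
      then have e: "e \<in> Ar (hom_cat K y (Mth L))" "regular_epi (hom_cat K y (M0 L)) (fa ?U e)"
        unfolding lifting_regular.regular_epi_lift_iff[OF lr[OF xy(2)]] by auto
      have "regular_epi (hom_cat K x (M0 L)) (fa (precomp K f) (fa ?U e))"
        using D(2) e(2) unfolding preserves_regular_epis_def by blast
      then show "regular_epi (hom_cat K x (Mth L)) (fa (precomp K f) e)"
        unfolding lifting_regular.regular_epi_lift_iff[OF lr[OF xy(1)]]
        using pp(2)[OF e(1)] rw_ar[OF f e(1)] by (simp add: precomp_sel)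
    qed
  qed
qed

lemma models_exact:
  assumes ex: "\<forall>c\<in>CSym \<Sigma>. rep_exact K (MC M c)"
    and ar: "\<forall>t\<in>arity_terms \<sigma> T. rep_preserves preserves_coeqs_of_kernel_pairs K (supp K \<Sigma> M L t)"
    and co: "\<forall>t\<in>coarity_terms \<sigma> T. rep_preserves preserves_finite_limits K (supp K \<Sigma> M L t)"
  shows "rep_exact K (Mth L)"
proof -
  have reg: "\<forall>c\<in>CSym \<Sigma>. rep_regular K (MC M c)" using ex unfolding rep_exact_def by blast
  \<comment> \<open>Arity supports preserve coequalizers of kernel pairs on the regular
    hom-categories of \<open>M0 L\<close>, so they preserve regular epimorphisms and the regular
    case becomes available.\<close>
  have ar': "\<forall>t\<in>arity_terms \<sigma> T. rep_preserves preserves_regular_epis K (supp K \<Sigma> M L t)"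
  proof
    fix t assume t: "t \<in> arity_terms \<sigma> T"
    note st = supp_in[OF arity_STerms[OF t]]
    show "rep_preserves preserves_regular_epis K (supp K \<Sigma> M L t)"
    proof (rule rep_preservesI[OF st])
      fix x assume x: "x \<in> Obj K"
      show "preserves_regular_epis (hom_cat K x (M0 L)) (hom_cat K x (MC M (stype \<Sigma> \<sigma> t)))
          (postcomp K (supp K \<Sigma> M L t))"
        using preserves_coeqs_imp_regular_epis rep_preservesD[OF ar[rule_format, OF t] st x]
            M0_regular[OF reg] x
        unfolding rep_regular_def by blast
    qed
  qed
  have "exact_category (hom_cat K x (Mth L))" if x: "x \<in> Obj K" for x
  proof (rule lifting_exact.A_exact[OF lifting_exact.intro[OF hom_lifting_regular[OF reg ar' co x]
      lifting_exact_axioms.intro]])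
    show "exact_category (hom_cat K x (M0 L))"
      using product_category.product_exact[OF P0.hom_product[OF x]] ex sty_CSym x unfolding rep_exact_def by
          blast
    fix i assume i: "i \<in> Inl ` Fn \<sigma> \<union> Inr ` T"
    note S = dmt_STerms[OF i]
    show "preserves_coeqs_of_kernel_pairs (hom_cat K x (M0 L)) (hom_cat K x (MC M (stype \<Sigma> \<sigma> (dmt i))))
        (postcomp K (supp K \<Sigma> M L (dmt i)))"
      by (rule rep_preservesD[OF ar[rule_format, OF S(4)] supp_in[OF S(1)] x])
  qed
  then show ?thesis using models_regular[OF reg ar' co] unfolding rep_exact_def by blast
qed

lemma reflexive_coeqs_kernel_pairs:
  assumes "t \<in> STerms \<Sigma> \<sigma>" "rep_preserves preserves_reflexive_coeqs K (supp K \<Sigma> M L t)"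
  shows "rep_preserves preserves_coeqs_of_kernel_pairs K (supp K \<Sigma> M L t)"
proof (rule rep_preservesI[OF supp_in[OF assms(1)]])
  fix x assume x: "x \<in> Obj K"
  show "preserves_coeqs_of_kernel_pairs (hom_cat K x (M0 L)) (hom_cat K x (MC M (stype \<Sigma> \<sigma> t)))
      (postcomp K (supp K \<Sigma> M L t))"
    using rep_preservesD[OF assms(2) supp_in[OF assms(1)] x] kernel_pair_reflexive[OF hom_category]
    unfolding preserves_coeqs_of_kernel_pairs_def preserves_reflexive_coeqs_def by blast
qed

end

theorem corollary5p10:
  fixes K :: "('o, 'm, 'a) twocat"
    and \<Sigma> :: "('c, 'f, 'v, 't) sig2"
    and \<sigma> :: "('c, 'f, 's, 'g) sig1"
    and T :: "('f, 't, 's, 'g) eqn set"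
    and M :: "('c, 'f, 't, 'o, 'm, 'a) model"
    and L :: "('f, 't, 's, 'g, 'o, 'm, 'a) constr"
  assumes "infinite (UNIV :: 'u set)"
    and "PIE_complete TYPE('u) K"
    and "signature_pair TYPE('u) \<Sigma> \<sigma>"
    and "is_theory \<Sigma> \<sigma> T"
    and "is_model K \<Sigma> M"
    and "is_construction K \<Sigma> \<sigma> T M L"
  shows
    \<comment> \<open>Part 1\<close>
    "(\<forall>R :: 'c \<Rightarrow> ('o, 'a) ofs_family.
        (\<forall>c\<in>CSym \<Sigma>. rep_OFS K (MC M c) (R c)) \<longrightarrow>
        (let R0 = product_OFS K (Srt \<sigma>) (M0 L) (pr0 L) (\<lambda>s. R (sty \<sigma> s));
             conclusion = (\<exists>!Q. rep_OFS K (Mth L) Q \<and>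
               (\<forall>s\<in>Srt \<sigma>.
                  rep_preserves_left K (c1 K (pr0 L s) (forgetful K L)) Q (R (sty \<sigma> s)) \<and>
                  rep_preserves_right K (c1 K (pr0 L s) (forgetful K L)) Q (R (sty \<sigma> s))))
         in ((\<forall>t\<in>arity_terms \<sigma> T.
                rep_preserves_left K (supp K \<Sigma> M L t) R0 (R (stype \<Sigma> \<sigma> t))) \<and>
             (\<forall>t\<in>coarity_terms \<sigma> T.
                rep_preserves_right K (supp K \<Sigma> M L t) R0 (R (stype \<Sigma> \<sigma> t)))
             \<longrightarrow> conclusion) \<and>
            ((\<forall>B\<in>FSym \<Sigma>. MB_preserves_classes_componentwise K \<Sigma> M R B)
             \<longrightarrow> conclusion)))
     \<and>
     \<comment> \<open>Part 2\<close>
     ((\<forall>c\<in>CSym \<Sigma>. rep_regular K (MC M c)) \<longrightarrow>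
        (let conclusion = (rep_regular K (Mth L) \<and>
               rep_preserves preserves_finite_limits K (forgetful K L) \<and>
               rep_preserves preserves_regular_epis K (forgetful K L))
         in ((\<forall>t\<in>arity_terms \<sigma> T. rep_preserves preserves_regular_epis K (supp K \<Sigma> M L t)) \<and>
             (\<forall>t\<in>coarity_terms \<sigma> T. rep_preserves preserves_finite_limits K (supp K \<Sigma> M L t))
             \<longrightarrow> conclusion) \<and>
            (algebraic \<sigma> T \<and>
             (\<forall>B\<in>FSym \<Sigma>. rep_preserves preserves_regular_epis K (MB M B))
             \<longrightarrow> conclusion)))
     \<and>
     \<comment> \<open>Part 3\<close>
     ((\<forall>c\<in>CSym \<Sigma>. rep_exact K (MC M c)) \<longrightarrow>
        ((\<forall>t\<in>arity_terms \<sigma> T.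
            rep_preserves preserves_coeqs_of_kernel_pairs K (supp K \<Sigma> M L t)) \<and>
         (\<forall>t\<in>coarity_terms \<sigma> T. rep_preserves preserves_finite_limits K (supp K \<Sigma> M L t))
         \<longrightarrow> rep_exact K (Mth L)) \<and>
        (algebraic \<sigma> T \<and>
         (\<forall>B\<in>FSym \<Sigma>. MB_preserves_reflexive_coeqs_componentwise K \<Sigma> M B)
         \<longrightarrow> rep_exact K (Mth L)))"
proof -
  have two: "two_category K" using assms(2) unfolding PIE_complete_def by blast
  interpret bialgebra K "TYPE('u)" \<Sigma> \<sigma> T M L
    by (intro bialgebra.intro bialgebra_axioms.intro two assms(3-6))
  show ?thesis
    unfolding Let_def
  proof (intro conjI allI impI; (elim conjE)?)
    fix R :: "'c \<Rightarrow> ('o, 'a) ofs_family"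
    assume R: "\<forall>c\<in>CSym \<Sigma>. rep_OFS K (MC M c) (R c)"
    note m = models_OFS[OF R refl]
    {
      assume "\<forall>t\<in>arity_terms \<sigma> T. rep_preserves_left K (supp K \<Sigma> M L t)
          (product_OFS K (Srt \<sigma>) (M0 L) (pr0 L) (\<lambda>s. R (sty \<sigma> s))) (R (stype \<Sigma> \<sigma> t))"
        "\<forall>t\<in>coarity_terms \<sigma> T. rep_preserves_right K (supp K \<Sigma> M L t)
          (product_OFS K (Srt \<sigma>) (M0 L) (pr0 L) (\<lambda>s. R (sty \<sigma> s))) (R (stype \<Sigma> \<sigma> t))"
      then show "\<exists>!Q. rep_OFS K (Mth L) Q \<and> (\<forall>s\<in>Srt \<sigma>.
          rep_preserves_left K (c1 K (pr0 L s) (forgetful K L)) Q (R (sty \<sigma> s)) \<and>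
          rep_preserves_right K (c1 K (pr0 L s) (forgetful K L)) Q (R (sty \<sigma> s)))" by (rule m)
    }
    \<comment> \<open>Under this hypothesis the support of every term preserves both classes, so
      arity and coarity terms are covered together.\<close>
    assume MB: "\<forall>B\<in>FSym \<Sigma>. MB_preserves_classes_componentwise K \<Sigma> M R B"
    show "\<exists>!Q. rep_OFS K (Mth L) Q \<and> (\<forall>s\<in>Srt \<sigma>.
          rep_preserves_left K (c1 K (pr0 L s) (forgetful K L)) Q (R (sty \<sigma> s)) \<and>
          rep_preserves_right K (c1 K (pr0 L s) (forgetful K L)) Q (R (sty \<sigma> s)))"
      by (rule m) (use componentwise_preserves_OFS[OF R refl MB] arity_STerms coarity_STerms in blast)+
  next
    assume reg: "\<forall>c\<in>CSym \<Sigma>. rep_regular K (MC M c)"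
    note m = models_regular[OF reg]
    {
      assume "\<forall>t\<in>arity_terms \<sigma> T. rep_preserves preserves_regular_epis K (supp K \<Sigma> M L t)"
        "\<forall>t\<in>coarity_terms \<sigma> T. rep_preserves preserves_finite_limits K (supp K \<Sigma> M L t)"
      from m[OF this] show "rep_regular K (Mth L)" "rep_preserves preserves_finite_limits K (forgetful K L)"
        "rep_preserves preserves_regular_epis K (forgetful K L)" by blast+
    }
    assume "algebraic \<sigma> T" "\<forall>B\<in>FSym \<Sigma>. rep_preserves preserves_regular_epis K (MB M B)"
    then have "\<forall>t\<in>arity_terms \<sigma> T. rep_preserves preserves_regular_epis K (supp K \<Sigma> M L t)"
      "\<forall>t\<in>coarity_terms \<sigma> T. rep_preserves preserves_finite_limits K (supp K \<Sigma> M L t)"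
      using supp_regular_epis arity_STerms algebraic_coarity_limits by blast+
    from m[OF this] show "rep_regular K (Mth L)" "rep_preserves preserves_finite_limits K (forgetful K L)"
      "rep_preserves preserves_regular_epis K (forgetful K L)" by blast+
  next
    assume ex: "\<forall>c\<in>CSym \<Sigma>. rep_exact K (MC M c)"
    note m = models_exact[OF ex]
    {
      assume "\<forall>t\<in>arity_terms \<sigma> T. rep_preserves preserves_coeqs_of_kernel_pairs K (supp K \<Sigma> M L t)"
        "\<forall>t\<in>coarity_terms \<sigma> T. rep_preserves preserves_finite_limits K (supp K \<Sigma> M L t)"
      then show "rep_exact K (Mth L)" by (rule m)
    }
    assume "algebraic \<sigma> T" "\<forall>B\<in>FSym \<Sigma>. MB_preserves_reflexive_coeqs_componentwise K \<Sigma> M B"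
    \<comment> \<open>Kernel pairs are reflexive, so the arity condition follows from preservation
      of reflexive coequalizers by supports; algebraicity supplies the coarity condition.\<close>
    then show "rep_exact K (Mth L)"
      using supp_reflexive_coeqs reflexive_coeqs_kernel_pairs arity_STerms algebraic_coarity_limits
      by (intro m) blast+
  qed
qed

end
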